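(* Let $P\in M(m,{}_U\mathcal D_* )$ and let $\lambda(z)=(\lambda_1(z),\ldots,\lambda_n(z))\in\mathcal O_U^n$. (i) Let $\Sigma\subset\mathbb N^n$ be a subset such that $\det\bigl(\sigma_*(P)(x,z,\lambda(z)+\gamma)\bigr)\not\equiv0$ (as a function of $(x,z)$) for all $\gamma\in\mathbb N^n\setminus\Sigma$. Let $\phi(t,x,z)=\sum_{\alpha\in\mathbb N^n}\phi_\alpha(x,z)t^\alpha\in{}_U\hat{\mathcal A}_M^m$ satisfy $P(t^{\lambda(z)}\phi)=0$. Then $\phi=0$ if $\phi_\alpha=0$ for all $\alpha\in\Sigma$. Now suppose moreover that $$\det\bar\sigma_*(P)(x,z,\xi)\neq0\quad\text{for all }(x,z,\xi)\in N\times U\times\bigl([0,\infty)^n\setminus\{0\}\bigr).$$ (ii) If $\phi(t,x,z)\in{}_U\hat{\mathcal A}_M^m$ satisfies $P(t^{\lambda(z)}\phi)=0$, then $\phi\in{}_U\mathcal A_M^m$. (iii) Fix $x^o\in N$. Let $\Sigma$ be a finite subset of $\mathbb N^n$ such that $\det\bigl(\sigma_*(P)(x^o,z^o,\lambda(z^o)+\gamma)\bigr)\neq0$ for all $\gamma\in\mathbb N^n\setminus\Sigma$. Put $$\operatorname{Sol}_U(P;\lambda):=\{u\,;\,ut^{-\lambda(z)}\in{}_U\mathcal A_M^m\text{ and }Pu=0\},$$ $$\operatorname{Sol}_U(P;\lambda)^\Sigma:=\Bigl\{\bar u=\sum_{\alpha\in\overline\Sigma}\phi_\alpha(x,z)t^{\lambda(z)+\alpha}\,;\,\bar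 ut^{-\lambda(z)}\in{}_U\mathcal A_M^m\text{ and }P\bar u\equiv0\bmod\sum_{\beta\in\partial\Sigma}{}_U\mathcal A_M^m\,t^{\lambda(z)+\beta}\Bigr\}.$$ Then, after shrinking $U\ni z^o$ and $N\ni x^o$ (and $M$) if necessary, the natural restriction map $$\operatorname{Sol}_U(P;\lambda)\to\operatorname{Sol}_U(P;\lambda)^\Sigma,\qquad\sum_{\alpha\in\mathbb N^n}\phi_\alpha(x,z)t^{\lambda(z)+\alpha}\mapsto\sum_{\alpha\in\overline\Sigma}\phi_\alpha(x,z)t^{\lambda(z)+\alpha}$$ is a bijection. In particular, identifying $u$ with $t^{\lambda(z)}u$, $$\operatorname{Sol}_U(P;\lambda)^{\{0\}}=\{u\in{}_U\mathcal A_N^m\,;\,\sigma_*(P)(x,z,\lambda(z))u=0\}.$$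
   Context: Setting. $M$ is a connected real analytic manifold of dimension $n+n'$, and $N_1,\ldots,N_n$ are one-codimensional submanifolds normally crossing at $N=N_1\cap\cdots\cap N_n$, with $N$ connected. A coordinate system $(t,x)=(t_1,\ldots,t_n,x_1,\ldots,x_{n'})$ is fixed in which $N_i=\{t_i=0\}$; $M$ is taken to be the domain of these coordinates, so $N=\{t=0\}$ with coordinates $x$. $\mathbb N=\{0,1,2,\ldots\}$. $\mathcal A_N$: complex-valued real analytic functions on $N$; $\mathcal A_M$: those defined on a neighborhood of $N$ in $M$ (identified if they agree near $N$). $\vartheta_i=t_i\partial/\partial t_i$, $\vartheta^\alpha=\prod\vartheta_i^{\alpha_i}$, $t^\lambda=\prod t_i^{\lambda_i}$, $\partial_x^\beta=\partial^{|\beta|}/\partial x_1^{\beta_1}\cdots\partial x_{n'}^{\beta_{n'}}$. $M(m,R)$ is the ring of $m\times m$ matrices over $R$. Parameters. $U$ is a connected open neighborhood of a point $z^o\in\mathbb C^\ell$ ($\ell\ge0$), $\mathcal O_U$ is the space of holomorphic functions on $U$; ${}_U\mathcal A_M$, ${}_U\mathcal A_N$ are the spaces of real analytic functions as in $\mathcal A_M$, $\mathcal A_N$ depending on the holomorphic parameter $z\in U$ (jointly analytic in all variables, holomorphic in $z$); ${}_U\hat{\mathcal A}_M$ is the space of formal power series in $t$ with coefficients in ${}_U\mathcal A_N$. ${}_U\mathcal D_*$ is the ring of operators (finite sums) $P=\sum_{\alpha\in\mathbb N^n,\beta\in\mathbb N^{n'}}a_{\alpha,\beta}(t,x,z)\vartheta^\alpha\partial_x^\beta$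 with $a_{\alpha,\beta}\in{}_U\mathcal A_M$ and $a_{\alpha,\beta}(0,x,z)=0$ if $\beta\ne0$. $\sigma_*(P)(x,z,\xi)=\sum_\alpha a_{\alpha,0}(0,x,z)\xi^\alpha$, taken entrywise for matrices. $\operatorname{ord}P$ is the maximal $|\alpha|+|\beta|$ with $a_{\alpha,\beta}\neq0$ in some entry, and $\bar\sigma_*(P)(x,z,\xi)$ is the matrix with entries $\sum_{|\alpha|=\operatorname{ord}P}a_{\alpha,0}(0,x,z)\xi^\alpha$. For $\Sigma\subset\mathbb N^n$: $\overline\Sigma=\{\alpha\in\mathbb N^n\,;\,(\alpha+\mathbb N^n)\cap\Sigma\neq\emptyset\}$ and $\partial\Sigma=\{\alpha\in\mathbb N^n\setminus\overline\Sigma\,;\,\text{there is }\gamma\in\overline\Sigma\text{ with }\sum_{i=1}^n|\alpha_i-\gamma_i|=1\}$. *)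

theory Defs
  imports "HOL-Analysis.Analysis"
begin

text \<open>
  The dimensions \<open>n\<close> (of \<open>t\<close>), \<open>k\<close> (of \<open>x\<close>) and \<open>l\<close> (of \<open>z\<close>) are natural numbers that may
  be \<open>0\<close>.  As in \<^const>\<open>Euclidean_space\<close>, a point of \<open>d\<close>-dimensional space is a
  sequence vanishing from index \<open>d\<close> on; coordinates are numbered from \<open>0\<close>.  The size of the
  matrices is the cardinality of the index type \<open>'m\<close>.
\<close>

definition Complex_space :: "nat \<Rightarrow> (nat \<Rightarrow> complex) topology" where
  "Complex_space l =
     subtopology (product_topology (\<lambda>_. euclidean) UNIV) {z. \<forall>i\<ge>l. z i = 0}"

definition multi_indices :: "nat \<Rightarrow> (nat \<Rightarrow> nat) set" where
  "multi_indices d = {\<alpha>. \<forall>i\<ge>d. \<alpha> i = 0}"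

definition multi_deg :: "nat \<Rightarrow> (nat \<Rightarrow> nat) \<Rightarrow> nat" where
  "multi_deg d \<alpha> = (\<Sum>i<d. \<alpha> i)"

definition multi_pow :: "nat \<Rightarrow> (nat \<Rightarrow> 'a::comm_monoid_mult) \<Rightarrow> (nat \<Rightarrow> nat) \<Rightarrow> 'a" where
  "multi_pow d y \<alpha> = (\<Prod>i<d. y i ^ \<alpha> i)"


section \<open>Spaces of analytic functions\<close>

text \<open>
  Local expansion in a convergent power series in \<open>(t, x, z)\<close>, with \<open>t\<close>, \<open>x\<close> real and \<open>z\<close>
  complex: real analytic jointly in all variables and holomorphic in \<open>z\<close>.
\<close>
definition jointly_analytic_at ::
  "nat \<Rightarrow> nat \<Rightarrow> nat \<Rightarrow> ((nat \<Rightarrow> real) \<Rightarrow> (nat \<Rightarrow> real) \<Rightarrow> (nat \<Rightarrow> complex) \<Rightarrow> complex)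
     \<Rightarrow> (nat \<Rightarrow> real) \<Rightarrow> (nat \<Rightarrow> real) \<Rightarrow> (nat \<Rightarrow> complex) \<Rightarrow> bool" where
  "jointly_analytic_at n k l f t0 x0 z0 \<longleftrightarrow>
     (\<exists>r>0. \<exists>c.
        \<forall>t \<in> topspace (Euclidean_space n). \<forall>x \<in> topspace (Euclidean_space k).
        \<forall>z \<in> topspace (Complex_space l).
          (\<forall>i<n. \<bar>t i - t0 i\<bar> < r) \<and> (\<forall>i<k. \<bar>x i - x0 i\<bar> < r) \<and> (\<forall>i<l. cmod (z i - z0 i) < r) \<longrightarrow>
          ((\<lambda>(\<alpha>, \<beta>, \<gamma>). c \<alpha> \<beta> \<gamma>
              * of_real (multi_pow n (\<lambda>i. t i - t0 i) \<alpha>)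
              * of_real (multi_pow k (\<lambda>i. x i - x0 i) \<beta>)
              * multi_pow l (\<lambda>i. z i - z0 i) \<gamma>)
            has_sum f t x z) (multi_indices n \<times> multi_indices k \<times> multi_indices l))"

definition O_space :: "nat \<Rightarrow> (nat \<Rightarrow> complex) set \<Rightarrow> ((nat \<Rightarrow> complex) \<Rightarrow> complex) set" where
  "O_space l U =
     {f. \<forall>z\<in>U. jointly_analytic_at 0 0 l (\<lambda>t x. f) (\<lambda>_. 0) (\<lambda>_. 0) z}"

text \<open>
  Vector-valued analytic functions on \<open>N \<times> U\<close>.  A function on \<open>N \<times> U\<close> is represented by its
  extension by \<open>0\<close>, so that equality in HOL is equality on \<open>N \<times> U\<close>.
\<close>
definition A_N ::
  "nat \<Rightarrow> nat \<Rightarrow> (nat \<Rightarrow> real) set \<Rightarrow> (nat \<Rightarrow> complex) set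
     \<Rightarrow> ((nat \<Rightarrow> real) \<Rightarrow> (nat \<Rightarrow> complex) \<Rightarrow> complex^'m) set" where
  "A_N k l N U =
     {u. (\<forall>x\<in>N. \<forall>z\<in>U. \<forall>j. jointly_analytic_at 0 k l (\<lambda>t x z. u x z $ j) (\<lambda>_. 0) x z) \<and>
         (\<forall>x z. x \<notin> N \<or> z \<notin> U \<longrightarrow> u x z = 0)}"

text \<open>
  Representatives of germs along \<open>{0} \<times> N \<times> U\<close>: functions of \<open>(t, x, z)\<close> that are analytic in
  some neighbourhood of \<open>{0} \<times> N \<times> U\<close>; their values elsewhere are irrelevant.  The size of the
  neighbourhood in the \<open>t\<close>-direction may depend on \<open>z\<close> as well as on \<open>x\<close>.
\<close>
definition A_M ::
  "nat \<Rightarrow> nat \<Rightarrow> nat \<Rightarrow> (nat \<Rightarrow> real) set \<Rightarrow> (nat \<Rightarrow> complex) set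
     \<Rightarrow> ((nat \<Rightarrow> real) \<Rightarrow> (nat \<Rightarrow> real) \<Rightarrow> (nat \<Rightarrow> complex) \<Rightarrow> complex) set" where
  "A_M n k l N U = {f. \<forall>x\<in>N. \<forall>z\<in>U. jointly_analytic_at n k l f (\<lambda>_. 0) x z}"

definition A_M_vec ::
  "nat \<Rightarrow> nat \<Rightarrow> nat \<Rightarrow> (nat \<Rightarrow> real) set \<Rightarrow> (nat \<Rightarrow> complex) set
     \<Rightarrow> ((nat \<Rightarrow> real) \<Rightarrow> (nat \<Rightarrow> real) \<Rightarrow> (nat \<Rightarrow> complex) \<Rightarrow> complex^'m) set" where
  "A_M_vec n k l N U = {f. \<forall>j. (\<lambda>t x z. f t x z $ j) \<in> A_M n k l N U}"

text \<open>The property \<open>Q\<close> holds throughout a neighbourhood of \<open>{0} \<times> N \<times> U\<close>.\<close>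
definition near_N ::
  "nat \<Rightarrow> nat \<Rightarrow> nat \<Rightarrow> (nat \<Rightarrow> real) set \<Rightarrow> (nat \<Rightarrow> complex) set
     \<Rightarrow> ((nat \<Rightarrow> real) \<Rightarrow> (nat \<Rightarrow> real) \<Rightarrow> (nat \<Rightarrow> complex) \<Rightarrow> bool) \<Rightarrow> bool" where
  "near_N n k l N U Q \<longleftrightarrow>
     (\<exists>W. openin (prod_topology (Euclidean_space n)
                    (prod_topology (Euclidean_space k) (Complex_space l))) W \<and>
          {\<lambda>_. 0} \<times> N \<times> U \<subseteq> W \<and> (\<forall>(t, x, z)\<in>W. Q t x z))"

text \<open>Formal power series \<open>\<Sum>\<alpha>. \<phi>\<^sub>\<alpha>(x, z) t\<^sup>\<alpha>\<close>, given by their coefficients.\<close>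
definition A_hat ::
  "nat \<Rightarrow> nat \<Rightarrow> nat \<Rightarrow> (nat \<Rightarrow> real) set \<Rightarrow> (nat \<Rightarrow> complex) set
     \<Rightarrow> ((nat \<Rightarrow> nat) \<Rightarrow> (nat \<Rightarrow> real) \<Rightarrow> (nat \<Rightarrow> complex) \<Rightarrow> complex^'m) set" where
  "A_hat n k l N U =
     {\<phi>. (\<forall>\<alpha>\<in>multi_indices n. \<phi> \<alpha> \<in> A_N k l N U) \<and>
         (\<forall>\<alpha>. \<alpha> \<notin> multi_indices n \<longrightarrow> \<phi> \<alpha> = (\<lambda>_ _. 0))}"


section \<open>Derivatives and Taylor expansion along \<open>t = 0\<close>\<close>

definition partial_deriv ::
  "nat \<Rightarrow> ((nat \<Rightarrow> real) \<Rightarrow> 'b::real_normed_vector) \<Rightarrow> (nat \<Rightarrow> real) \<Rightarrow> 'b" where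
  "partial_deriv i f y = vector_derivative (\<lambda>s. f (y(i := s))) (at (y i))"

definition multi_deriv ::
  "nat \<Rightarrow> (nat \<Rightarrow> nat) \<Rightarrow> ((nat \<Rightarrow> real) \<Rightarrow> 'b::real_normed_vector) \<Rightarrow> (nat \<Rightarrow> real) \<Rightarrow> 'b" where
  "multi_deriv d \<alpha> = fold (\<lambda>i. partial_deriv i ^^ \<alpha> i) [0..<d]"

definition taylor_coeff ::
  "nat \<Rightarrow> ((nat \<Rightarrow> real) \<Rightarrow> (nat \<Rightarrow> real) \<Rightarrow> (nat \<Rightarrow> complex) \<Rightarrow> 'b::real_normed_vector)
     \<Rightarrow> (nat \<Rightarrow> nat) \<Rightarrow> (nat \<Rightarrow> real) \<Rightarrow> (nat \<Rightarrow> complex) \<Rightarrow> 'b" where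
  "taylor_coeff n f \<alpha> x z =
     multi_deriv n \<alpha> (\<lambda>t. f t x z) (\<lambda>_. 0) /\<^sub>R (\<Prod>i<n. fact (\<alpha> i))"

text \<open>
  The embedding of germs into formal power series.  Two elements of \<^const>\<open>A_M_vec\<close> have the
  same image iff they agree near \<open>{0} \<times> N \<times> U\<close>, so the image of \<^const>\<open>A_M_vec\<close> is the space
  of germs.
\<close>
definition taylor ::
  "nat \<Rightarrow> (nat \<Rightarrow> real) set \<Rightarrow> (nat \<Rightarrow> complex) set
     \<Rightarrow> ((nat \<Rightarrow> real) \<Rightarrow> (nat \<Rightarrow> real) \<Rightarrow> (nat \<Rightarrow> complex) \<Rightarrow> complex^'m)
     \<Rightarrow> (nat \<Rightarrow> nat) \<Rightarrow> (nat \<Rightarrow> real) \<Rightarrow> (nat \<Rightarrow> complex) \<Rightarrow> complex^'m" where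
  "taylor n N U f = (\<lambda>\<alpha> x z.
     if \<alpha> \<in> multi_indices n \<and> x \<in> N \<and> z \<in> U then taylor_coeff n f \<alpha> x z else 0)"


section \<open>Matrices of operators\<close>

text \<open>
  \<open>a \<alpha> \<beta>\<close> is the matrix coefficient of \<open>\<vartheta>\<^sup>\<alpha> \<partial>\<^sub>x\<^sup>\<beta>\<close>.
\<close>
type_synonym 'm op_matrix =
  "(nat \<Rightarrow> nat) \<Rightarrow> (nat \<Rightarrow> nat) \<Rightarrow> (nat \<Rightarrow> real) \<Rightarrow> (nat \<Rightarrow> real) \<Rightarrow> (nat \<Rightarrow> complex) \<Rightarrow> complex^'m^'m"

definition op_supp :: "'m::finite op_matrix \<Rightarrow> ((nat \<Rightarrow> nat) \<times> (nat \<Rightarrow> nat)) set" where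
  "op_supp a = {(\<alpha>, \<beta>). a \<alpha> \<beta> \<noteq> (\<lambda>_ _ _. 0)}"

definition D_star ::
  "nat \<Rightarrow> nat \<Rightarrow> nat \<Rightarrow> (nat \<Rightarrow> real) set \<Rightarrow> (nat \<Rightarrow> complex) set \<Rightarrow> 'm::finite op_matrix set" where
  "D_star n k l N U =
     {a. finite (op_supp a) \<and> op_supp a \<subseteq> multi_indices n \<times> multi_indices k \<and>
         (\<forall>\<alpha> \<beta> i j. (\<lambda>t x z. a \<alpha> \<beta> t x z $ i $ j) \<in> A_M n k l N U) \<and>
         (\<forall>\<alpha> \<beta>. \<beta> \<noteq> (\<lambda>_. 0) \<longrightarrow> (\<forall>x\<in>N. \<forall>z\<in>U. a \<alpha> \<beta> (\<lambda>_. 0) x z = 0))}"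

definition sigma_star ::
  "nat \<Rightarrow> 'm::finite op_matrix \<Rightarrow> (nat \<Rightarrow> real) \<Rightarrow> (nat \<Rightarrow> complex) \<Rightarrow> (nat \<Rightarrow> complex) \<Rightarrow> complex^'m^'m" where
  "sigma_star n a x z \<xi> =
     (\<chi> i j. \<Sum>\<alpha> | (\<alpha>, \<lambda>_. 0) \<in> op_supp a. a \<alpha> (\<lambda>_. 0) (\<lambda>_. 0) x z $ i $ j * multi_pow n \<xi> \<alpha>)"

text \<open>The order only counts coefficients that are nonzero as germs.  For \<open>P = 0\<close> it is
  unspecified, but \<open>sigma_bar\<close> is then \<open>0\<close> on \<open>N \<times> U\<close> for any value of it.\<close>
definition op_ord ::
  "nat \<Rightarrow> nat \<Rightarrow> nat \<Rightarrow> (nat \<Rightarrow> real) set \<Rightarrow> (nat \<Rightarrow> complex) set \<Rightarrow> 'm::finite op_matrix \<Rightarrow> nat" where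
  "op_ord n k l N U a =
     Max {multi_deg n \<alpha> + multi_deg k \<beta> | \<alpha> \<beta>. \<not> near_N n k l N U (\<lambda>t x z. a \<alpha> \<beta> t x z = 0)}"

definition sigma_bar ::
  "nat \<Rightarrow> nat \<Rightarrow> nat \<Rightarrow> (nat \<Rightarrow> real) set \<Rightarrow> (nat \<Rightarrow> complex) set \<Rightarrow> 'm::finite op_matrix
     \<Rightarrow> (nat \<Rightarrow> real) \<Rightarrow> (nat \<Rightarrow> complex) \<Rightarrow> (nat \<Rightarrow> complex) \<Rightarrow> complex^'m^'m" where
  "sigma_bar n k l N U a x z \<xi> =
     (\<chi> i j. \<Sum>\<alpha> | (\<alpha>, \<lambda>_. 0) \<in> op_supp a \<and> multi_deg n \<alpha> = op_ord n k l N U a.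
        a \<alpha> (\<lambda>_. 0) (\<lambda>_. 0) x z $ i $ j * multi_pow n \<xi> \<alpha>)"

text \<open>
  \<open>\<phi>\<close> stands for the formal expression \<open>\<Sum>\<mu>. \<phi>\<^sub>\<mu> t\<^bsup>\<lambda>(z) + \<mu>\<^esup>\<close>, on which \<open>\<vartheta>\<^sup>\<alpha>\<close> multiplies the
  \<open>\<mu>\<close>-th term by \<open>(\<lambda>(z) + \<mu>)\<^sup>\<alpha>\<close>.  The coefficients of \<open>P\<close> act through their Taylor series; the
  value is the coefficient of \<open>t\<^bsup>\<lambda>(z) + \<gamma>\<^esup>\<close> in \<open>P (t\<^bsup>\<lambda>(z)\<^esup> \<phi>)\<close>.
\<close>
definition formal_apply ::
  "nat \<Rightarrow> nat \<Rightarrow> 'm::finite op_matrix \<Rightarrow> (nat \<Rightarrow> (nat \<Rightarrow> complex) \<Rightarrow> complex)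
     \<Rightarrow> ((nat \<Rightarrow> nat) \<Rightarrow> (nat \<Rightarrow> real) \<Rightarrow> (nat \<Rightarrow> complex) \<Rightarrow> complex^'m)
     \<Rightarrow> (nat \<Rightarrow> nat) \<Rightarrow> (nat \<Rightarrow> real) \<Rightarrow> (nat \<Rightarrow> complex) \<Rightarrow> complex^'m" where
  "formal_apply n k a lam \<phi> \<gamma> x z =
     (\<Sum>(\<alpha>, \<beta>)\<in>op_supp a. \<Sum>\<mu> | \<mu> \<le> \<gamma>.
        taylor_coeff n (a \<alpha> \<beta>) (\<lambda>i. \<gamma> i - \<mu> i) x z *v
          (multi_pow n (\<lambda>i. lam i z + of_nat (\<mu> i)) \<alpha> *s multi_deriv k \<beta> (\<lambda>x. \<phi> \<mu> x z) x))"

text \<open>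
  \<open>t\<^sup>-\<^sup>c \<vartheta>\<^sub>i t\<^sup>c = \<vartheta>\<^sub>i + c\<^sub>i\<close>, so this is \<open>t\<^sup>-\<^sup>c \<vartheta>\<^sup>\<alpha> (t\<^sup>c f)\<close>; it makes sense for all real
  \<open>t\<close>, independently of a branch of \<open>t\<^sup>c\<close>.
\<close>
definition theta_conj ::
  "nat \<Rightarrow> (nat \<Rightarrow> complex) \<Rightarrow> (nat \<Rightarrow> nat)
     \<Rightarrow> ((nat \<Rightarrow> real) \<Rightarrow> complex^'m::finite) \<Rightarrow> (nat \<Rightarrow> real) \<Rightarrow> complex^'m" where
  "theta_conj n c \<alpha> =
     fold (\<lambda>i. (\<lambda>g t. t i *\<^sub>R partial_deriv i g t + c i *s g t) ^^ \<alpha> i) [0..<n]"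

text \<open>The function \<open>t\<^bsup>-\<lambda>(z)\<^esup> P (t\<^bsup>\<lambda>(z)\<^esup> f)\<close>.\<close>
definition conj_apply ::
  "nat \<Rightarrow> nat \<Rightarrow> 'm::finite op_matrix \<Rightarrow> (nat \<Rightarrow> (nat \<Rightarrow> complex) \<Rightarrow> complex)
     \<Rightarrow> ((nat \<Rightarrow> real) \<Rightarrow> (nat \<Rightarrow> real) \<Rightarrow> (nat \<Rightarrow> complex) \<Rightarrow> complex^'m)
     \<Rightarrow> (nat \<Rightarrow> real) \<Rightarrow> (nat \<Rightarrow> real) \<Rightarrow> (nat \<Rightarrow> complex) \<Rightarrow> complex^'m" where
  "conj_apply n k a lam f t x z =
     (\<Sum>(\<alpha>, \<beta>)\<in>op_supp a.
        a \<alpha> \<beta> t x z *v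
          theta_conj n (\<lambda>i. lam i z) \<alpha> (\<lambda>t. multi_deriv k \<beta> (\<lambda>x. f t x z) x) t)"


section \<open>Solution spaces\<close>

definition Sigma_bar :: "nat \<Rightarrow> (nat \<Rightarrow> nat) set \<Rightarrow> (nat \<Rightarrow> nat) set" where
  "Sigma_bar n S = {\<alpha> \<in> multi_indices n. \<exists>\<gamma>\<in>multi_indices n. (\<lambda>i. \<alpha> i + \<gamma> i) \<in> S}"

definition Sigma_bd :: "nat \<Rightarrow> (nat \<Rightarrow> nat) set \<Rightarrow> (nat \<Rightarrow> nat) set" where
  "Sigma_bd n S =
     {\<alpha> \<in> multi_indices n - Sigma_bar n S.
        \<exists>\<gamma>\<in>Sigma_bar n S. (\<Sum>i<n. \<bar>int (\<alpha> i) - int (\<gamma> i)\<bar>) = 1}"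

text \<open>
  In both solution spaces \<open>u = t\<^bsup>\<lambda>(z)\<^esup> f\<close> is represented by the Taylor coefficients
  \<open>\<phi>\<^sub>\<alpha>\<close> of \<open>f\<close>, that is \<open>u = \<Sum>\<alpha>. \<phi>\<^sub>\<alpha> t\<^bsup>\<lambda>(z) + \<alpha>\<^esup>\<close>.
\<close>
definition Sol ::
  "nat \<Rightarrow> nat \<Rightarrow> nat \<Rightarrow> (nat \<Rightarrow> real) set \<Rightarrow> (nat \<Rightarrow> complex) set \<Rightarrow> 'm::finite op_matrix
     \<Rightarrow> (nat \<Rightarrow> (nat \<Rightarrow> complex) \<Rightarrow> complex)
     \<Rightarrow> ((nat \<Rightarrow> nat) \<Rightarrow> (nat \<Rightarrow> real) \<Rightarrow> (nat \<Rightarrow> complex) \<Rightarrow> complex^'m) set" where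
  "Sol n k l N U a lam =
     {taylor n N U f | f. f \<in> A_M_vec n k l N U \<and>
        near_N n k l N U (\<lambda>t x z. conj_apply n k a lam f t x z = 0)}"

definition Sol_Sigma ::
  "nat \<Rightarrow> nat \<Rightarrow> nat \<Rightarrow> (nat \<Rightarrow> real) set \<Rightarrow> (nat \<Rightarrow> complex) set \<Rightarrow> 'm::finite op_matrix
     \<Rightarrow> (nat \<Rightarrow> (nat \<Rightarrow> complex) \<Rightarrow> complex) \<Rightarrow> (nat \<Rightarrow> nat) set
     \<Rightarrow> ((nat \<Rightarrow> nat) \<Rightarrow> (nat \<Rightarrow> real) \<Rightarrow> (nat \<Rightarrow> complex) \<Rightarrow> complex^'m) set" where
  "Sol_Sigma n k l N U a lam S =
     {taylor n N U f | f. f \<in> A_M_vec n k l N U \<and>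
        (\<forall>\<alpha>. \<alpha> \<notin> Sigma_bar n S \<longrightarrow> taylor n N U f \<alpha> = (\<lambda>_ _. 0)) \<and>
        (\<exists>g. (\<forall>\<beta>\<in>Sigma_bd n S. g \<beta> \<in> A_M_vec n k l N U) \<and>
             near_N n k l N U (\<lambda>t x z. conj_apply n k a lam f t x z =
               (\<Sum>\<beta>\<in>Sigma_bd n S. multi_pow n t \<beta> *\<^sub>R g \<beta> t x z)))}"

definition restrict_to_Sigma_bar ::
  "nat \<Rightarrow> (nat \<Rightarrow> nat) set
     \<Rightarrow> ((nat \<Rightarrow> nat) \<Rightarrow> (nat \<Rightarrow> real) \<Rightarrow> (nat \<Rightarrow> complex) \<Rightarrow> complex^'m)
     \<Rightarrow> (nat \<Rightarrow> nat) \<Rightarrow> (nat \<Rightarrow> real) \<Rightarrow> (nat \<Rightarrow> complex) \<Rightarrow> complex^'m" where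
  "restrict_to_Sigma_bar n S \<phi> = (\<lambda>\<alpha>. if \<alpha> \<in> Sigma_bar n S then \<phi> \<alpha> else (\<lambda>_ _. 0))"

text \<open>The identification of \<open>u\<close> with \<open>t\<^bsup>\<lambda>(z)\<^esup> u\<close>, as a series with a single term.\<close>
definition const_series ::
  "((nat \<Rightarrow> real) \<Rightarrow> (nat \<Rightarrow> complex) \<Rightarrow> complex^'m)
     \<Rightarrow> (nat \<Rightarrow> nat) \<Rightarrow> (nat \<Rightarrow> real) \<Rightarrow> (nat \<Rightarrow> complex) \<Rightarrow> complex^'m" where
  "const_series u = (\<lambda>\<alpha>. if \<alpha> = (\<lambda>_. 0) then u else (\<lambda>_ _. 0))"


section \<open>The geometric setting\<close>

text \<open>
  \<open>M\<close> is the domain of the coordinates \<open>(t, x)\<close>; the hypersurfaces are \<open>{t\<^sub>i = 0}\<close>, and their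
  intersection is described by the coordinates \<open>x\<close>.
\<close>
definition N_of :: "((nat \<Rightarrow> real) \<times> (nat \<Rightarrow> real)) set \<Rightarrow> (nat \<Rightarrow> real) set" where
  "N_of M = {x. (\<lambda>_. 0, x) \<in> M}"

definition coordinate_domain ::
  "nat \<Rightarrow> nat \<Rightarrow> ((nat \<Rightarrow> real) \<times> (nat \<Rightarrow> real)) set \<Rightarrow> bool" where
  "coordinate_domain n k M \<longleftrightarrow>
     openin (prod_topology (Euclidean_space n) (Euclidean_space k)) M \<and>
     connectedin (prod_topology (Euclidean_space n) (Euclidean_space k)) M \<and>
     connectedin (Euclidean_space k) (N_of M)"

definition parameter_domain :: "nat \<Rightarrow> (nat \<Rightarrow> complex) \<Rightarrow> (nat \<Rightarrow> complex) set \<Rightarrow> bool" where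
  "parameter_domain l zo U \<longleftrightarrow>
     openin (Complex_space l) U \<and> connectedin (Complex_space l) U \<and> zo \<in> U"

end

theory Submission imports Defs "HOL-Complex_Analysis.Conformal_Mappings" begin

text \<open>
  The coefficient of \<open>t\<^bsup>\<lambda>(z) + \<gamma>\<^esup>\<close> in \<open>P (t\<^bsup>\<lambda>(z)\<^esup> \<phi>)\<close> is \<open>\<sigma>\<^sub>*(P)(x, z, \<lambda>(z) + \<gamma>) \<phi>\<^sub>\<gamma>\<close> plus terms
  in \<open>\<phi>\<^sub>\<mu>\<close> with \<open>\<mu> < \<gamma>\<close>, because coefficients of \<open>P\<close> at \<open>\<partial>\<^sub>x\<^sup>\<beta>\<close> with \<open>\<beta> \<noteq> 0\<close> vanish at \<open>t = 0\<close>.  Where the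
  symbol is invertible, \<open>\<phi>\<^sub>\<gamma>\<close> is determined by the previous coefficients, and the identity theorem
  on \<open>N \<times> U\<close> gives (i).

  Under the ellipticity hypothesis, homogeneity and compactness bound the inverse of the symbol by
  \<open>C (1 + \<bar>\<gamma>\<bar>)\<^bsup>-r\<^esup>\<close>, where \<open>r\<close> is the order of \<open>P\<close>.  The derivatives in \<open>x\<close> of \<open>\<phi>\<^sub>\<mu>\<close> are measured in norms whose
  index grows like \<open>r \<bar>\<mu>\<bar>\<close> (in the manner of Nagumo); each derivative then costs a factor \<open>O(1 + \<bar>\<mu>\<bar>)\<close>, and at most
  \<open>r\<close> factors, from \<open>\<vartheta>\<close> and \<open>\<partial>\<^sub>x\<close> together, arise.  This is exactly compensated by the inverse of the
  symbol, so the norms grow geometrically in \<open>\<bar>\<gamma>\<bar>\<close> and the formal solution converges: this is (ii).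

  For (iii), \<open>\<Sigma>\<close> is enlarged to a downward closed set, so that the equation modulo the boundary terms
  says precisely that the coefficients of index in that set vanish.  The elliptic bound
  makes the symbols outside \<open>\<Sigma>\<close> invertible on one neighbourhood of \<open>(x\<^sup>o, z\<^sup>o)\<close>; there the recursion extends each
  truncated solution uniquely, and the extension converges by (ii).
\<close>

text \<open>The obstacle in (ii) is the loss of domain. An element of \<open>A_hat\<close> gives
  each coefficient its own radius of convergence in (x, z), possibly shrinking with the index, and
  the recursion differentiates in x. Hence all estimates are made on the Taylor coefficients at one
  centre, with norms truncated at degree \<open>D\<close>: they are finite sums, so a part of the
  right-hand side may be absorbed before any convergence is known. The estimate at \<gamma> with
  truncation \<open>D\<close> uses those at \<mu> with \<open>D + r\<close>, so the bounds are
  proved for all \<open>D\<close> at once. The weights are the reciprocals of the coefficients of (1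
  - X)^(-p-1); the level p = r |\<gamma>| is undone at the end by halving the radius, at the cost
  2^p, which is only geometric in |\<gamma>|. The arrays of coefficients thus get a common radius,
  and continuation along segments shows that the functions themselves expand with it. For this
  bookkeeping t, x and z are the variables of a single complex power series, whose slices in t are
  the expansions of the Taylor coefficients.\<close>

lemma multi_indices_add: "\<alpha> \<in> multi_indices d \<Longrightarrow> \<beta> \<in> multi_indices d \<Longrightarrow> (\<lambda>i. \<alpha> i + \<beta> i) \<in> multi_indices d"
  by (auto simp: multi_indices_def)

lemma multi_indices_diff: "\<alpha> \<in> multi_indices d \<Longrightarrow> (\<lambda>i. \<alpha> i - \<beta> i) \<in> multi_indices d"
  by (auto simp: multi_indices_def)

lemma multi_indices_le: "\<alpha> \<in> multi_indices d \<Longrightarrow> \<beta> \<le> \<alpha> \<Longrightarrow> \<beta> \<in> multi_indices d"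
  by (auto simp: multi_indices_def le_fun_def) (metis le_zero_eq)

lemma multi_indices_upd: "\<alpha> \<in> multi_indices d \<Longrightarrow> i < d \<Longrightarrow> \<alpha>(i := m) \<in> multi_indices d"
  by (auto simp: multi_indices_def)

lemma multi_indices_zero [simp]: "(\<lambda>_. 0) \<in> multi_indices d"
  by (auto simp: multi_indices_def)

lemma multi_indices_0 [simp]: "multi_indices 0 = {\<lambda>_. 0}"
  by (auto simp: multi_indices_def)

lemma multi_deg_zero [simp]: "multi_deg d (\<lambda>_. 0) = 0"
  by (simp add: multi_deg_def)

lemma multi_deg_add: "multi_deg d (\<lambda>i. \<alpha> i + \<beta> i) = multi_deg d \<alpha> + multi_deg d \<beta>"
  by (simp add: multi_deg_def sum.distrib)

lemma multi_deg_mono: "\<beta> \<le> \<alpha> \<Longrightarrow> multi_deg d \<beta> \<le> multi_deg d \<alpha>"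
  by (auto simp: multi_deg_def le_fun_def intro: sum_mono)

lemma multi_deg_diff: "\<beta> \<le> \<alpha> \<Longrightarrow> multi_deg d (\<lambda>i. \<alpha> i - \<beta> i) = multi_deg d \<alpha> - multi_deg d \<beta>"
  by (auto simp: multi_deg_def le_fun_def sum_subtractf_nat)

lemma multi_deg_eq_0_iff: "\<alpha> \<in> multi_indices d \<Longrightarrow> multi_deg d \<alpha> = 0 \<longleftrightarrow> \<alpha> = (\<lambda>_. 0)"
  by (auto simp: multi_deg_def multi_indices_def fun_eq_iff) (metis lessThan_iff not_le)

lemma le_multi_deg: "i < d \<Longrightarrow> \<alpha> i \<le> multi_deg d \<alpha>"
  unfolding multi_deg_def by (rule member_le_sum) auto

text \<open>The recursions for coefficients pass from \<gamma> to indices \<mu> \<le> \<gamma> with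
  \<mu> \<noteq> \<gamma>; this lets them run on the degree.\<close>

lemma multi_deg_less:
  assumes "\<alpha> \<in> multi_indices d" "\<beta> \<le> \<alpha>" "\<beta> \<noteq> \<alpha>"
  shows "multi_deg d \<beta> < multi_deg d \<alpha>"
proof -
  obtain i where i: "\<beta> i \<noteq> \<alpha> i" using assms(3) by auto
  with assms have "i < d" "\<beta> i < \<alpha> i"
    by (auto simp: multi_indices_def le_fun_def) (metis le_zero_eq leI, metis le_neq_implies_less)
  then show ?thesis
    using assms(2) unfolding multi_deg_def by (intro sum_strict_mono_ex1) (auto simp: le_fun_def)
qed

lemma finite_multi_deg_le [simp]: "finite {\<alpha> \<in> multi_indices d. multi_deg d \<alpha> \<le> D}"
proof -
  have "finite {f. \<forall>x. (x \<in> {..<d} \<longrightarrow> f x \<in> {..D}) \<and> (x \<notin> {..<d} \<longrightarrow> f x = (0::nat))}"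
    by (rule finite_set_of_finite_funs) auto
  moreover have "{\<alpha> \<in> multi_indices d. multi_deg d \<alpha> \<le> D} \<subseteq>
      {f. \<forall>x. (x \<in> {..<d} \<longrightarrow> f x \<in> {..D}) \<and> (x \<notin> {..<d} \<longrightarrow> f x = (0::nat))}"
  proof clarsimp
    fix \<alpha> x assume "\<alpha> \<in> multi_indices d" "multi_deg d \<alpha> \<le> D"
    then show "(x < d \<longrightarrow> \<alpha> x \<le> D) \<and> (\<not> x < d \<longrightarrow> \<alpha> x = 0)"
      using le_multi_deg[of x d \<alpha>] by (auto simp: multi_indices_def)
  qed
  ultimately show ?thesis by (rule rev_finite_subset)
qed

lemma finite_le_multi_index: "\<alpha> \<in> multi_indices d \<Longrightarrow> finite {\<beta>. \<beta> \<le> \<alpha>}"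
  by (rule finite_subset[OF _ finite_multi_deg_le[of d "multi_deg d \<alpha>"]])
     (auto intro: multi_indices_le multi_deg_mono)

lemma multi_pow_add: "multi_pow d y (\<lambda>i. \<alpha> i + \<beta> i) = multi_pow d y \<alpha> * multi_pow d y \<beta>"
  by (simp add: multi_pow_def power_add prod.distrib)

lemma multi_pow_zero_index [simp]: "multi_pow d y (\<lambda>_. 0) = 1"
  by (simp add: multi_pow_def)

lemma norm_multi_pow_le:
  fixes y :: "nat \<Rightarrow> 'a::real_normed_field"
  assumes "\<And>i. i < d \<Longrightarrow> norm (y i) \<le> R"
  shows "norm (multi_pow d y \<alpha>) \<le> R ^ multi_deg d \<alpha>"
proof -
  have "norm (multi_pow d y \<alpha>) = (\<Prod>i<d. norm (y i) ^ \<alpha> i)"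
    by (simp add: multi_pow_def norm_power flip: prod_norm)
  also have "\<dots> \<le> (\<Prod>i<d. R ^ \<alpha> i)"
    using assms by (intro prod_mono) (auto intro: power_mono)
  also have "\<dots> = R ^ multi_deg d \<alpha>"
    by (simp add: multi_deg_def power_sum)
  finally show ?thesis .
qed

lemma multi_pow_const: "multi_pow d (\<lambda>_. R) \<alpha> = R ^ multi_deg d \<alpha>"
  by (simp add: multi_deg_def multi_pow_def power_sum)

lemma multi_pow_zero:
  assumes "\<alpha> \<in> multi_indices d" "\<alpha> \<noteq> (\<lambda>_. 0)"
  shows "multi_pow d (\<lambda>_. 0 :: 'a::{comm_semiring_1,semiring_no_zero_divisors}) \<alpha> = 0"
  using assms multi_deg_eq_0_iff[OF assms(1)] by (simp add: multi_pow_const power_0_left)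

text \<open>Separates one variable, so that a series in several variables can be read as a series in
  powers of \<open>s\<close> with the other variables frozen.\<close>

lemma multi_pow_upd:
  assumes "i < d"
  shows "multi_pow d (y(i := s)) \<alpha> = s ^ \<alpha> i * multi_pow d y (\<alpha>(i := 0))"
proof -
  have "(\<Prod>j<d. (y(i := s)) j ^ \<alpha> j) = (y(i := s)) i ^ \<alpha> i * (\<Prod>j\<in>{..<d}-{i}. (y(i := s)) j ^ \<alpha> j)"
    using assms by (subst prod.remove[of _ i]) auto
  moreover have "(\<Prod>j<d. y j ^ (\<alpha>(i := 0)) j) = (\<Prod>j\<in>{..<d}-{i}. y j ^ (\<alpha>(i := 0)) j)"
    using assms by (subst prod.remove[of _ i]) auto
  moreover have "(\<Prod>j\<in>{..<d}-{i}. (y(i := s)) j ^ \<alpha> j) = (\<Prod>j\<in>{..<d}-{i}. y j ^ (\<alpha>(i := 0)) j)"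
    by (rule prod.cong) auto
  ultimately show ?thesis by (simp add: multi_pow_def)
qed

section \<open>Multivariate power series\<close>

definition ps_summable :: "nat \<Rightarrow> real \<Rightarrow> ((nat \<Rightarrow> nat) \<Rightarrow> complex) \<Rightarrow> bool" where
  "ps_summable d R c \<longleftrightarrow> (\<lambda>\<alpha>. norm (c \<alpha>) * R ^ multi_deg d \<alpha>) summable_on multi_indices d"

text \<open>Absolute convergence on the open polydisc of radius \<open>R\<close>; unlike summability at the radius
  itself, this is stable under differentiation.\<close>
definition ps_conv :: "nat \<Rightarrow> real \<Rightarrow> ((nat \<Rightarrow> nat) \<Rightarrow> complex) \<Rightarrow> bool" where
  "ps_conv d R c \<longleftrightarrow> (\<forall>s. 0 < s \<and> s < R \<longrightarrow> ps_summable d s c)"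

definition ps_eval :: "nat \<Rightarrow> ((nat \<Rightarrow> nat) \<Rightarrow> complex) \<Rightarrow> (nat \<Rightarrow> complex) \<Rightarrow> complex" where
  "ps_eval d c y = (\<Sum>\<^sub>\<infinity>\<alpha>\<in>multi_indices d. c \<alpha> * multi_pow d y \<alpha>)"

text \<open>The Cauchy product. For a multi-index \<alpha> the set
  \<open>{\<beta>. \<beta> \<le> \<alpha>}\<close> is finite; values at other arguments carry no
  meaning.\<close>

definition ps_mult :: "((nat \<Rightarrow> nat) \<Rightarrow> 'a::comm_semiring_0) \<Rightarrow> ((nat \<Rightarrow> nat) \<Rightarrow> 'a) \<Rightarrow> (nat \<Rightarrow> nat) \<Rightarrow> 'a" where
  "ps_mult c e \<alpha> = (\<Sum>\<beta> | \<beta> \<le> \<alpha>. c \<beta> * e (\<lambda>i. \<alpha> i - \<beta> i))"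

definition ps_deriv :: "nat \<Rightarrow> ((nat \<Rightarrow> nat) \<Rightarrow> complex) \<Rightarrow> (nat \<Rightarrow> nat) \<Rightarrow> complex" where
  "ps_deriv i c \<alpha> = of_nat (\<alpha> i + 1) * c (\<alpha>(i := \<alpha> i + 1))"

lemma abs_summable_imp_summable:
  fixes f :: "'i \<Rightarrow> 'a::banach"
  shows "(\<lambda>x. norm (f x)) summable_on A \<Longrightarrow> f summable_on A"
  by (rule abs_summable_summable)

lemma summable_on_norm_comparison:
  fixes f :: "'i \<Rightarrow> 'a::banach"
  assumes "g summable_on A" "\<And>x. x \<in> A \<Longrightarrow> norm (f x) \<le> g x"
  shows "(\<lambda>x. norm (f x)) summable_on A"
  using assms by (intro Infinite_Sum.summable_on_comparison_test[OF assms(1)]) auto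

lemma ps_terms_summable:
  assumes "ps_summable d R c" "\<And>i. i < d \<Longrightarrow> norm (y i) \<le> R"
  shows "(\<lambda>\<alpha>. norm (c \<alpha> * multi_pow d y \<alpha>)) summable_on multi_indices d"
  using assms(1) unfolding ps_summable_def
  by (rule summable_on_norm_comparison)
     (auto simp: norm_mult intro!: mult_left_mono norm_multi_pow_le assms(2))

lemma ps_summable_mono:
  assumes "ps_summable d R c" "0 \<le> s" "s \<le> R"
  shows "ps_summable d s c"
  using assms(1) unfolding ps_summable_def
  by (rule Infinite_Sum.summable_on_comparison_test) (use assms in \<open>auto intro!: mult_left_mono power_mono\<close>)

lemma ps_summable_imp_conv: "ps_summable d R c \<Longrightarrow> ps_conv d R c"
  by (auto simp: ps_conv_def intro: ps_summable_mono)

lemma ps_conv_mono: "ps_conv d R c \<Longrightarrow> s \<le> R \<Longrightarrow> ps_conv d s c"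
  by (auto simp: ps_conv_def)

text \<open>Finitely many strict inequalities leave room below \<open>R\<close>: a point of the open
  polydisc lies in a smaller one, at whose radius \<open>ps_conv\<close> yields absolute
  summability.\<close>

lemma finite_radius:
  fixes y :: "nat \<Rightarrow> 'a::real_normed_vector"
  assumes "0 < R" "\<And>i. i < d \<Longrightarrow> norm (y i) < R"
  obtains s where "0 < s" "s < R" "\<And>i. i < d \<Longrightarrow> norm (y i) < s"
proof -
  \<comment> \<open>The inserted 0 covers \<open>d = 0\<close> and keeps \<open>m\<close>
    nonnegative.\<close>
  define m where "m = Max (insert 0 ((\<lambda>i. norm (y i)) ` {..<d}))"
  have "m < R" "0 \<le> m" unfolding m_def using assms by auto
  have "norm (y i) \<le> m" if "i < d" for i unfolding m_def using that by (intro Max_ge) auto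
  then show ?thesis using that[of "(m+R)/2"] \<open>m < R\<close> \<open>0 \<le> m\<close> assms(1) by fastforce
qed

lemma ps_conv_terms_summable:
  assumes "ps_conv d R c" "0 < R" "\<And>i. i < d \<Longrightarrow> norm (y i) < R"
  shows "(\<lambda>\<alpha>. norm (c \<alpha> * multi_pow d y \<alpha>)) summable_on multi_indices d"
proof -
  obtain s where "0 < s" "s < R" "\<And>i. i < d \<Longrightarrow> norm (y i) < s"
    using finite_radius[of R d y] assms(2,3) by metis
  then show ?thesis using assms(1) ps_terms_summable unfolding ps_conv_def by (meson less_imp_le)
qed

lemma ps_eval_has_sum:
  assumes "ps_conv d R c" "0 < R" "\<And>i. i < d \<Longrightarrow> norm (y i) < R"
  shows "((\<lambda>\<alpha>. c \<alpha> * multi_pow d y \<alpha>) has_sum ps_eval d c y) (multi_indices d)"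
  unfolding ps_eval_def using abs_summable_imp_summable[OF ps_conv_terms_summable[OF assms]] by simp

lemma ps_eval_cong:
  "(\<And>\<alpha>. \<alpha> \<in> multi_indices d \<Longrightarrow> c \<alpha> = c' \<alpha>) \<Longrightarrow> (\<And>i. i < d \<Longrightarrow> y i = y' i) \<Longrightarrow> ps_eval d c y = ps_eval d c' y'"
  unfolding ps_eval_def by (intro infsum_cong) (auto simp: multi_pow_def intro!: prod.cong)

lemma ps_conv_finite_support:
  assumes "finite A" "\<And>\<alpha>. \<alpha> \<notin> A \<Longrightarrow> c \<alpha> = 0"
  shows "ps_conv d R c"
  unfolding ps_conv_def ps_summable_def
proof safe
  fix s
  show "(\<lambda>\<alpha>. norm (c \<alpha>) * s ^ multi_deg d \<alpha>) summable_on multi_indices d"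
    by (rule summable_on_cong_neutral[THEN iffD1, OF _ _ _ summable_on_finite[of "A \<inter> multi_indices d"]])
       (use assms in auto)
qed

lemma ps_eval_zero [simp]: "ps_eval d (\<lambda>_. 0) y = 0"
  by (simp add: ps_eval_def)

lemma ps_conv_zero [simp]: "ps_conv d R (\<lambda>_. 0)"
  by (rule ps_conv_finite_support[of "{}"]) auto

lemma ps_eval_single:
  assumes "\<alpha> \<in> multi_indices d"
  shows "ps_eval d (\<lambda>\<beta>. if \<beta> = \<alpha> then a else 0) y = a * multi_pow d y \<alpha>"
proof -
  have "ps_eval d (\<lambda>\<beta>. if \<beta> = \<alpha> then a else 0) y = (\<Sum>\<^sub>\<infinity>\<beta>\<in>{\<alpha>}. a * multi_pow d y \<beta>)"
    unfolding ps_eval_def by (rule infsum_cong_neutral) (use assms in auto)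
  then show ?thesis by simp
qed

lemma ps_conv_single [simp]: "ps_conv d R (\<lambda>\<beta>. if \<beta> = \<alpha> then a else 0)"
  by (rule ps_conv_finite_support[of "{\<alpha>}"]) auto

lemma ps_eval_at_0: "ps_eval d c (\<lambda>_. 0) = c (\<lambda>_. 0)"
proof -
  have "ps_eval d c (\<lambda>_. 0) = (\<Sum>\<^sub>\<infinity>\<beta>\<in>{\<lambda>_. 0}. c \<beta> * multi_pow d (\<lambda>_. 0) \<beta>)"
    unfolding ps_eval_def by (rule infsum_cong_neutral) (auto simp: multi_pow_zero)
  then show ?thesis by simp
qed

lemma ps_conv_add:
  assumes "ps_conv d R c" "ps_conv d R e"
  shows "ps_conv d R (\<lambda>\<alpha>. c \<alpha> + e \<alpha>)"
  unfolding ps_conv_def ps_summable_def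
proof safe
  fix s :: real assume s: "0 < s" "s < R"
  have "(\<lambda>\<alpha>. norm (c \<alpha>) * s ^ multi_deg d \<alpha> + norm (e \<alpha>) * s ^ multi_deg d \<alpha>) summable_on multi_indices d"
    using assms s by (intro summable_on_add) (auto simp: ps_conv_def ps_summable_def)
  then show "(\<lambda>\<alpha>. norm (c \<alpha> + e \<alpha>) * s ^ multi_deg d \<alpha>) summable_on multi_indices d"
    by (rule Infinite_Sum.summable_on_comparison_test)
       (use s in \<open>auto simp flip: distrib_right intro!: mult_right_mono norm_triangle_ineq\<close>)
qed

lemma ps_eval_add:
  assumes "ps_conv d R c" "ps_conv d R e" "0 < R" "\<And>i. i < d \<Longrightarrow> norm (y i) < R"
  shows "ps_eval d (\<lambda>\<alpha>. c \<alpha> + e \<alpha>) y = ps_eval d c y + ps_eval d e y"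
proof -
  have "((\<lambda>\<alpha>. c \<alpha> * multi_pow d y \<alpha> + e \<alpha> * multi_pow d y \<alpha>) has_sum ps_eval d c y + ps_eval d e y) (multi_indices d)"
    by (intro has_sum_add ps_eval_has_sum[of _ R] assms)
  then show ?thesis unfolding ps_eval_def by (simp add: infsumI distrib_right)
qed

text \<open>Absolute convergence allows the double family over pairs (\<beta>, \<gamma>) to be
  regrouped along \<beta> + \<gamma> = \<alpha>. The type is general because the result is used for
  complex values and for real majorants.\<close>

lemma ps_mult_infsum:
  fixes f g :: "(nat \<Rightarrow> nat) \<Rightarrow> 'a::{real_normed_field,banach}"
  assumes f: "(\<lambda>\<alpha>. norm (f \<alpha>)) summable_on multi_indices d"
    and g: "(\<lambda>\<alpha>. norm (g \<alpha>)) summable_on multi_indices d"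
  shows "(\<lambda>\<alpha>. norm (ps_mult f g \<alpha>)) summable_on multi_indices d"
    and "infsum (ps_mult f g) (multi_indices d) = infsum f (multi_indices d) * infsum g (multi_indices d)"
proof -
  let ?I = "multi_indices d"
  let ?S = "Sigma ?I (\<lambda>\<alpha>. {\<beta>. \<beta> \<le> \<alpha>})"
  define h where "h = (\<lambda>(\<beta>, \<gamma>). f \<beta> * g \<gamma>)"
  have hs: "(\<lambda>p. norm (h p)) summable_on ?I \<times> ?I"
  proof (rule summable_on_SigmaI)
    show "((\<lambda>y. norm (h (x, y))) has_sum norm (f x) * (\<Sum>\<^sub>\<infinity>\<gamma>\<in>?I. norm (g \<gamma>))) ?I" for x
      unfolding h_def by (simp add: norm_mult) (intro has_sum_cmult_right has_sum_infsum g)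
    show "(\<lambda>x. norm (f x) * (\<Sum>\<^sub>\<infinity>\<gamma>\<in>?I. norm (g \<gamma>))) summable_on ?I"
      by (intro summable_on_cmult_left f)
  qed auto
  \<comment> \<open>Pairs (\<alpha>, \<beta>) with \<beta> \<le> \<alpha> correspond to pairs
    (\<beta>, \<alpha> - \<beta>); truncated subtraction inverts addition precisely because \<beta>
    \<le> \<alpha>.\<close>
  have bij: "bij_betw (\<lambda>(\<alpha>, \<beta>). (\<beta>, \<lambda>i. \<alpha> i - \<beta> i)) ?S (?I \<times> ?I)"
    by (rule bij_betw_byWitness[where f' = "\<lambda>(\<beta>, \<gamma>). (\<lambda>i. \<beta> i + \<gamma> i, \<beta>)"])
       (auto simp: le_fun_def intro: multi_indices_add multi_indices_diff multi_indices_le)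
  define h' where "h' = (\<lambda>(\<alpha>, \<beta>). f \<beta> * g (\<lambda>i. \<alpha> i - \<beta> i))"
  have h': "h' p = h ((\<lambda>(\<alpha>, \<beta>). (\<beta>, \<lambda>i. \<alpha> i - \<beta> i)) p)" for p
    by (auto simp: h_def h'_def split: prod.split)
  have h's: "(\<lambda>p. norm (h' p)) summable_on ?S"
    unfolding h' using summable_on_reindex_bij_betw[OF bij, of "\<lambda>p. norm (h p)"] hs by simp
  have fin: "infsum (\<lambda>\<beta>. h' (\<alpha>, \<beta>)) {\<beta>. \<beta> \<le> \<alpha>} = ps_mult f g \<alpha>"
    "infsum (\<lambda>\<beta>. norm (h' (\<alpha>, \<beta>))) {\<beta>. \<beta> \<le> \<alpha>} = (\<Sum>\<beta> | \<beta> \<le> \<alpha>. norm (h' (\<alpha>, \<beta>)))"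
    if "\<alpha> \<in> ?I" for \<alpha>
    using finite_le_multi_index[OF that] by (auto simp: ps_mult_def h'_def)
  have "(\<lambda>\<alpha>. infsum (\<lambda>\<beta>. norm (h' (\<alpha>, \<beta>))) {\<beta>. \<beta> \<le> \<alpha>}) summable_on ?I"
    by (rule summable_on_Sigma_banach) (use h's in \<open>simp add: case_prod_beta'\<close>)
  then have "(\<lambda>\<alpha>. \<Sum>\<beta> | \<beta> \<le> \<alpha>. norm (h' (\<alpha>, \<beta>))) summable_on ?I"
    using fin(2) by (simp cong: summable_on_cong)
  then show "(\<lambda>\<alpha>. norm (ps_mult f g \<alpha>)) summable_on ?I"
    by (rule summable_on_norm_comparison) (auto simp: ps_mult_def h'_def intro: norm_sum)
  have "infsum (ps_mult f g) ?I = infsum (\<lambda>\<alpha>. infsum (\<lambda>\<beta>. h' (\<alpha>, \<beta>)) {\<beta>. \<beta> \<le> \<alpha>}) ?I"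
    using fin(1) by (simp cong: infsum_cong)
  also have "\<dots> = infsum h' ?S"
    by (rule infsum_Sigma_banach) (rule abs_summable_imp_summable[OF h's])
  also have "\<dots> = infsum h (?I \<times> ?I)"
    unfolding h' by (rule infsum_reindex_bij_betw[OF bij])
  also have "\<dots> = infsum (\<lambda>\<beta>. infsum (\<lambda>\<gamma>. h (\<beta>, \<gamma>)) ?I) ?I"
    by (rule infsum_Sigma_banach[symmetric]) (rule abs_summable_imp_summable[OF hs])
  also have "\<dots> = infsum f ?I * infsum g ?I"
    unfolding h_def by (simp add: infsum_cmult_right' infsum_cmult_left')
  finally show "infsum (ps_mult f g) ?I = infsum f ?I * infsum g ?I" .
qed

text \<open>Monomials are multiplicative in the exponent, so weighting by them commutes with the
  Cauchy product. Applied to points and, with constant \<open>y\<close>, to norms.\<close>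

lemma ps_mult_monomial:
  fixes y :: "nat \<Rightarrow> 'a::comm_semiring_1"
  shows "ps_mult (\<lambda>\<alpha>. c \<alpha> * multi_pow d y \<alpha>) (\<lambda>\<alpha>. e \<alpha> * multi_pow d y \<alpha>) \<alpha> = ps_mult c e \<alpha> * multi_pow d y \<alpha>"
  unfolding ps_mult_def sum_distrib_right
proof (rule sum.cong)
  fix \<beta> assume "\<beta> \<in> {\<beta>. \<beta> \<le> \<alpha>}"
  then have "\<alpha> = (\<lambda>i. \<beta> i + (\<alpha> i - \<beta> i))" by (auto simp: le_fun_def)
  then have "multi_pow d y \<alpha> = multi_pow d y \<beta> * multi_pow d y (\<lambda>i. \<alpha> i - \<beta> i)"
    by (metis multi_pow_add)
  then show "c \<beta> * multi_pow d y \<beta> * (e (\<lambda>i. \<alpha> i - \<beta> i) * multi_pow d y (\<lambda>i. \<alpha> i - \<beta> i))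
    = c \<beta> * e (\<lambda>i. \<alpha> i - \<beta> i) * multi_pow d y \<alpha>" by (simp add: mult_ac)
qed auto

lemma norm_ps_mult_le:
  fixes f g :: "(nat \<Rightarrow> nat) \<Rightarrow> 'a::real_normed_field"
  shows "norm (ps_mult f g \<alpha>) \<le> ps_mult (\<lambda>\<beta>. norm (f \<beta>)) (\<lambda>\<beta>. norm (g \<beta>)) \<alpha>"
  unfolding ps_mult_def by (rule order_trans[OF norm_sum]) (simp add: norm_mult)

text \<open>The weight is the monomial at the constant vector \<open>s\<close>, so the moduli form
  majorant series to which the product theorem applies: the weighted l1 norm is
  submultiplicative.\<close>

lemma ps_summable_mult:
  assumes "ps_summable d s c" "ps_summable d s e" "0 \<le> s"
  shows "ps_summable d s (ps_mult c e)"
    and "(\<Sum>\<^sub>\<infinity>\<alpha>\<in>multi_indices d. norm (ps_mult c e \<alpha>) * s ^ multi_deg d \<alpha>)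
      \<le> (\<Sum>\<^sub>\<infinity>\<alpha>\<in>multi_indices d. norm (c \<alpha>) * s ^ multi_deg d \<alpha>) * (\<Sum>\<^sub>\<infinity>\<alpha>\<in>multi_indices d. norm (e \<alpha>) * s ^ multi_deg d \<alpha>)"
proof -
  define f where "f = (\<lambda>\<alpha>. norm (c \<alpha>) * multi_pow d (\<lambda>_. s) \<alpha>)"
  define g where "g = (\<lambda>\<alpha>. norm (e \<alpha>) * multi_pow d (\<lambda>_. s) \<alpha>)"
  have fg: "(\<lambda>\<alpha>. norm (f \<alpha>)) summable_on multi_indices d" "(\<lambda>\<alpha>. norm (g \<alpha>)) summable_on multi_indices d"
    using assms by (simp_all add: f_def g_def multi_pow_const ps_summable_def norm_power)
  have "ps_mult f g \<alpha> = ps_mult (\<lambda>\<alpha>. norm (c \<alpha>)) (\<lambda>\<alpha>. norm (e \<alpha>)) \<alpha> * s ^ multi_deg d \<alpha>" for \<alpha>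
    unfolding f_def g_def by (subst ps_mult_monomial) (simp add: multi_pow_const)
  then have le: "norm (ps_mult c e \<alpha>) * s ^ multi_deg d \<alpha> \<le> ps_mult f g \<alpha>" for \<alpha>
    using assms(3) by (auto intro!: mult_right_mono norm_ps_mult_le)
  have sm: "ps_mult f g summable_on multi_indices d"
    using ps_mult_infsum(1)[OF fg] by (rule abs_summable_imp_summable)
  show 1: "ps_summable d s (ps_mult c e)"
    unfolding ps_summable_def using sm
    by (rule Infinite_Sum.summable_on_comparison_test) (use le assms(3) in auto)
  have "(\<Sum>\<^sub>\<infinity>\<alpha>\<in>multi_indices d. norm (ps_mult c e \<alpha>) * s ^ multi_deg d \<alpha>) \<le> infsum (ps_mult f g) (multi_indices d)"
    using 1 sm le unfolding ps_summable_def by (intro infsum_mono) auto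
  then show "(\<Sum>\<^sub>\<infinity>\<alpha>\<in>multi_indices d. norm (ps_mult c e \<alpha>) * s ^ multi_deg d \<alpha>)
      \<le> (\<Sum>\<^sub>\<infinity>\<alpha>\<in>multi_indices d. norm (c \<alpha>) * s ^ multi_deg d \<alpha>) * (\<Sum>\<^sub>\<infinity>\<alpha>\<in>multi_indices d. norm (e \<alpha>) * s ^ multi_deg d \<alpha>)"
    unfolding ps_mult_infsum(2)[OF fg] by (simp add: f_def g_def multi_pow_const)
qed

lemma ps_conv_mult:
  "ps_conv d R c \<Longrightarrow> ps_conv d R e \<Longrightarrow> ps_conv d R (ps_mult c e)"
  by (auto simp: ps_conv_def intro: ps_summable_mult)

lemma ps_eval_mult:
  assumes "ps_conv d R c" "ps_conv d R e" "0 < R" "\<And>i. i < d \<Longrightarrow> norm (y i) < R"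
  shows "ps_eval d (ps_mult c e) y = ps_eval d c y * ps_eval d e y"
  using ps_mult_infsum(2)[of "\<lambda>\<alpha>. c \<alpha> * multi_pow d y \<alpha>" d "\<lambda>\<alpha>. e \<alpha> * multi_pow d y \<alpha>"]
    ps_conv_terms_summable[of d R c y] ps_conv_terms_summable[of d R e y] assms
  by (simp add: ps_mult_monomial[abs_def] ps_eval_def)

text \<open>Used both for partial derivatives (with \<open>e \<alpha> = \<alpha> i\<close>) and for restrictions to lines
  (with \<open>e \<alpha> = \<bar>\<alpha>\<bar>\<close>).\<close>
lemma has_field_derivative_infsum_powers:
  fixes a :: "'i \<Rightarrow> complex" and e :: "'i \<Rightarrow> nat"
  assumes "\<And>s. 0 < s \<Longrightarrow> s < \<rho> \<Longrightarrow> (\<lambda>i. norm (a i) * s ^ e i) summable_on I" and "norm w < \<rho>"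
  shows "((\<lambda>z. \<Sum>\<^sub>\<infinity>i\<in>I. a i * z ^ e i) has_field_derivative (\<Sum>\<^sub>\<infinity>i\<in>I. a i * (of_nat (e i) * w ^ (e i - 1)))) (at w)"
proof -
  define s where "s = (norm w + \<rho>) / 2"
  have "0 < \<rho>" using assms(2) norm_ge_zero[of w] by (rule le_less_trans[rotated])
  then have s: "norm w < s" "s < \<rho>" "0 < s" using assms(2) unfolding s_def by (auto simp: add_nonneg_pos)
  have sm: "(\<lambda>i. norm (a i) * s ^ e i) summable_on I" using s assms(1) by auto
  \<comment> \<open>Weierstrass M-test for the net of finite partial sums, on a closed disc strictly
    inside the disc of radius \<rho>.\<close>
  have ul: "uniform_limit (cball 0 s) (\<lambda>X z. \<Sum>i\<in>X. a i * z ^ e i) (\<lambda>z. \<Sum>\<^sub>\<infinity>i\<in>I. a i * z ^ e i) (finite_subsets_at_top I)"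
    by (rule Weierstrass_m_test_general[OF _ sm])
       (auto simp: norm_mult norm_power intro!: mult_left_mono power_mono)
  \<comment> \<open>A uniform limit of holomorphic functions may be differentiated term by term
    inside the disc.\<close>
  obtain g' where g': "\<And>w. w \<in> ball 0 s \<Longrightarrow> ((\<lambda>z. \<Sum>\<^sub>\<infinity>i\<in>I. a i * z ^ e i) has_field_derivative g' w) (at w) \<and>
      ((\<lambda>X. \<Sum>i\<in>X. a i * (of_nat (e i) * w ^ (e i - 1))) \<longlongrightarrow> g' w) (finite_subsets_at_top I)"
  proof (rule has_complex_derivative_uniform_limit[OF _ ul _ s(3)])
    show "\<forall>\<^sub>F X in finite_subsets_at_top I. continuous_on (cball 0 s) (\<lambda>z. \<Sum>i\<in>X. a i * z ^ e i) \<and>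
      (\<forall>w\<in>ball 0 s. ((\<lambda>z. \<Sum>i\<in>X. a i * z ^ e i) has_field_derivative (\<Sum>i\<in>X. a i * (of_nat (e i) * w ^ (e i - 1)))) (at w))"
      by (intro always_eventually allI conjI ballI continuous_intros)
         (auto intro!: derivative_eq_intros sum.cong simp: mult_ac)
  qed auto
  have "w \<in> ball 0 s" using s by auto
  note g' = g'[OF this]
  from g' have "((\<lambda>i. a i * (of_nat (e i) * w ^ (e i - 1))) has_sum g' w) I"
    unfolding has_sum_def by auto
  then have "g' w = (\<Sum>\<^sub>\<infinity>i\<in>I. a i * (of_nat (e i) * w ^ (e i - 1)))" by (simp add: infsumI)
  then show ?thesis using g' by simp
qed

text \<open>The linear factor produced by a derivative is paid for by passing to a slightly larger
  radius; the exponent \<open>Suc m\<close> on the right is the degree before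
  differentiation.\<close>

lemma Suc_times_power_bounded:
  assumes "0 < s" "s < (u::real)"
  obtains C where "0 < C" "\<And>m. real (Suc m) * s ^ m \<le> C * u ^ Suc m"
proof -
  have "(\<lambda>m. real m * (s/u) ^ m) \<longlonglongrightarrow> 0"
    using assms by (intro lim_n_over_pown powser_times_n_limit_0) auto
  then have "Bseq (\<lambda>m. real m * (s/u) ^ m)" by (rule convergentI[THEN convergent_imp_Bseq])
  then obtain K where K: "0 < K" "\<And>m. norm (real m * (s/u) ^ m) \<le> K" by (auto simp: Bseq_def)
  show ?thesis
  proof
    show "0 < K / s" using K assms by simp
    fix m
    have "real (Suc m) * (s/u) ^ Suc m \<le> K" using K(2)[of "Suc m"] assms by (simp add: abs_mult)
    then have "real (Suc m) * s ^ Suc m \<le> K * u ^ Suc m"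
      using assms by (simp add: power_divide divide_simps del: power_Suc)
    then show "real (Suc m) * s ^ m \<le> K / s * u ^ Suc m"
      using assms by (simp add: field_simps)
  qed
qed

lemma multi_deg_upd_Suc:
  assumes "i < d"
  shows "multi_deg d (\<alpha>(i := Suc (\<alpha> i))) = Suc (multi_deg d \<alpha>)"
proof -
  have "multi_deg d (\<alpha>(i := Suc (\<alpha> i))) = Suc (\<alpha> i) + (\<Sum>j\<in>{..<d}-{i}. \<alpha> j)"
    unfolding multi_deg_def using assms by (subst sum.remove[of _ i]) auto
  also have "\<dots> = Suc (multi_deg d \<alpha>)"
    unfolding multi_deg_def using assms by (subst (2) sum.remove[of _ i]) auto
  finally show ?thesis .
qed

lemma ps_conv_deriv:
  assumes "ps_conv d R c" "i < d"
  shows "ps_conv d R (ps_deriv i c)"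
  unfolding ps_conv_def ps_summable_def
proof safe
  fix s assume s: "0 < s" "s < R"
  \<comment> \<open>A radius between \<open>s\<close> and \<open>R\<close>: the original series is
    summable there, and the gap absorbs the factor \<alpha> i + 1.\<close>
  define u where "u = (s + R) / 2"
  have u: "s < u" "u < R" "0 < u" using s by (auto simp: u_def)
  obtain C where C: "0 < C" "\<And>m. real (Suc m) * s ^ m \<le> C * u ^ Suc m"
    using Suc_times_power_bounded[OF s(1) u(1)] by metis
  let ?h = "\<lambda>\<alpha>. \<alpha>(i := Suc (\<alpha> i)) :: nat \<Rightarrow> nat"
  have inj: "inj_on ?h (multi_indices d)"
    by (rule inj_onI, rule ext) (metis fun_upd_apply old.nat.inject)
  have "(\<lambda>\<alpha>. norm (c \<alpha>) * u ^ multi_deg d \<alpha>) summable_on multi_indices d"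
    using assms(1) u by (auto simp: ps_conv_def ps_summable_def)
  then have "(\<lambda>\<alpha>. norm (c \<alpha>) * u ^ multi_deg d \<alpha>) summable_on ?h ` multi_indices d"
    by (rule summable_on_subset_banach) (use assms(2) multi_indices_upd in auto)
  then have "(\<lambda>\<alpha>. norm (c (?h \<alpha>)) * u ^ multi_deg d (?h \<alpha>)) summable_on multi_indices d"
    unfolding summable_on_reindex[OF inj] by (simp add: o_def)
  then have "(\<lambda>\<alpha>. C * (norm (c (?h \<alpha>)) * u ^ multi_deg d (?h \<alpha>))) summable_on multi_indices d"
    by (rule summable_on_cmult_right)
  then show "(\<lambda>\<alpha>. norm (ps_deriv i c \<alpha>) * s ^ multi_deg d \<alpha>) summable_on multi_indices d"
  proof (rule Infinite_Sum.summable_on_comparison_test)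
    fix \<alpha> assume "\<alpha> \<in> multi_indices d"
    have "norm (ps_deriv i c \<alpha>) * s ^ multi_deg d \<alpha> = norm (c (?h \<alpha>)) * (real (Suc (\<alpha> i)) * s ^ multi_deg d \<alpha>)"
      by (simp add: ps_deriv_def norm_mult del: of_nat_Suc of_nat_add)
    also have "\<dots> \<le> norm (c (?h \<alpha>)) * (real (Suc (multi_deg d \<alpha>)) * s ^ multi_deg d \<alpha>)"
      using le_multi_deg[OF assms(2), of \<alpha>] s by (intro mult_left_mono mult_right_mono) auto
    also have "\<dots> \<le> norm (c (?h \<alpha>)) * (C * u ^ Suc (multi_deg d \<alpha>))"
      using C by (intro mult_left_mono) auto
    finally show "norm (ps_deriv i c \<alpha>) * s ^ multi_deg d \<alpha> \<le> C * (norm (c (?h \<alpha>)) * u ^ multi_deg d (?h \<alpha>))"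
      by (simp add: multi_deg_upd_Suc[OF assms(2)] mult_ac)
  qed (use s in auto)
qed

lemma ps_eval_has_deriv:
  assumes "ps_conv d R c" "0 < R" "\<And>j. j < d \<Longrightarrow> norm (y j) < R" "i < d"
  shows "((\<lambda>s. ps_eval d c (y(i := s))) has_field_derivative ps_eval d (ps_deriv i c) y) (at (y i))"
proof -
  let ?a = "\<lambda>\<alpha>. c \<alpha> * multi_pow d y (\<alpha>(i := 0))"
  have 1: "ps_eval d c (y(i := s)) = (\<Sum>\<^sub>\<infinity>\<alpha>\<in>multi_indices d. ?a \<alpha> * s ^ \<alpha> i)" for s
    unfolding ps_eval_def multi_pow_upd[OF assms(4)] by (simp add: mult_ac)
  have "((\<lambda>s. \<Sum>\<^sub>\<infinity>\<alpha>\<in>multi_indices d. ?a \<alpha> * s ^ \<alpha> i) has_field_derivative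
      (\<Sum>\<^sub>\<infinity>\<alpha>\<in>multi_indices d. ?a \<alpha> * (of_nat (\<alpha> i) * (y i) ^ (\<alpha> i - 1)))) (at (y i))"
  proof (rule has_field_derivative_infsum_powers)
    show "norm (y i) < R" using assms by auto
    fix s :: real assume "0 < s" "s < R"
    then have "\<And>j. j < d \<Longrightarrow> norm ((y(i := of_real s)) j) < R" using assms(3) by auto
    then have "(\<lambda>\<alpha>. norm (c \<alpha> * multi_pow d (y(i := of_real s)) \<alpha>)) summable_on multi_indices d"
      by (rule ps_conv_terms_summable[OF assms(1,2)])
    then show "(\<lambda>\<alpha>. norm (?a \<alpha>) * s ^ \<alpha> i) summable_on multi_indices d"
      unfolding multi_pow_upd[OF assms(4)] using \<open>0 < s\<close> by (simp add: norm_mult norm_power mult_ac)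
  qed
  moreover have "(\<Sum>\<^sub>\<infinity>\<alpha>\<in>multi_indices d. ?a \<alpha> * (of_nat (\<alpha> i) * (y i) ^ (\<alpha> i - 1))) = ps_eval d (ps_deriv i c) y"
  proof -
    \<comment> \<open>Terms with \<alpha> i = 0 are killed by the factor
      \<open>of_nat (\<alpha> i)\<close>; every other index is a shift \<open>?h \<alpha>\<close>,
      and undoing the shift turns the sum into that of \<open>ps_deriv\<close>.\<close>
    let ?h = "\<lambda>\<alpha>. \<alpha>(i := Suc (\<alpha> i)) :: nat \<Rightarrow> nat"
    have inj: "inj_on ?h (multi_indices d)"
      by (rule inj_onI, rule ext) (metis fun_upd_apply old.nat.inject)
    have "(\<Sum>\<^sub>\<infinity>\<alpha>\<in>multi_indices d. ?a \<alpha> * (of_nat (\<alpha> i) * (y i) ^ (\<alpha> i - 1)))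
       = (\<Sum>\<^sub>\<infinity>\<alpha>\<in>?h ` multi_indices d. ?a \<alpha> * (of_nat (\<alpha> i) * (y i) ^ (\<alpha> i - 1)))"
    proof (rule infsum_cong_neutral)
      fix \<alpha> assume \<alpha>: "\<alpha> \<in> multi_indices d - ?h ` multi_indices d"
      have "\<alpha> i = 0"
      proof (rule ccontr)
        assume "\<alpha> i \<noteq> 0"
        then have "\<alpha> = ?h (\<alpha>(i := \<alpha> i - 1))" by auto
        moreover have "\<alpha>(i := \<alpha> i - 1) \<in> multi_indices d" using \<alpha> assms(4) by (intro multi_indices_upd) auto
        ultimately show False using \<alpha> by blast
      qed
      then show "?a \<alpha> * (of_nat (\<alpha> i) * (y i) ^ (\<alpha> i - 1)) = 0" by simp
    qed (use assms(4) multi_indices_upd in auto)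
    also have "\<dots> = (\<Sum>\<^sub>\<infinity>\<alpha>\<in>multi_indices d. ?a (?h \<alpha>) * (of_nat (?h \<alpha> i) * (y i) ^ (?h \<alpha> i - 1)))"
      by (subst infsum_reindex[OF inj]) (simp only: o_def)
    also have "\<dots> = ps_eval d (ps_deriv i c) y"
      unfolding ps_eval_def
    proof (rule infsum_cong)
      fix \<alpha>
      have "multi_pow d y \<alpha> = y i ^ \<alpha> i * multi_pow d y (\<alpha>(i := 0))"
        using multi_pow_upd[OF assms(4), of y "y i" \<alpha>] by simp
      then show "?a (?h \<alpha>) * (of_nat (?h \<alpha> i) * (y i) ^ (?h \<alpha> i - 1)) = ps_deriv i c \<alpha> * multi_pow d y \<alpha>"
        by (simp add: ps_deriv_def mult_ac)
    qed
    finally show ?thesis .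
  qed
  ultimately show ?thesis unfolding 1 by simp
qed

section \<open>Expansions around a point of \<open>{0} \<times> N \<times> U\<close>\<close>

text \<open>Concatenation: \<open>a\<close> fills the first \<open>n\<close> places and
  \<open>b\<close> is moved behind them. Points and exponents are joined in the same way, which
  makes (t, x, z) the variables of one series.\<close>

definition jn :: "nat \<Rightarrow> (nat \<Rightarrow> 'a) \<Rightarrow> (nat \<Rightarrow> 'a) \<Rightarrow> nat \<Rightarrow> 'a" where
  "jn n a b = (\<lambda>i. if i < n then a i else b (i - n))"

lemma jn_0 [simp]: "jn 0 a b = b"
  by (simp add: jn_def)

lemma jn_zero [simp]: "jn n (\<lambda>_. c) (\<lambda>_. c) = (\<lambda>_. c)"
  by (auto simp: jn_def)

lemma jn_mem: "\<alpha> \<in> multi_indices n \<Longrightarrow> \<beta> \<in> multi_indices e \<Longrightarrow> jn n \<alpha> \<beta> \<in> multi_indices (n + e)"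
  by (auto simp: jn_def multi_indices_def)

lemma bij_betw_jn: "bij_betw (\<lambda>(\<alpha>, \<beta>). jn n \<alpha> \<beta>) (multi_indices n \<times> multi_indices e) (multi_indices (n + e))"
  by (rule bij_betw_byWitness[where f' = "\<lambda>\<gamma>. (\<lambda>i. if i < n then \<gamma> i else 0, \<lambda>i. \<gamma> (i + n))"])
     (auto simp: jn_def multi_indices_def fun_eq_iff)

lemma jn_cases:
  assumes "\<delta> \<in> multi_indices (n + e)"
  obtains \<alpha> \<beta> where "\<alpha> \<in> multi_indices n" "\<beta> \<in> multi_indices e" "\<delta> = jn n \<alpha> \<beta>"
proof -
  have "\<delta> \<in> (\<lambda>(\<alpha>, \<beta>). jn n \<alpha> \<beta>) ` (multi_indices n \<times> multi_indices e)"
    using assms bij_betw_imp_surj_on[OF bij_betw_jn[of n e]] by simp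
  then show ?thesis using that by force
qed

lemma multi_pow_jn: "multi_pow (n + e) (jn n y w) (jn n \<alpha> \<beta>) = multi_pow n y \<alpha> * multi_pow e w \<beta>"
proof -
  have "(\<Prod>i<n+e. jn n y w i ^ jn n \<alpha> \<beta> i) = (\<Prod>i<n. jn n y w i ^ jn n \<alpha> \<beta> i) * (\<Prod>i=n..<n+e. jn n y w i ^ jn n \<alpha> \<beta> i)"
    by (subst prod.union_disjoint[symmetric]) (auto intro!: prod.cong)
  also have "(\<Prod>i=n..<n+e. jn n y w i ^ jn n \<alpha> \<beta> i) = (\<Prod>i<e. w i ^ \<beta> i)"
    by (rule prod.reindex_bij_witness[of _ "\<lambda>i. i + n" "\<lambda>i. i - n"]) (auto simp: jn_def)
  also have "(\<Prod>i<n. jn n y w i ^ jn n \<alpha> \<beta> i) = (\<Prod>i<n. y i ^ \<alpha> i)"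
    by (rule prod.cong) (auto simp: jn_def)
  finally show ?thesis by (simp add: multi_pow_def)
qed

lemma multi_deg_jn: "multi_deg (n + e) (jn n \<alpha> \<beta>) = multi_deg n \<alpha> + multi_deg e \<beta>"
proof -
  have "(\<Sum>i<n+e. jn n \<alpha> \<beta> i) = (\<Sum>i<n. jn n \<alpha> \<beta> i) + (\<Sum>i=n..<n+e. jn n \<alpha> \<beta> i)"
    by (subst sum.union_disjoint[symmetric]) (auto intro!: sum.cong)
  also have "(\<Sum>i=n..<n+e. jn n \<alpha> \<beta> i) = (\<Sum>i<e. \<beta> i)"
    by (rule sum.reindex_bij_witness[of _ "\<lambda>i. i + n" "\<lambda>i. i - n"]) (auto simp: jn_def)
  also have "(\<Sum>i<n. jn n \<alpha> \<beta> i) = (\<Sum>i<n. \<alpha> i)"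
    by (rule sum.cong) (auto simp: jn_def)
  finally show ?thesis by (simp add: multi_deg_def)
qed

lemma summable_on_jn:
  fixes f :: "(nat \<Rightarrow> nat) \<Rightarrow> real"
  shows "f summable_on multi_indices (n + e) \<longleftrightarrow>
    (\<lambda>(\<alpha>, \<beta>). f (jn n \<alpha> \<beta>)) summable_on multi_indices n \<times> multi_indices e"
  using summable_on_reindex_bij_betw[OF bij_betw_jn, of f] by (simp add: case_prod_beta')

text \<open>A slice is the coefficient of t^\<alpha> as a series in the remaining variables. It is a
  subfamily of the whole series, whose weights carry the extra factor
  \<open>R ^ multi_deg n \<alpha>\<close>; the second bound therefore plays the part of Cauchy's
  estimate in t.\<close>

lemma ps_summable_slice:
  assumes "ps_summable (n + e) R c" "\<alpha> \<in> multi_indices n" "0 < R"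
  shows "ps_summable e R (\<lambda>\<beta>. c (jn n \<alpha> \<beta>))"
    and "(\<Sum>\<^sub>\<infinity>\<beta>\<in>multi_indices e. norm (c (jn n \<alpha> \<beta>)) * R ^ multi_deg e \<beta>)
      \<le> (\<Sum>\<^sub>\<infinity>\<delta>\<in>multi_indices (n + e). norm (c \<delta>) * R ^ multi_deg (n + e) \<delta>) / R ^ multi_deg n \<alpha>"
proof -
  let ?F = "\<lambda>\<delta>. norm (c \<delta>) * R ^ multi_deg (n + e) \<delta>"
  have inj: "inj_on (jn n \<alpha>) (multi_indices e)"
    by (rule inj_onI, rule ext) (metis add_diff_cancel_right' jn_def not_add_less2)
  have sub: "jn n \<alpha> ` multi_indices e \<subseteq> multi_indices (n + e)" using jn_mem[OF assms(2)] by auto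
  have sm: "?F summable_on jn n \<alpha> ` multi_indices e"
    using assms(1) sub unfolding ps_summable_def by (rule summable_on_subset_banach)
  then have sm': "(\<lambda>\<beta>. R ^ multi_deg n \<alpha> * (norm (c (jn n \<alpha> \<beta>)) * R ^ multi_deg e \<beta>)) summable_on multi_indices e"
    unfolding summable_on_reindex[OF inj] by (simp add: o_def multi_deg_jn power_add mult_ac)
  then show "ps_summable e R (\<lambda>\<beta>. c (jn n \<alpha> \<beta>))"
    unfolding ps_summable_def using assms(3) by (subst (asm) summable_on_cmult_right') auto
  have "R ^ multi_deg n \<alpha> * (\<Sum>\<^sub>\<infinity>\<beta>\<in>multi_indices e. norm (c (jn n \<alpha> \<beta>)) * R ^ multi_deg e \<beta>)
      = infsum ?F (jn n \<alpha> ` multi_indices e)"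
    by (subst infsum_reindex[OF inj])
       (simp add: o_def multi_deg_jn power_add mult_ac infsum_cmult_right'[symmetric])
  also have "\<dots> \<le> infsum ?F (multi_indices (n + e))"
    using sm assms(1,3) sub unfolding ps_summable_def by (intro infsum_mono2) auto
  finally show "(\<Sum>\<^sub>\<infinity>\<beta>\<in>multi_indices e. norm (c (jn n \<alpha> \<beta>)) * R ^ multi_deg e \<beta>)
      \<le> infsum ?F (multi_indices (n + e)) / R ^ multi_deg n \<alpha>"
    using assms(3) by (simp add: field_simps)
qed

lemma ps_conv_slice: "ps_conv (n + e) R c \<Longrightarrow> \<alpha> \<in> multi_indices n \<Longrightarrow> ps_conv e R (\<lambda>\<beta>. c (jn n \<alpha> \<beta>))"
  by (auto simp: ps_conv_def intro: ps_summable_slice)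

lemma jn_norm_less:
  assumes "\<And>i. i < n \<Longrightarrow> norm (y i) < R" "\<And>i. i < e \<Longrightarrow> norm (w i) < R" "i < n + e"
  shows "norm (jn n y w i) < R"
  using assms by (auto simp: jn_def)

text \<open>Fubini: the last \<open>e\<close> variables are summed first, which exhibits the
  function as a series in \<open>y\<close> whose coefficients are functions of
  \<open>w\<close>.\<close>

lemma ps_eval_jn_has_sum:
  assumes "ps_conv (n + e) R c" "0 < R" "\<And>i. i < n \<Longrightarrow> norm (y i) < R" "\<And>i. i < e \<Longrightarrow> norm (w i) < R"
  shows "((\<lambda>\<alpha>. ps_eval e (\<lambda>\<beta>. c (jn n \<alpha> \<beta>)) w * multi_pow n y \<alpha>) has_sum ps_eval (n + e) c (jn n y w)) (multi_indices n)"
proof -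
  let ?F = "\<lambda>\<delta>. c \<delta> * multi_pow (n + e) (jn n y w) \<delta>"
  have "(?F has_sum ps_eval (n + e) c (jn n y w)) (multi_indices (n + e))"
    using assms by (intro ps_eval_has_sum[of _ R]) (auto intro: jn_norm_less)
  then have "((\<lambda>p. ?F ((\<lambda>(\<alpha>, \<beta>). jn n \<alpha> \<beta>) p)) has_sum ps_eval (n + e) c (jn n y w)) (multi_indices n \<times> multi_indices e)"
    by (subst has_sum_reindex_bij_betw[OF bij_betw_jn])
  then show ?thesis
  proof (rule has_sum_SigmaD)
    fix \<alpha> assume \<alpha>: "\<alpha> \<in> multi_indices n"
    have "((\<lambda>\<beta>. c (jn n \<alpha> \<beta>) * multi_pow e w \<beta> * multi_pow n y \<alpha>) has_sum ps_eval e (\<lambda>\<beta>. c (jn n \<alpha> \<beta>)) w * multi_pow n y \<alpha>) (multi_indices e)"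
      by (intro has_sum_cmult_left ps_eval_has_sum[of _ R] assms ps_conv_slice \<alpha>)
    then show "((\<lambda>\<beta>. ?F ((\<lambda>(\<alpha>, \<beta>). jn n \<alpha> \<beta>) (\<alpha>, \<beta>))) has_sum ps_eval e (\<lambda>\<beta>. c (jn n \<alpha> \<beta>)) w * multi_pow n y \<alpha>) (multi_indices e)"
      by (simp add: multi_pow_jn mult_ac)
  qed
qed

lemma ps_eval_jn_zero: "ps_eval (n + e) c (jn n (\<lambda>_. 0) w) = ps_eval e (\<lambda>\<beta>. c (jn n (\<lambda>_. 0) \<beta>)) w"
proof -
  have inj: "inj_on (jn n (\<lambda>_. 0)) (multi_indices e)"
    by (rule inj_onI, rule ext) (metis add_diff_cancel_right' jn_def not_add_less2)
  have "ps_eval (n + e) c (jn n (\<lambda>_. 0) w)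
      = (\<Sum>\<^sub>\<infinity>\<delta>\<in>jn n (\<lambda>_. 0) ` multi_indices e. c \<delta> * multi_pow (n + e) (jn n (\<lambda>_. 0) w) \<delta>)"
    unfolding ps_eval_def
  proof (rule infsum_cong_neutral)
    fix \<delta> assume \<delta>: "\<delta> \<in> multi_indices (n + e) - jn n (\<lambda>_. 0) ` multi_indices e"
    then obtain \<alpha> \<beta> where ab: "\<alpha> \<in> multi_indices n" "\<beta> \<in> multi_indices e" "\<delta> = jn n \<alpha> \<beta>"
      using jn_cases by blast
    with \<delta> have "\<alpha> \<noteq> (\<lambda>_. 0)" by auto
    then show "c \<delta> * multi_pow (n + e) (jn n (\<lambda>_. 0) w) \<delta> = 0"
      unfolding ab(3) multi_pow_jn using multi_pow_zero[OF ab(1), where 'a = complex] by simp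
  qed (auto intro: jn_mem)
  then show ?thesis
    unfolding ps_eval_def infsum_reindex[OF inj] by (simp add: o_def multi_pow_jn)
qed

text \<open>Regards a function of the last variables as constant in the first \<open>n\<close>:
  \<lambda> is passed in this way from z to (x, z) and on to (t, x, z), and a series with a single
  term in t is written with it.\<close>

definition ps_lift :: "nat \<Rightarrow> ((nat \<Rightarrow> nat) \<Rightarrow> complex) \<Rightarrow> (nat \<Rightarrow> nat) \<Rightarrow> complex" where
  "ps_lift n c = (\<lambda>\<delta>. if \<forall>i<n. \<delta> i = 0 then c (\<lambda>i. \<delta> (i + n)) else 0)"

lemma ps_lift_jn: "\<alpha> \<in> multi_indices n \<Longrightarrow> ps_lift n c (jn n \<alpha> \<beta>) = (if \<alpha> = (\<lambda>_. 0) then c \<beta> else 0)"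
  by (auto simp: ps_lift_def jn_def multi_indices_def fun_eq_iff) (metis not_le neq0_conv)

text \<open>Formulated for any \<open>F\<close> that vanishes together with the lifted coefficients,
  so that both the value and the absolute summability of a lift can be read off.\<close>

lemma ps_lift_neutral:
  assumes "\<And>\<delta>. c' \<delta> = 0 \<Longrightarrow> F \<delta> = (0::'a::{comm_monoid_add,t2_space})" "c' = ps_lift n c"
  shows "infsum F (multi_indices (n + e)) = infsum (\<lambda>\<beta>. F (jn n (\<lambda>_. 0) \<beta>)) (multi_indices e)"
    "F summable_on multi_indices (n + e) \<longleftrightarrow> (\<lambda>\<beta>. F (jn n (\<lambda>_. 0) \<beta>)) summable_on multi_indices e"
proof -
  have inj: "inj_on (jn n (\<lambda>_. 0)) (multi_indices e)"
    by (rule inj_onI, rule ext) (metis add_diff_cancel_right' jn_def not_add_less2)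
  have *: "F \<delta> = 0" if \<delta>: "\<delta> \<in> multi_indices (n + e) - jn n (\<lambda>_. 0) ` multi_indices e" for \<delta>
  proof -
    obtain \<alpha> \<beta> where ab: "\<alpha> \<in> multi_indices n" "\<beta> \<in> multi_indices e" "\<delta> = jn n \<alpha> \<beta>"
      using jn_cases \<delta> by blast
    with \<delta> have "\<alpha> \<noteq> (\<lambda>_. 0)" by auto
    then show ?thesis using assms ps_lift_jn[OF ab(1)] ab by auto
  qed
  have sub: "jn n (\<lambda>_. 0) ` multi_indices e \<subseteq> multi_indices (n + e)" by (auto intro: jn_mem)
  have "infsum F (multi_indices (n + e)) = infsum F (jn n (\<lambda>_. 0) ` multi_indices e)"
    by (rule infsum_cong_neutral) (use * sub in auto)
  then show "infsum F (multi_indices (n + e)) = infsum (\<lambda>\<beta>. F (jn n (\<lambda>_. 0) \<beta>)) (multi_indices e)"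
    unfolding infsum_reindex[OF inj] by (simp add: o_def)
  have "F summable_on multi_indices (n + e) \<longleftrightarrow> F summable_on (jn n (\<lambda>_. 0) ` multi_indices e)"
    by (rule summable_on_cong_neutral) (use * sub in auto)
  then show "F summable_on multi_indices (n + e) \<longleftrightarrow> (\<lambda>\<beta>. F (jn n (\<lambda>_. 0) \<beta>)) summable_on multi_indices e"
    unfolding summable_on_reindex[OF inj] by (simp add: o_def)
qed

lemma ps_conv_lift:
  assumes "ps_conv e R c"
  shows "ps_conv (n + e) R (ps_lift n c)"
  unfolding ps_conv_def ps_summable_def
proof safe
  fix s assume "0 < s" "s < R"
  have "(\<lambda>\<delta>. norm (ps_lift n c \<delta>) * s ^ multi_deg (n + e) \<delta>) summable_on multi_indices (n + e) \<longleftrightarrow>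
    (\<lambda>\<beta>. norm (ps_lift n c (jn n (\<lambda>_. 0) \<beta>)) * s ^ multi_deg (n + e) (jn n (\<lambda>_. 0) \<beta>)) summable_on multi_indices e"
    by (rule ps_lift_neutral(2)[of "ps_lift n c" _ n c]) auto
  then show "(\<lambda>\<delta>. norm (ps_lift n c \<delta>) * s ^ multi_deg (n + e) \<delta>) summable_on multi_indices (n + e)"
    using assms \<open>0 < s\<close> \<open>s < R\<close> by (simp add: ps_lift_jn multi_deg_jn ps_conv_def ps_summable_def)
qed

lemma ps_eval_lift: "ps_eval (n + e) (ps_lift n c) (jn n y w) = ps_eval e c w"
proof -
  have "(\<Sum>\<^sub>\<infinity>\<delta>\<in>multi_indices (n + e). ps_lift n c \<delta> * multi_pow (n + e) (jn n y w) \<delta>) =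
    (\<Sum>\<^sub>\<infinity>\<beta>\<in>multi_indices e. ps_lift n c (jn n (\<lambda>_. 0) \<beta>) * multi_pow (n + e) (jn n y w) (jn n (\<lambda>_. 0) \<beta>))"
    by (rule ps_lift_neutral(1)[of "ps_lift n c" _ n c]) auto
  then show ?thesis unfolding ps_eval_def by (simp add: ps_lift_jn multi_pow_jn)
qed

text \<open>A box around the point (0, \<open>x0\<close>, \<open>z0\<close>) of the zero section,
  real in t and x, complex in z. For \<open>n = 0\<close> the first condition forces t = 0, so the
  same predicate serves functions on \<open>N \<times> U\<close>.\<close>

definition in_box where
  "in_box n k l x0 z0 R t x z \<longleftrightarrow>
     t \<in> topspace (Euclidean_space n) \<and> x \<in> topspace (Euclidean_space k) \<and> z \<in> topspace (Complex_space l) \<and>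
     (\<forall>i<n. \<bar>t i\<bar> < R) \<and> (\<forall>i<k. \<bar>x i - x0 i\<bar> < R) \<and> (\<forall>i<l. cmod (z i - z0 i) < R)"

text \<open>The displacement from (0, \<open>x0\<close>, \<open>z0\<close>), written as one complex
  vector that can be inserted into a power series.\<close>

definition pt :: "nat \<Rightarrow> nat \<Rightarrow> (nat \<Rightarrow> real) \<Rightarrow> (nat \<Rightarrow> complex) \<Rightarrow> (nat \<Rightarrow> real) \<Rightarrow> (nat \<Rightarrow> real) \<Rightarrow> (nat \<Rightarrow> complex) \<Rightarrow> nat \<Rightarrow> complex" where
  "pt n k x0 z0 t x z = jn n (\<lambda>i. of_real (t i)) (jn k (\<lambda>i. of_real (x i - x0 i)) (\<lambda>i. z i - z0 i))"

text \<open>Working form of \<open>jointly_analytic_at\<close> along t = 0. Radius and coefficient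
  array are explicit because the later estimates concern them rather than the function.\<close>

definition expands where
  "expands n k l f x0 z0 R c \<longleftrightarrow> 0 < R \<and> ps_conv (n + (k + l)) R c \<and>
     (\<forall>t x z. in_box n k l x0 z0 R t x z \<longrightarrow> f t x z = ps_eval (n + (k + l)) c (pt n k x0 z0 t x z))"

lemma Complex_space_topspace: "z \<in> topspace (Complex_space l) \<longleftrightarrow> (\<forall>i\<ge>l. z i = 0)"
  by (simp add: Complex_space_def)

lemma Euclidean_space_topspace: "x \<in> topspace (Euclidean_space n) \<longleftrightarrow> (\<forall>i\<ge>n. x i = 0)"
  by (simp add: topspace_Euclidean_space)

lemma pt_norm_less: "in_box n k l x0 z0 R t x z \<Longrightarrow> i < n + (k + l) \<Longrightarrow> norm (pt n k x0 z0 t x z i) < R"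
  by (auto simp: pt_def jn_def in_box_def norm_of_real simp del: of_real_diff)

lemma in_box_mono: "in_box n k l x0 z0 s t x z \<Longrightarrow> s \<le> R \<Longrightarrow> in_box n k l x0 z0 R t x z"
  by (fastforce simp: in_box_def)

lemma expands_mono: "expands n k l f x0 z0 R c \<Longrightarrow> 0 < s \<Longrightarrow> s \<le> R \<Longrightarrow> expands n k l f x0 z0 s c"
  unfolding expands_def by (meson in_box_mono ps_conv_mono)

lemma expandsD: "expands n k l f x0 z0 R c \<Longrightarrow> in_box n k l x0 z0 R t x z \<Longrightarrow> f t x z = ps_eval (n + (k + l)) c (pt n k x0 z0 t x z)"
  by (simp add: expands_def)

lemma expands_cong:
  assumes "\<And>t x z. in_box n k l x0 z0 R t x z \<Longrightarrow> f t x z = g t x z"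
  shows "expands n k l f x0 z0 R c \<longleftrightarrow> expands n k l g x0 z0 R c"
  using assms by (auto simp: expands_def)

lemma multi_pow_of_real: "multi_pow d (\<lambda>i. of_real (y i)) \<alpha> = of_real (multi_pow d y \<alpha>)"
  by (simp add: multi_pow_def)

lemma bij_betw_jn3:
  "bij_betw (\<lambda>(\<alpha>, \<beta>, \<gamma>). jn n \<alpha> (jn k \<beta> \<gamma>)) (multi_indices n \<times> multi_indices k \<times> multi_indices l) (multi_indices (n + (k + l)))"
proof -
  have "bij_betw ((\<lambda>(\<alpha>, \<beta>). jn n \<alpha> \<beta>) \<circ> map_prod id (\<lambda>(\<beta>, \<gamma>). jn k \<beta> \<gamma>))
      (multi_indices n \<times> multi_indices k \<times> multi_indices l) (multi_indices (n + (k + l)))"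
    by (intro bij_betw_trans[OF _ bij_betw_jn] bij_betw_map_prod bij_betw_jn) auto
  moreover have "(\<lambda>(\<alpha>, \<beta>). jn n \<alpha> \<beta>) \<circ> map_prod id (\<lambda>(\<beta>, \<gamma>). jn k \<beta> \<gamma>) = (\<lambda>(\<alpha>, \<beta>, \<gamma>). jn n \<alpha> (jn k \<beta> \<gamma>) :: nat \<Rightarrow> nat)"
    by auto
  ultimately show ?thesis by (simp only:)
qed

lemma has_sum_jn3:
  "((\<lambda>(\<alpha>, \<beta>, \<gamma>). c (jn n \<alpha> (jn k \<beta> \<gamma>)) * of_real (multi_pow n t \<alpha>) * of_real (multi_pow k x \<beta>) * multi_pow l z \<gamma>)
     has_sum S) (multi_indices n \<times> multi_indices k \<times> multi_indices l) \<longleftrightarrow>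
   ((\<lambda>\<delta>. c \<delta> * multi_pow (n + (k + l)) (jn n (\<lambda>i. of_real (t i)) (jn k (\<lambda>i. of_real (x i)) z)) \<delta>)
     has_sum S) (multi_indices (n + (k + l)))"
  by (subst has_sum_reindex_bij_betw[OF bij_betw_jn3[of n k l], symmetric])
     (simp add: case_prod_beta' multi_pow_jn multi_pow_of_real mult_ac)

text \<open>The sums in the definition run over an unordered index set, so for complex terms they
  converge absolutely. Evaluation at suitable points of the box then gives
  \<open>ps_conv\<close>.\<close>

lemma jointly_analytic_at_iff:
  "jointly_analytic_at n k l f (\<lambda>_. 0) x0 z0 \<longleftrightarrow> (\<exists>R c. expands n k l f x0 z0 R c)"
proof
  assume "jointly_analytic_at n k l f (\<lambda>_. 0) x0 z0"
  then obtain R c3 where R: "R > 0" and c3: "\<And>t x z. in_box n k l x0 z0 R t x z \<Longrightarrow>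
      ((\<lambda>(\<alpha>, \<beta>, \<gamma>). c3 \<alpha> \<beta> \<gamma> * of_real (multi_pow n t \<alpha>) * of_real (multi_pow k (\<lambda>i. x i - x0 i) \<beta>)
              * multi_pow l (\<lambda>i. z i - z0 i) \<gamma>)
            has_sum f t x z) (multi_indices n \<times> multi_indices k \<times> multi_indices l)"
    unfolding jointly_analytic_at_def in_box_def by fastforce
  \<comment> \<open>The three exponents are recovered from the joint one; on multi-indices this
    inverts \<open>jn\<close>.\<close>
  define c where "c = (\<lambda>\<delta>. c3 (\<lambda>i. if i < n then \<delta> i else 0) (\<lambda>i. if i < k then \<delta> (i + n) else 0) (\<lambda>i. \<delta> (i + k + n)))"
  have cc: "c3 \<alpha> \<beta> \<gamma> = c (jn n \<alpha> (jn k \<beta> \<gamma>))" if "\<alpha> \<in> multi_indices n" "\<beta> \<in> multi_indices k" for \<alpha> \<beta> \<gamma>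
  proof -
    have "\<alpha> = (\<lambda>i. if i < n then jn n \<alpha> (jn k \<beta> \<gamma>) i else 0)" "\<beta> = (\<lambda>i. if i < k then jn n \<alpha> (jn k \<beta> \<gamma>) (i + n) else 0)"
      "\<gamma> = (\<lambda>i. jn n \<alpha> (jn k \<beta> \<gamma>) (i + k + n))"
      using that by (auto simp: jn_def multi_indices_def)
    then show ?thesis unfolding c_def by metis
  qed
  have *: "((\<lambda>\<delta>. c \<delta> * multi_pow (n + (k + l)) (pt n k x0 z0 t x z) \<delta>) has_sum f t x z) (multi_indices (n + (k + l)))"
    if "in_box n k l x0 z0 R t x z" for t x z
    using c3[OF that] unfolding pt_def has_sum_jn3[symmetric]
    by (subst (asm) has_sum_cong[where g = "\<lambda>(\<alpha>, \<beta>, \<gamma>). c (jn n \<alpha> (jn k \<beta> \<gamma>)) * of_real (multi_pow n t \<alpha>) * of_real (multi_pow k (\<lambda>i. x i - x0 i) \<beta>)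
              * multi_pow l (\<lambda>i. z i - z0 i) \<gamma>"]) (auto simp: cc)
  have "ps_conv (n + (k + l)) R c"
    unfolding ps_conv_def ps_summable_def
  proof safe
    fix s assume s: "0 < s" "s < R"
    \<comment> \<open>The point all of whose displacements equal \<open>s\<close>: there each
      monomial attains its maximal modulus on the closed polydisc of radius \<open>s\<close>, which
      is the weight in \<open>ps_summable\<close>.\<close>
    let ?t = "\<lambda>i. if i < n then s else 0" and ?x = "\<lambda>i. if i < k then x0 i + s else 0"
      and ?z = "\<lambda>i. if i < l then z0 i + of_real s else 0"
    have "in_box n k l x0 z0 R ?t ?x ?z"
      using s by (auto simp: in_box_def Complex_space_topspace Euclidean_space_topspace)
    from *[OF this] have "(\<lambda>\<delta>. norm (c \<delta> * multi_pow (n + (k + l)) (pt n k x0 z0 ?t ?x ?z) \<delta>)) summable_on multi_indices (n + (k + l))"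
      by (rule summable_on_iff_abs_summable_on_complex[THEN iffD1, OF has_sum_imp_summable])
    moreover have "multi_pow (n + (k + l)) (pt n k x0 z0 ?t ?x ?z) \<delta> = multi_pow (n + (k + l)) (\<lambda>_. of_real s) \<delta>" for \<delta>
      unfolding multi_pow_def by (rule prod.cong) (auto simp: pt_def jn_def)
    ultimately show "(\<lambda>\<alpha>. norm (c \<alpha>) * s ^ multi_deg (n + (k + l)) \<alpha>) summable_on multi_indices (n + (k + l))"
      using s by (simp add: norm_mult multi_pow_const norm_power)
  qed
  then have "expands n k l f x0 z0 R c"
    using R * unfolding expands_def ps_eval_def by (auto intro!: infsumI[symmetric])
  then show "\<exists>R c. expands n k l f x0 z0 R c" by blast
next
  assume "\<exists>R c. expands n k l f x0 z0 R c"
  then obtain R c where Rc: "expands n k l f x0 z0 R c" by blast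
  then have *: "((\<lambda>\<delta>. c \<delta> * multi_pow (n + (k + l)) (pt n k x0 z0 t x z) \<delta>) has_sum f t x z) (multi_indices (n + (k + l)))"
    if "in_box n k l x0 z0 R t x z" for t x z
    using ps_eval_has_sum[of "n + (k + l)" R c "pt n k x0 z0 t x z"] pt_norm_less[OF that] that
    by (auto simp: expands_def)
  show "jointly_analytic_at n k l f (\<lambda>_. 0) x0 z0"
    unfolding jointly_analytic_at_def
  proof (rule exI[of _ R], safe)
    show "0 < R" using Rc by (simp add: expands_def)
    show "\<exists>c. \<forall>t\<in>topspace (Euclidean_space n). \<forall>x\<in>topspace (Euclidean_space k). \<forall>z\<in>topspace (Complex_space l).
         (\<forall>i<n. \<bar>t i - 0\<bar> < R) \<and> (\<forall>i<k. \<bar>x i - x0 i\<bar> < R) \<and> (\<forall>i<l. cmod (z i - z0 i) < R) \<longrightarrow>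
         ((\<lambda>(\<alpha>, \<beta>, \<gamma>). c \<alpha> \<beta> \<gamma> * of_real (multi_pow n (\<lambda>i. t i - 0) \<alpha>) * of_real (multi_pow k (\<lambda>i. x i - x0 i) \<beta>)
              * multi_pow l (\<lambda>i. z i - z0 i) \<gamma>) has_sum f t x z) (multi_indices n \<times> multi_indices k \<times> multi_indices l)"
      by (rule exI[of _ "\<lambda>\<alpha> \<beta> \<gamma>. c (jn n \<alpha> (jn k \<beta> \<gamma>))"], intro ballI impI)
         (use * in \<open>simp add: has_sum_jn3 pt_def in_box_def\<close>)
  qed
qed

subsection \<open>Closure properties\<close>

lemma expands_add:
  "expands n k l f x0 z0 R c \<Longrightarrow> expands n k l g x0 z0 R e \<Longrightarrow>
   expands n k l (\<lambda>t x z. f t x z + g t x z) x0 z0 R (\<lambda>\<alpha>. c \<alpha> + e \<alpha>)"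
  unfolding expands_def using pt_norm_less by (auto simp: ps_conv_add ps_eval_add)

lemma expands_mult:
  "expands n k l f x0 z0 R c \<Longrightarrow> expands n k l g x0 z0 R e \<Longrightarrow>
   expands n k l (\<lambda>t x z. f t x z * g t x z) x0 z0 R (ps_mult c e)"
  unfolding expands_def using pt_norm_less by (auto simp: ps_conv_mult ps_eval_mult)

lemma expands_zero: "0 < R \<Longrightarrow> expands n k l (\<lambda>t x z. 0) x0 z0 R (\<lambda>_. 0)"
  by (simp add: expands_def)

lemma expands_const: "0 < R \<Longrightarrow> expands n k l (\<lambda>t x z. a) x0 z0 R (\<lambda>\<beta>. if \<beta> = (\<lambda>_. 0) then a else 0)"
  by (simp add: expands_def ps_eval_single)

lemma expands_sum:
  assumes "\<And>i. i \<in> I \<Longrightarrow> expands n k l (f i) x0 z0 R (c i)" "0 < R"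
  shows "expands n k l (\<lambda>t x z. \<Sum>i\<in>I. f i t x z) x0 z0 R (\<lambda>\<alpha>. \<Sum>i\<in>I. c i \<alpha>)"
proof (cases "finite I")
  case True
  then show ?thesis using assms(1)
    by (induction I rule: finite_induct) (auto simp: expands_zero assms(2) intro: expands_add)
qed (simp add: expands_zero assms(2))

lemma expands_uminus:
  "expands n k l f x0 z0 R c \<Longrightarrow> expands n k l (\<lambda>t x z. - f t x z) x0 z0 R (\<lambda>\<alpha>. - c \<alpha>)"
  by (auto simp: expands_def ps_conv_def ps_summable_def ps_eval_def infsum_uminus)

lemma expands_coord:
  assumes "i < n" "0 < R"
  shows "expands n k l (\<lambda>t x z. of_real (t i)) x0 z0 R (\<lambda>\<beta>. if \<beta> = (\<lambda>_. 0)(i := 1) then 1 else 0)"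
proof -
  have "multi_pow (n + (k + l)) y ((\<lambda>_. 0)(i := 1)) = y i" for y :: "nat \<Rightarrow> complex"
  proof -
    have "multi_pow (n + (k + l)) y ((\<lambda>_. 0)(i := 1)) = (\<Prod>j<n+(k+l). if j = i then y i else 1)"
      unfolding multi_pow_def by (rule prod.cong) auto
    then show ?thesis using assms by simp
  qed
  moreover have "(\<lambda>_. 0)(i := 1) \<in> multi_indices (n + (k + l))"
    using assms by (auto simp: multi_indices_def)
  ultimately show ?thesis using assms
    by (simp add: expands_def ps_eval_single pt_def jn_def)
qed

lemma expands_lift:
  assumes "expands 0 k l (\<lambda>_. u) x0 z0 R c"
  shows "expands n k l (\<lambda>_. u) x0 z0 R (ps_lift n c)"
  unfolding expands_def
proof safe
  show "0 < R" "ps_conv (n + (k + l)) R (ps_lift n c)"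
    using assms by (auto simp: expands_def ps_conv_lift)
  fix t x z assume "in_box n k l x0 z0 R t x z"
  then have "in_box 0 k l x0 z0 R (\<lambda>_. 0) x z"
    by (simp add: in_box_def Euclidean_space_topspace)
  from expandsD[OF assms this] show "u x z = ps_eval (n + (k + l)) (ps_lift n c) (pt n k x0 z0 t x z)"
    by (simp add: pt_def ps_eval_lift)
qed

lemma expands_lift_x:
  assumes "expands 0 0 l (\<lambda>_ _. u) x0' z0 R c"
  shows "expands 0 k l (\<lambda>_ _. u) x0 z0 R (ps_lift k c)"
  unfolding expands_def
proof safe
  show "0 < R" "ps_conv (0 + (k + l)) R (ps_lift k c)"
    using assms by (auto simp: expands_def ps_conv_lift)
  fix t x z assume "in_box 0 k l x0 z0 R t x z"
  then have "in_box 0 0 l x0' z0 R (\<lambda>_. 0) (\<lambda>_. 0) z"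
    by (simp add: in_box_def Euclidean_space_topspace)
  from expandsD[OF assms this] show "u z = ps_eval (0 + (k + l)) (ps_lift k c) (pt 0 k x0 z0 t x z)"
    by (simp add: pt_def ps_eval_lift)
qed

subsection \<open>Derivatives and Taylor coefficients\<close>

text \<open>Coordinate functionals that detect differentiability; this treats scalar, vector and matrix
  valued functions uniformly.\<close>
definition components :: "('c \<Rightarrow> 'b::real_normed_vector \<Rightarrow> complex) \<Rightarrow> bool" where
  "components prj \<longleftrightarrow> (\<forall>j. bounded_linear (prj j)) \<and>
     (\<forall>g D s. (\<forall>j. ((\<lambda>s. prj j (g s)) has_vector_derivative D j) (at (s::real))) \<longrightarrow>
        (\<exists>v. (g has_vector_derivative v) (at s)))"

lemma has_vector_derivative_vecI:
  fixes g :: "real \<Rightarrow> 'b::real_normed_vector ^ 'm::finite"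
  assumes "\<And>j. ((\<lambda>s. g s $ j) has_vector_derivative D j) (at s)"
  shows "(g has_vector_derivative (\<chi> j. D j)) (at s)"
  unfolding has_vector_derivative_def has_derivative_at2
proof safe
  show "bounded_linear (\<lambda>x. x *\<^sub>R (\<chi> j. D j))" by (rule bounded_linear_scaleR_left)
  show "(\<lambda>y. (1 / norm (y - s)) *\<^sub>R (g y - (g s + (y - s) *\<^sub>R (\<chi> j. D j)))) \<midarrow>s\<rightarrow> 0"
  proof (rule vec_tendstoI)
    fix j
    show "((\<lambda>y. ((1 / norm (y - s)) *\<^sub>R (g y - (g s + (y - s) *\<^sub>R (\<chi> j. D j)))) $ j) \<longlongrightarrow> 0 $ j) (at s)"
      using assms[of j] unfolding has_vector_derivative_def has_derivative_at2 by simp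
  qed
qed

lemma components_id: "components (\<lambda>(_::unit) v. v)"
  by (auto simp: components_def bounded_linear_ident)

lemma components_vec: "components (\<lambda>j (v :: complex ^ 'm::finite). v $ j)"
  unfolding components_def using has_vector_derivative_vecI bounded_linear_vec_nth by blast

lemma components_mat: "components (\<lambda>(i, j) (A :: complex ^ 'm::finite ^ 'n::finite). A $ i $ j)"
  unfolding components_def
proof (intro conjI allI impI)
  show "bounded_linear ((\<lambda>(i, j) (A :: complex ^ 'm ^ 'n). A $ i $ j) p)" for p
    using bounded_linear_compose[OF bounded_linear_vec_nth bounded_linear_vec_nth] by (cases p) simp
next
  fix g :: "real \<Rightarrow> complex ^ 'm ^ 'n" and D s
  assume *: "\<forall>p. ((\<lambda>s. (\<lambda>(i, j) A. A $ i $ j) p (g s)) has_vector_derivative D p) (at s)"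
  have "((\<lambda>s. g s $ i $ j) has_vector_derivative D (i, j)) (at s)" for i j
    using *[rule_format, of "(i, j)"] by simp
  then have "((\<lambda>s. g s $ i) has_vector_derivative (\<chi> j. D (i, j))) (at s)" for i
    by (rule has_vector_derivative_vecI)
  then show "\<exists>v. (g has_vector_derivative v) (at s)"
    by (intro exI) (rule has_vector_derivative_vecI)
qed

text \<open>\<open>vector_derivative\<close> is meaningful only where a derivative exists. The
  second clause of \<open>components\<close> supplies existence, and uniqueness of the derivative of
  each component then identifies the value.\<close>

lemma components_derivative:
  assumes "components prj" "\<And>j. ((\<lambda>s. prj j (g s)) has_vector_derivative D j) (at s)"
  shows "prj j (vector_derivative g (at s)) = D j"
proof -
  obtain v where v: "(g has_vector_derivative v) (at s)"
    using assms unfolding components_def by meson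
  have "bounded_linear (prj j)" using assms(1) by (simp add: components_def)
  from bounded_linear.has_vector_derivative[OF this v] assms(2)[of j]
  have "prj j v = D j" by (rule vector_derivative_unique_at)
  then show ?thesis using vector_derivative_at[OF v] by simp
qed

definition vexpands where
  "vexpands prj n k l f x0 z0 R C \<longleftrightarrow> (\<forall>j. expands n k l (\<lambda>t x z. prj j (f t x z)) x0 z0 R (C j))"

lemma pt_upd_t: "i < n \<Longrightarrow> pt n k x0 z0 (t(i := s)) x z = (pt n k x0 z0 t x z)(i := of_real s)"
  by (auto simp: pt_def jn_def)

lemma pt_upd_x: "i < k \<Longrightarrow> pt n k x0 z0 t (x(i := s)) z = (pt n k x0 z0 t x z)(n + i := of_real (s - x0 i))"
  by (auto simp: pt_def jn_def fun_eq_iff)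

text \<open>Chain rule along a real path in one complex variable. The shift \<open>a\<close> is the
  base point of that variable: 0 for t, and \<open>x0 i\<close> for x.\<close>

lemma ps_eval_has_vector_derivative:
  assumes "ps_conv d R c" "0 < R" "\<And>j. j < d \<Longrightarrow> norm (y j) < R" "i < d" "y i = of_real (s0 - a)"
  shows "((\<lambda>s. ps_eval d c (y(i := of_real (s - a)))) has_vector_derivative ps_eval d (ps_deriv i c) y) (at s0)"
proof -
  have 1: "((\<lambda>s. of_real (s - a) :: complex) has_vector_derivative 1) (at s0)"
    using has_vector_derivative_of_real[of "\<lambda>s. s - a" 1 "at s0"] by (auto intro!: derivative_eq_intros)
  have 2: "((\<lambda>w. ps_eval d c (y(i := w))) has_field_derivative ps_eval d (ps_deriv i c) y) (at (of_real (s0 - a)))"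
    using ps_eval_has_deriv[of d R c y i] assms by simp
  from field_vector_diff_chain_at[OF 1 2] show ?thesis by (simp add: o_def)
qed

text \<open>Differentiation keeps the radius, since \<open>ps_conv\<close> refers to the open
  polydisc; derivatives of any order can be taken without shrinking the box.\<close>

lemma vexpands_partial_t:
  assumes prj: "components prj" and v: "vexpands prj n k l f x0 z0 R C" and i: "i < n"
  shows "vexpands prj n k l (\<lambda>t x z. partial_deriv i (\<lambda>t. f t x z) t) x0 z0 R (\<lambda>j. ps_deriv i (C j))"
  unfolding vexpands_def expands_def
proof safe
  fix j
  have e: "expands n k l (\<lambda>t x z. prj j (f t x z)) x0 z0 R (C j)" for j
    using v by (simp add: vexpands_def)
  show "0 < R" using e by (simp add: expands_def)
  show "ps_conv (n + (k + l)) R (ps_deriv i (C j))"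
    using e i by (auto simp: expands_def intro: ps_conv_deriv)
  fix t x z assume box: "in_box n k l x0 z0 R t x z"
  have *: "((\<lambda>s. prj j (f (t(i := s)) x z)) has_vector_derivative
      ps_eval (n + (k + l)) (ps_deriv i (C j)) (pt n k x0 z0 t x z)) (at (t i))" for j
  proof (rule has_vector_derivative_transform_within_open)
    show "((\<lambda>s. ps_eval (n + (k + l)) (C j) ((pt n k x0 z0 t x z)(i := of_real (s - 0)))) has_vector_derivative
      ps_eval (n + (k + l)) (ps_deriv i (C j)) (pt n k x0 z0 t x z)) (at (t i))"
      by (rule ps_eval_has_vector_derivative[of _ R])
         (use e i box in \<open>auto simp: expands_def pt_norm_less, simp add: pt_def jn_def\<close>)
    \<comment> \<open>As long as the i-th coordinate moves in this interval the point stays in the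
      box, so function and series agree near \<open>t i\<close> and have the same
      derivative.\<close>
    show "open {-R<..<R}" "t i \<in> {-R<..<R}" using box i by (auto simp: in_box_def abs_less_iff)
    fix s assume "s \<in> {-R<..<R}"
    then have "in_box n k l x0 z0 R (t(i := s)) x z"
      using box i by (auto simp: in_box_def Euclidean_space_topspace)
    from expandsD[OF e this] show "ps_eval (n + (k + l)) (C j) ((pt n k x0 z0 t x z)(i := of_real (s - 0))) = prj j (f (t(i := s)) x z)"
      by (simp add: pt_upd_t i)
  qed
  from components_derivative[OF prj, of "\<lambda>s. f (t(i := s)) x z", OF *]
  show "prj j (partial_deriv i (\<lambda>t. f t x z) t) = ps_eval (n + (k + l)) (ps_deriv i (C j)) (pt n k x0 z0 t x z)"
    by (simp add: partial_deriv_def)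
qed

lemma vexpands_partial_x:
  assumes prj: "components prj" and v: "vexpands prj n k l f x0 z0 R C" and i: "i < k"
  shows "vexpands prj n k l (\<lambda>t x z. partial_deriv i (\<lambda>x. f t x z) x) x0 z0 R (\<lambda>j. ps_deriv (n + i) (C j))"
  unfolding vexpands_def expands_def
proof safe
  fix j
  have e: "expands n k l (\<lambda>t x z. prj j (f t x z)) x0 z0 R (C j)" for j
    using v by (simp add: vexpands_def)
  show "0 < R" using e by (simp add: expands_def)
  show "ps_conv (n + (k + l)) R (ps_deriv (n + i) (C j))"
    using e i by (auto simp: expands_def intro: ps_conv_deriv)
  fix t x z assume box: "in_box n k l x0 z0 R t x z"
  have *: "((\<lambda>s. prj j (f t (x(i := s)) z)) has_vector_derivative
      ps_eval (n + (k + l)) (ps_deriv (n + i) (C j)) (pt n k x0 z0 t x z)) (at (x i))" for j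
  proof (rule has_vector_derivative_transform_within_open)
    show "((\<lambda>s. ps_eval (n + (k + l)) (C j) ((pt n k x0 z0 t x z)(n + i := of_real (s - x0 i)))) has_vector_derivative
      ps_eval (n + (k + l)) (ps_deriv (n + i) (C j)) (pt n k x0 z0 t x z)) (at (x i))"
      by (rule ps_eval_has_vector_derivative[of _ R])
         (use e i box in \<open>auto simp: expands_def pt_norm_less, simp add: pt_def jn_def\<close>)
    show "open {x0 i - R<..<x0 i + R}" "x i \<in> {x0 i - R<..<x0 i + R}" using box i by (auto simp: in_box_def abs_less_iff)
    fix s assume "s \<in> {x0 i - R<..<x0 i + R}"
    then have "in_box n k l x0 z0 R t (x(i := s)) z"
      using box i by (auto simp: in_box_def Euclidean_space_topspace)
    from expandsD[OF e this] show "ps_eval (n + (k + l)) (C j) ((pt n k x0 z0 t x z)(n + i := of_real (s - x0 i))) = prj j (f t (x(i := s)) z)"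
      by (simp add: pt_upd_x i)
  qed
  from components_derivative[OF prj, of "\<lambda>s. f t (x(i := s)) z", OF *]
  show "prj j (partial_deriv i (\<lambda>x. f t x z) x) = ps_eval (n + (k + l)) (ps_deriv (n + i) (C j)) (pt n k x0 z0 t x z)"
    by (simp add: partial_deriv_def)
qed

text \<open>The variables numbered m, ..., m + d - 1 are differentiated: m = 0 serves for t in a
  series in (t, x, z) and for x in a series in (x, z), and m = n for x in a series in (t, x,
  z).\<close>

definition ps_mderiv :: "nat \<Rightarrow> nat \<Rightarrow> (nat \<Rightarrow> nat) \<Rightarrow> ((nat \<Rightarrow> nat) \<Rightarrow> complex) \<Rightarrow> (nat \<Rightarrow> nat) \<Rightarrow> complex" where
  "ps_mderiv m d \<alpha> c = fold (\<lambda>i. ps_deriv (m + i) ^^ \<alpha> i) [0..<d] c"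

lemma vexpands_multi_t:
  assumes prj: "components prj" and v: "vexpands prj n k l f x0 z0 R C" and "d \<le> n"
  shows "vexpands prj n k l (\<lambda>t x z. multi_deriv d \<alpha> (\<lambda>t. f t x z) t) x0 z0 R (\<lambda>j. ps_mderiv 0 d \<alpha> (C j))"
proof -
  have pow: "vexpands prj n k l (\<lambda>t x z. (partial_deriv i ^^ m) (\<lambda>t. g t x z) t) x0 z0 R (\<lambda>j. (ps_deriv i ^^ m) (E j))"
    if "vexpands prj n k l g x0 z0 R E" "i < n" for i m g E
    by (induction m) (use that vexpands_partial_t[OF prj] in auto)
  show ?thesis
    using \<open>d \<le> n\<close> unfolding multi_deriv_def ps_mderiv_def
  proof (induction d)
    case (Suc d)
    then show ?case using pow[of "\<lambda>t x z. fold (\<lambda>i. partial_deriv i ^^ \<alpha> i) [0..<d] (\<lambda>t. f t x z) t" _ d "\<alpha> d"] by simp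
  qed (use v in simp)
qed

lemma vexpands_multi_x:
  assumes prj: "components prj" and v: "vexpands prj n k l f x0 z0 R C" and "d \<le> k"
  shows "vexpands prj n k l (\<lambda>t x z. multi_deriv d \<alpha> (\<lambda>x. f t x z) x) x0 z0 R (\<lambda>j. ps_mderiv n d \<alpha> (C j))"
proof -
  have pow: "vexpands prj n k l (\<lambda>t x z. (partial_deriv i ^^ m) (\<lambda>x. g t x z) x) x0 z0 R (\<lambda>j. (ps_deriv (n + i) ^^ m) (E j))"
    if "vexpands prj n k l g x0 z0 R E" "i < k" for i m g E
    by (induction m) (use that vexpands_partial_x[OF prj] in auto)
  show ?thesis
    using \<open>d \<le> k\<close> unfolding multi_deriv_def ps_mderiv_def
  proof (induction d)
    case (Suc d)
    then show ?case using pow[of "\<lambda>t x z. fold (\<lambda>i. partial_deriv i ^^ \<alpha> i) [0..<d] (\<lambda>x. f t x z) x" _ d "\<alpha> d"] by simp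
  qed (use v in simp)
qed

lemma ps_deriv_funpow:
  "(ps_deriv i ^^ m) c \<beta> = fact (\<beta> i + m) / fact (\<beta> i) * c (\<beta>(i := \<beta> i + m))"
proof (induction m arbitrary: \<beta>)
  case (Suc m)
  let ?\<beta> = "\<beta>(i := Suc (\<beta> i))"
  have upd: "?\<beta>(i := ?\<beta> i + m) = \<beta>(i := \<beta> i + Suc m)" by simp
  have "(ps_deriv i ^^ Suc m) c \<beta> = of_nat (Suc (\<beta> i)) * (ps_deriv i ^^ m) c ?\<beta>"
    by (simp add: ps_deriv_def)
  also have "\<dots> = of_nat (Suc (\<beta> i)) * (fact (\<beta> i + Suc m) / fact (Suc (\<beta> i)) * c (\<beta>(i := \<beta> i + Suc m)))"
    unfolding Suc upd by simp
  also have "\<dots> = fact (\<beta> i + Suc m) / fact (\<beta> i) * c (\<beta>(i := \<beta> i + Suc m))"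
    by (simp add: fact_Suc[of "\<beta> i"] del: of_nat_Suc fact_Suc)
  finally show ?case .
qed simp

lemma ps_mderiv_eq:
  "ps_mderiv m d \<alpha> c \<beta> = (\<Prod>i<d. fact (\<beta> (m + i) + \<alpha> i) / fact (\<beta> (m + i))) *
     c (\<lambda>j. if m \<le> j \<and> j < m + d then \<beta> j + \<alpha> (j - m) else \<beta> j)"
proof (induction d arbitrary: \<beta>)
  case 0
  then show ?case by (simp add: ps_mderiv_def) (meson not_le)
next
  case (Suc d)
  have "ps_mderiv m (Suc d) \<alpha> c \<beta> = (ps_deriv (m + d) ^^ \<alpha> d) (ps_mderiv m d \<alpha> c) \<beta>"
    by (simp add: ps_mderiv_def)
  also have "\<dots> = fact (\<beta> (m + d) + \<alpha> d) / fact (\<beta> (m + d)) * ps_mderiv m d \<alpha> c (\<beta>(m + d := \<beta> (m + d) + \<alpha> d))"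
    by (simp add: ps_deriv_funpow)
  also have "ps_mderiv m d \<alpha> c (\<beta>(m + d := \<beta> (m + d) + \<alpha> d)) =
     (\<Prod>i<d. fact (\<beta> (m + i) + \<alpha> i) / fact (\<beta> (m + i))) *
     c (\<lambda>j. if m \<le> j \<and> j < m + Suc d then \<beta> j + \<alpha> (j - m) else \<beta> j)"
    unfolding Suc by (intro arg_cong2[of _ _ _ _ "(*)"] prod.cong arg_cong[of _ _ c])
       (auto simp: fun_eq_iff less_Suc_eq)
  finally show ?case by (simp add: mult_ac)
qed

text \<open>At t = 0 only the slice at index 0 of the differentiated series remains. The quotients
  of factorials reduce there to the factorials of \<gamma>, which the normalisation cancels, and
  what is left is the slice of the original array at \<gamma>.\<close>

lemma taylor_coeff_expands:
  assumes prj: "components prj" and v: "vexpands prj n k l f x0 z0 R C"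
    and \<gamma>: "\<gamma> \<in> multi_indices n" and box: "in_box n k l x0 z0 R (\<lambda>_. 0) x z"
  shows "prj j (taylor_coeff n f \<gamma> x z) = ps_eval (k + l) (\<lambda>b. C j (jn n \<gamma> b)) (pt 0 k x0 z0 (\<lambda>_. 0) x z)"
proof -
  let ?y = "jn k (\<lambda>i. of_real (x i - x0 i)) (\<lambda>i. z i - z0 i)"
  have bl: "bounded_linear (prj j)" using prj by (simp add: components_def)
  have "vexpands prj n k l (\<lambda>t x z. multi_deriv n \<gamma> (\<lambda>t. f t x z) t) x0 z0 R (\<lambda>j. ps_mderiv 0 n \<gamma> (C j))"
    by (rule vexpands_multi_t[OF prj v]) simp
  then have "prj j (multi_deriv n \<gamma> (\<lambda>t. f t x z) (\<lambda>_. 0)) = ps_eval (n + (k + l)) (ps_mderiv 0 n \<gamma> (C j)) (pt n k x0 z0 (\<lambda>_. 0) x z)"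
    using expandsD[OF _ box] unfolding vexpands_def by blast
  also have "\<dots> = ps_eval (k + l) (\<lambda>b. ps_mderiv 0 n \<gamma> (C j) (jn n (\<lambda>_. 0) b)) ?y"
    unfolding pt_def of_real_0 ps_eval_jn_zero ..
  also have "\<dots> = ps_eval (k + l) (\<lambda>b. (\<Prod>i<n. fact (\<gamma> i)) * C j (jn n \<gamma> b)) ?y"
  proof (rule ps_eval_cong)
    fix b
    have "(\<lambda>j. if 0 \<le> j \<and> j < 0 + n then jn n (\<lambda>_. 0) b j + \<gamma> (j - 0) else jn n (\<lambda>_. 0) b j) = jn n \<gamma> b"
      by (auto simp: jn_def)
    moreover have "(\<Prod>i<n. fact (jn n (\<lambda>_. 0) b (0 + i) + \<gamma> i) / fact (jn n (\<lambda>_. 0) b (0 + i)) :: complex) = (\<Prod>i<n. fact (\<gamma> i))"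
      by (rule prod.cong) (auto simp: jn_def)
    ultimately show "ps_mderiv 0 n \<gamma> (C j) (jn n (\<lambda>_. 0) b) = (\<Prod>i<n. fact (\<gamma> i)) * C j (jn n \<gamma> b)"
      unfolding ps_mderiv_eq by simp
  qed auto
  also have "\<dots> = (\<Prod>i<n. fact (\<gamma> i)) * ps_eval (k + l) (\<lambda>b. C j (jn n \<gamma> b)) ?y"
    unfolding ps_eval_def by (simp add: infsum_cmult_right' mult.assoc)
  finally have *: "prj j (multi_deriv n \<gamma> (\<lambda>t. f t x z) (\<lambda>_. 0)) = (\<Prod>i<n. fact (\<gamma> i)) * ps_eval (k + l) (\<lambda>b. C j (jn n \<gamma> b)) ?y" .
  have nz: "(\<Prod>i<n. fact (\<gamma> i) :: complex) \<noteq> 0" by simp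
  have "prj j (taylor_coeff n f \<gamma> x z) = prj j (multi_deriv n \<gamma> (\<lambda>t. f t x z) (\<lambda>_. 0)) /\<^sub>R (\<Prod>i<n. fact (\<gamma> i))"
    unfolding taylor_coeff_def using bounded_linear.linear[OF bl] by (simp add: linear_cmul)
  also have "\<dots> = ps_eval (k + l) (\<lambda>b. C j (jn n \<gamma> b)) ?y"
    unfolding * using nz by (simp add: scaleR_conv_of_real)
  finally show ?thesis by (simp add: pt_def)
qed

lemma ps_eval_0: "ps_eval 0 c y = c (\<lambda>_. 0)"
  by (simp add: ps_eval_def)

text \<open>Coefficients are recovered as Taylor coefficients: all \<open>d\<close> variables are
  treated as t, and there are no x and z. Agreement at real points is enough, as befits real
  analytic functions.\<close>

lemma ps_unique:
  assumes "ps_conv d R c" "ps_conv d R e" "0 < R" "\<alpha> \<in> multi_indices d"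
    and eq: "\<And>y. (\<And>i. i < d \<Longrightarrow> \<bar>y i\<bar> < R) \<Longrightarrow> ps_eval d c (\<lambda>i. of_real (y i)) = ps_eval d e (\<lambda>i. of_real (y i))"
  shows "c \<alpha> = e \<alpha>"
proof -
  define f where "f = (\<lambda>t (x :: nat \<Rightarrow> real) (z :: nat \<Rightarrow> complex). ps_eval d c (\<lambda>i. of_real (t i :: real)))"
  have pt: "ps_eval d g (pt d 0 (\<lambda>_. 0) (\<lambda>_. 0) t x z) = ps_eval d g (\<lambda>i. of_real (t i))" for g t x z
    by (rule ps_eval_cong) (auto simp: pt_def jn_def)
  have 1: "vexpands (\<lambda>(_::unit) v. v) d 0 0 f (\<lambda>_. 0) (\<lambda>_. 0) R (\<lambda>_. c)"
    using assms by (simp add: vexpands_def expands_def pt f_def)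
  have 2: "vexpands (\<lambda>(_::unit) v. v) d 0 0 f (\<lambda>_. 0) (\<lambda>_. 0) R (\<lambda>_. e)"
    using assms by (auto simp: vexpands_def expands_def pt f_def in_box_def)
  have box: "in_box d 0 0 (\<lambda>_. 0) (\<lambda>_. 0) R (\<lambda>_. 0) (\<lambda>_. 0) (\<lambda>_. 0)"
    using \<open>0 < R\<close> by (simp add: in_box_def Euclidean_space_topspace Complex_space_topspace)
  have "jn d \<alpha> (\<lambda>_. 0) = \<alpha>" using assms(4) by (auto simp: jn_def multi_indices_def)
  then show ?thesis
    using taylor_coeff_expands[OF components_id 1 assms(4) box] taylor_coeff_expands[OF components_id 2 assms(4) box]
    by (simp add: ps_eval_0)
qed

text \<open>The two series are compared within the smaller radius. Real displacements of z from
  \<open>z0\<close> suffice, because \<open>ps_unique\<close> asks for real points only.\<close>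

lemma expands_unique:
  assumes 1: "expands n k l f x0 z0 R c" and 2: "expands n k l f x0 z0 R' e" and "\<alpha> \<in> multi_indices (n + (k + l))"
    and x0: "x0 \<in> topspace (Euclidean_space k)" and z0: "z0 \<in> topspace (Complex_space l)"
  shows "c \<alpha> = e \<alpha>"
proof -
  define S where "S = min R R'"
  have S: "0 < S" "S \<le> R" "S \<le> R'" using 1 2 by (auto simp: S_def expands_def)
  show ?thesis
  proof (rule ps_unique[of "n + (k + l)" S c e \<alpha>])
    show "ps_conv (n + (k + l)) S c" "ps_conv (n + (k + l)) S e"
      using 1 2 S by (auto simp: expands_def intro: ps_conv_mono)
    fix y :: "nat \<Rightarrow> real" assume y: "\<And>i. i < n + (k + l) \<Longrightarrow> \<bar>y i\<bar> < S"
    let ?t = "\<lambda>i. if i < n then y i else 0" and ?x = "\<lambda>i. if i < k then x0 i + y (i + n) else 0"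
      and ?z = "\<lambda>i. if i < l then z0 i + of_real (y (i + k + n)) else 0"
    have box: "in_box n k l x0 z0 S ?t ?x ?z"
      using y by (auto simp: in_box_def Euclidean_space_topspace Complex_space_topspace)
    have pt: "ps_eval (n + (k + l)) g (pt n k x0 z0 ?t ?x ?z) = ps_eval (n + (k + l)) g (\<lambda>i. of_real (y i))" for g
      by (rule ps_eval_cong) (auto simp: pt_def jn_def)
    show "ps_eval (n + (k + l)) c (\<lambda>i. of_real (y i)) = ps_eval (n + (k + l)) e (\<lambda>i. of_real (y i))"
      using expandsD[OF 1 in_box_mono[OF box S(2)]] expandsD[OF 2 in_box_mono[OF box S(3)]] by (simp add: pt)
  qed (use S assms in auto)
qed

section \<open>Truncated Nagumo norms\<close>

text \<open>The weights make differentiation map level \<open>p\<close> to level \<open>p + 1\<close> at the cost of a factor \<open>(p + 1) / s\<close>,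
  while multiplication by a convergent series is bounded uniformly in \<open>p\<close>.  Only the coefficients up to
  degree \<open>D\<close> are counted, so that no convergence has to be known beforehand.\<close>
definition nagumo :: "nat \<Rightarrow> real \<Rightarrow> nat \<Rightarrow> nat \<Rightarrow> ((nat \<Rightarrow> nat) \<Rightarrow> complex) \<Rightarrow> real" where
  "nagumo d s p D u = (\<Sum>\<alpha> | \<alpha> \<in> multi_indices d \<and> multi_deg d \<alpha> \<le> D.
     norm (u \<alpha>) * s ^ multi_deg d \<alpha> / real ((p + multi_deg d \<alpha>) choose multi_deg d \<alpha>))"

lemma nagumo_nonneg: "0 \<le> s \<Longrightarrow> 0 \<le> nagumo d s p D u"
  unfolding nagumo_def by (intro sum_nonneg) auto

lemma choose_pos': "0 < real ((p + b) choose b)"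
  by (simp add: zero_less_binomial_iff)

lemma choose_mono_left: "p \<le> p' \<Longrightarrow> (p + b) choose b \<le> (p' + b) choose b"
  by (rule binomial_right_mono) simp

lemma choose_mono_right:
  assumes "b \<le> b'"
  shows "(p + b) choose b \<le> (p + b') choose b'"
proof -
  have "(p + b) choose b = (p + b) choose p" "(p + b') choose b' = (p + b') choose p"
    using binomial_symmetric[of b "p + b"] binomial_symmetric[of b' "p + b'"] by auto
  then show ?thesis using assms binomial_right_mono[of "p + b" "p + b'" p] by simp
qed

lemma nagumo_cong: "(\<And>\<alpha>. \<alpha> \<in> multi_indices d \<Longrightarrow> u \<alpha> = v \<alpha>) \<Longrightarrow> nagumo d s p D u = nagumo d s p D v"
  unfolding nagumo_def by (rule sum.cong) auto

lemma nagumo_add: "0 \<le> s \<Longrightarrow> nagumo d s p D (\<lambda>\<alpha>. u \<alpha> + v \<alpha>) \<le> nagumo d s p D u + nagumo d s p D v"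
  unfolding nagumo_def sum.distrib[symmetric]
  by (intro sum_mono) (auto simp flip: add_divide_distrib distrib_right intro!: divide_right_mono mult_right_mono norm_triangle_ineq)

lemma nagumo_zero [simp]: "nagumo d s p D (\<lambda>_. 0) = 0"
  by (simp add: nagumo_def)

lemma nagumo_uminus [simp]: "nagumo d s p D (\<lambda>\<alpha>. - u \<alpha>) = nagumo d s p D u"
  by (simp add: nagumo_def)

lemma nagumo_cmult: "nagumo d s p D (\<lambda>\<alpha>. a * u \<alpha>) = norm a * nagumo d s p D u"
  by (simp add: nagumo_def norm_mult sum_distrib_left mult_ac)

lemma nagumo_sum: "0 \<le> s \<Longrightarrow> nagumo d s p D (\<lambda>\<alpha>. \<Sum>i\<in>I. u i \<alpha>) \<le> (\<Sum>i\<in>I. nagumo d s p D (u i))"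
proof (induction I rule: infinite_finite_induct)
  case (insert i I)
  then show ?case using nagumo_add[of s d p D "u i" "\<lambda>\<alpha>. \<Sum>i\<in>I. u i \<alpha>"] by simp
qed auto

lemma nagumo_mono_p: "0 \<le> s \<Longrightarrow> p \<le> p' \<Longrightarrow> nagumo d s p' D u \<le> nagumo d s p D u"
  unfolding nagumo_def using choose_mono_left choose_pos'
  by (intro sum_mono divide_left_mono mult_pos_pos mult_nonneg_nonneg) auto

lemma nagumo_mono_D: "0 \<le> s \<Longrightarrow> D \<le> D' \<Longrightarrow> nagumo d s p D u \<le> nagumo d s p D' u"
  unfolding nagumo_def by (intro sum_mono2) auto

text \<open>For \<beta> \<le> \<alpha> the binomial of \<alpha> is at least that of \<alpha> -
  \<beta>, so the weight of the product can be handed on to \<open>u\<close> alone; the multiplier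
  \<open>f\<close> is then measured at level 0, where all binomials are 1.\<close>

lemma nagumo_mult:
  assumes "0 \<le> s"
  shows "nagumo d s p D (ps_mult f u) \<le> nagumo d s 0 D f * nagumo d s p D u"
proof -
  let ?I = "{\<alpha> \<in> multi_indices d. multi_deg d \<alpha> \<le> D}" and ?v = "\<lambda>\<alpha>. real ((p + multi_deg d \<alpha>) choose multi_deg d \<alpha>)"
  have "nagumo d s p D (ps_mult f u) \<le> (\<Sum>\<alpha>\<in>?I. \<Sum>\<beta> | \<beta> \<le> \<alpha>. norm (f \<beta>) * norm (u (\<lambda>i. \<alpha> i - \<beta> i)) * s ^ multi_deg d \<alpha> / ?v \<alpha>)"
    unfolding nagumo_def sum_distrib_right[symmetric] sum_divide_distrib[symmetric] ps_mult_def
    using assms by (intro sum_mono divide_right_mono mult_right_mono order_trans[OF norm_sum]) (auto simp: norm_mult)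
  also have "\<dots> = (\<Sum>(\<alpha>,\<beta>)\<in>Sigma ?I (\<lambda>\<alpha>. {\<beta>. \<beta> \<le> \<alpha>}). norm (f \<beta>) * norm (u (\<lambda>i. \<alpha> i - \<beta> i)) * s ^ multi_deg d \<alpha> / ?v \<alpha>)"
    by (rule sum.Sigma) (auto intro: finite_le_multi_index)
  also have "\<dots> \<le> (\<Sum>(\<beta>,\<gamma>)\<in>?I \<times> ?I. (norm (f \<beta>) * s ^ multi_deg d \<beta>) * (norm (u \<gamma>) * s ^ multi_deg d \<gamma> / ?v \<gamma>))"
  \<comment> \<open>Each term of the convolution is charged to the pair (\<beta>, \<alpha> -
    \<beta>). Distinct terms use distinct pairs, and both members again have degree at most
    \<open>D\<close>, so truncation is compatible with products.\<close>
  proof (rule sum_le_included[where i = "\<lambda>(\<beta>, \<gamma>). (\<lambda>i. \<beta> i + \<gamma> i, \<beta>)"])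
    show "finite (Sigma ?I (\<lambda>\<alpha>. {\<beta>. \<beta> \<le> \<alpha>}))" by (rule finite_SigmaI) (auto intro: finite_le_multi_index)
    show "finite (?I \<times> ?I)" by simp
    show "\<forall>y\<in>?I \<times> ?I. 0 \<le> (case y of (\<beta>, \<gamma>) \<Rightarrow> (norm (f \<beta>) * s ^ multi_deg d \<beta>) * (norm (u \<gamma>) * s ^ multi_deg d \<gamma> / ?v \<gamma>))"
      using assms by auto
    show "\<forall>x\<in>Sigma ?I (\<lambda>\<alpha>. {\<beta>. \<beta> \<le> \<alpha>}). \<exists>y\<in>?I \<times> ?I. (case y of (\<beta>, \<gamma>) \<Rightarrow> (\<lambda>i. \<beta> i + \<gamma> i, \<beta>)) = x \<and>
       (case x of (\<alpha>, \<beta>) \<Rightarrow> norm (f \<beta>) * norm (u (\<lambda>i. \<alpha> i - \<beta> i)) * s ^ multi_deg d \<alpha> / ?v \<alpha>)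
       \<le> (case y of (\<beta>, \<gamma>) \<Rightarrow> (norm (f \<beta>) * s ^ multi_deg d \<beta>) * (norm (u \<gamma>) * s ^ multi_deg d \<gamma> / ?v \<gamma>))"
    proof safe
      fix \<alpha> \<beta> assume \<alpha>: "\<alpha> \<in> multi_indices d" "multi_deg d \<alpha> \<le> D" and \<beta>: "\<beta> \<le> \<alpha>"
      let ?\<gamma> = "\<lambda>i. \<alpha> i - \<beta> i"
      have eq: "\<alpha> = (\<lambda>i. \<beta> i + ?\<gamma> i)" using \<beta> by (auto simp: le_fun_def)
      have deg: "multi_deg d \<alpha> = multi_deg d \<beta> + multi_deg d ?\<gamma>" by (subst eq) (rule multi_deg_add)
      have mem: "\<beta> \<in> ?I" "?\<gamma> \<in> ?I" using \<alpha> \<beta> deg by (auto intro: multi_indices_le multi_indices_diff)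
      have "norm (f \<beta>) * norm (u ?\<gamma>) * s ^ multi_deg d \<alpha> / ?v \<alpha> \<le> norm (f \<beta>) * norm (u ?\<gamma>) * s ^ multi_deg d \<alpha> / ?v ?\<gamma>"
        using assms choose_pos' choose_mono_right[of "multi_deg d ?\<gamma>" "multi_deg d \<alpha>" p] deg
        by (intro divide_left_mono mult_pos_pos mult_nonneg_nonneg) auto
      also have "\<dots> = (norm (f \<beta>) * s ^ multi_deg d \<beta>) * (norm (u ?\<gamma>) * s ^ multi_deg d ?\<gamma> / ?v ?\<gamma>)"
        by (simp add: deg power_add)
      finally show "\<exists>y\<in>?I \<times> ?I. (case y of (\<beta>, \<gamma>) \<Rightarrow> (\<lambda>i. \<beta> i + \<gamma> i, \<beta>)) = (\<alpha>, \<beta>) \<and>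
       norm (f \<beta>) * norm (u ?\<gamma>) * s ^ multi_deg d \<alpha> / ?v \<alpha>
       \<le> (case y of (\<beta>, \<gamma>) \<Rightarrow> (norm (f \<beta>) * s ^ multi_deg d \<beta>) * (norm (u \<gamma>) * s ^ multi_deg d \<gamma> / ?v \<gamma>))"
        using mem eq by (intro bexI[of _ "(\<beta>, ?\<gamma>)"]) auto
    qed
  qed
  also have "\<dots> = nagumo d s 0 D f * nagumo d s p D u"
    unfolding nagumo_def by (simp add: sum_product sum.cartesian_product)
  finally show ?thesis .
qed

text \<open>The weights are made for the identity \<open>Suc b * ((p + Suc b) choose Suc b) = Suc p
  * ((Suc p + b) choose b)\<close>: it trades the factor b + 1 of the derivative, unbounded in the
  degree, for p + 1. The truncation rises by one because coefficients of \<open>u\<close> of degree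
  \<open>Suc D\<close> enter.\<close>

lemma nagumo_deriv:
  assumes "0 < s" "i < d"
  shows "nagumo d s (Suc p) D (ps_deriv i u) \<le> real (Suc p) / s * nagumo d s p (Suc D) u"
proof -
  let ?I = "\<lambda>D. {\<alpha> \<in> multi_indices d. multi_deg d \<alpha> \<le> D}"
  let ?g = "\<lambda>\<alpha>. real (Suc p) / s * (norm (u \<alpha>) * s ^ multi_deg d \<alpha> / real ((p + multi_deg d \<alpha>) choose multi_deg d \<alpha>))"
  have "nagumo d s (Suc p) D (ps_deriv i u) \<le> sum ?g (?I (Suc D))"
    unfolding nagumo_def
  proof (rule sum_le_included[where i = "\<lambda>\<alpha>. \<alpha>(i := \<alpha> i - 1)"])
    show "\<forall>\<alpha>\<in>?I D. \<exists>\<beta>\<in>?I (Suc D). \<beta>(i := \<beta> i - 1) = \<alpha> \<and>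
        norm (ps_deriv i u \<alpha>) * s ^ multi_deg d \<alpha> / real ((Suc p + multi_deg d \<alpha>) choose multi_deg d \<alpha>) \<le> ?g \<beta>"
    proof safe
      fix \<alpha> assume \<alpha>: "\<alpha> \<in> multi_indices d" "multi_deg d \<alpha> \<le> D"
      define b where "b = multi_deg d \<alpha>"
      let ?\<beta> = "\<alpha>(i := Suc (\<alpha> i))"
      have deg: "multi_deg d ?\<beta> = Suc b" using multi_deg_upd_Suc[OF assms(2)] by (simp add: b_def)
      have "real (Suc b) * real ((p + Suc b) choose Suc b) = real (Suc p) * real ((Suc p + b) choose b)"
        using arg_cong[OF Suc_times_binomial_add[of b p], of real] by (simp only: of_nat_mult add.commute[of b] add_Suc add_Suc_right)
      then have v: "real (Suc b) / real ((Suc p + b) choose b) = real (Suc p) / real ((p + Suc b) choose Suc b)"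
        using choose_pos'[of "Suc p" b] choose_pos'[of p "Suc b"] by (simp add: field_simps del: binomial_Suc_Suc of_nat_Suc)
      have "norm (ps_deriv i u \<alpha>) * s ^ b / real ((Suc p + b) choose b) = norm (u ?\<beta>) * s ^ b * (real (Suc (\<alpha> i)) / real ((Suc p + b) choose b))"
        by (simp add: ps_deriv_def norm_mult del: of_nat_Suc of_nat_add binomial_Suc_Suc)
      also have "\<dots> \<le> norm (u ?\<beta>) * s ^ b * (real (Suc b) / real ((Suc p + b) choose b))"
        using le_multi_deg[OF assms(2), of \<alpha>] assms(1)
        by (intro mult_left_mono divide_right_mono) (auto simp: b_def)
      also have "\<dots> = ?g ?\<beta>" unfolding v deg using assms(1) by (simp add: field_simps del: binomial_Suc_Suc of_nat_Suc)
      finally show "\<exists>\<beta>\<in>?I (Suc D). \<beta>(i := \<beta> i - 1) = \<alpha> \<and>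
        norm (ps_deriv i u \<alpha>) * s ^ multi_deg d \<alpha> / real ((Suc p + multi_deg d \<alpha>) choose multi_deg d \<alpha>) \<le> ?g \<beta>"
        using \<alpha> assms(2) deg by (intro bexI[of _ ?\<beta>]) (auto simp: b_def multi_indices_upd)
    qed
  qed (use assms in auto)
  then show ?thesis by (simp add: nagumo_def sum_distrib_left)
qed

lemma nagumo_le_infsum:
  assumes "ps_summable d s f" "0 \<le> s"
  shows "nagumo d s 0 D f \<le> (\<Sum>\<^sub>\<infinity>\<alpha>\<in>multi_indices d. norm (f \<alpha>) * s ^ multi_deg d \<alpha>)"
proof -
  have "nagumo d s 0 D f = (\<Sum>\<alpha> | \<alpha> \<in> multi_indices d \<and> multi_deg d \<alpha> \<le> D. norm (f \<alpha>) * s ^ multi_deg d \<alpha>)"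
    by (simp add: nagumo_def)
  also have "\<dots> \<le> (\<Sum>\<^sub>\<infinity>\<alpha>\<in>multi_indices d. norm (f \<alpha>) * s ^ multi_deg d \<alpha>)"
    by (rule finite_sum_le_infsum) (use assms in \<open>auto simp: ps_summable_def\<close>)
  finally show ?thesis .
qed

text \<open>Returns from truncated norms to convergence: a finite set of indices has bounded degree,
  so a bound uniform in \<open>D\<close> controls all finite partial sums.\<close>

lemma ps_summable_nagumo:
  assumes "0 \<le> s" "\<And>D. nagumo d s 0 D f \<le> B"
  shows "ps_summable d s f"
  unfolding ps_summable_def
proof (rule nonneg_bdd_above_summable_on)
  show "bdd_above (sum (\<lambda>\<alpha>. norm (f \<alpha>) * s ^ multi_deg d \<alpha>) ` {F. F \<subseteq> multi_indices d \<and> finite F})"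
  proof (rule bdd_aboveI2)
    fix F assume F: "F \<in> {F. F \<subseteq> multi_indices d \<and> finite F}"
    define D where "D = Max (insert 0 (multi_deg d ` F))"
    have "sum (\<lambda>\<alpha>. norm (f \<alpha>) * s ^ multi_deg d \<alpha>) F \<le> nagumo d s 0 D f"
      unfolding nagumo_def using F assms(1)
      by (simp, intro sum_mono2) (auto simp: D_def)
    then show "sum (\<lambda>\<alpha>. norm (f \<alpha>) * s ^ multi_deg d \<alpha>) F \<le> B" using assms(2)[of D] by linarith
  qed
qed (use assms in auto)

text \<open>Without a constant term every monomial has degree at least 1, and shrinking the radius
  gains a factor s / s0. The smallness in the later absorption arguments stems from this.\<close>

lemma nagumo_no_const:
  assumes "0 < s" "s \<le> s0"
  shows "nagumo d s 0 D (\<lambda>\<alpha>. if \<alpha> = (\<lambda>_. 0) then 0 else f \<alpha>) \<le> s / s0 * nagumo d s0 0 D f"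
  unfolding nagumo_def sum_distrib_left
proof (rule sum_mono)
  fix \<alpha> assume \<alpha>: "\<alpha> \<in> {\<alpha> \<in> multi_indices d. multi_deg d \<alpha> \<le> D}"
  show "norm (if \<alpha> = (\<lambda>_. 0) then 0 else f \<alpha>) * s ^ multi_deg d \<alpha> / real ((0 + multi_deg d \<alpha>) choose multi_deg d \<alpha>)
     \<le> s / s0 * (norm (f \<alpha>) * s0 ^ multi_deg d \<alpha> / real ((0 + multi_deg d \<alpha>) choose multi_deg d \<alpha>))"
  proof (cases "\<alpha> = (\<lambda>_. 0)")
    case False
    then obtain b where b: "multi_deg d \<alpha> = Suc b"
      using \<alpha> multi_deg_eq_0_iff[of \<alpha> d] not0_implies_Suc by auto
    have "s ^ Suc b \<le> s / s0 * s0 ^ Suc b" using assms by (simp add: power_mono)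
    then have "norm (f \<alpha>) * s ^ Suc b \<le> norm (f \<alpha>) * (s / s0 * s0 ^ Suc b)"
      by (rule mult_left_mono) simp
    moreover have "s0 \<noteq> 0" using assms by simp
    ultimately show ?thesis using False by (simp add: b mult_ac)
  qed (use assms in simp)
qed

lemma nagumo_single: "nagumo d s p D (\<lambda>\<alpha>. if \<alpha> = (\<lambda>_. 0) then a else 0) = norm a"
proof -
  have "nagumo d s p D (\<lambda>\<alpha>. if \<alpha> = (\<lambda>_. 0) then a else 0) =
    (\<Sum>\<alpha>\<in>{\<lambda>_. 0}. norm a * s ^ multi_deg d \<alpha> / real ((p + multi_deg d \<alpha>) choose multi_deg d \<alpha>))"
    unfolding nagumo_def by (rule sum.mono_neutral_cong_right) auto
  then show ?thesis by simp
qed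

text \<open>Well-founded recursion on the degree, stated as the existence of a fixed point. It
  yields both the reciprocal of a series and the coefficients of a formal solution.\<close>

lemma multi_index_recursion:
  fixes H :: "((nat \<Rightarrow> nat) \<Rightarrow> 'b) \<Rightarrow> (nat \<Rightarrow> nat) \<Rightarrow> 'b"
  assumes "\<And>\<alpha> e e'. \<alpha> \<in> multi_indices d \<Longrightarrow>
      (\<And>\<beta>. \<beta> \<in> multi_indices d \<Longrightarrow> multi_deg d \<beta> < multi_deg d \<alpha> \<Longrightarrow> e \<beta> = e' \<beta>) \<Longrightarrow> H e \<alpha> = H e' \<alpha>"
  obtains e where "\<And>\<alpha>. \<alpha> \<in> multi_indices d \<Longrightarrow> e \<alpha> = H e \<alpha>"
proof -
  \<comment> \<open>Outside the multi-indices \<open>F\<close> is constant: admissibility is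
    demanded everywhere, whereas the hypothesis speaks about \<open>H\<close> only at
    multi-indices.\<close>
  define F where "F = (\<lambda>e \<alpha>. if \<alpha> \<in> multi_indices d then H e \<alpha> else undefined)"
  have "adm_wf (Wellfounded.measure (multi_deg d)) F"
    unfolding adm_wf_def
  proof (intro allI impI)
    fix f g :: "(nat \<Rightarrow> nat) \<Rightarrow> 'b" and \<alpha>
    assume *: "\<forall>\<beta>. (\<beta>, \<alpha>) \<in> Wellfounded.measure (multi_deg d) \<longrightarrow> f \<beta> = g \<beta>"
    have "H f \<alpha> = H g \<alpha>" if "\<alpha> \<in> multi_indices d"
      by (rule assms[OF that]) (use * in simp)
    then show "F f \<alpha> = F g \<alpha>" by (simp add: F_def)
  qed
  from wfrec_fixpoint[OF wf_measure this] have "wfrec (Wellfounded.measure (multi_deg d)) F = F (wfrec (Wellfounded.measure (multi_deg d)) F)" .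
  then have "wfrec (Wellfounded.measure (multi_deg d)) F \<alpha> = F (wfrec (Wellfounded.measure (multi_deg d)) F) \<alpha>" for \<alpha> by (rule fun_cong)
  then show ?thesis using that[of "wfrec (Wellfounded.measure (multi_deg d)) F"] by (simp add: F_def)
qed

section \<open>Reciprocals of convergent power series\<close>

lemma ps_mult_remove_const:
  assumes "\<alpha> \<in> multi_indices d"
  shows "ps_mult c e \<alpha> = c (\<lambda>_. 0) * e \<alpha> + ps_mult (\<lambda>\<beta>. if \<beta> = (\<lambda>_. 0) then 0 else c \<beta>) e \<alpha>"
proof -
  have fin: "finite {\<beta>. \<beta> \<le> \<alpha>}" using assms by (rule finite_le_multi_index)
  have 0: "(\<lambda>_. 0) \<in> {\<beta>. \<beta> \<le> \<alpha>}" by (auto simp: le_fun_def)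
  have "ps_mult c e \<alpha> = c (\<lambda>_. 0) * e \<alpha> + (\<Sum>\<beta>\<in>{\<beta>. \<beta> \<le> \<alpha>} - {\<lambda>_. 0}. c \<beta> * e (\<lambda>i. \<alpha> i - \<beta> i))"
    unfolding ps_mult_def by (subst sum.remove[OF fin 0]) simp
  also have "(\<Sum>\<beta>\<in>{\<beta>. \<beta> \<le> \<alpha>} - {\<lambda>_. 0}. c \<beta> * e (\<lambda>i. \<alpha> i - \<beta> i)) = ps_mult (\<lambda>\<beta>. if \<beta> = (\<lambda>_. 0) then 0 else c \<beta>) e \<alpha>"
    unfolding ps_mult_def by (rule sum.mono_neutral_cong_left) (use fin in auto)
  finally show ?thesis .
qed

text \<open>The coefficients of the reciprocal are determined degree by degree. They converge
  because the constant term dominates the rest of \<open>c\<close> on a small polydisc. Needed for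
  the quotients in Cramer's rule.\<close>

lemma ps_inverse:
  assumes c: "ps_conv d R c" "0 < R" "c (\<lambda>_. 0) \<noteq> 0"
  obtains e S where "0 < S" "ps_conv d S e"
    "\<And>\<alpha>. \<alpha> \<in> multi_indices d \<Longrightarrow> ps_mult c e \<alpha> = (if \<alpha> = (\<lambda>_. 0) then 1 else 0)"
proof -
  let ?c' = "\<lambda>\<beta>. if \<beta> = (\<lambda>_. 0) then 0 else c \<beta>"
  define H where "H = (\<lambda>e \<alpha>. ((if \<alpha> = (\<lambda>_. 0) then 1 else 0) - ps_mult ?c' e \<alpha>) / c (\<lambda>_. 0))"
  obtain e where e: "\<And>\<alpha>. \<alpha> \<in> multi_indices d \<Longrightarrow> e \<alpha> = H e \<alpha>"
  proof (rule multi_index_recursion[of d H])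
    fix \<alpha> and e e' :: "(nat \<Rightarrow> nat) \<Rightarrow> complex"
    assume \<alpha>: "\<alpha> \<in> multi_indices d" and eq: "\<And>\<beta>. \<beta> \<in> multi_indices d \<Longrightarrow> multi_deg d \<beta> < multi_deg d \<alpha> \<Longrightarrow> e \<beta> = e' \<beta>"
    have "ps_mult ?c' e \<alpha> = ps_mult ?c' e' \<alpha>"
      unfolding ps_mult_def
    proof (rule sum.cong)
      fix \<beta> assume \<beta>: "\<beta> \<in> {\<beta>. \<beta> \<le> \<alpha>}"
      show "?c' \<beta> * e (\<lambda>i. \<alpha> i - \<beta> i) = ?c' \<beta> * e' (\<lambda>i. \<alpha> i - \<beta> i)"
      proof (cases "\<beta> = (\<lambda>_. 0)")
        case False
        have "multi_deg d \<beta> \<noteq> 0" using False \<alpha> \<beta> multi_deg_eq_0_iff multi_indices_le by blast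
        then have "multi_deg d (\<lambda>i. \<alpha> i - \<beta> i) < multi_deg d \<alpha>"
          using \<beta> multi_deg_diff[of \<beta> \<alpha> d] multi_deg_mono[of \<beta> \<alpha> d] by auto
        then show ?thesis using eq[of "\<lambda>i. \<alpha> i - \<beta> i"] multi_indices_diff[OF \<alpha>] by simp
      qed simp
    qed simp
    then show "H e \<alpha> = H e' \<alpha>" by (simp add: H_def)
  next
    fix e assume "\<And>\<alpha>. \<alpha> \<in> multi_indices d \<Longrightarrow> e \<alpha> = H e \<alpha>"
    then show ?thesis by (rule that)
  qed
  have eq: "c (\<lambda>_. 0) * e \<alpha> = (if \<alpha> = (\<lambda>_. 0) then 1 else 0) + - ps_mult ?c' e \<alpha>" if "\<alpha> \<in> multi_indices d" for \<alpha>
    using c(3) by (subst e[OF that]) (simp add: H_def)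
  define K where "K = norm (c (\<lambda>_. 0))"
  have K: "0 < K" using c(3) by (simp add: K_def)
  define s0 where "s0 = R / 2"
  have s0: "0 < s0" "s0 < R" using c(2) by (auto simp: s0_def)
  define A where "A = (\<Sum>\<^sub>\<infinity>\<alpha>\<in>multi_indices d. norm (c \<alpha>) * s0 ^ multi_deg d \<alpha>)"
  have A: "0 \<le> A" unfolding A_def using s0 by (intro infsum_nonneg) auto
  \<comment> \<open>Chosen so that the part of \<open>c\<close> without constant term has norm at
    most K / 2; the 1 in A + 1 avoids a division by zero.\<close>
  define s where "s = min s0 (s0 * K / (2 * (A + 1)))"
  have s: "0 < s" "s \<le> s0" using s0 K A by (auto simp: s_def)
  have "s \<le> s0 * K / (2 * (A + 1))" by (simp add: s_def)
  then have "s / s0 \<le> K / (2 * (A + 1))" using s0 by (simp add: field_simps)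
  then have "s / s0 * A \<le> K / (2 * (A + 1)) * A" using A by (rule mult_right_mono)
  also have "\<dots> \<le> K / 2" using A K by (simp add: field_simps)
  finally have sA: "s / s0 * A \<le> K / 2" .
  \<comment> \<open>The truncated norm is a finite number x with K x \<le> 1 + (K / 2) x; half of
    the left-hand side may thus be subtracted, with a result independent of
    \<open>D\<close>.\<close>
  have "nagumo d s 0 D e \<le> 2 / K" for D
  proof -
    have "nagumo d s 0 D ?c' \<le> s / s0 * nagumo d s0 0 D c" by (rule nagumo_no_const[OF s])
    also have "\<dots> \<le> s / s0 * A"
      using nagumo_le_infsum[of d s0 c D] c s0 s unfolding A_def ps_conv_def by (intro mult_left_mono) auto
    finally have c': "nagumo d s 0 D ?c' \<le> K / 2" using sA by linarith
    have "K * nagumo d s 0 D e = nagumo d s 0 D (\<lambda>\<alpha>. c (\<lambda>_. 0) * e \<alpha>)"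
      by (simp add: nagumo_cmult K_def)
    also have "\<dots> = nagumo d s 0 D (\<lambda>\<alpha>. (if \<alpha> = (\<lambda>_. 0) then 1 else 0) + - ps_mult ?c' e \<alpha>)"
      by (rule nagumo_cong) (rule eq)
    also have "\<dots> \<le> nagumo d s 0 D (\<lambda>\<alpha>. if \<alpha> = (\<lambda>_. 0) then 1 else 0) + nagumo d s 0 D (\<lambda>\<alpha>. - ps_mult ?c' e \<alpha>)"
      by (rule nagumo_add) (use s in simp)
    also have "\<dots> \<le> 1 + K / 2 * nagumo d s 0 D e"
      using nagumo_mult[of s d 0 D ?c' e] mult_right_mono[OF c' nagumo_nonneg[of s d 0 D e]] s
      by (simp add: nagumo_single)
    finally show ?thesis using K by (simp add: field_simps)
  qed
  then have "ps_conv d s e"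
    by (intro ps_summable_imp_conv ps_summable_nagumo[of s]) (use s in auto)
  moreover have "ps_mult c e \<alpha> = (if \<alpha> = (\<lambda>_. 0) then 1 else 0)" if "\<alpha> \<in> multi_indices d" for \<alpha>
    using ps_mult_remove_const[OF that, of c e] eq[OF that] by simp
  ultimately show ?thesis using that s by blast
qed

lemma expands_inverse:
  assumes f: "expands n k l f x0 z0 R c" and "c (\<lambda>_. 0) \<noteq> 0"
  obtains e S where "expands n k l (\<lambda>t x z. inverse (f t x z)) x0 z0 S e"
    "\<And>t x z. in_box n k l x0 z0 S t x z \<Longrightarrow> f t x z \<noteq> 0"
proof -
  let ?d = "n + (k + l)"
  obtain e S where e: "0 < S" "ps_conv ?d S e"
    "\<And>\<alpha>. \<alpha> \<in> multi_indices ?d \<Longrightarrow> ps_mult c e \<alpha> = (if \<alpha> = (\<lambda>_. 0) then 1 else 0)"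
    using ps_inverse[of ?d R c] assms unfolding expands_def by metis
  define T where "T = min R S"
  have T: "0 < T" "T \<le> R" "T \<le> S" using e f by (auto simp: T_def expands_def)
  have conv: "ps_conv ?d T c" "ps_conv ?d T e"
    using f e T ps_conv_mono unfolding expands_def by blast+
  have *: "f t x z * ps_eval ?d e (pt n k x0 z0 t x z) = 1" if box: "in_box n k l x0 z0 T t x z" for t x z
  proof -
    have "f t x z * ps_eval ?d e (pt n k x0 z0 t x z) = ps_eval ?d c (pt n k x0 z0 t x z) * ps_eval ?d e (pt n k x0 z0 t x z)"
      using expandsD[OF f in_box_mono[OF box T(2)]] by simp
    also have "\<dots> = ps_eval ?d (ps_mult c e) (pt n k x0 z0 t x z)"
      by (rule ps_eval_mult[symmetric, OF conv T(1)]) (rule pt_norm_less[OF box])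
    also have "\<dots> = ps_eval ?d (\<lambda>\<alpha>. if \<alpha> = (\<lambda>_. 0) then 1 else 0) (pt n k x0 z0 t x z)"
      by (rule ps_eval_cong) (use e in auto)
    finally show ?thesis by (simp add: ps_eval_single)
  qed
  show ?thesis
  proof (rule that)
    show "expands n k l (\<lambda>t x z. inverse (f t x z)) x0 z0 T e"
      unfolding expands_def using T conv * by (auto intro!: inverse_unique)
    show "f t x z \<noteq> 0" if "in_box n k l x0 z0 T t x z" for t x z
      using *[OF that] by auto
  qed
qed

section \<open>Neighbourhoods and the identity theorem\<close>

text \<open>Stated over any normed space, so that it applies to \<open>Euclidean_space\<close> and
  to \<open>Complex_space\<close> alike. A box is open in the product topology because only the
  first \<open>d\<close> factors are restricted.\<close>

lemma coordinate_ball: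
  fixes d :: nat and y :: "nat \<Rightarrow> 'a::real_normed_vector"
  defines "X \<equiv> subtopology (product_topology (\<lambda>_. euclidean) UNIV) {w :: nat \<Rightarrow> 'a. \<forall>i\<ge>d. w i = 0}"
  defines "B \<equiv> \<lambda>R. {w. (\<forall>i\<ge>d. w i = 0) \<and> (\<forall>i<d. norm (w i - y i) < R)}"
  shows openin_coordinate_ball: "openin X (B R)"
    and connectedin_coordinate_ball: "connectedin X (B R)"
    and coordinate_ball_subset: "openin X V \<Longrightarrow> y \<in> V \<Longrightarrow> \<exists>R>0. B R \<subseteq> V"
proof -
  have "openin (product_topology (\<lambda>_. euclidean) UNIV) (PiE UNIV (\<lambda>i. if i < d then ball (y i) R else UNIV))"
    unfolding openin_PiE_gen
    by (rule disjI2) (auto intro!: rev_finite_subset[of "{..<d}"] split: if_splits)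
  moreover have "B R = PiE UNIV (\<lambda>i. if i < d then ball (y i) R else UNIV) \<inter> {w. \<forall>i\<ge>d. w i = 0}"
    by (auto simp: B_def dist_norm norm_minus_commute PiE_iff split: if_splits)
  ultimately show "openin X (B R)" unfolding X_def openin_subtopology by blast
  \<comment> \<open>With the remaining factors shrunk to the point 0, the same box appears as a
    product of connected sets.\<close>
  have "B R = PiE UNIV (\<lambda>i. if i < d then ball (y i) R else {0})"
    by (auto simp: B_def dist_norm norm_minus_commute PiE_iff split: if_splits)
  then show "connectedin X (B R)"
    unfolding X_def connectedin_subtopology
    by (auto simp: connectedin_PiE connectedin_iff_connected) (auto simp: B_def)
  assume V: "openin X V" "y \<in> V"
  then obtain T where T: "openin (product_topology (\<lambda>_. euclidean) UNIV) T" "V = T \<inter> {w. \<forall>i\<ge>d. w i = 0}"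
    unfolding X_def openin_subtopology by blast
  have "y \<in> T" using V T(2) by blast
  with T(1)[unfolded openin_product_topology_alt]
  have "\<exists>W. finite {i \<in> UNIV. W i \<noteq> topspace euclidean} \<and> (\<forall>i\<in>UNIV. openin euclidean (W i)) \<and> y \<in> PiE UNIV W \<and> PiE UNIV W \<subseteq> T"
    by (rule bspec)
  then obtain W where W': "\<forall>i\<in>UNIV. openin euclidean (W i)" and W: "y \<in> PiE UNIV W" "PiE UNIV W \<subseteq> T"
    by (elim exE conjE)
  have W1: "open (W i)" for i using W' by simp
  have "\<exists>e>0. ball (y i) e \<subseteq> W i" for i
    using W1[of i] PiE_mem[OF W(1), of i] by (auto simp: open_contains_ball)
  then obtain e where e: "\<And>i. 0 < e i" "\<And>i. ball (y i) (e i) \<subseteq> W i" by metis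
  \<comment> \<open>Only the first \<open>d\<close> coordinates need a bound, since \<open>y\<close>
    and all points of the box vanish beyond; the inserted 1 covers \<open>d = 0\<close>.\<close>
  define R where "R = Min (insert 1 (e ` {..<d}))"
  have R: "0 < R" "\<And>i. i < d \<Longrightarrow> R \<le> e i" using e(1) by (auto simp: R_def)
  have y0: "\<forall>i\<ge>d. y i = 0" using V T by auto
  have "B R \<subseteq> V"
  proof
    fix w assume w: "w \<in> B R"
    have "w i \<in> W i" for i
    proof (cases "i < d")
      case True
      then have "w i \<in> ball (y i) (e i)" using w R(2)[of i] by (auto simp: B_def dist_norm norm_minus_commute intro: less_le_trans)
      then show ?thesis using e(2)[of i] by blast
    next
      case False
      then have "w i = y i" using w y0 by (auto simp: B_def)
      then show ?thesis using PiE_mem[OF W(1), of i] by simp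
    qed
    then have "w \<in> PiE UNIV W" by (simp add: PiE_iff)
    then show "w \<in> V" using W(2) T(2) w by (auto simp: B_def)
  qed
  then show "\<exists>R>0. B R \<subseteq> V" using R by blast
qed

lemma Euclidean_space_eq: "Euclidean_space d = subtopology (product_topology (\<lambda>_. euclidean) UNIV) {w :: nat \<Rightarrow> real. \<forall>i\<ge>d. w i = 0}"
  by (simp add: Euclidean_space_def)

abbreviation "Xspace n k l \<equiv> prod_topology (Euclidean_space n) (prod_topology (Euclidean_space k) (Complex_space l))"

lemma openin_in_box: "openin (Xspace n k l) {(t, x, z). in_box n k l x0 z0 R t x z}"
proof -
  have "{(t, x, z). in_box n k l x0 z0 R t x z} =
     {t. (\<forall>i\<ge>n. t i = 0) \<and> (\<forall>i<n. norm (t i - (\<lambda>_. 0) i) < R)} \<times>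
     {x. (\<forall>i\<ge>k. x i = 0) \<and> (\<forall>i<k. norm (x i - x0 i) < R)} \<times>
     {z. (\<forall>i\<ge>l. z i = 0) \<and> (\<forall>i<l. norm (z i - z0 i) < R)}"
    by (auto simp: in_box_def Euclidean_space_topspace Complex_space_topspace)
  then show ?thesis
    unfolding Euclidean_space_eq Complex_space_def
    by (simp only: openin_prod_Times_iff openin_coordinate_ball) simp
qed

lemma box_in_openin:
  assumes "openin (Xspace n k l) W" "(\<lambda>_. 0, x0, z0) \<in> W"
  obtains R where "0 < R" "\<And>t x z. in_box n k l x0 z0 R t x z \<Longrightarrow> (t, x, z) \<in> W"
proof -
  obtain T V where TV: "openin (Euclidean_space n) T" "openin (prod_topology (Euclidean_space k) (Complex_space l)) V"
    "(\<lambda>_. 0) \<in> T" "(x0, z0) \<in> V" "T \<times> V \<subseteq> W"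
    using openin_prod_topology_alt[THEN iffD1, rule_format, OF assms] by (elim exE conjE)
  then obtain A B where AB: "openin (Euclidean_space k) A" "openin (Complex_space l) B" "x0 \<in> A" "z0 \<in> B" "A \<times> B \<subseteq> V"
    using openin_prod_topology_alt[THEN iffD1, rule_format, OF TV(2,4)] by (elim exE conjE)
  obtain R1 where R1: "0 < R1" "{w. (\<forall>i\<ge>n. w i = 0) \<and> (\<forall>i<n. norm (w i - (\<lambda>_. 0) i) < R1)} \<subseteq> T"
    using coordinate_ball_subset[OF TV(1)[unfolded Euclidean_space_eq] TV(3)] by blast
  obtain R2 where R2: "0 < R2" "{w. (\<forall>i\<ge>k. w i = 0) \<and> (\<forall>i<k. norm (w i - x0 i) < R2)} \<subseteq> A"
    using coordinate_ball_subset[OF AB(1)[unfolded Euclidean_space_eq] AB(3)] by blast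
  obtain R3 where R3: "0 < R3" "{w. (\<forall>i\<ge>l. w i = 0) \<and> (\<forall>i<l. norm (w i - z0 i) < R3)} \<subseteq> B"
    using coordinate_ball_subset[OF AB(2)[unfolded Complex_space_def] AB(4)] by blast
  show ?thesis
  proof (rule that)
    show "0 < min R1 (min R2 R3)" using R1 R2 R3 by simp
    fix t x z assume "in_box n k l x0 z0 (min R1 (min R2 R3)) t x z"
    then have "t \<in> T" "x \<in> A" "z \<in> B"
      using R1(2) R2(2) R3(2) by (auto simp: in_box_def Euclidean_space_topspace Complex_space_topspace)
    then show "(t, x, z) \<in> W" using TV(5) AB(5) by auto
  qed
qed

lemma box_in_Times:
  assumes "openin (Euclidean_space k) N" "openin (Complex_space l) U" "x0 \<in> N" "z0 \<in> U"
  obtains R where "0 < R" "\<And>t x z. in_box n k l x0 z0 R t x z \<Longrightarrow> x \<in> N \<and> z \<in> U"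
proof -
  obtain R where "0 < R" "\<And>t x z. in_box n k l x0 z0 R t x z \<Longrightarrow> (t, x, z) \<in> topspace (Euclidean_space n) \<times> N \<times> U"
  proof (rule box_in_openin)
    show "openin (Xspace n k l) (topspace (Euclidean_space n) \<times> N \<times> U)"
      using assms by (simp add: openin_prod_Times_iff)
    show "(\<lambda>_. 0, x0, z0) \<in> topspace (Euclidean_space n) \<times> N \<times> U"
      using assms by (simp add: Euclidean_space_topspace)
  next
    fix R assume "0 < R" "\<And>t x z. in_box n k l x0 z0 R t x z \<Longrightarrow> (t, x, z) \<in> topspace (Euclidean_space n) \<times> N \<times> U"
    then show thesis by (rule that)
  qed
  then show ?thesis using that by blast
qed

text \<open>Makes the condition local: a union of boxes, with radii depending arbitrarily on the
  point of \<open>N \<times> U\<close>, is an open neighbourhood of the zero section.\<close>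

lemma near_N_boxes:
  assumes "N \<subseteq> topspace (Euclidean_space k)" "U \<subseteq> topspace (Complex_space l)"
  shows "near_N n k l N U Q \<longleftrightarrow> (\<forall>x0\<in>N. \<forall>z0\<in>U. \<exists>R>0. \<forall>t x z. in_box n k l x0 z0 R t x z \<longrightarrow> Q t x z)"
proof
  assume "near_N n k l N U Q"
  then obtain W where W: "openin (Xspace n k l) W" "{\<lambda>_. 0} \<times> N \<times> U \<subseteq> W" "\<forall>(t, x, z)\<in>W. Q t x z"
    unfolding near_N_def by blast
  show "\<forall>x0\<in>N. \<forall>z0\<in>U. \<exists>R>0. \<forall>t x z. in_box n k l x0 z0 R t x z \<longrightarrow> Q t x z"
  proof (intro ballI)
    fix x0 z0 assume "x0 \<in> N" "z0 \<in> U"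
    then have "(\<lambda>_. 0, x0, z0) \<in> W" using W by auto
    then obtain R where "0 < R" "\<And>t x z. in_box n k l x0 z0 R t x z \<Longrightarrow> (t, x, z) \<in> W"
      using box_in_openin[OF W(1)] by metis
    then show "\<exists>R>0. \<forall>t x z. in_box n k l x0 z0 R t x z \<longrightarrow> Q t x z" using W(3) by blast
  qed
next
  assume "\<forall>x0\<in>N. \<forall>z0\<in>U. \<exists>R>0. \<forall>t x z. in_box n k l x0 z0 R t x z \<longrightarrow> Q t x z"
  then obtain R where R: "\<And>x0 z0. x0 \<in> N \<Longrightarrow> z0 \<in> U \<Longrightarrow> 0 < R x0 z0"
    "\<And>x0 z0 t x z. x0 \<in> N \<Longrightarrow> z0 \<in> U \<Longrightarrow> in_box n k l x0 z0 (R x0 z0) t x z \<Longrightarrow> Q t x z" by metis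
  define W where "W = (\<Union>x0\<in>N. \<Union>z0\<in>U. {(t, x, z). in_box n k l x0 z0 (R x0 z0) t x z})"
  have "openin (Xspace n k l) W"
    unfolding W_def by (auto intro!: openin_Union openin_in_box)
  moreover have "{\<lambda>_. 0} \<times> N \<times> U \<subseteq> W"
  proof clarsimp
    fix x z assume xz: "x \<in> N" "z \<in> U"
    then have "in_box n k l x z (R x z) (\<lambda>_. 0) x z"
      using R(1)[OF xz] assms by (auto simp: in_box_def Euclidean_space_topspace)
    then show "(\<lambda>_. 0, x, z) \<in> W" using xz by (auto simp: W_def)
  qed
  moreover have "\<forall>(t, x, z)\<in>W. Q t x z" using R(2) by (auto simp: W_def)
  ultimately show "near_N n k l N U Q" unfolding near_N_def by blast
qed

text \<open>On a complex line through the centre, terms of equal degree carry the same power of w,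
  so the series becomes a power series in one variable and the theory of holomorphic functions
  applies.\<close>

lemma ps_eval_line_holomorphic:
  assumes "ps_conv d R c" "0 < R" "\<And>s i. 0 < s \<Longrightarrow> s < \<rho> \<Longrightarrow> i < d \<Longrightarrow> s * norm (v i) < R"
  shows "(\<lambda>w. ps_eval d c (\<lambda>i. w * v i)) holomorphic_on ball 0 \<rho>"
proof -
  have *: "ps_eval d c (\<lambda>i. w * v i) = (\<Sum>\<^sub>\<infinity>\<alpha>\<in>multi_indices d. (c \<alpha> * multi_pow d v \<alpha>) * w ^ multi_deg d \<alpha>)" for w
    unfolding ps_eval_def
    by (simp add: multi_pow_def multi_deg_def power_mult_distrib prod.distrib power_sum mult_ac)
  have "((\<lambda>w. ps_eval d c (\<lambda>i. w * v i)) has_field_derivative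
     (\<Sum>\<^sub>\<infinity>\<alpha>\<in>multi_indices d. (c \<alpha> * multi_pow d v \<alpha>) * (of_nat (multi_deg d \<alpha>) * w ^ (multi_deg d \<alpha> - 1)))) (at w)"
    if "w \<in> ball 0 \<rho>" for w
    unfolding *
  proof (rule has_field_derivative_infsum_powers)
    show "norm w < \<rho>" using that by simp
    fix s :: real assume s: "0 < s" "s < \<rho>"
    have "(\<lambda>\<alpha>. norm (c \<alpha> * multi_pow d (\<lambda>i. of_real s * v i) \<alpha>)) summable_on multi_indices d"
      by (rule ps_conv_terms_summable[OF assms(1,2)]) (use assms(3)[OF s] s in \<open>simp add: norm_mult\<close>)
    then show "(\<lambda>\<alpha>. norm (c \<alpha> * multi_pow d v \<alpha>) * s ^ multi_deg d \<alpha>) summable_on multi_indices d"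
      using s by (simp add: multi_pow_def multi_deg_def power_mult_distrib prod.distrib power_sum norm_mult
          norm_power prod_norm[symmetric] mult_ac)
  qed
  then show ?thesis unfolding holomorphic_on_open[OF open_ball] by blast
qed

text \<open>Real points near \<open>b\<close> accumulate at \<open>b\<close> and the disc is
  connected, so analytic continuation applies; the interval is cut down to stay inside the
  disc.\<close>

lemma holomorphic_zero_on_real_interval:
  assumes "K holomorphic_on ball (of_real a) \<epsilon>" "\<bar>b - a\<bar> < \<epsilon>" "0 < \<delta>"
    and zero: "\<And>s. \<bar>s - b\<bar> < \<delta> \<Longrightarrow> \<bar>s - a\<bar> < \<epsilon> \<Longrightarrow> K (of_real s) = 0"
    and w: "w \<in> ball (of_real a) \<epsilon>"
  shows "K w = (0::complex)"
proof -
  define \<eta> where "\<eta> = min \<delta> (\<epsilon> - \<bar>b - a\<bar>)"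
  have \<eta>: "0 < \<eta>" "\<eta> \<le> \<delta>" "\<eta> \<le> \<epsilon> - \<bar>b - a\<bar>" using assms by (auto simp: \<eta>_def)
  let ?U = "of_real ` {b - \<eta><..<b + \<eta>} :: complex set"
  show ?thesis
  proof (rule analytic_continuation[of K "ball (of_real a) \<epsilon>" ?U "of_real b"])
    show "?U \<subseteq> ball (of_real a) \<epsilon>"
      using \<eta> by (auto simp: dist_of_real dist_real_def)
    show "of_real b \<in> ball (of_real a :: complex) \<epsilon>" using assms(2) by (simp add: dist_of_real dist_real_def abs_minus_commute)
    show "of_real b islimpt ?U"
      unfolding islimpt_approachable
    proof (intro allI impI)
      fix e :: real assume e: "0 < e"
      define s where "s = b + min e \<eta> / 2"
      have "s \<noteq> b" "s \<in> {b - \<eta><..<b + \<eta>}" "\<bar>s - b\<bar> < e" using e \<eta> by (auto simp: s_def)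
      then show "\<exists>x'\<in>?U. x' \<noteq> of_real b \<and> dist x' (of_real b) < e"
        by (intro bexI[of _ "of_real s"]) (auto simp: dist_of_real dist_real_def)
    qed
    show "K z = 0" if zU: "z \<in> ?U" for z
    proof -
      from zU obtain s where s: "z = of_real s" "s \<in> {b - \<eta><..<b + \<eta>}" by (rule imageE)
      show ?thesis unfolding s(1) by (rule zero) (use s(2) \<eta> in auto)
    qed
  qed (use assms w in auto)
qed

text \<open>Separates the radius at which the function is known to equal its series from the radius
  at which the series converges. The former may be tiny; if the function is locally analytic on the
  larger box, equality is carried along the segment from the centre to the given point by the
  one-variable identity theorem.\<close>

lemma expands_on_box:
  assumes loc: "\<And>t x z. in_box 0 k l x0 z0 R t x z \<Longrightarrow> \<exists>S e. expands 0 k l (\<lambda>_. u) x z S e"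
    and S: "expands 0 k l (\<lambda>_. u) x0 z0 S c" and R: "0 < R" and c: "ps_conv (k + l) R c"
    and x0: "x0 \<in> topspace (Euclidean_space k)" and z0: "z0 \<in> topspace (Complex_space l)"
  shows "expands 0 k l (\<lambda>_. u) x0 z0 R c"
  unfolding expands_def
proof safe
  show "0 < R" "ps_conv (0 + (k + l)) R c" using R c by auto
  fix t x z assume box: "in_box 0 k l x0 z0 R t x z"
  define v where "v = pt 0 k x0 z0 t x z"
  have v: "norm (v i) < R" if "i < k + l" for i using pt_norm_less[OF box, of i] that by (simp add: v_def)
  obtain s1 where s1: "0 < s1" "s1 < R" "\<And>i. i < k + l \<Longrightarrow> norm (v i) < s1"
    using finite_radius[of R "k + l" v] R v by metis
  define \<rho> where "\<rho> = R / s1"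
  have \<rho>: "1 < \<rho>" using s1 by (simp add: \<rho>_def)
  have \<rho>v: "s * norm (v i) < R" if "0 \<le> s" "s < \<rho>" "i < k + l" for s i
  proof -
    have "s * norm (v i) \<le> s * s1" using s1(3)[OF that(3)] that(1) by (intro mult_left_mono) auto
    also have "\<dots> < R" using that(2) s1(1) by (simp add: \<rho>_def field_simps)
    finally show ?thesis .
  qed
  define xx where "xx = (\<lambda>\<tau> i. x0 i + \<tau> * (x i - x0 i))"
  define zz where "zz = (\<lambda>\<tau> i. z0 i + of_real \<tau> * (z i - z0 i))"
  define h where "h = (\<lambda>\<tau>. u (xx \<tau>) (zz \<tau>))"
  define H where "H = (\<lambda>w. ps_eval (k + l) c (\<lambda>i. w * v i))"
  have top: "x \<in> topspace (Euclidean_space k)" "z \<in> topspace (Complex_space l)" using box by (auto simp: in_box_def)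
  have step: "in_box 0 k l (xx a) (zz a) r (\<lambda>_. 0) (xx b) (zz b)"
    if st: "\<And>i. i < k + l \<Longrightarrow> \<bar>b - a\<bar> * norm (v i) < r" for a b r
  proof -
    have "\<bar>xx b i - xx a i\<bar> < r" if "i < k" for i
    proof -
      have "xx b i - xx a i = (b - a) * (x i - x0 i)" by (simp add: xx_def algebra_simps)
      then show ?thesis using st[of i] that
        by (simp add: v_def pt_def jn_def abs_mult norm_of_real flip: of_real_diff)
    qed
    moreover have "norm (zz b i - zz a i) < r" if "i < l" for i
    proof -
      have "zz b i - zz a i = of_real (b - a) * (z i - z0 i)" by (simp add: zz_def algebra_simps)
      then show ?thesis using st[of "i + k"] that
        by (simp add: v_def pt_def jn_def norm_mult norm_of_real del: of_real_diff)
    qed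
    ultimately show ?thesis using top x0 z0
      by (auto simp: in_box_def Euclidean_space_topspace Complex_space_topspace xx_def zz_def)
  qed
  have pt: "ps_eval (k + l) e (pt 0 k (xx a) (zz a) t' (xx b) (zz b)) = ps_eval (k + l) e (\<lambda>i. (of_real b - of_real a) * v i)" for e a b t'
    by (rule ps_eval_cong) (auto simp: pt_def jn_def xx_def zz_def v_def algebra_simps)
  have xz0: "xx 0 = x0" "zz 0 = z0" "xx 1 = x" "zz 1 = z" by (auto simp: xx_def zz_def)
  have vsmall: "\<exists>\<epsilon>>0. \<forall>s i. \<bar>s\<bar> < \<epsilon> \<longrightarrow> i < k + l \<longrightarrow> \<bar>s\<bar> * norm (v i) < r" if "0 < r" for r
  proof (intro exI[of _ "r / s1"] conjI allI impI)
    show "0 < r / s1" using that s1 by simp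
    fix s i assume "\<bar>s\<bar> < r / s1" "i < k + l"
    then have "\<bar>s\<bar> * norm (v i) \<le> \<bar>s\<bar> * s1" using s1(3)[of i] by (intro mult_left_mono) auto
    also have "\<dots> < r" using \<open>\<bar>s\<bar> < r / s1\<close> s1(1) by (simp add: field_simps)
    finally show "\<bar>s\<bar> * norm (v i) < r" .
  qed
  have holH: "H holomorphic_on ball 0 \<rho>"
    unfolding H_def by (rule ps_eval_line_holomorphic[OF c R]) (use \<rho>v in auto)
  \<comment> \<open>Agreement on a whole real interval around \<tau> is required, as agreement at a
    single point could not be continued.\<close>
  define P where "P = (\<lambda>\<tau>. \<exists>\<epsilon>>0. \<forall>s. \<bar>s - \<tau>\<bar> < \<epsilon> \<longrightarrow> h s = H (of_real s))"
  have "P 1"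
  proof (rule connected_induction_simple[of "{0..1::real}" 0 1])
    show "P 0"
    proof -
      obtain \<epsilon> where \<epsilon>: "0 < \<epsilon>" "\<And>s i. \<bar>s\<bar> < \<epsilon> \<Longrightarrow> i < k + l \<Longrightarrow> \<bar>s\<bar> * norm (v i) < S"
        using vsmall[of S] S unfolding expands_def by metis
      have "h s = H (of_real s)" if "\<bar>s\<bar> < \<epsilon>" for s
        using expandsD[OF S, of "\<lambda>_. 0" "xx s" "zz s"] step[of s 0 S] \<epsilon>(2)[OF that] pt[of c 0 "\<lambda>_. 0" s]
        by (simp add: xz0 h_def H_def)
      then show ?thesis using \<epsilon>(1) unfolding P_def by auto
    qed
    fix a :: real assume a: "a \<in> {0..1}"
    have "in_box 0 k l x0 z0 R (\<lambda>_. 0) (xx a) (zz a)"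
      using step[of a 0 R] \<rho>v[of a] a \<rho> by (simp add: xz0)
    then obtain S' e where e: "expands 0 k l (\<lambda>_. u) (xx a) (zz a) S' e" using loc by blast
    obtain \<epsilon>0 where \<epsilon>0: "0 < \<epsilon>0" "\<And>s i. \<bar>s\<bar> < \<epsilon>0 \<Longrightarrow> i < k + l \<Longrightarrow> \<bar>s\<bar> * norm (v i) < S'"
      using vsmall[of S'] e unfolding expands_def by metis
    \<comment> \<open>With \<epsilon> \<le> \<rho> - 1 and \<open>a\<close> \<le> 1 the disc around
      \<open>a\<close> lies in the disc where \<open>H\<close> is holomorphic.\<close>
    define \<epsilon> where "\<epsilon> = min \<epsilon>0 (\<rho> - 1)"
    have \<epsilon>: "0 < \<epsilon>" "\<epsilon> \<le> \<epsilon>0" "\<epsilon> \<le> \<rho> - 1" using \<epsilon>0 \<rho> by (auto simp: \<epsilon>_def)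
    \<comment> \<open>The function \<open>u\<close> accepts real x only, but its local series
      extends to complex parameters along the segment; hence the difference to \<open>H\<close> is
      holomorphic near \<open>a\<close>.\<close>
    define K where "K = (\<lambda>w. ps_eval (k + l) e (\<lambda>i. (w - of_real a) * v i) - H w)"
    have hK: "h s - H (of_real s) = K (of_real s)" if "\<bar>s - a\<bar> < \<epsilon>" for s
      using expandsD[OF e, of "\<lambda>_. 0" "xx s" "zz s"] step[of s a S'] \<epsilon>0(2)[of "s - a"] that \<epsilon>(2) pt[of e a "\<lambda>_. 0" s]
      by (simp add: K_def h_def)
    have sv: "s * norm (v i) < S'" if "0 < s" "s < \<epsilon>" "i < k + l" for s i
      using \<epsilon>0(2)[of s i] that \<epsilon>(2) by simp
    have 1: "(\<lambda>w. ps_eval (k + l) e (\<lambda>i. w * v i)) holomorphic_on ball 0 \<epsilon>"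
      by (rule ps_eval_line_holomorphic[of _ S']) (use e sv in \<open>auto simp: expands_def\<close>)
    have "((\<lambda>w. ps_eval (k + l) e (\<lambda>i. w * v i)) \<circ> (\<lambda>w. w - of_real a)) holomorphic_on ball (of_real a) \<epsilon>"
      by (intro holomorphic_on_compose_gen[OF _ 1] holomorphic_intros) (auto simp: dist_norm norm_minus_commute)
    moreover have "ball (of_real a :: complex) \<epsilon> \<subseteq> ball 0 \<rho>"
    proof
      fix w :: complex assume "w \<in> ball (of_real a) \<epsilon>"
      then have "norm (w - of_real a) < \<epsilon>" by (simp add: dist_norm norm_minus_commute)
      moreover have "norm w \<le> norm (w - of_real a) + norm (of_real a :: complex)" using norm_triangle_sub[of w "of_real a"] by (simp add: add.commute)
      ultimately show "w \<in> ball 0 \<rho>" using a \<epsilon>(3) by (simp add: norm_of_real)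
    qed
    ultimately have Khol: "K holomorphic_on ball (of_real a) \<epsilon>"
      unfolding K_def using holH by (auto simp: o_def intro!: holomorphic_intros intro: holomorphic_on_subset)
    show "\<exists>T. openin (top_of_set {0..1}) T \<and> a \<in> T \<and> (\<forall>x\<in>T. \<forall>y\<in>T. P x \<longrightarrow> P y)"
    proof (intro exI[of _ "{0..1} \<inter> ball a \<epsilon>"] conjI ballI impI)
      show "openin (top_of_set {0..1}) ({0..1} \<inter> ball a \<epsilon>)" by auto
      show "a \<in> {0..1} \<inter> ball a \<epsilon>" using a \<epsilon> by simp
      fix p q assume p: "p \<in> {0..1} \<inter> ball a \<epsilon>" "P p" and q: "q \<in> {0..1} \<inter> ball a \<epsilon>"
      obtain \<delta> where \<delta>: "0 < \<delta>" "\<And>s. \<bar>s - p\<bar> < \<delta> \<Longrightarrow> h s = H (of_real s)" using p unfolding P_def by blast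
      have Kz: "K (of_real s) = 0" if "\<bar>s - p\<bar> < \<delta>" "\<bar>s - a\<bar> < \<epsilon>" for s
        using hK[OF that(2)] \<delta>(2)[OF that(1)] by simp
      have K0: "K w = 0" if "w \<in> ball (of_real a) \<epsilon>" for w
        by (rule holomorphic_zero_on_real_interval[OF Khol _ \<delta>(1) _ that, of p])
           (use p Kz in \<open>auto simp: dist_real_def abs_minus_commute\<close>)
      have "h s = H (of_real s)" if "\<bar>s - a\<bar> < \<epsilon>" for s
        using hK[OF that] K0[of "of_real s"] that by (simp add: dist_of_real dist_real_def abs_minus_commute)
      then show "P q" unfolding P_def
        using q by (intro exI[of _ "\<epsilon> - \<bar>q - a\<bar>"]) (auto simp: dist_real_def abs_minus_commute)
    qed
  qed auto
  then have "h 1 = H 1" unfolding P_def by force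
  then show "u x z = ps_eval (0 + (k + l)) c (pt 0 k x0 z0 t x z)"
    by (simp add: h_def H_def xz0 v_def)
qed

lemma in_box_triangle:
  assumes "in_box 0 k l x0 z0 r t x1 z1" "in_box 0 k l x1 z1 r' t' x z"
  shows "in_box 0 k l x0 z0 (r + r') t' x z"
proof -
  have "\<bar>x i - x0 i\<bar> < r + r'" if "i < k" for i
    using assms that by (force simp: in_box_def)
  moreover have "norm (z i - z0 i) < r + r'" if "i < l" for i
    using norm_triangle_ineq[of "z i - z1 i" "z1 i - z0 i"] assms that by (force simp: in_box_def)
  ultimately show ?thesis using assms by (auto simp: in_box_def)
qed

lemma in_box_commute:
  assumes "in_box 0 k l x0 z0 r t x z" "x0 \<in> topspace (Euclidean_space k)" "z0 \<in> topspace (Complex_space l)"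
  shows "in_box 0 k l x z r t x0 z0"
  using assms by (auto simp: in_box_def norm_minus_commute abs_minus_commute)

text \<open>The points at which the local expansion is zero form a subset of the connected
  \<open>N \<times> U\<close> that is open and has open complement. The point of \<open>key\<close>
  is a neighbourhood whose size does not depend on the radius of the zero expansion;
  \<open>expands_on_box\<close> provides it.\<close>

lemma expands_identity_theorem:
  assumes N: "openin (Euclidean_space k) N" "connectedin (Euclidean_space k) N"
    and U: "openin (Complex_space l) U" "connectedin (Complex_space l) U"
    and u: "\<And>x z. x \<in> N \<Longrightarrow> z \<in> U \<Longrightarrow> \<exists>S e. expands 0 k l (\<lambda>_. u) x z S e"
    and x1: "x1 \<in> N" and z1: "z1 \<in> U" and e: "expands 0 k l (\<lambda>_. u) x1 z1 S (\<lambda>_. 0)"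
    and x: "x \<in> N" and z: "z \<in> U"
  shows "u x z = 0"
proof -
  have NU: "N \<subseteq> topspace (Euclidean_space k)" "U \<subseteq> topspace (Complex_space l)"
    using N U openin_subset by auto
  define A where "A = {p \<in> N \<times> U. \<exists>S. expands 0 k l (\<lambda>_. u) (fst p) (snd p) S (\<lambda>_. 0)}"
  define Y where "Y = prod_topology (Euclidean_space k) (Complex_space l)"
  have key: "\<exists>T. openin Y T \<and> p \<in> T \<and> T \<subseteq> N \<times> U \<and> (\<forall>a\<in>T. \<forall>b\<in>T. a \<in> A \<longrightarrow> b \<in> A)" if p: "p \<in> N \<times> U" for p
  proof -
    obtain p1 p2 where pp: "p = (p1, p2)" by (cases p)
    have ptop: "p1 \<in> topspace (Euclidean_space k)" "p2 \<in> topspace (Complex_space l)" using p NU pp by auto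
    obtain R where R: "0 < R" "\<And>t x z. in_box 0 k l p1 p2 R t x z \<Longrightarrow> x \<in> N \<and> z \<in> U"
      using box_in_Times[OF N(1) U(1), of p1 p2 0] p pp by auto
    \<comment> \<open>Two points of this box differ by less than R/4. The box of radius R/2 around
      the first stays within R of \<open>p\<close>, hence over \<open>N \<times> U\<close>, and it
      contains the box of radius R/4 around the second.\<close>
    define T where "T = {(x, z). in_box 0 k l p1 p2 (R/8) (\<lambda>_. 0) x z}"
    have "T = {x. (\<forall>i\<ge>k. x i = 0) \<and> (\<forall>i<k. norm (x i - p1 i) < R/8)} \<times> {z. (\<forall>i\<ge>l. z i = 0) \<and> (\<forall>i<l. norm (z i - p2 i) < R/8)}"
      by (auto simp: T_def in_box_def Euclidean_space_topspace Complex_space_topspace)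
    then have "openin Y T" unfolding Y_def Euclidean_space_eq Complex_space_def
      by (simp only: openin_prod_Times_iff openin_coordinate_ball) simp
    moreover have "p \<in> T" using ptop R by (auto simp: T_def pp in_box_def Euclidean_space_topspace)
    moreover have "T \<subseteq> N \<times> U"
    proof (clarsimp simp: T_def)
      fix x z assume "in_box 0 k l p1 p2 (R/8) (\<lambda>_. 0) x z"
      then have "in_box 0 k l p1 p2 R (\<lambda>_. 0) x z" by (rule in_box_mono) (use R in simp)
      then show "x \<in> N \<and> z \<in> U" by (rule R(2))
    qed
    moreover have "b \<in> A" if a: "a \<in> T" "a \<in> A" and b: "b \<in> T" for a b
    proof -
      obtain a1 a2 b1 b2 where ab: "a = (a1, a2)" "b = (b1, b2)" by (cases a, cases b)
      have box: "in_box 0 k l p1 p2 (R/8) (\<lambda>_. 0) a1 a2" "in_box 0 k l p1 p2 (R/8) (\<lambda>_. 0) b1 b2"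
        using a b by (auto simp: T_def ab)
      have top: "a1 \<in> topspace (Euclidean_space k)" "a2 \<in> topspace (Complex_space l)" using box by (auto simp: in_box_def)
      obtain S where S: "expands 0 k l (\<lambda>_. u) a1 a2 S (\<lambda>_. 0)" using a(2) by (auto simp: A_def ab)
      have ex: "expands 0 k l (\<lambda>_. u) a1 a2 (R/2) (\<lambda>_. 0)"
      proof (rule expands_on_box[OF _ S _ _ top])
        fix t x z assume "in_box 0 k l a1 a2 (R/2) t x z"
        then have "in_box 0 k l p1 p2 (R/8 + R/2) t x z" by (rule in_box_triangle[OF box(1)])
        then have "in_box 0 k l p1 p2 R t x z" by (rule in_box_mono) (use R in simp)
        then show "\<exists>S e. expands 0 k l (\<lambda>_. u) x z S e" using R(2) u by blast
      qed (use R in auto)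
      have "in_box 0 k l a1 a2 (R/8 + R/8) (\<lambda>_. 0) b1 b2"
        using in_box_triangle[OF in_box_commute[OF box(1) ptop] box(2)] .
      then have ab4: "in_box 0 k l a1 a2 (R/4) (\<lambda>_. 0) b1 b2" by simp
      have "expands 0 k l (\<lambda>_. u) b1 b2 (R/4) (\<lambda>_. 0)"
        unfolding expands_def
      proof safe
        fix t x z assume "in_box 0 k l b1 b2 (R/4) t x z"
        then have "in_box 0 k l a1 a2 (R/4 + R/4) t x z" by (rule in_box_triangle[OF ab4])
        then have "in_box 0 k l a1 a2 (R/2) t x z" by simp
        from expandsD[OF ex this] show "u x z = ps_eval (0 + (k + l)) (\<lambda>_. 0) (pt 0 k b1 b2 t x z)" by simp
      qed (use R in auto)
      then show "b \<in> A" using b \<open>T \<subseteq> N \<times> U\<close> by (auto simp: A_def ab)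
    qed
    ultimately show ?thesis by blast
  qed
  have ANU: "A \<subseteq> N \<times> U" by (auto simp: A_def)
  have A1: "openin Y A"
  proof (subst openin_subopen, intro ballI)
    fix p assume p: "p \<in> A"
    then obtain T where "openin Y T" "p \<in> T" "\<forall>a\<in>T. \<forall>b\<in>T. a \<in> A \<longrightarrow> b \<in> A" using key ANU by blast
    then show "\<exists>T. openin Y T \<and> p \<in> T \<and> T \<subseteq> A" using p by blast
  qed
  have A2: "openin Y (N \<times> U - A)"
  proof (subst openin_subopen, intro ballI)
    fix p assume p: "p \<in> N \<times> U - A"
    then have "p \<in> N \<times> U" by blast
    from key[OF this] obtain T where "openin Y T" "p \<in> T" "T \<subseteq> N \<times> U" "\<forall>a\<in>T. \<forall>b\<in>T. a \<in> A \<longrightarrow> b \<in> A" by (elim exE conjE)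
    moreover from this p have "T \<subseteq> N \<times> U - A" by blast
    ultimately show "\<exists>T. openin Y T \<and> p \<in> T \<and> T \<subseteq> N \<times> U - A" by blast
  qed
  have A3: "connectedin Y (N \<times> U)"
    unfolding Y_def using N U by (simp add: connectedin_Times)
  have A4: "(x1, z1) \<in> A" using x1 z1 e by (auto simp: A_def)
  have "\<not> (openin Y A \<and> openin Y (N \<times> U - A) \<and> N \<times> U \<subseteq> A \<union> (N \<times> U - A) \<and> A \<inter> (N \<times> U - A) \<inter> (N \<times> U) = {} \<and>
      A \<inter> (N \<times> U) \<noteq> {} \<and> (N \<times> U - A) \<inter> (N \<times> U) \<noteq> {})"
    using A3 unfolding connectedin by meson
  moreover have "A \<inter> (N \<times> U) \<noteq> {}" using A4 ANU by blast
  ultimately have "(x, z) \<in> A" using A1 A2 x z by blast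
  then obtain S' where S': "expands 0 k l (\<lambda>_. u) x z S' (\<lambda>_. 0)" by (auto simp: A_def)
  have "in_box 0 k l x z S' (\<lambda>_. 0) x z"
    using S' x z NU by (auto simp: in_box_def expands_def Euclidean_space_topspace)
  from expandsD[OF S' this] show ?thesis by simp
qed

section \<open>Operators and expansions\<close>

abbreviation vec_prj :: "'m::finite \<Rightarrow> complex ^ 'm \<Rightarrow> complex" where
  "vec_prj \<equiv> \<lambda>j v. v $ j"

abbreviation mat_prj :: "'m::finite \<times> 'm \<Rightarrow> complex ^ 'm ^ 'm \<Rightarrow> complex" where
  "mat_prj \<equiv> \<lambda>(i, j) A. A $ i $ j"

lemma vexpands_mono: "vexpands prj n k l f x0 z0 R C \<Longrightarrow> 0 < s \<Longrightarrow> s \<le> R \<Longrightarrow> vexpands prj n k l f x0 z0 s C"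
  by (auto simp: vexpands_def intro: expands_mono)

lemma vexpandsI:
  fixes prj :: "'c::finite \<Rightarrow> 'b \<Rightarrow> complex"
  assumes "\<And>j. \<exists>R c. expands n k l (\<lambda>t x z. prj j (f t x z)) x0 z0 R c"
  obtains R C where "0 < R" "vexpands prj n k l f x0 z0 R C"
proof -
  obtain R C where RC: "\<And>j. expands n k l (\<lambda>t x z. prj j (f t x z)) x0 z0 (R j) (C j)"
    using assms by metis
  define S where "S = Min (range R)"
  have "0 < R j" for j using RC by (simp add: expands_def)
  then have S: "0 < S" "\<And>j. S \<le> R j" by (auto simp: S_def)
  then have "vexpands prj n k l f x0 z0 S C"
    unfolding vexpands_def using RC expands_mono by blast
  then show ?thesis using that S by blast
qed

lemma finite_common_radius:
  fixes R :: "'i \<Rightarrow> real"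
  assumes "finite I" "\<And>i. i \<in> I \<Longrightarrow> 0 < R i"
  obtains S where "0 < S" "\<And>i. i \<in> I \<Longrightarrow> S \<le> R i"
proof
  show "0 < Min (insert 1 (R ` I))" using assms by (auto simp: Min_gr_iff)
  show "Min (insert 1 (R ` I)) \<le> R i" if "i \<in> I" for i using assms that by (intro Min_le) auto
qed

lemma in_box_center:
  "0 < R \<Longrightarrow> x0 \<in> topspace (Euclidean_space k) \<Longrightarrow> z0 \<in> topspace (Complex_space l) \<Longrightarrow> in_box n k l x0 z0 R (\<lambda>_. 0) x0 z0"
  by (auto simp: in_box_def Euclidean_space_topspace)

lemma pt_center: "pt n k x0 z0 (\<lambda>_. 0) x0 z0 = (\<lambda>_. 0)"
  by (auto simp: pt_def jn_def)

lemma expands_center: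
  assumes "expands n k l f x0 z0 R c" "x0 \<in> topspace (Euclidean_space k)" "z0 \<in> topspace (Complex_space l)"
  shows "f (\<lambda>_. 0) x0 z0 = c (\<lambda>_. 0)"
proof -
  have "in_box n k l x0 z0 R (\<lambda>_. 0) x0 z0"
    by (rule in_box_center) (use assms in \<open>auto simp: expands_def\<close>)
  from expandsD[OF assms(1) this] show ?thesis by (simp add: pt_center ps_eval_at_0)
qed

lemma ps_mult_at_0: "ps_mult c e (\<lambda>_. 0) = c (\<lambda>_. 0) * e (\<lambda>_. 0)"
proof -
  have "{\<beta> :: nat \<Rightarrow> nat. \<beta> \<le> (\<lambda>_. 0)} = {\<lambda>_. 0}" by (auto simp: le_fun_def)
  then show ?thesis by (simp add: ps_mult_def)
qed

text \<open>Over index 0 in the remaining variables a Cauchy product splits the t-exponent only;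
  this is the sum over \<mu> \<le> \<gamma> in \<open>formal_apply\<close>.\<close>

lemma ps_mult_jn_zero:
  assumes "\<gamma> \<in> multi_indices n"
  shows "ps_mult c e (jn n \<gamma> (\<lambda>_. 0)) = (\<Sum>\<mu> | \<mu> \<le> \<gamma>. c (jn n (\<lambda>i. \<gamma> i - \<mu> i) (\<lambda>_. 0)) * e (jn n \<mu> (\<lambda>_. 0)))"
  unfolding ps_mult_def
proof (rule sum.reindex_bij_witness[of _ "\<lambda>\<mu>. jn n (\<lambda>i. \<gamma> i - \<mu> i) (\<lambda>_. 0)" "\<lambda>\<beta> i. \<gamma> i - (if i < n then \<beta> i else 0)"])
  fix \<beta> :: "nat \<Rightarrow> nat" assume "\<beta> \<in> {\<beta>. \<beta> \<le> jn n \<gamma> (\<lambda>_. 0)}"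
  then have \<beta>: "\<beta> i \<le> (if i < n then \<gamma> i else 0)" for i by (auto simp: le_fun_def jn_def split: if_splits)
  have 1: "jn n (\<lambda>i. \<gamma> i - (\<gamma> i - (if i < n then \<beta> i else 0))) (\<lambda>_. 0) = \<beta>"
  proof
    fix i show "jn n (\<lambda>i. \<gamma> i - (\<gamma> i - (if i < n then \<beta> i else 0))) (\<lambda>_. 0) i = \<beta> i"
      using \<beta>[of i] by (auto simp: jn_def split: if_splits)
  qed
  show "jn n (\<lambda>i. \<gamma> i - (\<gamma> i - (if i < n then \<beta> i else 0))) (\<lambda>_. 0) = \<beta>" by (rule 1)
  have 2: "jn n (\<lambda>i. \<gamma> i - (if i < n then \<beta> i else 0)) (\<lambda>_. 0) = (\<lambda>i. jn n \<gamma> (\<lambda>_. 0) i - \<beta> i)"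
    by (auto simp: jn_def)
  show "(\<lambda>i. \<gamma> i - (if i < n then \<beta> i else 0)) \<in> {\<mu>. \<mu> \<le> \<gamma>}" by (auto simp: le_fun_def)
  show "c (jn n (\<lambda>i. \<gamma> i - (\<gamma> i - (if i < n then \<beta> i else 0))) (\<lambda>_. 0)) * e (jn n (\<lambda>i. \<gamma> i - (if i < n then \<beta> i else 0)) (\<lambda>_. 0))
     = c \<beta> * e (\<lambda>i. jn n \<gamma> (\<lambda>_. 0) i - \<beta> i)"
    unfolding 1 2 ..
next
  fix \<mu> :: "nat \<Rightarrow> nat" assume "\<mu> \<in> {\<mu>. \<mu> \<le> \<gamma>}"
  then have \<mu>: "\<mu> i \<le> \<gamma> i" for i by (auto simp: le_fun_def)
  moreover have "\<gamma> i = 0" if "\<not> i < n" for i using assms that by (auto simp: multi_indices_def)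
  ultimately show "(\<lambda>i. \<gamma> i - (if i < n then jn n (\<lambda>i. \<gamma> i - \<mu> i) (\<lambda>_. 0) i else 0)) = \<mu>"
    by (auto simp: jn_def fun_eq_iff) (metis le_zero_eq)
  show "jn n (\<lambda>i. \<gamma> i - \<mu> i) (\<lambda>_. 0) \<in> {\<beta>. \<beta> \<le> jn n \<gamma> (\<lambda>_. 0)}"
    by (auto simp: jn_def le_fun_def)
qed

section \<open>Weighted l1 norms, powers of \<lambda> + \<mu>, and the operators on coefficient
  arrays\<close>

definition ps_norm :: "nat \<Rightarrow> real \<Rightarrow> ((nat \<Rightarrow> nat) \<Rightarrow> complex) \<Rightarrow> real" where
  "ps_norm d s c = (\<Sum>\<^sub>\<infinity>\<alpha>\<in>multi_indices d. norm (c \<alpha>) * s ^ multi_deg d \<alpha>)"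

lemma ps_norm_nonneg: "0 \<le> s \<Longrightarrow> 0 \<le> ps_norm d s c"
  unfolding ps_norm_def by (intro infsum_nonneg) auto

lemma ps_norm_mult:
  "ps_summable d s c \<Longrightarrow> ps_summable d s e \<Longrightarrow> 0 \<le> s \<Longrightarrow> ps_norm d s (ps_mult c e) \<le> ps_norm d s c * ps_norm d s e"
  unfolding ps_norm_def by (rule ps_summable_mult)

lemma ps_norm_add_const:
  assumes "ps_summable d s c" "0 \<le> s"
  shows "ps_norm d s (\<lambda>\<alpha>. c \<alpha> + (if \<alpha> = (\<lambda>_. 0) then a else 0)) \<le> ps_norm d s c + norm a"
    and "ps_summable d s (\<lambda>\<alpha>. c \<alpha> + (if \<alpha> = (\<lambda>_. 0) then a else 0))"
proof -
  let ?e = "\<lambda>\<alpha>. norm (if \<alpha> = (\<lambda>_. 0) then a else 0) * s ^ multi_deg d \<alpha>"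
  have e0: "(\<Sum>\<^sub>\<infinity>\<alpha>\<in>multi_indices d. ?e \<alpha>) = (\<Sum>\<^sub>\<infinity>\<alpha>\<in>{\<lambda>_. 0}. ?e \<alpha>)"
    by (rule infsum_cong_neutral) auto
  have e1: "?e summable_on multi_indices d"
    by (rule summable_on_cong_neutral[THEN iffD1, OF _ _ _ summable_on_finite[of "{\<lambda>_. 0} :: (nat \<Rightarrow> nat) set"]]) auto
  have sm: "(\<lambda>\<alpha>. norm (c \<alpha>) * s ^ multi_deg d \<alpha> + ?e \<alpha>) summable_on multi_indices d"
    using assms(1) e1 unfolding ps_summable_def by (rule summable_on_add)
  have le: "norm (c \<alpha> + (if \<alpha> = (\<lambda>_. 0) then a else 0)) * s ^ multi_deg d \<alpha> \<le> norm (c \<alpha>) * s ^ multi_deg d \<alpha> + ?e \<alpha>" for \<alpha>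
    unfolding distrib_right[symmetric] using assms(2) by (intro mult_right_mono norm_triangle_ineq) auto
  show 1: "ps_summable d s (\<lambda>\<alpha>. c \<alpha> + (if \<alpha> = (\<lambda>_. 0) then a else 0))"
    unfolding ps_summable_def using sm
    by (rule Infinite_Sum.summable_on_comparison_test) (use le assms(2) in auto)
  have "ps_norm d s (\<lambda>\<alpha>. c \<alpha> + (if \<alpha> = (\<lambda>_. 0) then a else 0)) \<le> (\<Sum>\<^sub>\<infinity>\<alpha>\<in>multi_indices d. norm (c \<alpha>) * s ^ multi_deg d \<alpha> + ?e \<alpha>)"
    unfolding ps_norm_def using 1 sm le unfolding ps_summable_def by (intro infsum_mono) auto
  also have "\<dots> = ps_norm d s c + (\<Sum>\<^sub>\<infinity>\<alpha>\<in>multi_indices d. ?e \<alpha>)"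
    unfolding ps_norm_def using assms(1) e1 unfolding ps_summable_def by (rule infsum_add)
  finally show "ps_norm d s (\<lambda>\<alpha>. c \<alpha> + (if \<alpha> = (\<lambda>_. 0) then a else 0)) \<le> ps_norm d s c + norm a"
    unfolding e0 by simp
qed

definition ps_const :: "complex \<Rightarrow> (nat \<Rightarrow> nat) \<Rightarrow> complex" where
  "ps_const a = (\<lambda>\<alpha>. if \<alpha> = (\<lambda>_. 0) then a else 0)"

lemma ps_norm_const: "0 \<le> s \<Longrightarrow> ps_norm d s (ps_const a) \<le> norm a"
  using ps_norm_add_const(1)[of d s "\<lambda>_. 0" a] by (simp add: ps_const_def ps_norm_def ps_summable_def)

lemma ps_summable_const: "0 \<le> s \<Longrightarrow> ps_summable d s (ps_const a)"
  using ps_norm_add_const(2)[of d s "\<lambda>_. 0" a] by (simp add: ps_const_def ps_summable_def)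

text \<open>The series of \<open>(\<lambda>(z) + \<mu>)\<^sup>\<alpha>\<close>, given those of the components of \<open>\<lambda>\<close>.\<close>
fun ps_lam_pow :: "(nat \<Rightarrow> (nat \<Rightarrow> nat) \<Rightarrow> complex) \<Rightarrow> nat \<Rightarrow> (nat \<Rightarrow> nat) \<Rightarrow> (nat \<Rightarrow> nat) \<Rightarrow> (nat \<Rightarrow> nat) \<Rightarrow> complex" where
  "ps_lam_pow L 0 \<alpha> \<mu> = ps_const 1"
| "ps_lam_pow L (Suc m) \<alpha> \<mu> = (ps_mult (\<lambda>\<delta>. L m \<delta> + (if \<delta> = (\<lambda>_. 0) then of_nat (\<mu> m) else 0)) ^^ \<alpha> m) (ps_lam_pow L m \<alpha> \<mu>)"

text \<open>Submultiplicativity, one factor after another; the constant added to \<open>L i\<close>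
  raises its norm by at most \<open>\<mu> i\<close>.\<close>

lemma ps_lam_pow_norm:
  assumes "\<And>i. i < m \<Longrightarrow> ps_summable d s (L i)" "0 \<le> s"
  shows "ps_summable d s (ps_lam_pow L m \<alpha> \<mu>) \<and>
    ps_norm d s (ps_lam_pow L m \<alpha> \<mu>) \<le> (\<Prod>i<m. (ps_norm d s (L i) + real (\<mu> i)) ^ \<alpha> i)"
  using assms(1)
proof (induction m)
  case 0
  then show ?case using ps_norm_const[of s d 1] ps_summable_const assms(2) by simp
next
  case (Suc m)
  let ?g = "\<lambda>\<delta>. L m \<delta> + (if \<delta> = (\<lambda>_. 0) then of_nat (\<mu> m) else 0)"
  have g: "ps_summable d s ?g" "ps_norm d s ?g \<le> ps_norm d s (L m) + real (\<mu> m)"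
    using ps_norm_add_const[of d s "L m" "of_nat (\<mu> m)"] Suc.prems assms(2) by auto
  have IH: "ps_summable d s (ps_lam_pow L m \<alpha> \<mu>)"
    "ps_norm d s (ps_lam_pow L m \<alpha> \<mu>) \<le> (\<Prod>i<m. (ps_norm d s (L i) + real (\<mu> i)) ^ \<alpha> i)"
    using Suc by auto
  have "ps_summable d s ((ps_mult ?g ^^ q) (ps_lam_pow L m \<alpha> \<mu>)) \<and>
     ps_norm d s ((ps_mult ?g ^^ q) (ps_lam_pow L m \<alpha> \<mu>)) \<le> (ps_norm d s (L m) + real (\<mu> m)) ^ q * (\<Prod>i<m. (ps_norm d s (L i) + real (\<mu> i)) ^ \<alpha> i)" for q
  proof (induction q)
    case 0
    then show ?case using IH by simp
  next
    case (Suc q)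
    let ?e = "(ps_mult ?g ^^ q) (ps_lam_pow L m \<alpha> \<mu>)"
    have "ps_norm d s (ps_mult ?g ?e) \<le> ps_norm d s ?g * ps_norm d s ?e"
      using g Suc assms(2) by (intro ps_norm_mult) auto
    also have "\<dots> \<le> (ps_norm d s (L m) + real (\<mu> m)) * ((ps_norm d s (L m) + real (\<mu> m)) ^ q * (\<Prod>i<m. (ps_norm d s (L i) + real (\<mu> i)) ^ \<alpha> i))"
      using g(2) Suc assms(2) by (intro mult_mono) (auto intro!: ps_norm_nonneg add_nonneg_nonneg)
    finally show ?case using g Suc assms(2) by (auto simp: mult_ac intro: ps_summable_mult)
  qed
  from this[of "\<alpha> m"] show ?case by (simp add: mult_ac)
qed

lemma expands_lam_pow:
  assumes "\<And>i. i < m \<Longrightarrow> expands 0 k l (\<lambda>_ _. lam i) x0 z0 R (L i)" "0 < R"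
  shows "expands 0 k l (\<lambda>_ _ z. multi_pow m (\<lambda>i. lam i z + of_nat (\<mu> i)) \<alpha>) x0 z0 R (ps_lam_pow L m \<alpha> \<mu>)"
  using assms(1)
proof (induction m)
  case 0
  then show ?case using expands_const[OF assms(2), of 0 k l 1] by (simp add: multi_pow_def ps_const_def)
next
  case (Suc m)
  have g: "expands 0 k l (\<lambda>_ _ z. lam m z + of_nat (\<mu> m)) x0 z0 R (\<lambda>\<delta>. L m \<delta> + (if \<delta> = (\<lambda>_. 0) then of_nat (\<mu> m) else 0))"
    using Suc.prems assms(2) by (intro expands_add expands_const) auto
  have "expands 0 k l (\<lambda>_ _ z. (lam m z + of_nat (\<mu> m)) ^ q * multi_pow m (\<lambda>i. lam i z + of_nat (\<mu> i)) \<alpha>) x0 z0 R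
      ((ps_mult (\<lambda>\<delta>. L m \<delta> + (if \<delta> = (\<lambda>_. 0) then of_nat (\<mu> m) else 0)) ^^ q) (ps_lam_pow L m \<alpha> \<mu>))" for q
  proof (induction q)
    case 0
    then show ?case using Suc by simp
  next
    case (Suc q)
    from expands_mult[OF g Suc.IH] show ?case by (simp add: mult_ac)
  qed
  from this[of "\<alpha> m"] show ?case by (simp add: multi_pow_def mult_ac)
qed

text \<open>The array of (t_i d/dt_i + \<lambda>_i) f: the factor t_i is itself a series with a
  single coefficient, so that everything is expressed by \<open>ps_mult\<close> and
  \<open>ps_deriv\<close>.\<close>

definition ps_theta :: "nat \<Rightarrow> ((nat \<Rightarrow> nat) \<Rightarrow> complex) \<Rightarrow> ((nat \<Rightarrow> nat) \<Rightarrow> complex) \<Rightarrow> (nat \<Rightarrow> nat) \<Rightarrow> complex" where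
  "ps_theta i L c \<delta> = ps_mult (\<lambda>\<beta>. if \<beta> = (\<lambda>_. 0)(i := 1) then 1 else 0) (ps_deriv i c) \<delta> + ps_mult L c \<delta>"

text \<open>The Euler operator acts diagonally: multiplication by t_i restores the degree that the
  derivative lowers.\<close>

lemma ps_mult_coord:
  assumes "\<delta> \<in> multi_indices d"
  shows "ps_mult (\<lambda>\<beta>. if \<beta> = (\<lambda>_. 0)(i := 1) then 1 else 0) (ps_deriv i c) \<delta> = of_nat (\<delta> i) * c \<delta>"
proof -
  let ?e = "(\<lambda>_. 0)(i := 1) :: nat \<Rightarrow> nat"
  have fin: "finite {\<beta>. \<beta> \<le> \<delta>}" by (rule finite_le_multi_index[OF assms])
  have "ps_mult (\<lambda>\<beta>. if \<beta> = ?e then 1 else 0) (ps_deriv i c) \<delta> = (\<Sum>\<beta>\<in>{\<beta>. \<beta> \<le> \<delta>} \<inter> {?e}. ps_deriv i c (\<lambda>j. \<delta> j - \<beta> j))"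
    unfolding ps_mult_def by (rule sum.mono_neutral_cong_right) (use fin in auto)
  also have "\<dots> = of_nat (\<delta> i) * c \<delta>"
  proof (cases "\<delta> i = 0")
    case True
    then have "{\<beta>. \<beta> \<le> \<delta>} \<inter> {?e} = {}" by (auto simp: le_fun_def)
    then show ?thesis using True by simp
  next
    case False
    then have 1: "{\<beta>. \<beta> \<le> \<delta>} \<inter> {?e} = {?e}" by (auto simp: le_fun_def)
    have 2: "(\<lambda>j. \<delta> j - ?e j)(i := \<delta> i) = \<delta>" using False by auto
    have 3: "\<delta> i - ?e i + 1 = \<delta> i" using False by simp
    show ?thesis unfolding 1 by (simp only: sum.insert finite.emptyI empty_iff not_False_eq_True sum.empty add_0_right ps_deriv_def 2 3)
  qed
  finally show ?thesis .
qed

lemma vexpands_theta_step: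
  assumes f: "vexpands vec_prj n k l f x0 z0 R C" and lam: "expands n k l (\<lambda>_ _. lam) x0 z0 R L" and i: "i < n"
  shows "vexpands vec_prj n k l (\<lambda>t x z. t i *\<^sub>R partial_deriv i (\<lambda>t. f t x z) t + lam z *s f t x z) x0 z0 R (\<lambda>j. ps_theta i L (C j))"
  unfolding vexpands_def
proof
  fix j
  have R: "0 < R" using lam by (simp add: expands_def)
  have 1: "expands n k l (\<lambda>t x z. partial_deriv i (\<lambda>t. f t x z) t $ j) x0 z0 R (ps_deriv i (C j))"
    using vexpands_partial_t[OF components_vec f i] by (simp add: vexpands_def)
  have 2: "expands n k l (\<lambda>t x z. f t x z $ j) x0 z0 R (C j)"
    using f by (simp add: vexpands_def)
  have "expands n k l (\<lambda>t x z. of_real (t i) * (partial_deriv i (\<lambda>t. f t x z) t $ j) + lam z * (f t x z $ j)) x0 z0 R (ps_theta i L (C j))"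
    unfolding ps_theta_def[abs_def]
    by (intro expands_add expands_mult expands_coord i R 1 2 lam)
  then show "expands n k l (\<lambda>t x z. (t i *\<^sub>R partial_deriv i (\<lambda>t. f t x z) t + lam z *s f t x z) $ j) x0 z0 R (ps_theta i L (C j))"
    by (simp only: vector_add_component vector_scaleR_component vector_smult_component scaleR_conv_of_real[where 'a = complex])
qed

definition ps_theta_pow where
  "ps_theta_pow n L \<alpha> c = fold (\<lambda>i. ps_theta i (L i) ^^ \<alpha> i) [0..<n] c"

lemma vexpands_theta_conj:
  assumes f: "vexpands vec_prj n k l f x0 z0 R C" and lam: "\<And>i. i < n \<Longrightarrow> expands n k l (\<lambda>_ _. lam i) x0 z0 R (L i)"
  shows "vexpands vec_prj n k l (\<lambda>t x z. theta_conj n (\<lambda>i. lam i z) \<alpha> (\<lambda>t. f t x z) t) x0 z0 R (\<lambda>j. ps_theta_pow n L \<alpha> (C j))"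
proof -
  have pow: "vexpands vec_prj n k l (\<lambda>t x z. ((\<lambda>g t. t i *\<^sub>R partial_deriv i g t + lam i z *s g t) ^^ q) (\<lambda>t. g t x z) t) x0 z0 R
      (\<lambda>j. (ps_theta i (L i) ^^ q) (E j))"
    if "vexpands vec_prj n k l g x0 z0 R E" "i < n" for i q g E
    by (induction q) (use that vexpands_theta_step[OF _ lam] in auto)
  have "vexpands vec_prj n k l (\<lambda>t x z. fold (\<lambda>i. (\<lambda>g t. t i *\<^sub>R partial_deriv i g t + lam i z *s g t) ^^ \<alpha> i) [0..<m] (\<lambda>t. f t x z) t) x0 z0 R
     (\<lambda>j. fold (\<lambda>i. ps_theta i (L i) ^^ \<alpha> i) [0..<m] (C j))" if "m \<le> n" for m
    using that
  proof (induction m)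
    case (Suc m)
    then show ?case
      using pow[of "\<lambda>t x z. fold (\<lambda>i. (\<lambda>g t. t i *\<^sub>R partial_deriv i g t + lam i z *s g t) ^^ \<alpha> i) [0..<m] (\<lambda>t. f t x z) t" _ m "\<alpha> m"]
      by simp
  qed (use f in simp)
  from this[of n] show ?thesis by (simp add: theta_conj_def ps_theta_pow_def)
qed

text \<open>Since \<open>\<lambda>\<close> does not depend on \<open>t\<close>, the coefficients of \<open>t\<^sup>\<gamma>\<close> at the centre are multiplied by a scalar.\<close>
lemma ps_theta_pow_center:
  assumes "\<gamma> \<in> multi_indices n"
  shows "ps_theta_pow n (\<lambda>i. ps_lift n (L i)) \<alpha> c (jn n \<gamma> (\<lambda>_. 0)) =
     multi_pow n (\<lambda>i. L i (\<lambda>_. 0) + of_nat (\<gamma> i)) \<alpha> * c (jn n \<gamma> (\<lambda>_. 0))"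
proof -
  let ?g = "jn n \<gamma> (\<lambda>_. 0)"
  have mem: "?g \<in> multi_indices n" using assms by (auto simp: jn_def multi_indices_def)
  have step: "ps_theta i (ps_lift n (L i)) e ?g = (L i (\<lambda>_. 0) + of_nat (\<gamma> i)) * e ?g" if "i < n" for i e
  proof -
    have "ps_mult (ps_lift n (L i)) e ?g = (\<Sum>\<mu> | \<mu> \<le> \<gamma>. if \<mu> = \<gamma> then L i (\<lambda>_. 0) * e ?g else 0)"
      unfolding ps_mult_jn_zero[OF assms]
    proof (rule sum.cong)
      fix \<mu> assume \<mu>: "\<mu> \<in> {\<mu>. \<mu> \<le> \<gamma>}"
      have "(\<lambda>i. \<gamma> i - \<mu> i) = (\<lambda>_. 0) \<longleftrightarrow> \<mu> = \<gamma>" using \<mu> by (auto simp: le_fun_def fun_eq_iff intro: antisym)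
      then show "ps_lift n (L i) (jn n (\<lambda>i. \<gamma> i - \<mu> i) (\<lambda>_. 0)) * e (jn n \<mu> (\<lambda>_. 0)) = (if \<mu> = \<gamma> then L i (\<lambda>_. 0) * e ?g else 0)"
        using ps_lift_jn[OF multi_indices_diff[OF assms]] by auto
    qed simp
    also have "\<dots> = L i (\<lambda>_. 0) * e ?g" using finite_le_multi_index[OF assms] by simp
    finally show ?thesis unfolding ps_theta_def ps_mult_coord[OF mem] using that
      by (simp add: jn_def algebra_simps)
  qed
  have pow: "(ps_theta i (ps_lift n (L i)) ^^ q) e ?g = (L i (\<lambda>_. 0) + of_nat (\<gamma> i)) ^ q * e ?g" if "i < n" for i q e
    by (induction q) (use step[OF that] in auto)
  have "fold (\<lambda>i. ps_theta i (ps_lift n (L i)) ^^ \<alpha> i) [0..<m] c ?g = (\<Prod>i<m. (L i (\<lambda>_. 0) + of_nat (\<gamma> i)) ^ \<alpha> i) * c ?g" if "m \<le> n" for m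
    using that by (induction m) (auto simp: pow)
  from this[of n] show ?thesis by (simp add: ps_theta_pow_def multi_pow_def)
qed

text \<open>The data of the operator at one point, with one radius for all of them. The arrays
  \<open>A\<close> are in (t, x, z); the arrays \<open>L\<close> of \<lambda> are in (x, z), the
  variables of the coefficients of a formal series.\<close>

locale expansion_at =
  fixes n k l :: nat and P :: "'m::finite op_matrix" and lam :: "nat \<Rightarrow> (nat \<Rightarrow> complex) \<Rightarrow> complex"
    and x0 :: "nat \<Rightarrow> real" and z0 :: "nat \<Rightarrow> complex" and R :: real
    and A :: "(nat \<Rightarrow> nat) \<Rightarrow> (nat \<Rightarrow> nat) \<Rightarrow> 'm \<times> 'm \<Rightarrow> (nat \<Rightarrow> nat) \<Rightarrow> complex"
    and L :: "nat \<Rightarrow> (nat \<Rightarrow> nat) \<Rightarrow> complex"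
  assumes R: "0 < R"
    and x0: "x0 \<in> topspace (Euclidean_space k)" and z0: "z0 \<in> topspace (Complex_space l)"
    and finite_supp: "finite (op_supp P)" and supp: "op_supp P \<subseteq> multi_indices n \<times> multi_indices k"
    and A: "\<And>\<alpha> \<beta>. (\<alpha>, \<beta>) \<in> op_supp P \<Longrightarrow> vexpands mat_prj n k l (P \<alpha> \<beta>) x0 z0 R (A \<alpha> \<beta>)"
    and L: "\<And>i. i < n \<Longrightarrow> expands 0 k l (\<lambda>_ _. lam i) x0 z0 R (L i)"
begin

definition conj_arr :: "('m \<Rightarrow> (nat \<Rightarrow> nat) \<Rightarrow> complex) \<Rightarrow> 'm \<Rightarrow> (nat \<Rightarrow> nat) \<Rightarrow> complex" where
  "conj_arr C i = (\<lambda>\<delta>. \<Sum>(\<alpha>, \<beta>)\<in>op_supp P. \<Sum>j\<in>UNIV.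
     ps_mult (A \<alpha> \<beta> (i, j)) (ps_theta_pow n (\<lambda>i. ps_lift n (L i)) \<alpha> (ps_mderiv n k \<beta> (C j))) \<delta>)"

lemma vexpands_conj_apply:
  assumes f: "vexpands vec_prj n k l f x0 z0 s C" and s: "0 < s" "s \<le> R"
  shows "vexpands vec_prj n k l (conj_apply n k P lam f) x0 z0 s (conj_arr C)"
  unfolding vexpands_def
proof
  fix i
  have Q: "vexpands vec_prj n k l (\<lambda>t x z. theta_conj n (\<lambda>i. lam i z) \<alpha> (\<lambda>t. multi_deriv k \<beta> (\<lambda>x. f t x z) x) t) x0 z0 s
     (\<lambda>j. ps_theta_pow n (\<lambda>i. ps_lift n (L i)) \<alpha> (ps_mderiv n k \<beta> (C j)))" for \<alpha> \<beta>
    by (intro vexpands_theta_conj vexpands_multi_x[OF components_vec f] expands_lift)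
       (use L s expands_mono in blast)+
  have "expands n k l (\<lambda>t x z. \<Sum>p\<in>op_supp P. \<Sum>j\<in>UNIV. (P (fst p) (snd p) t x z $ i $ j) *
      (theta_conj n (\<lambda>i. lam i z) (fst p) (\<lambda>t. multi_deriv k (snd p) (\<lambda>x. f t x z) x) t $ j)) x0 z0 s
     (\<lambda>\<delta>. \<Sum>p\<in>op_supp P. \<Sum>j\<in>UNIV. ps_mult (A (fst p) (snd p) (i, j)) (ps_theta_pow n (\<lambda>i. ps_lift n (L i)) (fst p) (ps_mderiv n k (snd p) (C j))) \<delta>)"
  proof (rule expands_sum[OF _ s(1)], rule expands_sum[OF _ s(1)], rule expands_mult)
    fix p j assume p: "p \<in> op_supp P"
    then have "(fst p, snd p) \<in> op_supp P" by simp
    from vexpands_mono[OF A[OF this] s] have "expands n k l (\<lambda>t x z. mat_prj (i, j) (P (fst p) (snd p) t x z)) x0 z0 s (A (fst p) (snd p) (i, j))"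
      unfolding vexpands_def by blast
    then show "expands n k l (\<lambda>t x z. P (fst p) (snd p) t x z $ i $ j) x0 z0 s (A (fst p) (snd p) (i, j))" by simp
    show "expands n k l (\<lambda>t x z. theta_conj n (\<lambda>i. lam i z) (fst p) (\<lambda>t. multi_deriv k (snd p) (\<lambda>x. f t x z) x) t $ j) x0 z0 s
       (ps_theta_pow n (\<lambda>i. ps_lift n (L i)) (fst p) (ps_mderiv n k (snd p) (C j)))"
      using Q by (simp add: vexpands_def)
  qed
  then show "expands n k l (\<lambda>t x z. conj_apply n k P lam f t x z $ i) x0 z0 s (conj_arr C i)"
    by (simp add: conj_apply_def conj_arr_def case_prod_beta' matrix_vector_mult_def)
qed

text \<open>The slicewise counterpart of \<open>conj_arr\<close>: \<open>\<Phi> \<mu> j\<close>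
  stands for the array in (x, z) of a component of \<open>\<phi> \<mu>\<close>. Being purely
  algebraic, it presupposes no relation between the radii of different slices.\<close>

definition formal_arr :: "((nat \<Rightarrow> nat) \<Rightarrow> 'm \<Rightarrow> (nat \<Rightarrow> nat) \<Rightarrow> complex) \<Rightarrow> (nat \<Rightarrow> nat) \<Rightarrow> 'm \<Rightarrow> (nat \<Rightarrow> nat) \<Rightarrow> complex" where
  "formal_arr \<Phi> \<gamma> i = (\<lambda>b. \<Sum>(\<alpha>, \<beta>)\<in>op_supp P. \<Sum>\<mu> | \<mu> \<le> \<gamma>. \<Sum>j\<in>UNIV.
     ps_mult (\<lambda>b. A \<alpha> \<beta> (i, j) (jn n (\<lambda>i. \<gamma> i - \<mu> i) b)) (ps_mult (ps_lam_pow L n \<alpha> \<mu>) (ps_mderiv 0 k \<beta> (\<Phi> \<mu> j))) b)"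

lemma expands_taylor_coeff:
  assumes "(\<alpha>, \<beta>) \<in> op_supp P" "\<gamma> \<in> multi_indices n" "0 < s" "s \<le> R"
  shows "expands 0 k l (\<lambda>_ x z. taylor_coeff n (P \<alpha> \<beta>) \<gamma> x z $ i $ j) x0 z0 s (\<lambda>b. A \<alpha> \<beta> (i, j) (jn n \<gamma> b))"
  unfolding expands_def
proof safe
  have e: "expands n k l (\<lambda>t x z. mat_prj (i, j) (P \<alpha> \<beta> t x z)) x0 z0 R (A \<alpha> \<beta> (i, j))"
    using A[OF assms(1)] unfolding vexpands_def by blast
  then show "ps_conv (0 + (k + l)) s (\<lambda>b. A \<alpha> \<beta> (i, j) (jn n \<gamma> b))"
    using assms by (auto simp: expands_def intro: ps_conv_mono ps_conv_slice)
  fix t x z assume box: "in_box 0 k l x0 z0 s t x z"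
  then have "in_box n k l x0 z0 R (\<lambda>_. 0) x z"
    using in_box_mono[OF box assms(4)] R by (simp add: in_box_def Euclidean_space_topspace)
  from taylor_coeff_expands[OF components_mat A[OF assms(1)] assms(2) this, of "(i, j)"]
  show "taylor_coeff n (P \<alpha> \<beta>) \<gamma> x z $ i $ j = ps_eval (0 + (k + l)) (\<lambda>b. A \<alpha> \<beta> (i, j) (jn n \<gamma> b)) (pt 0 k x0 z0 t x z)"
    by (simp add: pt_def)
qed (use assms in auto)

lemma vexpands_formal_apply:
  assumes \<gamma>: "\<gamma> \<in> multi_indices n" and s: "0 < s" "s \<le> R"
    and \<phi>: "\<And>\<mu>. \<mu> \<le> \<gamma> \<Longrightarrow> vexpands vec_prj 0 k l (\<lambda>_. \<phi> \<mu>) x0 z0 s (\<Phi> \<mu>)"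
  shows "vexpands vec_prj 0 k l (\<lambda>_. formal_apply n k P lam \<phi> \<gamma>) x0 z0 s (formal_arr \<Phi> \<gamma>)"
  unfolding vexpands_def
proof
  fix i
  have "expands 0 k l (\<lambda>_ x z. \<Sum>p\<in>op_supp P. \<Sum>\<mu> | \<mu> \<le> \<gamma>. \<Sum>j\<in>UNIV. (taylor_coeff n (P (fst p) (snd p)) (\<lambda>i. \<gamma> i - \<mu> i) x z $ i $ j) *
      (multi_pow n (\<lambda>i. lam i z + of_nat (\<mu> i)) (fst p) * (multi_deriv k (snd p) (\<lambda>x. \<phi> \<mu> x z) x $ j))) x0 z0 s
     (\<lambda>b. \<Sum>p\<in>op_supp P. \<Sum>\<mu> | \<mu> \<le> \<gamma>. \<Sum>j\<in>UNIV. ps_mult (\<lambda>b. A (fst p) (snd p) (i, j) (jn n (\<lambda>i. \<gamma> i - \<mu> i) b))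
        (ps_mult (ps_lam_pow L n (fst p) \<mu>) (ps_mderiv 0 k (snd p) (\<Phi> \<mu> j))) b)"
  proof (rule expands_sum[OF _ s(1)], rule expands_sum[OF _ s(1)], rule expands_sum[OF _ s(1)], rule expands_mult,
      rule_tac[2] expands_mult, rule_tac[2] expands_lam_pow[OF _ s(1)])
    fix p \<mu> j assume p: "p \<in> op_supp P" and \<mu>: "\<mu> \<in> {\<mu>. \<mu> \<le> \<gamma>}"
    show "expands 0 k l (\<lambda>_ x z. taylor_coeff n (P (fst p) (snd p)) (\<lambda>i. \<gamma> i - \<mu> i) x z $ i $ j) x0 z0 s (\<lambda>b. A (fst p) (snd p) (i, j) (jn n (\<lambda>i. \<gamma> i - \<mu> i) b))"
      by (rule expands_taylor_coeff) (use p s multi_indices_diff[OF \<gamma>] in auto)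
    show "expands 0 k l (\<lambda>_ _. lam i) x0 z0 s (L i)" if "i < n" for i using L[OF that] s expands_mono by blast
    from vexpands_multi_x[OF components_vec \<phi>, of \<mu> k "snd p"] \<mu>
    show "expands 0 k l (\<lambda>_ x z. multi_deriv k (snd p) (\<lambda>x. \<phi> \<mu> x z) x $ j) x0 z0 s (ps_mderiv 0 k (snd p) (\<Phi> \<mu> j))"
      by (simp add: vexpands_def)
  qed
  then show "expands 0 k l (\<lambda>_ x z. formal_apply n k P lam \<phi> \<gamma> x z $ i) x0 z0 s (formal_arr \<Phi> \<gamma> i)"
    by (simp add: formal_apply_def formal_arr_def case_prod_beta' matrix_vector_mult_def)
qed

text \<open>Compares the action on germs with the formal action, at the centre only. As the centre
  is an arbitrary point, this determines all values.\<close>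

lemma conj_arr_center:
  assumes \<gamma>: "\<gamma> \<in> multi_indices n"
  shows "conj_arr C i (jn n \<gamma> (\<lambda>_. 0)) = formal_arr (\<lambda>\<mu> j b. C j (jn n \<mu> b)) \<gamma> i (\<lambda>_. 0)"
proof -
  have pow0: "(ps_mult g ^^ q) e (\<lambda>_. 0) = g (\<lambda>_. 0) ^ q * e (\<lambda>_. 0)" for g e :: "(nat \<Rightarrow> nat) \<Rightarrow> complex" and q
    by (induction q) (auto simp: ps_mult_at_0)
  have lam0: "ps_lam_pow L m \<alpha> \<mu> (\<lambda>_. 0) = multi_pow m (\<lambda>i. L i (\<lambda>_. 0) + of_nat (\<mu> i)) \<alpha>" for m \<alpha> \<mu>
    by (induction m) (auto simp: ps_const_def multi_pow_def pow0 mult.commute)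
  have md: "ps_mderiv n k \<beta> c (jn n \<mu> (\<lambda>_. 0)) = ps_mderiv 0 k \<beta> (\<lambda>b. c (jn n \<mu> b)) (\<lambda>_. 0)" for \<beta> \<mu> c
  proof -
    have "(\<lambda>j. if n \<le> j \<and> j < n + k then jn n \<mu> (\<lambda>_. 0) j + \<beta> (j - n) else jn n \<mu> (\<lambda>_. 0) j)
        = jn n \<mu> (\<lambda>j. if 0 \<le> j \<and> j < 0 + k then 0 + \<beta> (j - 0) else 0)"
      by (auto simp: jn_def fun_eq_iff)
    then show ?thesis unfolding ps_mderiv_eq by (simp add: jn_def)
  qed
  show ?thesis
    unfolding conj_arr_def formal_arr_def ps_mult_jn_zero[OF \<gamma>] ps_mult_at_0
    by (subst (2) sum.swap, intro sum.cong refl)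
       (auto simp: md lam0 ps_theta_pow_center[OF multi_indices_le[OF \<gamma>]] intro!: sum.cong)
qed

end

section \<open>The ellipticity estimate\<close>

text \<open>The finite set is enclosed in a cube, over which the sum factors into \<open>n\<close>
  geometric sums.\<close>

lemma sum_power_multi_deg_le:
  fixes t :: real
  assumes "0 \<le> t" "t < 1" "finite F" "F \<subseteq> multi_indices n"
  shows "(\<Sum>\<delta>\<in>F. t ^ multi_deg n \<delta>) \<le> (1 / (1 - t)) ^ n"
proof -
  define D where "D = Max (insert 0 (multi_deg n ` F))"
  have D: "\<delta> i \<le> D" if "\<delta> \<in> F" "i < n" for \<delta> i
    using le_multi_deg[OF that(2), of \<delta>] that(1) assms(3) by (auto simp: D_def intro: order_trans)
  have inj: "inj_on (\<lambda>\<delta>. restrict \<delta> {..<n}) F"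
  proof (rule inj_onI, rule ext)
    fix \<delta> \<delta>' i assume *: "\<delta> \<in> F" "\<delta>' \<in> F" "restrict \<delta> {..<n} = restrict \<delta>' {..<n}"
    show "\<delta> i = \<delta>' i"
    proof (cases "i < n")
      case True
      then show ?thesis using fun_cong[OF *(3), of i] by simp
    next
      case False
      then show ?thesis using * assms(4) unfolding multi_indices_def by (metis (mono_tags, lifting) mem_Collect_eq not_le subsetD)
    qed
  qed
  have "(\<Sum>\<delta>\<in>F. t ^ multi_deg n \<delta>) = (\<Sum>\<delta>\<in>F. \<Prod>i<n. t ^ restrict \<delta> {..<n} i)"
    by (simp add: multi_deg_def power_sum)
  also have "\<dots> = (\<Sum>g\<in>(\<lambda>\<delta>. restrict \<delta> {..<n}) ` F. \<Prod>i<n. t ^ g i)"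
    by (subst sum.reindex[OF inj]) simp
  also have "\<dots> \<le> (\<Sum>g\<in>PiE {..<n} (\<lambda>_. {..D}). \<Prod>i<n. t ^ g i)"
    using D assms(1) by (intro sum_mono2 finite_PiE prod_nonneg) (auto split: if_splits)
  also have "\<dots> = (\<Prod>i<n. \<Sum>m\<le>D. t ^ m)"
    by (rule prod_sum_PiE[symmetric]) auto
  also have "\<dots> = (\<Sum>m\<le>D. t ^ m) ^ n" by simp
  also have "\<dots> \<le> (1 / (1 - t)) ^ n"
  proof (rule power_mono)
    have "(\<Sum>m\<le>D. t ^ m) = (1 - t ^ Suc D) / (1 - t)"
      using assms(2) by (simp add: sum_gp0 del: power_Suc)
    also have "\<dots> \<le> 1 / (1 - t)" using assms by (intro divide_right_mono) auto
    finally show "(\<Sum>m\<le>D. t ^ m) \<le> 1 / (1 - t)" .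
  qed (use assms in \<open>auto intro: sum_nonneg\<close>)
  finally show ?thesis .
qed

text \<open>From each nonzero \<delta> one factor q is set aside and the rest is compared with
  powers of 1/2. The bound tends to 0 with q, uniformly in \<gamma>.\<close>

lemma sum_power_multi_deg_nonzero_le:
  fixes q :: real
  assumes "0 \<le> q" "q \<le> 1/2" "\<gamma> \<in> multi_indices n"
  shows "(\<Sum>\<delta>\<in>{\<delta>. \<delta> \<le> \<gamma>} - {\<lambda>_. 0}. q ^ multi_deg n \<delta>) \<le> 2 * q * 2 ^ n"
proof -
  let ?F = "{\<delta>. \<delta> \<le> \<gamma>} - {\<lambda>_. 0}"
  have F: "finite ?F" "?F \<subseteq> multi_indices n"
    using assms(3) finite_le_multi_index multi_indices_le by auto
  have "(\<Sum>\<delta>\<in>?F. q ^ multi_deg n \<delta>) \<le> (\<Sum>\<delta>\<in>?F. 2 * q * (1/2) ^ multi_deg n \<delta>)"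
  proof (rule sum_mono)
    fix \<delta> assume \<delta>: "\<delta> \<in> ?F"
    then have "multi_deg n \<delta> \<noteq> 0" using F multi_deg_eq_0_iff by blast
    then obtain m where m: "multi_deg n \<delta> = Suc m" using not0_implies_Suc by blast
    have "q ^ m \<le> (1/2) ^ m" using assms by (intro power_mono) auto
    then have "q * q ^ m \<le> q * (1/2) ^ m" using assms(1) by (rule mult_left_mono)
    then show "q ^ multi_deg n \<delta> \<le> 2 * q * (1/2) ^ multi_deg n \<delta>" by (simp add: m)
  qed
  also have "\<dots> = 2 * q * (\<Sum>\<delta>\<in>?F. (1/2) ^ multi_deg n \<delta>)" by (rule sum_distrib_left[symmetric])
  also have "\<dots> \<le> 2 * q * 2 ^ n"
    using sum_power_multi_deg_le[of "1/2" ?F n] F assms(1) by (intro mult_left_mono) auto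
  finally show ?thesis .
qed

text \<open>An l1 norm, so that the sum over components and the sum over coefficients in
  \<open>nagumo\<close> can be interchanged.\<close>

abbreviation l1norm :: "complex ^ 'm::finite \<Rightarrow> real" where
  "l1norm v \<equiv> \<Sum>j\<in>UNIV. norm (v $ j)"

text \<open>The constant is the sum of the moduli of the entries of a left inverse; the added 1
  keeps it positive.\<close>

lemma matrix_inverse_bound:
  fixes S :: "complex ^ 'm::finite ^ 'm"
  assumes "det S \<noteq> 0"
  shows "\<exists>C>0. \<forall>v. l1norm v \<le> C * l1norm (S *v v)"
proof -
  obtain T where T: "T ** S = mat 1"
    using assms invertible_det_nz[of S] invertible_def by blast
  define C where "C = 1 + (\<Sum>j\<in>UNIV. \<Sum>i\<in>UNIV. norm (T $ j $ i))"
  have C: "0 < C" unfolding C_def by (intro add_pos_nonneg sum_nonneg) auto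
  have "l1norm v \<le> C * l1norm (S *v v)" for v
  proof -
    define w where "w = S *v v"
    have "v = T *v w" by (simp add: w_def matrix_vector_mul_assoc T)
    then have vj: "v $ j = (\<Sum>i\<in>UNIV. T $ j $ i * w $ i)" for j
      by (simp add: matrix_vector_mult_def)
    have "l1norm v \<le> (\<Sum>j\<in>UNIV. \<Sum>i\<in>UNIV. norm (T $ j $ i) * l1norm w)"
    proof (rule sum_mono)
      fix j
      have "norm (v $ j) \<le> (\<Sum>i\<in>UNIV. norm (T $ j $ i) * norm (w $ i))"
        unfolding vj by (rule order_trans[OF norm_sum]) (simp add: norm_mult)
      also have "\<dots> \<le> (\<Sum>i\<in>UNIV. norm (T $ j $ i) * l1norm w)"
        by (intro sum_mono mult_left_mono member_le_sum) auto
      finally show "norm (v $ j) \<le> (\<Sum>i\<in>UNIV. norm (T $ j $ i) * l1norm w)" .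
    qed
    also have "\<dots> = (C - 1) * l1norm w" by (simp add: C_def sum_distrib_right)
    also have "\<dots> \<le> C * l1norm w" by (intro mult_right_mono sum_nonneg) auto
    finally show ?thesis unfolding w_def .
  qed
  then show ?thesis using C by blast
qed

text \<open>The simplex is a closed part of a product of intervals and points, which is compact in
  the product topology.\<close>

lemma compact_simplex: "compact {\<xi> :: nat \<Rightarrow> real. (\<forall>i\<ge>n. \<xi> i = 0) \<and> (\<forall>i<n. 0 \<le> \<xi> i) \<and> (\<Sum>i<n. \<xi> i) = 1}" (is "compact ?X")
proof -
  let ?K = "PiE UNIV (\<lambda>i. if i < n then {0..1} else {0}) :: (nat \<Rightarrow> real) set"
  have "compactin (product_topology (\<lambda>_. euclidean) UNIV) ?K"
    unfolding compactin_PiE by auto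
  then have K: "compact ?K"
    by (simp add: euclidean_product_topology)
  have "closed {\<xi> :: nat \<Rightarrow> real. (\<Sum>i<n. \<xi> i) = 1}"
    by (intro closed_Collect_eq continuous_intros continuous_on_product_coordinates)
  then have "compact (?K \<inter> {\<xi>. (\<Sum>i<n. \<xi> i) = 1})" using K by (rule compact_Int_closed[rotated])
  moreover have "?X = ?K \<inter> {\<xi>. (\<Sum>i<n. \<xi> i) = 1}"
  proof (intro set_eqI iffI)
    fix \<xi> assume \<xi>: "\<xi> \<in> ?X"
    have "\<xi> i \<le> 1" if "i < n" for i
    proof -
      have "\<xi> i \<le> (\<Sum>i<n. \<xi> i)" using \<xi> that by (intro member_le_sum) auto
      then show ?thesis using \<xi> by simp
    qed
    then show "\<xi> \<in> ?K \<inter> {\<xi>. (\<Sum>i<n. \<xi> i) = 1}" using \<xi> by (auto simp: PiE_iff)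
  next
    fix \<xi> :: "nat \<Rightarrow> real" assume \<xi>: "\<xi> \<in> ?K \<inter> {\<xi>. (\<Sum>i<n. \<xi> i) = 1}"
    have "\<xi> i \<in> (if i < n then {0..1} else {0})" for i using \<xi> PiE_mem[of \<xi> UNIV _ i] by blast
    then have "\<xi> i = 0" if "n \<le> i" for i using that by (metis not_le singletonD)
    moreover have "0 \<le> \<xi> i" if "i < n" for i using \<open>\<And>i. \<xi> i \<in> _\<close>[of i] that by simp
    ultimately show "\<xi> \<in> ?X" using \<xi> by simp
  qed
  ultimately show ?thesis by simp
qed

lemma compact_l1_sphere: "compact {v :: complex ^ 'm::finite. l1norm v = 1}"
proof -
  have "closed {v :: complex ^ 'm. l1norm v = 1}"
    by (intro closed_Collect_eq continuous_intros)
  moreover have "bounded {v :: complex ^ 'm. l1norm v = 1}"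
  proof (rule boundedI)
    fix v :: "complex ^ 'm" assume "v \<in> {v. l1norm v = 1}"
    then show "norm v \<le> 1" unfolding norm_vec_def using L2_set_le_sum[of UNIV "\<lambda>j. norm (v $ j)"] by simp
  qed
  ultimately show ?thesis by (simp add: compact_eq_bounded_closed)
qed

text \<open>The symbol at \<open>a + \<gamma>\<close> is \<open>\<bar>\<gamma>\<bar>\<^sup>r\<close> times the homogenised symbol at \<open>(\<gamma>/\<bar>\<gamma>\<bar>, 1/\<bar>\<gamma>\<bar>)\<close>, whose value at
  \<open>(\<xi>, 0)\<close> is the principal symbol; compactness of the simplex gives a uniform lower bound.\<close>
lemma elliptic_bound:
  fixes M :: "(nat \<Rightarrow> nat) \<Rightarrow> complex ^ 'm::finite ^ 'm" and a :: "nat \<Rightarrow> complex"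
  assumes fin: "finite I" and M: "\<And>\<alpha>. \<alpha> \<in> I \<Longrightarrow> multi_deg n \<alpha> > r \<Longrightarrow> M \<alpha> = 0"
    and bar: "\<And>\<xi>. (\<forall>i\<ge>n. \<xi> i = 0) \<Longrightarrow> (\<forall>i<n. 0 \<le> \<xi> i) \<Longrightarrow> \<xi> \<noteq> (\<lambda>_. 0) \<Longrightarrow>
       det (\<chi> i j. \<Sum>\<alpha> | \<alpha> \<in> I \<and> multi_deg n \<alpha> = r. M \<alpha> $ i $ j * multi_pow n (\<lambda>i. of_real (\<xi> i :: real)) \<alpha>) \<noteq> 0"
  shows "\<exists>C>0. \<exists>g0. \<forall>\<gamma>\<in>multi_indices n. \<forall>v. g0 \<le> multi_deg n \<gamma> \<longrightarrow>
      (1 + real (multi_deg n \<gamma>)) ^ r * l1norm v \<le> C * l1norm ((\<chi> i j. \<Sum>\<alpha>\<in>I. M \<alpha> $ i $ j * multi_pow n (\<lambda>i. a i + of_nat (\<gamma> i)) \<alpha>) *v v)"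
proof -
  define X where "X = {\<xi> :: nat \<Rightarrow> real. (\<forall>i\<ge>n. \<xi> i = 0) \<and> (\<forall>i<n. 0 \<le> \<xi> i) \<and> (\<Sum>i<n. \<xi> i) = 1}"
  define Y where "Y = {v :: complex ^ 'm. l1norm v = 1}"
  let ?J = "{\<alpha>\<in>I. multi_deg n \<alpha> \<le> r}"
  define G where "G = (\<lambda>\<xi> h. (\<chi> i j. \<Sum>\<alpha>\<in>?J. M \<alpha> $ i $ j * (multi_pow n (\<lambda>i. of_real h * a i + of_real (\<xi> i)) \<alpha> * of_real h ^ (r - multi_deg n \<alpha>))) :: complex ^ 'm ^ 'm)"
  define f where "f = (\<lambda>(\<xi> :: nat \<Rightarrow> real, h :: real, v :: complex ^ 'm). l1norm (G \<xi> h *v v))"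
  have cont: "continuous_on S f" for S
    unfolding f_def G_def case_prod_beta' matrix_vector_mult_def multi_pow_def vec_lambda_beta
    by (intro continuous_intros continuous_on_product_then_coordinatewise[of S fst])
  have G0: "G \<xi> 0 *v v \<noteq> 0" if \<xi>: "\<xi> \<in> X" and v: "v \<in> Y" for \<xi> v
  proof -
    have "G \<xi> 0 = (\<chi> i j. \<Sum>\<alpha> | \<alpha> \<in> I \<and> multi_deg n \<alpha> = r. M \<alpha> $ i $ j * multi_pow n (\<lambda>i. of_real (\<xi> i)) \<alpha>)"
    proof -
      have "(\<Sum>\<alpha>\<in>?J. M \<alpha> $ i $ j * (multi_pow n (\<lambda>i. of_real 0 * a i + of_real (\<xi> i)) \<alpha> * of_real 0 ^ (r - multi_deg n \<alpha>)))
        = (\<Sum>\<alpha> | \<alpha> \<in> I \<and> multi_deg n \<alpha> = r. M \<alpha> $ i $ j * multi_pow n (\<lambda>i. of_real (\<xi> i)) \<alpha>)" for i j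
        by (rule sum.mono_neutral_cong_right) (use fin in auto)
      then show ?thesis unfolding G_def by simp
    qed
    moreover have "\<xi> \<noteq> (\<lambda>_. 0)" using \<xi> by (auto simp: X_def)
    ultimately have "det (G \<xi> 0) \<noteq> 0" using bar[of \<xi>] \<xi> by (simp add: X_def)
    from matrix_inverse_bound[OF this] obtain C where C: "\<forall>v. l1norm v \<le> C * l1norm (G \<xi> 0 *v v)" by (elim exE conjE)
    have "1 \<le> C * l1norm (G \<xi> 0 *v v)" using v C[rule_format, of v] unfolding Y_def by simp
    then show ?thesis by auto
  qed
  have f_pos: "0 < f (\<xi>, h, v) \<longleftrightarrow> G \<xi> h *v v \<noteq> 0" for \<xi> h v
  proof -
    have "f (\<xi>, h, v) = 0 \<longleftrightarrow> G \<xi> h *v v = 0"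
      unfolding f_def by (auto simp: sum_nonneg_eq_0_iff vec_eq_iff)
    moreover have "0 \<le> f (\<xi>, h, v)" unfolding f_def by (auto intro: sum_nonneg)
    ultimately show ?thesis by linarith
  qed
  have compX: "compact X" "compact Y" unfolding X_def Y_def by (rule compact_simplex compact_l1_sphere)+
  \<comment> \<open>The zeros of \<open>f\<close> with h in [0, 1]. Their h-values form a compact
    set that misses 0, so a whole interval of h starting at 0 is free of zeros.\<close>
  define Z where "Z = (X \<times> {0..1::real} \<times> Y) \<inter> {p. f p = 0}"
  have "closed {p. f p = 0}" by (intro closed_Collect_eq cont continuous_intros)
  then have "compact Z" unfolding Z_def using compX by (intro compact_Int_closed compact_Times) auto
  then have "compact ((\<lambda>p. fst (snd p)) ` Z)" by (intro compact_continuous_image continuous_intros)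
  then have "closed ((\<lambda>p. fst (snd p)) ` Z)" by (rule compact_imp_closed)
  moreover have "0 \<notin> (\<lambda>p. fst (snd p)) ` Z"
  proof
    assume "0 \<in> (\<lambda>p. fst (snd p)) ` Z"
    then obtain \<xi> v where "\<xi> \<in> X" "v \<in> Y" "f (\<xi>, 0, v) = 0" unfolding Z_def by force
    then show False using G0[of \<xi> v] f_pos[of \<xi> 0 v] by simp
  qed
  ultimately have "\<exists>e>0. ball 0 e \<subseteq> - (\<lambda>p. fst (snd p)) ` Z"
    by (intro open_contains_ball[THEN iffD1, rule_format] open_Compl) auto
  then obtain e where e: "0 < e" "ball 0 e \<subseteq> - (\<lambda>p. fst (snd p)) ` Z" by (elim exE conjE)
  define h0 where "h0 = min 1 (e / 2)"
  have h0: "0 < h0" "h0 \<le> 1" "h0 < e" using e by (auto simp: h0_def)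
  have pos: "0 < f (\<xi>, h, v)" if "\<xi> \<in> X" "h \<in> {0..h0}" "v \<in> Y" for \<xi> h v
  proof -
    have "h \<notin> (\<lambda>p. fst (snd p)) ` Z" 
    proof -
      have "h \<in> ball 0 e" using that h0 by auto
      then show ?thesis using e(2) by blast
    qed
    then have "f (\<xi>, h, v) \<noteq> 0" using that h0 unfolding Z_def by force
    moreover have "0 \<le> f (\<xi>, h, v)" unfolding f_def by (auto intro: sum_nonneg)
    ultimately show ?thesis by linarith
  qed
  obtain c where c: "0 < c" "\<And>\<xi> h v. \<xi> \<in> X \<Longrightarrow> h \<in> {0..h0} \<Longrightarrow> v \<in> Y \<Longrightarrow> c \<le> f (\<xi>, h, v)"
  proof (cases "X \<times> {0..h0} \<times> Y = {}")
    \<comment> \<open>This is the case \<open>n = 0\<close>, where no \<xi> has coordinate sum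
      1.\<close>
    case True
    show ?thesis
    proof (rule that[of 1])
      fix \<xi> h v assume "\<xi> \<in> X" "h \<in> {0..h0}" "v \<in> Y"
      then have "(\<xi>, h, v) \<in> X \<times> {0..h0} \<times> Y" by simp
      then show "1 \<le> f (\<xi>, h, v)" unfolding True by simp
    qed simp
  next
    case False
    have "compact (X \<times> {0..h0} \<times> Y)" by (intro compact_Times compX compact_Icc)
    from continuous_attains_inf[OF this False cont]
    obtain p where p: "p \<in> X \<times> {0..h0} \<times> Y" "\<forall>p'\<in>X \<times> {0..h0} \<times> Y. f p \<le> f p'" by (elim bexE)
    show ?thesis
    proof (rule that[of "f p"])
      show "0 < f p" using pos[of "fst p" "fst (snd p)" "snd (snd p)"] p(1) by auto
      show "f p \<le> f (\<xi>, h, v)" if "\<xi> \<in> X" "h \<in> {0..h0}" "v \<in> Y" for \<xi> h v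
        using bspec[OF p(2), of "(\<xi>, h, v)"] that by simp
    qed
  qed
  \<comment> \<open>From this degree on, h = 1 / |\<gamma>| is at most \<open>h0\<close>.\<close>
  define g0 where "g0 = nat \<lceil>1 / h0\<rceil>"
  have g0: "1 / h0 \<le> real g" if "g0 \<le> g" for g using that by (simp add: g0_def nat_ceiling_le_eq le_nat_iff ceiling_le_iff)
  show ?thesis
  proof (intro exI[of _ "2 ^ r / c"] exI[of _ g0] conjI ballI allI impI)
    show "0 < 2 ^ r / c" using c by simp
    fix \<gamma> v assume \<gamma>: "\<gamma> \<in> multi_indices n" "g0 \<le> multi_deg n \<gamma>"
    define g where "g = real (multi_deg n \<gamma>)"
    have g: "1 / h0 \<le> g" using g0[OF \<gamma>(2)] by (simp add: g_def)
    have "1 \<le> 1 / h0" using h0 by simp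
    then have g1: "1 \<le> g" using g by linarith
    let ?S = "(\<chi> i j. \<Sum>\<alpha>\<in>I. M \<alpha> $ i $ j * multi_pow n (\<lambda>i. a i + of_nat (\<gamma> i)) \<alpha>) :: complex ^ 'm ^ 'm"
    define \<xi> where "\<xi> = (\<lambda>i. real (\<gamma> i) / g)"
    have \<xi>: "\<xi> \<in> X"
    proof -
      have "(\<Sum>i<n. \<xi> i) = 1" using g1 by (simp add: \<xi>_def sum_divide_distrib[symmetric] g_def multi_deg_def)
      then show ?thesis using \<gamma>(1) g1 by (auto simp: X_def \<xi>_def multi_indices_def)
    qed
    have entry: "?S $ i $ j = of_real (g ^ r) * G \<xi> (1 / g) $ i $ j" for i j
    proof -
      have "?S $ i $ j = (\<Sum>\<alpha>\<in>?J. M \<alpha> $ i $ j * multi_pow n (\<lambda>i. a i + of_nat (\<gamma> i)) \<alpha>)"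
        unfolding vec_lambda_beta by (rule sum.mono_neutral_right) (use fin M in \<open>auto simp: not_le\<close>)
      also have "\<dots> = (\<Sum>\<alpha>\<in>?J. of_real (g ^ r) * (M \<alpha> $ i $ j * (multi_pow n (\<lambda>i. of_real (1 / g) * a i + of_real (\<xi> i)) \<alpha> * of_real (1 / g) ^ (r - multi_deg n \<alpha>))))"
      proof (rule sum.cong)
        fix \<alpha> assume "\<alpha> \<in> ?J"
        then have \<alpha>: "multi_deg n \<alpha> \<le> r" by simp
        have "multi_pow n (\<lambda>i. of_real (1 / g) * a i + of_real (\<xi> i)) \<alpha> = multi_pow n (\<lambda>i. of_real (1 / g) * (a i + of_nat (\<gamma> i))) \<alpha>"
          by (simp add: \<xi>_def distrib_left)
        also have "\<dots> = of_real (1 / g) ^ multi_deg n \<alpha> * multi_pow n (\<lambda>i. a i + of_nat (\<gamma> i)) \<alpha>"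
          by (simp only: multi_pow_def power_mult_distrib prod.distrib multi_deg_def power_sum)
        finally have "multi_pow n (\<lambda>i. of_real (1 / g) * a i + of_real (\<xi> i)) \<alpha> * of_real (1 / g) ^ (r - multi_deg n \<alpha>)
           = multi_pow n (\<lambda>i. a i + of_nat (\<gamma> i)) \<alpha> * (of_real (1 / g) ^ multi_deg n \<alpha> * of_real (1 / g) ^ (r - multi_deg n \<alpha>))"
          by (simp only: mult_ac)
        also have "of_real (1 / g) ^ multi_deg n \<alpha> * of_real (1 / g) ^ (r - multi_deg n \<alpha>) = (of_real (1 / g) ^ r :: complex)"
          using \<alpha> by (simp flip: power_add)
        finally show "M \<alpha> $ i $ j * multi_pow n (\<lambda>i. a i + of_nat (\<gamma> i)) \<alpha> = of_real (g ^ r) * (M \<alpha> $ i $ j * (multi_pow n (\<lambda>i. of_real (1 / g) * a i + of_real (\<xi> i)) \<alpha> * of_real (1 / g) ^ (r - multi_deg n \<alpha>)))"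
          using g1 by (simp add: power_divide)
      qed simp
      finally show ?thesis by (simp add: G_def sum_distrib_left)
    qed
    have Sv: "l1norm (?S *v v) = g ^ r * f (\<xi>, 1 / g, v)"
    proof -
      have "(?S *v v) $ i = of_real (g ^ r) * (G \<xi> (1 / g) *v v) $ i" for i
        by (simp only: matrix_vector_mult_def vec_lambda_beta[of _ i] entry sum_distrib_left mult.assoc)
      then show ?thesis using g1 unfolding f_def by (simp add: norm_mult norm_power sum_distrib_left)
    qed
    have hg: "1 / g \<in> {0..h0}" using g g1 h0 by (simp add: field_simps)
    have fv: "c * l1norm v \<le> f (\<xi>, 1 / g, v)"
    proof (cases "v = 0")
      case True
      then show ?thesis by (simp add: f_def)
    next
      case False
      define q where "q = l1norm v"
      have "q \<noteq> 0" unfolding q_def using False by (auto simp: sum_nonneg_eq_0_iff vec_eq_iff)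
      moreover have "0 \<le> q" unfolding q_def by (intro sum_nonneg) auto
      ultimately have q: "0 < q" by simp
      define w where "w = (\<chi> j. v $ j / of_real q)"
      have "l1norm w = 1" using q by (simp add: w_def norm_divide sum_divide_distrib[symmetric]) (simp add: q_def)
      then have "c \<le> f (\<xi>, 1 / g, w)" using c(2)[OF \<xi> hg] by (simp add: Y_def)
      moreover have "f (\<xi>, 1 / g, v) = q * f (\<xi>, 1 / g, w)"
      proof -
        have "(G \<xi> (1 / g) *v v) $ i = of_real q * (G \<xi> (1 / g) *v w) $ i" for i
          using q by (simp add: matrix_vector_mult_def w_def sum_distrib_left)
        then show ?thesis using q unfolding f_def by (simp add: norm_mult sum_distrib_left)
      qed
      ultimately show ?thesis using q by (simp add: q_def mult.commute)
    qed
    \<comment> \<open>Origin of the factor 2^r in the constant: 1 + g \<le> 2 g for g \<ge>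
      1.\<close>
    have "(1 + g) ^ r \<le> (2 * g) ^ r" using g1 by (intro power_mono) auto
    then have "(1 + g) ^ r * l1norm v \<le> (2 * g) ^ r * l1norm v" by (intro mult_right_mono sum_nonneg) auto
    also have "\<dots> = 2 ^ r / c * (g ^ r * (c * l1norm v))" using c(1) by (simp add: power_mult_distrib)
    also have "\<dots> \<le> 2 ^ r / c * (g ^ r * f (\<xi>, 1 / g, v))" using c(1) g1 fv by (intro mult_left_mono) auto
    finally show "(1 + real (multi_deg n \<gamma>)) ^ r * l1norm v \<le> 2 ^ r / c * l1norm (?S *v v)"
      unfolding Sv by (simp add: g_def)
  qed
qed

text \<open>Only finitely many indices lie below the threshold of \<open>elliptic_bound\<close>.
  Each of them outside \<open>S\<close> has an invertible symbol and contributes a constant of its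
  own; the sum of all constants serves every index.\<close>

lemma elliptic_bound_off_finite:
  fixes M :: "(nat \<Rightarrow> nat) \<Rightarrow> complex ^ 'm::finite ^ 'm" and a :: "nat \<Rightarrow> complex"
  assumes fin: "finite I" and M: "\<And>\<alpha>. \<alpha> \<in> I \<Longrightarrow> multi_deg n \<alpha> > r \<Longrightarrow> M \<alpha> = 0"
    and bar: "\<And>\<xi>. (\<forall>i\<ge>n. \<xi> i = 0) \<Longrightarrow> (\<forall>i<n. 0 \<le> \<xi> i) \<Longrightarrow> \<xi> \<noteq> (\<lambda>_. 0) \<Longrightarrow>
       det (\<chi> i j. \<Sum>\<alpha> | \<alpha> \<in> I \<and> multi_deg n \<alpha> = r. M \<alpha> $ i $ j * multi_pow n (\<lambda>i. of_real (\<xi> i :: real)) \<alpha>) \<noteq> 0"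
    and S: "\<And>\<gamma>. \<gamma> \<in> multi_indices n - S \<Longrightarrow> det (\<chi> i j. \<Sum>\<alpha>\<in>I. M \<alpha> $ i $ j * multi_pow n (\<lambda>i. a i + of_nat (\<gamma> i)) \<alpha>) \<noteq> 0"
  shows "\<exists>C>0. \<forall>\<gamma>\<in>multi_indices n - S. \<forall>v.
      (1 + real (multi_deg n \<gamma>)) ^ r * l1norm v \<le> C * l1norm ((\<chi> i j. \<Sum>\<alpha>\<in>I. M \<alpha> $ i $ j * multi_pow n (\<lambda>i. a i + of_nat (\<gamma> i)) \<alpha>) *v v)"
proof -
  let ?S = "\<lambda>\<gamma>. (\<chi> i j. \<Sum>\<alpha>\<in>I. M \<alpha> $ i $ j * multi_pow n (\<lambda>i. a i + of_nat (\<gamma> i)) \<alpha>) :: complex ^ 'm ^ 'm"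
  have "\<exists>C>0. \<exists>g0. \<forall>\<gamma>\<in>multi_indices n. \<forall>v. g0 \<le> multi_deg n \<gamma> \<longrightarrow>
      (1 + real (multi_deg n \<gamma>)) ^ r * l1norm v \<le> C * l1norm (?S \<gamma> *v v)"
    by (rule elliptic_bound[OF fin M bar])
  then obtain C g0 where C: "0 < C" "\<forall>\<gamma>\<in>multi_indices n. \<forall>v. g0 \<le> multi_deg n \<gamma> \<longrightarrow>
      (1 + real (multi_deg n \<gamma>)) ^ r * l1norm v \<le> C * l1norm (?S \<gamma> *v v)" by (elim exE conjE)
  let ?F = "{\<gamma> \<in> multi_indices n - S. multi_deg n \<gamma> \<le> g0}"
  have finF: "finite ?F" by (rule finite_subset[OF _ finite_multi_deg_le[of n g0]]) auto
  have "\<forall>\<gamma>\<in>?F. \<exists>c>0. \<forall>v. l1norm v \<le> c * l1norm (?S \<gamma> *v v)"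
    by (intro ballI matrix_inverse_bound S) auto
  from bchoice[OF this] obtain c where c': "\<forall>\<gamma>\<in>?F. 0 < c \<gamma> \<and> (\<forall>v. l1norm v \<le> c \<gamma> * l1norm (?S \<gamma> *v v))" ..
  have c: "0 < c \<gamma>" "l1norm v \<le> c \<gamma> * l1norm (?S \<gamma> *v v)" if "\<gamma> \<in> ?F" for \<gamma> v
    using bspec[OF c' that] by auto
  define C' where "C' = C + (\<Sum>\<gamma>\<in>?F. (1 + real (multi_deg n \<gamma>)) ^ r * c \<gamma>)"
  have nonneg: "0 \<le> (1 + real (multi_deg n \<gamma>)) ^ r * c \<gamma>" if "\<gamma> \<in> ?F" for \<gamma>
    using c(1)[OF that] by (intro mult_nonneg_nonneg) auto
  have sum_nn: "0 \<le> (\<Sum>\<gamma>\<in>?F. (1 + real (multi_deg n \<gamma>)) ^ r * c \<gamma>)" by (rule sum_nonneg) (rule nonneg)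
  show ?thesis
  proof (intro exI[of _ C'] conjI ballI allI)
    show "0 < C'" unfolding C'_def using C(1) sum_nn by linarith
    fix \<gamma> and v :: "complex ^ 'm" assume \<gamma>: "\<gamma> \<in> multi_indices n - S"
    have nn: "0 \<le> l1norm (?S \<gamma> *v v)" by (intro sum_nonneg) auto
    show "(1 + real (multi_deg n \<gamma>)) ^ r * l1norm v \<le> C' * l1norm (?S \<gamma> *v v)"
    proof (cases "g0 \<le> multi_deg n \<gamma>")
      case True
      then have "(1 + real (multi_deg n \<gamma>)) ^ r * l1norm v \<le> C * l1norm (?S \<gamma> *v v)" using C(2) \<gamma> by simp
      also have "\<dots> \<le> C' * l1norm (?S \<gamma> *v v)" using nn sum_nn by (intro mult_right_mono) (auto simp: C'_def)
      finally show ?thesis .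
    next
      case False
      then have \<gamma>F: "\<gamma> \<in> ?F" using \<gamma> by auto
      have "(1 + real (multi_deg n \<gamma>)) ^ r * l1norm v \<le> (1 + real (multi_deg n \<gamma>)) ^ r * (c \<gamma> * l1norm (?S \<gamma> *v v))"
        using c(2)[OF \<gamma>F] by (intro mult_left_mono) auto
      also have "\<dots> \<le> C' * l1norm (?S \<gamma> *v v)"
        using nn C(1) member_le_sum[of \<gamma> ?F "\<lambda>\<gamma>. (1 + real (multi_deg n \<gamma>)) ^ r * c \<gamma>"] \<gamma>F nonneg finF
        unfolding mult.assoc[symmetric] by (intro mult_right_mono) (auto simp: C'_def)
      finally show ?thesis .
    qed
  qed
qed

section \<open>Convergence of formal solutions\<close>

lemma nagumo_mono_s: "0 \<le> s \<Longrightarrow> s \<le> s' \<Longrightarrow> nagumo d s p D u \<le> nagumo d s' p D u"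
  unfolding nagumo_def by (intro sum_mono divide_right_mono mult_left_mono power_mono) auto

lemma norm_const_le_nagumo:
  assumes "0 \<le> s"
  shows "norm (c (\<lambda>_. 0)) \<le> nagumo d s p D c"
proof -
  let ?f = "\<lambda>\<alpha>. norm (c \<alpha>) * s ^ multi_deg d \<alpha> / real ((p + multi_deg d \<alpha>) choose multi_deg d \<alpha>)"
  have "?f (\<lambda>_. 0) \<le> nagumo d s p D c"
    unfolding nagumo_def by (rule member_le_sum) (use assms in auto)
  then show ?thesis by simp
qed

text \<open>The levels passed between p and p + |\<beta>| are at most q, so each derivative is
  charged the same factor q / s; the truncation grows by one each time.\<close>

lemma nagumo_mderiv:
  assumes "0 < s" "k \<le> d" "p + multi_deg k \<beta> \<le> q"
  shows "nagumo d s (p + multi_deg k \<beta>) D (ps_mderiv 0 k \<beta> u) \<le> (real q / s) ^ multi_deg k \<beta> * nagumo d s p (D + multi_deg k \<beta>) u"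
proof -
  have pow: "nagumo d s (p' + a) D' ((ps_deriv i ^^ a) w) \<le> (real q / s) ^ a * nagumo d s p' (D' + a) w"
    if "i < d" "p' + a \<le> q" for i a p' D' w
    using that
  proof (induction a arbitrary: D')
    case (Suc a)
    have "nagumo d s (p' + Suc a) D' ((ps_deriv i ^^ Suc a) w) \<le> real (Suc (p' + a)) / s * nagumo d s (p' + a) (Suc D') ((ps_deriv i ^^ a) w)"
      using nagumo_deriv[OF assms(1) Suc.prems(1), of "p' + a" D' "(ps_deriv i ^^ a) w"] by simp
    also have "\<dots> \<le> real q / s * ((real q / s) ^ a * nagumo d s p' (Suc D' + a) w)"
      using Suc.prems Suc.IH[of "Suc D'"] assms(1)
      by (intro mult_mono divide_right_mono) (auto intro!: nagumo_nonneg mult_nonneg_nonneg)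
    finally show ?case by (simp add: mult.assoc)
  qed simp
  have "nagumo d s (p + multi_deg m \<beta>) D (ps_mderiv 0 m \<beta> u) \<le> (real q / s) ^ multi_deg m \<beta> * nagumo d s p (D + multi_deg m \<beta>) u"
    if "m \<le> k" for m D
    using that
  proof (induction m arbitrary: D)
    case 0
    then show ?case by (simp add: multi_deg_def ps_mderiv_def)
  next
    case (Suc m)
    have deg: "multi_deg (Suc m) \<beta> = multi_deg m \<beta> + \<beta> m" by (simp add: multi_deg_def)
    have "multi_deg (Suc m) \<beta> \<le> multi_deg k \<beta>" unfolding multi_deg_def by (rule sum_mono2) (use Suc.prems in auto)
    then have "(p + multi_deg m \<beta>) + \<beta> m \<le> q" using assms(3) deg by simp
    then have "nagumo d s (p + multi_deg (Suc m) \<beta>) D (ps_mderiv 0 (Suc m) \<beta> u)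
       \<le> (real q / s) ^ \<beta> m * nagumo d s (p + multi_deg m \<beta>) (D + \<beta> m) (ps_mderiv 0 m \<beta> u)"
      using pow[of m "p + multi_deg m \<beta>" "\<beta> m" D "ps_mderiv 0 m \<beta> u"] Suc.prems assms(2)
      by (simp add: deg ps_mderiv_def add.assoc)
    also have "\<dots> \<le> (real q / s) ^ \<beta> m * ((real q / s) ^ multi_deg m \<beta> * nagumo d s p (D + \<beta> m + multi_deg m \<beta>) u)"
      using Suc.IH[of "D + \<beta> m"] Suc.prems assms(1) by (intro mult_left_mono) auto
    finally show ?case by (simp add: deg power_add mult_ac add_ac)
  qed
  then show ?thesis by simp
qed

lemma sum_nagumo:
  "(\<Sum>j\<in>J. nagumo d s p D (u j)) = (\<Sum>b | b \<in> multi_indices d \<and> multi_deg d b \<le> D.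
     s ^ multi_deg d b / real ((p + multi_deg d b) choose multi_deg d b) * (\<Sum>j\<in>J. norm (u j b)))"
  unfolding nagumo_def sum_distrib_left by (subst sum.swap) (simp add: mult_ac)

lemma nagumo_system:
  assumes "\<And>b. b \<in> multi_indices d \<Longrightarrow> \<kappa> * (\<Sum>j\<in>J. norm (u j b)) \<le> C * (\<Sum>i\<in>I. norm (w i b))" "0 \<le> s"
  shows "\<kappa> * (\<Sum>j\<in>J. nagumo d s p D (u j)) \<le> C * (\<Sum>i\<in>I. nagumo d s p D (w i))"
proof -
  let ?B = "{b. b \<in> multi_indices d \<and> multi_deg d b \<le> D}" and ?w = "\<lambda>b. s ^ multi_deg d b / real ((p + multi_deg d b) choose multi_deg d b)"
  have "\<kappa> * (\<Sum>b\<in>?B. ?w b * (\<Sum>j\<in>J. norm (u j b))) = (\<Sum>b\<in>?B. ?w b * (\<kappa> * (\<Sum>j\<in>J. norm (u j b))))"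
    unfolding sum_distrib_left[of \<kappa> _ ?B] by (simp only: mult.left_commute)
  also have "\<dots> \<le> (\<Sum>b\<in>?B. ?w b * (C * (\<Sum>i\<in>I. norm (w i b))))"
    using assms by (intro sum_mono mult_left_mono) auto
  also have "\<dots> = C * (\<Sum>b\<in>?B. ?w b * (\<Sum>i\<in>I. norm (w i b)))"
    unfolding sum_distrib_left[of C _ ?B] by (simp only: mult.left_commute)
  finally show ?thesis unfolding sum_nagumo .
qed

section \<open>Bounds for the operator at one point\<close>

context expansion_at
begin

abbreviation "supp0 \<equiv> {\<alpha>. (\<alpha>, \<lambda>_. 0) \<in> op_supp P}"

text \<open>The value of \<open>sigma_star\<close> at \<lambda> + \<gamma>, frozen at the centre:
  only the constant terms of the arrays enter.\<close>

definition symb :: "(nat \<Rightarrow> nat) \<Rightarrow> complex ^ 'm ^ 'm" where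
  "symb \<gamma> = (\<chi> i j. \<Sum>\<alpha>\<in>supp0. A \<alpha> (\<lambda>_. 0) (i, j) (\<lambda>_. 0) * multi_pow n (\<lambda>i. L i (\<lambda>_. 0) + of_nat (\<gamma> i)) \<alpha>)"

lemma finite_supp0: "finite supp0"
proof -
  have "supp0 \<subseteq> fst ` op_supp P" by force
  then show ?thesis using finite_supp finite_surj by blast
qed

lemma card_supp0: "card supp0 \<le> card (op_supp P)"
proof -
  have "supp0 \<subseteq> fst ` op_supp P" by force
  then show ?thesis using finite_supp surj_card_le by blast
qed

lemma A_expands: "(\<alpha>, \<beta>) \<in> op_supp P \<Longrightarrow> expands n k l (\<lambda>t x z. P \<alpha> \<beta> t x z $ i $ j) x0 z0 R (A \<alpha> \<beta> (i, j))"
  using A[of \<alpha> \<beta>, unfolded vexpands_def, THEN spec, of "(i, j)"] by simp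

text \<open>A sum over all entries, used as a common bound. The radius is R / 2 because
  \<open>ps_conv\<close> promises summability only below R.\<close>

definition KA :: real where
  "KA = (\<Sum>p\<in>op_supp P. \<Sum>ij\<in>UNIV. ps_norm (n + (k + l)) (R / 2) (A (fst p) (snd p) ij))"

text \<open>The summand 1 makes the constant at least 1, so that its powers may be replaced by the
  r-th one.\<close>

definition KL :: real where
  "KL = 1 + (\<Sum>i<n. ps_norm (k + l) (R / 2) (L i))"

lemma A_summable: "(\<alpha>, \<beta>) \<in> op_supp P \<Longrightarrow> ps_summable (n + (k + l)) (R / 2) (A \<alpha> \<beta> (i, j))"
  using A_expands[of \<alpha> \<beta> i j] R unfolding expands_def ps_conv_def by simp

lemma L_summable: "i < n \<Longrightarrow> ps_summable (k + l) (R / 2) (L i)"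
  using L[of i] R unfolding expands_def ps_conv_def by simp

lemma KA_nonneg: "0 \<le> KA"
  unfolding KA_def using R by (intro sum_nonneg ps_norm_nonneg) auto

lemma KL_ge_1: "1 \<le> KL"
  unfolding KL_def using R sum_nonneg[of "{..<n}" "\<lambda>i. ps_norm (k + l) (R / 2) (L i)"] ps_norm_nonneg by simp

lemma A_norm:
  assumes "(\<alpha>, \<beta>) \<in> op_supp P"
  shows "ps_norm (n + (k + l)) (R / 2) (A \<alpha> \<beta> (i, j)) \<le> KA"
proof -
  have "ps_norm (n + (k + l)) (R / 2) (A \<alpha> \<beta> (i, j)) \<le> (\<Sum>ij\<in>UNIV. ps_norm (n + (k + l)) (R / 2) (A (fst (\<alpha>, \<beta>)) (snd (\<alpha>, \<beta>)) ij))"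
    using R member_le_sum[of "(i, j)" UNIV "\<lambda>ij. ps_norm (n + (k + l)) (R / 2) (A \<alpha> \<beta> ij)"] ps_norm_nonneg by simp
  also have "\<dots> \<le> KA"
    unfolding KA_def using R assms finite_supp
    by (intro member_le_sum[of "(\<alpha>, \<beta>)" "op_supp P" "\<lambda>p. \<Sum>ij\<in>UNIV. ps_norm (n + (k + l)) (R / 2) (A (fst p) (snd p) ij)"] sum_nonneg ps_norm_nonneg) auto
  finally show ?thesis .
qed

text \<open>Cauchy's estimate in t: the slices decay like (2 / R)^|\<delta>|. The inverse ratio R /
  2 enters the choice of the geometric rate in the convergence proof.\<close>

lemma slice_nagumo:
  assumes "(\<alpha>, \<beta>) \<in> op_supp P" "\<delta> \<in> multi_indices n" "0 \<le> s" "s \<le> R / 2"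
  shows "nagumo (k + l) s 0 D (\<lambda>b. A \<alpha> \<beta> (i, j) (jn n \<delta> b)) \<le> KA * (2 / R) ^ multi_deg n \<delta>"
proof -
  have R2: "0 < R / 2" using R by simp
  have "nagumo (k + l) s 0 D (\<lambda>b. A \<alpha> \<beta> (i, j) (jn n \<delta> b)) \<le> nagumo (k + l) (R / 2) 0 D (\<lambda>b. A \<alpha> \<beta> (i, j) (jn n \<delta> b))"
    by (rule nagumo_mono_s) (use assms in auto)
  also have "\<dots> \<le> ps_norm (k + l) (R / 2) (\<lambda>b. A \<alpha> \<beta> (i, j) (jn n \<delta> b))"
    unfolding ps_norm_def using ps_summable_slice(1)[OF A_summable[OF assms(1)] assms(2) R2] R
    by (intro nagumo_le_infsum) auto
  also have "\<dots> \<le> ps_norm (n + (k + l)) (R / 2) (A \<alpha> \<beta> (i, j)) / (R / 2) ^ multi_deg n \<delta>"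
    unfolding ps_norm_def by (rule ps_summable_slice(2)[OF A_summable[OF assms(1)] assms(2) R2])
  also have "\<dots> \<le> KA / (R / 2) ^ multi_deg n \<delta>"
    using A_norm[OF assms(1)] R by (intro divide_right_mono) auto
  also have "\<dots> = KA * (2 / R) ^ multi_deg n \<delta>" using R by (simp add: power_divide)
  finally show ?thesis .
qed

text \<open>Each factor \<lambda>_i + \<mu>_i has norm at most \<open>KL\<close> (1 + |\<mu>|), so
  the operator with exponent \<alpha> costs |\<alpha>| powers of 1 + |\<mu>|.\<close>

lemma lam_pow_norm:
  assumes "multi_deg n \<alpha> \<le> r"
  shows "ps_summable (k + l) (R / 2) (ps_lam_pow L n \<alpha> \<mu>)"
    and "ps_norm (k + l) (R / 2) (ps_lam_pow L n \<alpha> \<mu>) \<le> KL ^ r * (1 + real (multi_deg n \<mu>)) ^ multi_deg n \<alpha>"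
proof -
  note * = ps_lam_pow_norm[of n "k + l" "R / 2" L \<alpha> \<mu>]
  show "ps_summable (k + l) (R / 2) (ps_lam_pow L n \<alpha> \<mu>)" using * L_summable R by simp
  have "ps_norm (k + l) (R / 2) (ps_lam_pow L n \<alpha> \<mu>) \<le> (\<Prod>i<n. (ps_norm (k + l) (R / 2) (L i) + real (\<mu> i)) ^ \<alpha> i)"
    using * L_summable R by simp
  also have "\<dots> \<le> (\<Prod>i<n. (KL * (1 + real (multi_deg n \<mu>))) ^ \<alpha> i)"
  proof (rule prod_mono, safe)
    fix i assume i: "i < n"
    have nn: "0 \<le> ps_norm (k + l) (R / 2) (L i)" using R by (intro ps_norm_nonneg) simp
    then show "0 \<le> (ps_norm (k + l) (R / 2) (L i) + real (\<mu> i)) ^ \<alpha> i" by simp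
    have "ps_norm (k + l) (R / 2) (L i) \<le> (\<Sum>i<n. ps_norm (k + l) (R / 2) (L i))"
      using i R by (intro member_le_sum) (auto intro: ps_norm_nonneg)
    then have 1: "ps_norm (k + l) (R / 2) (L i) \<le> KL" by (simp add: KL_def)
    have 2: "real (\<mu> i) \<le> KL * real (multi_deg n \<mu>)"
      using le_multi_deg[OF i, of \<mu>] mult_right_mono[OF KL_ge_1, of "real (multi_deg n \<mu>)"] by simp
    show "(ps_norm (k + l) (R / 2) (L i) + real (\<mu> i)) ^ \<alpha> i \<le> (KL * (1 + real (multi_deg n \<mu>))) ^ \<alpha> i"
      using 1 2 nn by (intro power_mono) (auto simp: distrib_left)
  qed
  also have "\<dots> = (KL * (1 + real (multi_deg n \<mu>))) ^ multi_deg n \<alpha>" by (simp add: multi_deg_def power_sum)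
  also have "\<dots> = KL ^ multi_deg n \<alpha> * (1 + real (multi_deg n \<mu>)) ^ multi_deg n \<alpha>" by (rule power_mult_distrib)
  also have "\<dots> \<le> KL ^ r * (1 + real (multi_deg n \<mu>)) ^ multi_deg n \<alpha>"
    using assms KL_ge_1 by (intro mult_right_mono power_increasing) auto
  finally show "ps_norm (k + l) (R / 2) (ps_lam_pow L n \<alpha> \<mu>) \<le> KL ^ r * (1 + real (multi_deg n \<mu>)) ^ multi_deg n \<alpha>" .
qed

lemma lam_pow_nagumo:
  assumes "multi_deg n \<alpha> \<le> r" "0 \<le> s" "s \<le> R / 2"
  shows "nagumo (k + l) s 0 D (ps_lam_pow L n \<alpha> \<mu>) \<le> KL ^ r * (1 + real (multi_deg n \<mu>)) ^ multi_deg n \<alpha>"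
proof -
  have "nagumo (k + l) s 0 D (ps_lam_pow L n \<alpha> \<mu>) \<le> nagumo (k + l) (R / 2) 0 D (ps_lam_pow L n \<alpha> \<mu>)"
    by (rule nagumo_mono_s) (use assms in auto)
  also have "\<dots> \<le> ps_norm (k + l) (R / 2) (ps_lam_pow L n \<alpha> \<mu>)"
    unfolding ps_norm_def using lam_pow_norm(1)[OF assms(1)] R by (intro nagumo_le_infsum) auto
  also have "\<dots> \<le> KL ^ r * (1 + real (multi_deg n \<mu>)) ^ multi_deg n \<alpha>" by (rule lam_pow_norm(2)[OF assms(1)])
  finally show ?thesis .
qed

end

text \<open>The hypotheses on the operator at one point, rewritten for arrays: by
  \<open>order\<close> the coefficients of order above r vanish as germs, by \<open>t0\<close> those
  with \<beta> \<noteq> 0 vanish at t = 0. \<open>C\<close> is the constant of the elliptic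
  estimate, and \<open>S\<close> contains the exceptional indices.\<close>

locale regular_expansion_at = expansion_at n k l P lam x0 z0 R A L
  for n k l :: nat and P :: "'m::finite op_matrix" and lam x0 z0 R A L +
  fixes r :: nat and S :: "(nat \<Rightarrow> nat) set" and C :: real
  assumes order: "\<And>\<alpha> \<beta> i j \<delta>. (\<alpha>, \<beta>) \<in> op_supp P \<Longrightarrow> r < multi_deg n \<alpha> + multi_deg k \<beta> \<Longrightarrow>
        \<delta> \<in> multi_indices (n + (k + l)) \<Longrightarrow> A \<alpha> \<beta> (i, j) \<delta> = 0"
    and t0: "\<And>\<alpha> \<beta> i j b. (\<alpha>, \<beta>) \<in> op_supp P \<Longrightarrow> \<beta> \<noteq> (\<lambda>_. 0) \<Longrightarrow> b \<in> multi_indices (k + l) \<Longrightarrow> A \<alpha> \<beta> (i, j) (jn n (\<lambda>_. 0) b) = 0"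
    and C: "0 < C"
    and elliptic: "\<And>\<gamma> v. \<gamma> \<in> multi_indices n - S \<Longrightarrow>
        (1 + real (multi_deg n \<gamma>)) ^ r * l1norm v \<le> C * l1norm (symb \<gamma> *v v)"
begin

text \<open>Since |\<mu>| < |\<gamma>|, the level r |\<gamma>| exceeds r |\<mu>| by at least r,
  which leaves room for the at most r derivatives in x. These cost |\<beta>| factors r (1 + |\<mu>|)
  / s, the powers of \<lambda> + \<mu> cost |\<alpha>| factors 1 + |\<mu>|, and |\<alpha>| +
  |\<beta>| \<le> r.\<close>

lemma off_diagonal_nagumo:
  assumes \<gamma>: "\<gamma> \<in> multi_indices n" and \<mu>: "\<mu> \<le> \<gamma>" "\<mu> \<noteq> \<gamma>" and ab: "(\<alpha>, \<beta>) \<in> op_supp P"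
    and s: "0 < s" "s \<le> R / 2"
  shows "nagumo (k + l) s (r * multi_deg n \<gamma>) D (ps_mult (\<lambda>b. A \<alpha> \<beta> (i, j) (jn n (\<lambda>i. \<gamma> i - \<mu> i) b))
      (ps_mult (ps_lam_pow L n \<alpha> \<mu>) (ps_mderiv 0 k \<beta> u)))
    \<le> KA * KL ^ r * (1 + real r / s) ^ r * ((2 / R) ^ multi_deg n (\<lambda>i. \<gamma> i - \<mu> i) *
        ((1 + real (multi_deg n \<mu>)) ^ r * nagumo (k + l) s (r * multi_deg n \<mu>) (D + r) u))"
proof (cases "r < multi_deg n \<alpha> + multi_deg k \<beta>")
  \<comment> \<open>Such a pair may belong to \<open>op_supp\<close> although its coefficient
    vanishes near the centre; the whole term is then zero.\<close>
  case True
  let ?a = "\<lambda>b. A \<alpha> \<beta> (i, j) (jn n (\<lambda>i. \<gamma> i - \<mu> i) b)"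
  have "nagumo (k + l) s 0 D ?a = nagumo (k + l) s 0 D (\<lambda>_. 0)"
    by (rule nagumo_cong) (rule order[OF ab True jn_mem[OF multi_indices_diff[OF \<gamma>]]])
  then have "nagumo (k + l) s (r * multi_deg n \<gamma>) D (ps_mult ?a (ps_mult (ps_lam_pow L n \<alpha> \<mu>) (ps_mderiv 0 k \<beta> u))) \<le> 0"
    using nagumo_mult[of s "k + l" "r * multi_deg n \<gamma>" D ?a] s by (metis less_imp_le mult_zero_left nagumo_zero)
  also have "0 \<le> KA * KL ^ r * (1 + real r / s) ^ r * ((2 / R) ^ multi_deg n (\<lambda>i. \<gamma> i - \<mu> i) *
        ((1 + real (multi_deg n \<mu>)) ^ r * nagumo (k + l) s (r * multi_deg n \<mu>) (D + r) u))"
    using KA_nonneg KL_ge_1 s R by (intro mult_nonneg_nonneg nagumo_nonneg zero_le_power) auto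
  finally show ?thesis .
next
  case False
  let ?a = "\<lambda>b. A \<alpha> \<beta> (i, j) (jn n (\<lambda>i. \<gamma> i - \<mu> i) b)" and ?l = "ps_lam_pow L n \<alpha> \<mu>" and ?u = "ps_mderiv 0 k \<beta> u"
  define g where "g = multi_deg n \<mu>"
  have deg: "multi_deg n \<alpha> + multi_deg k \<beta> \<le> r" using False by simp
  have "g < multi_deg n \<gamma>" unfolding g_def by (rule multi_deg_less[OF \<gamma> \<mu>])
  then have "r * Suc g \<le> r * multi_deg n \<gamma>" by (intro mult_le_mono2) simp
  then have p: "r * g + multi_deg k \<beta> \<le> r * multi_deg n \<gamma>" using deg by simp
  have u: "nagumo (k + l) s (r * multi_deg n \<gamma>) D ?u \<le> (1 + real r / s) ^ r * (1 + real g) ^ multi_deg k \<beta> * nagumo (k + l) s (r * g) (D + r) u"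
  proof -
    have "nagumo (k + l) s (r * multi_deg n \<gamma>) D ?u \<le> nagumo (k + l) s (r * g + multi_deg k \<beta>) D ?u"
      by (rule nagumo_mono_p) (use s p in auto)
    also have "\<dots> \<le> (real (r * Suc g) / s) ^ multi_deg k \<beta> * nagumo (k + l) s (r * g) (D + multi_deg k \<beta>) u"
      by (rule nagumo_mderiv) (use s deg in auto)
    also have "\<dots> \<le> ((1 + real r / s) ^ r * (1 + real g) ^ multi_deg k \<beta>) * nagumo (k + l) s (r * g) (D + r) u"
    proof (rule mult_mono)
      have "(real (r * Suc g) / s) ^ multi_deg k \<beta> = (real r / s) ^ multi_deg k \<beta> * (1 + real g) ^ multi_deg k \<beta>"
        by (simp add: power_mult_distrib[symmetric] distrib_left add_divide_distrib)
      also have "(real r / s) ^ multi_deg k \<beta> \<le> (1 + real r / s) ^ multi_deg k \<beta>" using s by (intro power_mono) auto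
      also have "\<dots> \<le> (1 + real r / s) ^ r" using s deg by (intro power_increasing) auto
      finally show "(real (r * Suc g) / s) ^ multi_deg k \<beta> \<le> (1 + real r / s) ^ r * (1 + real g) ^ multi_deg k \<beta>"
        by (simp add: mult_right_mono)
      show "nagumo (k + l) s (r * g) (D + multi_deg k \<beta>) u \<le> nagumo (k + l) s (r * g) (D + r) u"
        by (rule nagumo_mono_D) (use s deg in auto)
    qed (use s in \<open>auto intro!: nagumo_nonneg mult_nonneg_nonneg\<close>)
    finally show ?thesis .
  qed
  have "nagumo (k + l) s (r * multi_deg n \<gamma>) D (ps_mult ?a (ps_mult ?l ?u)) \<le> nagumo (k + l) s 0 D ?a * nagumo (k + l) s (r * multi_deg n \<gamma>) D (ps_mult ?l ?u)"
    using s by (intro nagumo_mult) simp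
  also have "\<dots> \<le> (KA * (2 / R) ^ multi_deg n (\<lambda>i. \<gamma> i - \<mu> i)) * ((KL ^ r * (1 + real g) ^ multi_deg n \<alpha>) *
      ((1 + real r / s) ^ r * (1 + real g) ^ multi_deg k \<beta> * nagumo (k + l) s (r * g) (D + r) u))"
  proof (rule mult_mono)
    show "nagumo (k + l) s 0 D ?a \<le> KA * (2 / R) ^ multi_deg n (\<lambda>i. \<gamma> i - \<mu> i)"
      by (rule slice_nagumo[OF ab multi_indices_diff[OF \<gamma>]]) (use s in auto)
    have "nagumo (k + l) s (r * multi_deg n \<gamma>) D (ps_mult ?l ?u) \<le> nagumo (k + l) s 0 D ?l * nagumo (k + l) s (r * multi_deg n \<gamma>) D ?u"
      using s by (intro nagumo_mult) simp
    also have "\<dots> \<le> (KL ^ r * (1 + real g) ^ multi_deg n \<alpha>) * ((1 + real r / s) ^ r * (1 + real g) ^ multi_deg k \<beta> * nagumo (k + l) s (r * g) (D + r) u)"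
      using lam_pow_nagumo[of \<alpha> r s D \<mu>] deg s u KL_ge_1
      by (intro mult_mono) (auto simp: g_def intro!: nagumo_nonneg)
    finally show "nagumo (k + l) s (r * multi_deg n \<gamma>) D (ps_mult ?l ?u) \<le> (KL ^ r * (1 + real g) ^ multi_deg n \<alpha>) * ((1 + real r / s) ^ r * (1 + real g) ^ multi_deg k \<beta> * nagumo (k + l) s (r * g) (D + r) u)" .
  qed (use s R KA_nonneg in \<open>auto intro!: nagumo_nonneg mult_nonneg_nonneg\<close>)
  also have "\<dots> = KA * KL ^ r * (1 + real r / s) ^ r * ((2 / R) ^ multi_deg n (\<lambda>i. \<gamma> i - \<mu> i) *
        ((1 + real g) ^ (multi_deg n \<alpha> + multi_deg k \<beta>) * nagumo (k + l) s (r * g) (D + r) u))"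
    by (simp add: power_add mult_ac)
  also have "\<dots> \<le> KA * KL ^ r * (1 + real r / s) ^ r * ((2 / R) ^ multi_deg n (\<lambda>i. \<gamma> i - \<mu> i) *
        ((1 + real g) ^ r * nagumo (k + l) s (r * g) (D + r) u))"
    using KA_nonneg KL_ge_1 s R deg
    by (intro mult_left_mono mult_right_mono power_increasing mult_nonneg_nonneg nagumo_nonneg zero_le_power) auto
  finally show ?thesis by (simp add: g_def)
qed

lemma ps_mult_zero_left:
  assumes "\<And>b. b \<in> multi_indices d \<Longrightarrow> c b = 0" "\<alpha> \<in> multi_indices d"
  shows "ps_mult c e \<alpha> = 0"
  unfolding ps_mult_def using assms multi_indices_le by (intro sum.neutral) auto

text \<open>In the term \<open>\<mu> = \<gamma>\<close> of \<open>formal_arr\<close>, freezing the symbol at the centre leaves an error whose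
  factors vanish at the centre; it is small for small radii.\<close>
definition diag_rest :: "((nat \<Rightarrow> nat) \<Rightarrow> 'm \<Rightarrow> (nat \<Rightarrow> nat) \<Rightarrow> complex) \<Rightarrow> (nat \<Rightarrow> nat) \<Rightarrow> 'm \<Rightarrow> (nat \<Rightarrow> nat) \<Rightarrow> complex" where
  "diag_rest \<Phi> \<gamma> i b = (\<Sum>\<alpha>\<in>supp0. \<Sum>j\<in>UNIV.
      A \<alpha> (\<lambda>_. 0) (i, j) (\<lambda>_. 0) * ps_mult (\<lambda>b. if b = (\<lambda>_. 0) then 0 else ps_lam_pow L n \<alpha> \<gamma> b) (\<Phi> \<gamma> j) b +
      ps_mult (\<lambda>b. if b = (\<lambda>_. 0) then 0 else A \<alpha> (\<lambda>_. 0) (i, j) (jn n (\<lambda>_. 0) b)) (ps_mult (ps_lam_pow L n \<alpha> \<gamma>) (\<Phi> \<gamma> j)) b)"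

definition off_diag :: "((nat \<Rightarrow> nat) \<Rightarrow> 'm \<Rightarrow> (nat \<Rightarrow> nat) \<Rightarrow> complex) \<Rightarrow> (nat \<Rightarrow> nat) \<Rightarrow> 'm \<Rightarrow> (nat \<Rightarrow> nat) \<Rightarrow> complex" where
  "off_diag \<Phi> \<gamma> i b = (\<Sum>p\<in>op_supp P. \<Sum>\<mu>\<in>{\<mu>. \<mu> \<le> \<gamma>} - {\<gamma>}. \<Sum>j\<in>UNIV.
     ps_mult (\<lambda>b. A (fst p) (snd p) (i, j) (jn n (\<lambda>i. \<gamma> i - \<mu> i) b)) (ps_mult (ps_lam_pow L n (fst p) \<mu>) (ps_mderiv 0 k (snd p) (\<Phi> \<mu> j))) b)"

lemma formal_arr_split:
  assumes \<gamma>: "\<gamma> \<in> multi_indices n" and b: "b \<in> multi_indices (k + l)"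
  shows "formal_arr \<Phi> \<gamma> i b = (symb \<gamma> *v (\<chi> j. \<Phi> \<gamma> j b)) $ i + diag_rest \<Phi> \<gamma> i b + off_diag \<Phi> \<gamma> i b"
proof -
  let ?T = "\<lambda>p \<mu>. \<Sum>j\<in>UNIV. ps_mult (\<lambda>b. A (fst p) (snd p) (i, j) (jn n (\<lambda>i. \<gamma> i - \<mu> i) b)) (ps_mult (ps_lam_pow L n (fst p) \<mu>) (ps_mderiv 0 k (snd p) (\<Phi> \<mu> j))) b"
  have fin: "finite {\<mu>. \<mu> \<le> \<gamma>}" by (rule finite_le_multi_index[OF \<gamma>])
  have "formal_arr \<Phi> \<gamma> i b = (\<Sum>p\<in>op_supp P. ?T p \<gamma> + (\<Sum>\<mu>\<in>{\<mu>. \<mu> \<le> \<gamma>} - {\<gamma>}. ?T p \<mu>))"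
    unfolding formal_arr_def case_prod_beta'
    by (rule sum.cong[OF refl], rule sum.remove[OF fin]) simp
  also have "\<dots> = (\<Sum>p\<in>op_supp P. ?T p \<gamma>) + off_diag \<Phi> \<gamma> i b"
    by (simp add: sum.distrib off_diag_def)
  also have "(\<Sum>p\<in>op_supp P. ?T p \<gamma>) = (\<Sum>p\<in>(\<lambda>\<alpha>. (\<alpha>, \<lambda>_. 0)) ` supp0. ?T p \<gamma>)"
  proof (rule sum.mono_neutral_right[OF finite_supp])
    show "\<forall>p\<in>op_supp P - (\<lambda>\<alpha>. (\<alpha>, \<lambda>_. 0)) ` supp0. ?T p \<gamma> = 0"
    proof
      fix p assume p: "p \<in> op_supp P - (\<lambda>\<alpha>. (\<alpha>, \<lambda>_. 0)) ` supp0"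
      obtain \<alpha> \<beta> where ab: "p = (\<alpha>, \<beta>)" by (cases p)
      have "\<beta> \<noteq> (\<lambda>_. 0)" using p ab by auto
      then show "?T p \<gamma> = 0"
        using t0[of \<alpha> \<beta>] p ab by (intro sum.neutral ballI ps_mult_zero_left[OF _ b]) auto
    qed
  qed auto
  also have "\<dots> = (\<Sum>\<alpha>\<in>supp0. ?T (\<alpha>, \<lambda>_. 0) \<gamma>)"
    by (subst sum.reindex) (auto simp: inj_on_def)
  also have "\<dots> = (\<Sum>\<alpha>\<in>supp0. \<Sum>j\<in>UNIV. A \<alpha> (\<lambda>_. 0) (i, j) (\<lambda>_. 0) * multi_pow n (\<lambda>i. L i (\<lambda>_. 0) + of_nat (\<gamma> i)) \<alpha> * \<Phi> \<gamma> j b) + diag_rest \<Phi> \<gamma> i b"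
    unfolding diag_rest_def sum.distrib[symmetric]
  proof (intro sum.cong refl)
    fix \<alpha> j
    let ?a = "\<lambda>b. A \<alpha> (\<lambda>_. 0) (i, j) (jn n (\<lambda>_. 0) b)" and ?l = "ps_lam_pow L n \<alpha> \<gamma>"
    have md: "ps_mderiv 0 k (\<lambda>_. 0) u = u" for u
    proof -
      have "fold (\<lambda>i. ps_deriv (0 + i) ^^ 0) xs u = u" for xs :: "nat list" by (induction xs) auto
      then show ?thesis by (simp add: ps_mderiv_def)
    qed
    have pow0: "(ps_mult g ^^ q) e (\<lambda>_. 0) = g (\<lambda>_. 0) ^ q * e (\<lambda>_. 0)" for g e :: "(nat \<Rightarrow> nat) \<Rightarrow> complex" and q
      by (induction q) (auto simp: ps_mult_at_0)
    have lam0: "ps_lam_pow L m \<alpha> \<gamma> (\<lambda>_. 0) = multi_pow m (\<lambda>i. L i (\<lambda>_. 0) + of_nat (\<gamma> i)) \<alpha>" for m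
      by (induction m) (auto simp: ps_const_def multi_pow_def pow0 mult.commute)
    show "ps_mult (\<lambda>b. A (fst (\<alpha>, \<lambda>_. 0)) (snd (\<alpha>, \<lambda>_. 0)) (i, j) (jn n (\<lambda>i. \<gamma> i - \<gamma> i) b))
         (ps_mult (ps_lam_pow L n (fst (\<alpha>, \<lambda>_. 0)) \<gamma>) (ps_mderiv 0 k (snd (\<alpha>, \<lambda>_. 0)) (\<Phi> \<gamma> j))) b
      = A \<alpha> (\<lambda>_. 0) (i, j) (\<lambda>_. 0) * multi_pow n (\<lambda>i. L i (\<lambda>_. 0) + of_nat (\<gamma> i)) \<alpha> * \<Phi> \<gamma> j b +
        (A \<alpha> (\<lambda>_. 0) (i, j) (\<lambda>_. 0) * ps_mult (\<lambda>b. if b = (\<lambda>_. 0) then 0 else ?l b) (\<Phi> \<gamma> j) b +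
         ps_mult (\<lambda>b. if b = (\<lambda>_. 0) then 0 else ?a b) (ps_mult ?l (\<Phi> \<gamma> j)) b)"
      using ps_mult_remove_const[OF b, of ?a "ps_mult ?l (\<Phi> \<gamma> j)"] ps_mult_remove_const[OF b, of ?l "\<Phi> \<gamma> j"]
      by (simp add: md lam0 distrib_left mult.assoc)
  qed
  also have "(\<Sum>\<alpha>\<in>supp0. \<Sum>j\<in>UNIV. A \<alpha> (\<lambda>_. 0) (i, j) (\<lambda>_. 0) * multi_pow n (\<lambda>i. L i (\<lambda>_. 0) + of_nat (\<gamma> i)) \<alpha> * \<Phi> \<gamma> j b)
     = (symb \<gamma> *v (\<chi> j. \<Phi> \<gamma> j b)) $ i"
    by (subst sum.swap) (simp add: symb_def matrix_vector_mult_def sum_distrib_right)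
  finally show ?thesis .
qed

text \<open>\<open>nagumo_no_const\<close> extracts s from each of the two products; both contribute
  2 s / R, hence the 4. The growth (1 + |\<gamma>|)^r is the one that ellipticity divides out, so
  the error is relatively small, uniformly in \<gamma>, once s is small.\<close>

lemma diag_rest_nagumo:
  assumes \<gamma>: "\<gamma> \<in> multi_indices n" and s: "0 < s" "s \<le> R / 2"
  shows "nagumo (k + l) s p D (diag_rest \<Phi> \<gamma> i) \<le>
     real (card (op_supp P)) * (s * (4 * KA * KL ^ r / R)) * (1 + real (multi_deg n \<gamma>)) ^ r * (\<Sum>j\<in>UNIV. nagumo (k + l) s p D (\<Phi> \<gamma> j))"
proof -
  let ?g = "1 + real (multi_deg n \<gamma>)" and ?N = "\<lambda>j. nagumo (k + l) s p D (\<Phi> \<gamma> j)"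
  have N: "0 \<le> ?N j" for j using s by (intro nagumo_nonneg) simp
  have summand: "nagumo (k + l) s p D (\<lambda>b. A \<alpha> (\<lambda>_. 0) (i, j) (\<lambda>_. 0) * ps_mult (\<lambda>b. if b = (\<lambda>_. 0) then 0 else ps_lam_pow L n \<alpha> \<gamma> b) (\<Phi> \<gamma> j) b +
      ps_mult (\<lambda>b. if b = (\<lambda>_. 0) then 0 else A \<alpha> (\<lambda>_. 0) (i, j) (jn n (\<lambda>_. 0) b)) (ps_mult (ps_lam_pow L n \<alpha> \<gamma>) (\<Phi> \<gamma> j)) b)
    \<le> s * (4 * KA * KL ^ r / R) * ?g ^ r * ?N j" (is "nagumo _ _ _ _ (\<lambda>b. ?a0 * ps_mult ?l' _ b + ps_mult ?a' (ps_mult ?l _) b) \<le> _")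
    if \<alpha>: "\<alpha> \<in> supp0" for \<alpha> j
  proof (cases "multi_deg n \<alpha> \<le> r")
    case False
    then have a0: "A \<alpha> (\<lambda>_. 0) (i, j) (jn n (\<lambda>_. 0) b) = 0" if "b \<in> multi_indices (k + l)" for b
      using order[of \<alpha> "\<lambda>_. 0"] \<alpha> jn_mem[OF multi_indices_zero that] by auto
    have "nagumo (k + l) s p D (\<lambda>b. ?a0 * ps_mult ?l' (\<Phi> \<gamma> j) b + ps_mult ?a' (ps_mult ?l (\<Phi> \<gamma> j)) b) = nagumo (k + l) s p D (\<lambda>_. 0)"
    proof (rule nagumo_cong)
      fix b assume b: "b \<in> multi_indices (k + l)"
      have "ps_mult ?a' (ps_mult ?l (\<Phi> \<gamma> j)) b = 0"
        by (rule ps_mult_zero_left[OF _ b]) (use a0 in auto)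
      then show "?a0 * ps_mult ?l' (\<Phi> \<gamma> j) b + ps_mult ?a' (ps_mult ?l (\<Phi> \<gamma> j)) b = 0"
        using a0[of "\<lambda>_. 0"] by simp
    qed
    also have "\<dots> \<le> s * (4 * KA * KL ^ r / R) * ?g ^ r * ?N j"
      using s R KA_nonneg KL_ge_1 N by (simp del: of_nat_add)
    finally show ?thesis .
  next
    case True
    have l: "nagumo (k + l) s' 0 D ?l \<le> KL ^ r * ?g ^ r" if "0 \<le> s'" "s' \<le> R / 2" for s'
    proof -
      have "nagumo (k + l) s' 0 D ?l \<le> KL ^ r * ?g ^ multi_deg n \<alpha>" by (rule lam_pow_nagumo[OF True that])
      also have "\<dots> \<le> KL ^ r * ?g ^ r" using True KL_ge_1 by (intro mult_left_mono power_increasing) auto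
      finally show ?thesis .
    qed
    have a: "nagumo (k + l) s' 0 D (\<lambda>b. A \<alpha> (\<lambda>_. 0) (i, j) (jn n (\<lambda>_. 0) b)) \<le> KA" if "0 \<le> s'" "s' \<le> R / 2" for s'
      using slice_nagumo[of \<alpha> "\<lambda>_. 0" "\<lambda>_. 0" s' D i j] \<alpha> that by simp
    have sR: "0 < s" "s \<le> R / 2" by (rule s)+
    have l': "nagumo (k + l) s 0 D ?l' \<le> s / (R / 2) * (KL ^ r * ?g ^ r)"
      using order_trans[OF nagumo_no_const[OF sR, of "k + l" D ?l] mult_left_mono[OF l[of "R / 2"]]] s R by simp
    have a': "nagumo (k + l) s 0 D ?a' \<le> s / (R / 2) * KA"
      using order_trans[OF nagumo_no_const[OF sR, of "k + l" D "\<lambda>b. A \<alpha> (\<lambda>_. 0) (i, j) (jn n (\<lambda>_. 0) b)"] mult_left_mono[OF a[of "R / 2"]]] s R by simp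
    have a0: "norm ?a0 \<le> KA"
      using order_trans[OF norm_const_le_nagumo[of s "\<lambda>b. A \<alpha> (\<lambda>_. 0) (i, j) (jn n (\<lambda>_. 0) b)" "k + l" 0 D] a[of s]] s by simp
    have lnn: "0 \<le> KL ^ r * ?g ^ r" using KL_ge_1 by simp
    have 1: "nagumo (k + l) s p D (\<lambda>b. ?a0 * ps_mult ?l' (\<Phi> \<gamma> j) b) \<le> KA * (s / (R / 2) * (KL ^ r * ?g ^ r) * ?N j)"
      unfolding nagumo_cmult
      using nagumo_mult[of s "k + l" p D ?l' "\<Phi> \<gamma> j"] mult_right_mono[OF l' N[of j]] s R a0 lnn N[of j] KA_nonneg
      by (intro mult_mono) (auto intro!: nagumo_nonneg)
    have "nagumo (k + l) s p D (ps_mult ?l (\<Phi> \<gamma> j)) \<le> (KL ^ r * ?g ^ r) * ?N j"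
      using nagumo_mult[of s "k + l" p D ?l "\<Phi> \<gamma> j"] mult_right_mono[OF l[of s] N[of j]] s by simp
    then have 2: "nagumo (k + l) s p D (ps_mult ?a' (ps_mult ?l (\<Phi> \<gamma> j))) \<le> (s / (R / 2) * KA) * ((KL ^ r * ?g ^ r) * ?N j)"
      using s R lnn N[of j] KA_nonneg a'
      by (intro order_trans[OF nagumo_mult[of s "k + l" p D ?a'] mult_mono]) (auto intro!: nagumo_nonneg)
    have "nagumo (k + l) s p D (\<lambda>b. ?a0 * ps_mult ?l' (\<Phi> \<gamma> j) b + ps_mult ?a' (ps_mult ?l (\<Phi> \<gamma> j)) b)
      \<le> KA * (s / (R / 2) * (KL ^ r * ?g ^ r) * ?N j) + (s / (R / 2) * KA) * ((KL ^ r * ?g ^ r) * ?N j)"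
      using nagumo_add[of s "k + l" p D "\<lambda>b. ?a0 * ps_mult ?l' (\<Phi> \<gamma> j) b" "ps_mult ?a' (ps_mult ?l (\<Phi> \<gamma> j))"] 1 2 s by linarith
    also have "\<dots> = s * (4 * KA * KL ^ r / R) * ?g ^ r * ?N j"
      using R by (simp add: field_simps)
    finally show ?thesis .
  qed
  have "nagumo (k + l) s p D (diag_rest \<Phi> \<gamma> i) \<le> (\<Sum>\<alpha>\<in>supp0. \<Sum>j\<in>UNIV. s * (4 * KA * KL ^ r / R) * ?g ^ r * ?N j)"
    unfolding diag_rest_def[abs_def] using s
    by (intro order_trans[OF nagumo_sum] sum_mono summand) auto
  also have "\<dots> = real (card supp0) * (s * (4 * KA * KL ^ r / R) * ?g ^ r * (\<Sum>j\<in>UNIV. ?N j))"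
    by (simp add: sum_distrib_left)
  also have "\<dots> \<le> real (card (op_supp P)) * (s * (4 * KA * KL ^ r / R) * ?g ^ r * (\<Sum>j\<in>UNIV. ?N j))"
    using card_supp0 s R KA_nonneg KL_ge_1 N by (intro mult_right_mono mult_nonneg_nonneg sum_nonneg) auto
  finally show ?thesis by (simp add: mult_ac)
qed

lemma off_diag_nagumo:
  assumes \<gamma>: "\<gamma> \<in> multi_indices n" and s: "0 < s" "s \<le> R / 2"
  shows "nagumo (k + l) s (r * multi_deg n \<gamma>) D (off_diag \<Phi> \<gamma> i) \<le>
     real (card (op_supp P)) * (KA * KL ^ r * (1 + real r / s) ^ r) * (1 + real (multi_deg n \<gamma>)) ^ r *
     (\<Sum>\<mu>\<in>{\<mu>. \<mu> \<le> \<gamma>} - {\<gamma>}. (2 / R) ^ multi_deg n (\<lambda>i. \<gamma> i - \<mu> i) *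
        (\<Sum>j\<in>UNIV. nagumo (k + l) s (r * multi_deg n \<mu>) (D + r) (\<Phi> \<mu> j)))"
proof -
  let ?K = "KA * KL ^ r * (1 + real r / s) ^ r" and ?N = "\<lambda>\<mu> j. nagumo (k + l) s (r * multi_deg n \<mu>) (D + r) (\<Phi> \<mu> j)"
  have K: "0 \<le> ?K" using KA_nonneg KL_ge_1 s by simp
  have "nagumo (k + l) s (r * multi_deg n \<gamma>) D (off_diag \<Phi> \<gamma> i) \<le>
     (\<Sum>p\<in>op_supp P. \<Sum>\<mu>\<in>{\<mu>. \<mu> \<le> \<gamma>} - {\<gamma>}. \<Sum>j\<in>UNIV. ?K * ((2 / R) ^ multi_deg n (\<lambda>i. \<gamma> i - \<mu> i) * ((1 + real (multi_deg n \<gamma>)) ^ r * ?N \<mu> j)))"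
    unfolding off_diag_def[abs_def]
  proof (intro order_trans[OF nagumo_sum] sum_mono)
    fix p \<mu> j assume p: "p \<in> op_supp P" and \<mu>: "\<mu> \<in> {\<mu>. \<mu> \<le> \<gamma>} - {\<gamma>}"
    have "nagumo (k + l) s (r * multi_deg n \<gamma>) D (ps_mult (\<lambda>b. A (fst p) (snd p) (i, j) (jn n (\<lambda>i. \<gamma> i - \<mu> i) b))
         (ps_mult (ps_lam_pow L n (fst p) \<mu>) (ps_mderiv 0 k (snd p) (\<Phi> \<mu> j))))
      \<le> ?K * ((2 / R) ^ multi_deg n (\<lambda>i. \<gamma> i - \<mu> i) * ((1 + real (multi_deg n \<mu>)) ^ r * ?N \<mu> j))"
      by (rule off_diagonal_nagumo) (use \<gamma> p \<mu> s in auto)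
    \<comment> \<open>The power of 1 + |\<mu>| is enlarged to that of 1 + |\<gamma>|, exactly the
      factor gained from the elliptic estimate.\<close>
    also have "\<dots> \<le> ?K * ((2 / R) ^ multi_deg n (\<lambda>i. \<gamma> i - \<mu> i) * ((1 + real (multi_deg n \<gamma>)) ^ r * ?N \<mu> j))"
      using K R s multi_deg_mono[of \<mu> \<gamma> n] \<mu>
      by (intro mult_left_mono mult_right_mono power_mono nagumo_nonneg) auto
    finally show "nagumo (k + l) s (r * multi_deg n \<gamma>) D (ps_mult (\<lambda>b. A (fst p) (snd p) (i, j) (jn n (\<lambda>i. \<gamma> i - \<mu> i) b))
         (ps_mult (ps_lam_pow L n (fst p) \<mu>) (ps_mderiv 0 k (snd p) (\<Phi> \<mu> j))))
      \<le> ?K * ((2 / R) ^ multi_deg n (\<lambda>i. \<gamma> i - \<mu> i) * ((1 + real (multi_deg n \<gamma>)) ^ r * ?N \<mu> j))" .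
  qed (use s in auto)
  also have "\<dots> = real (card (op_supp P)) * ?K * (1 + real (multi_deg n \<gamma>)) ^ r *
     (\<Sum>\<mu>\<in>{\<mu>. \<mu> \<le> \<gamma>} - {\<gamma>}. (2 / R) ^ multi_deg n (\<lambda>i. \<gamma> i - \<mu> i) * (\<Sum>j\<in>UNIV. ?N \<mu> j))"
    by (simp add: sum_distrib_left mult_ac)
  finally show ?thesis .
qed

end

text \<open>The binomial is at most 2^(p + b). Halving the radius pays for 2^b; the remaining 2^p is
  geometric in |\<gamma>| when p = r |\<gamma>|.\<close>

lemma nagumo_half_le: "0 \<le> s \<Longrightarrow> nagumo d (s / 2) 0 D u \<le> 2 ^ p * nagumo d s p D u"
  unfolding nagumo_def sum_distrib_left
proof (rule sum_mono)
  fix \<alpha> assume "0 \<le> s"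
  let ?b = "multi_deg d \<alpha>"
  have "(p + ?b) choose ?b \<le> 2 ^ (p + ?b)" by (rule binomial_le_pow2)
  then have "real ((p + ?b) choose ?b) \<le> 2 ^ (p + ?b)" by (metis of_nat_le_iff of_nat_numeral of_nat_power)
  then have "1 / 2 ^ (p + ?b) \<le> 1 / real ((p + ?b) choose ?b)"
    using choose_pos'[of p ?b] by (intro divide_left_mono) auto
  then have "norm (u \<alpha>) * s ^ ?b * 2 ^ p * (1 / 2 ^ (p + ?b)) \<le> norm (u \<alpha>) * s ^ ?b * 2 ^ p * (1 / real ((p + ?b) choose ?b))"
    using \<open>0 \<le> s\<close> by (intro mult_left_mono) auto
  then show "norm (u \<alpha>) * (s / 2) ^ ?b / real ((0 + ?b) choose ?b) \<le> 2 ^ p * (norm (u \<alpha>) * s ^ ?b / real ((p + ?b) choose ?b))"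
    by (simp add: power_divide power_add mult_ac)
qed

lemma summable_power_multi_deg: "(\<lambda>\<delta>. (1/2 :: real) ^ multi_deg n \<delta>) summable_on multi_indices n"
proof (rule nonneg_bdd_above_summable_on)
  show "bdd_above (sum (\<lambda>\<delta>. (1/2 :: real) ^ multi_deg n \<delta>) ` {F. F \<subseteq> multi_indices n \<and> finite F})"
    by (rule bdd_aboveI2[of _ _ "2 ^ n"]) (use sum_power_multi_deg_le[of "1/2"] in auto)
qed auto

text \<open>Joins the slices to one series: at radius T the slice at \<gamma>, weighted by
  T^|\<gamma>|, has norm at most K (T B)^|\<gamma>|, and T B \<le> 1/2 makes this summable over
  \<gamma>.\<close>

lemma ps_conv_of_slices:
  assumes "0 < s" "0 < B" "0 \<le> K" and bound: "\<And>\<gamma> D. \<gamma> \<in> multi_indices n \<Longrightarrow> nagumo e s 0 D (c \<gamma>) \<le> K * B ^ multi_deg n \<gamma>"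
  shows "\<exists>T>0. ps_conv (n + e) T (\<lambda>\<delta>. c (\<lambda>i. if i < n then \<delta> i else 0) (\<lambda>i. \<delta> (i + n)))"
proof -
  define T where "T = min s (1 / (2 * B))"
  have T: "0 < T" "T \<le> s" "T * B \<le> 1/2"
    using assms(1,2) by (auto simp: T_def min_def field_simps)
  let ?c = "\<lambda>\<delta>. c (\<lambda>i. if i < n then \<delta> i else 0) (\<lambda>i. \<delta> (i + n))"
  have cj: "?c (jn n \<gamma> b) = c \<gamma> b" if "\<gamma> \<in> multi_indices n" for \<gamma> b
  proof -
    have "(\<lambda>i. if i < n then jn n \<gamma> b i else 0) = \<gamma>" "(\<lambda>i. jn n \<gamma> b (i + n)) = b"
      using that by (auto simp: jn_def multi_indices_def)
    then show ?thesis by simp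
  qed
  have sm: "ps_summable e T (c \<gamma>)" "ps_norm e T (c \<gamma>) \<le> K * B ^ multi_deg n \<gamma>" if \<gamma>: "\<gamma> \<in> multi_indices n" for \<gamma>
  proof -
    have nag: "nagumo e T 0 D (c \<gamma>) \<le> K * B ^ multi_deg n \<gamma>" for D
      using nagumo_mono_s[of T s e 0 D "c \<gamma>"] T bound[OF \<gamma>, of D] by linarith
    then show sm: "ps_summable e T (c \<gamma>)" using T by (intro ps_summable_nagumo[of T]) auto
    show "ps_norm e T (c \<gamma>) \<le> K * B ^ multi_deg n \<gamma>"
      unfolding ps_norm_def
    proof (rule infsum_le_finite_sums)
      show "(\<lambda>\<alpha>. norm (c \<gamma> \<alpha>) * T ^ multi_deg e \<alpha>) summable_on multi_indices e" using sm by (simp add: ps_summable_def)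
      fix F assume F: "finite F" "F \<subseteq> multi_indices e"
      have "(\<Sum>\<alpha>\<in>F. norm (c \<gamma> \<alpha>) * T ^ multi_deg e \<alpha>) \<le> nagumo e T 0 (Max (insert 0 (multi_deg e ` F))) (c \<gamma>)"
        unfolding nagumo_def using F T by (simp, intro sum_mono2) auto
      also have "\<dots> \<le> K * B ^ multi_deg n \<gamma>" by (rule nag)
      finally show "(\<Sum>\<alpha>\<in>F. norm (c \<gamma> \<alpha>) * T ^ multi_deg e \<alpha>) \<le> K * B ^ multi_deg n \<gamma>" .
    qed
  qed
  have "ps_summable (n + e) T ?c"
    unfolding ps_summable_def summable_on_jn
  proof (rule summable_on_SigmaI)
    fix \<gamma> assume \<gamma>: "\<gamma> \<in> multi_indices n"
    have "((\<lambda>b. T ^ multi_deg n \<gamma> * (norm (c \<gamma> b) * T ^ multi_deg e b)) has_sum T ^ multi_deg n \<gamma> * ps_norm e T (c \<gamma>)) (multi_indices e)"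
      using sm(1)[OF \<gamma>] unfolding ps_norm_def ps_summable_def by (intro has_sum_cmult_right has_sum_infsum)
    then show "((\<lambda>b. case (\<gamma>, b) of (\<alpha>, \<beta>) \<Rightarrow> norm (?c (jn n \<alpha> \<beta>)) * T ^ multi_deg (n + e) (jn n \<alpha> \<beta>)) has_sum T ^ multi_deg n \<gamma> * ps_norm e T (c \<gamma>)) (multi_indices e)"
      by (simp only: prod.case cj[OF \<gamma>] multi_deg_jn power_add mult_ac)
  next
    show "(\<lambda>\<gamma>. T ^ multi_deg n \<gamma> * ps_norm e T (c \<gamma>)) summable_on multi_indices n"
    proof (rule Infinite_Sum.summable_on_comparison_test)
      show "(\<lambda>\<gamma>. K * (1/2 :: real) ^ multi_deg n \<gamma>) summable_on multi_indices n"
        by (intro summable_on_cmult_right summable_power_multi_deg)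
      fix \<gamma> assume \<gamma>: "\<gamma> \<in> multi_indices n"
      have "T ^ multi_deg n \<gamma> * ps_norm e T (c \<gamma>) \<le> T ^ multi_deg n \<gamma> * (K * B ^ multi_deg n \<gamma>)"
        using sm(2)[OF \<gamma>] T by (intro mult_left_mono) auto
      also have "\<dots> = K * (T * B) ^ multi_deg n \<gamma>" by (simp add: power_mult_distrib)
      also have "\<dots> \<le> K * (1/2) ^ multi_deg n \<gamma>"
        using T assms by (intro mult_left_mono power_mono) auto
      finally show "T ^ multi_deg n \<gamma> * ps_norm e T (c \<gamma>) \<le> K * (1/2) ^ multi_deg n \<gamma>" .
      show "0 \<le> T ^ multi_deg n \<gamma> * ps_norm e T (c \<gamma>)" using T by (intro mult_nonneg_nonneg zero_le_power ps_norm_nonneg) auto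
    qed
  qed (use T in auto)
  then show ?thesis using T(1) ps_summable_imp_conv by blast
qed

context regular_expansion_at
begin

text \<open>Off \<open>S\<close>, ellipticity bounds the norm of the slice at \<gamma> by
  \<open>diag_rest\<close>, which is absorbed, and by the earlier slices; on \<open>S\<close>,
  finitely many convergent slices provide the start. The norms at the fixed radius s make sense for
  every slice because they are truncated.\<close>

lemma convergence:
  assumes finS: "finite S"
    and \<Phi>: "\<And>\<mu> j. \<mu> \<in> multi_indices n \<inter> S \<Longrightarrow> \<exists>\<rho>>0. ps_conv (k + l) \<rho> (\<Phi> \<mu> j)"
    and eq: "\<And>\<gamma> i b. \<gamma> \<in> multi_indices n - S \<Longrightarrow> b \<in> multi_indices (k + l) \<Longrightarrow> formal_arr \<Phi> \<gamma> i b = 0"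
  shows "\<exists>T>0. ps_conv (n + (k + l)) T (\<lambda>\<delta>. \<Phi> (\<lambda>i. if i < n then \<delta> i else 0) j (\<lambda>i. \<delta> (i + n)))"
proof -
  let ?S = "multi_indices n \<inter> S"
  define q where "q = real (card (op_supp P))"
  define m where "m = real (CARD('m))"
  define K1 where "K1 = C * m * q * (4 * KA * KL ^ r / R)"
  have q: "0 \<le> q" "0 \<le> m" by (auto simp: q_def m_def)
  have K1: "0 \<le> K1" unfolding K1_def using C q KA_nonneg KL_ge_1 R by simp
  have "\<forall>p\<in>?S \<times> (UNIV :: 'm set). \<exists>\<rho>>0. ps_conv (k + l) \<rho> (\<Phi> (fst p) (snd p))"
    using \<Phi> by auto
  from bchoice[OF this] obtain \<rho> where \<rho>: "\<forall>p\<in>?S \<times> (UNIV :: 'm set). 0 < \<rho> p \<and> ps_conv (k + l) (\<rho> p) (\<Phi> (fst p) (snd p))" ..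
  obtain s1 where s1: "0 < s1" "\<And>p. p \<in> ?S \<times> (UNIV :: 'm set) \<Longrightarrow> s1 \<le> \<rho> p"
  proof (rule finite_common_radius[of "?S \<times> (UNIV :: 'm set)" \<rho>])
    show "finite (?S \<times> (UNIV :: 'm set))" using finS by simp
    show "0 < \<rho> p" if "p \<in> ?S \<times> (UNIV :: 'm set)" for p using \<rho> that by blast
  qed blast
  \<comment> \<open>At this radius the error \<open>diag_rest\<close> of freezing the symbol is absorbed by the left-hand side.\<close>
  define s where "s = min (s1 / 2) (min (R / 2) (1 / (2 * (K1 + 1))))"
  have s: "0 < s" "s \<le> R / 2" "s < s1" using s1 R K1 by (auto simp: s_def min_def)
  have "s \<le> 1 / (2 * (K1 + 1))" by (simp add: s_def)
  then have "s * K1 \<le> 1 / (2 * (K1 + 1)) * K1" using K1 by (rule mult_right_mono)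
  also have "\<dots> \<le> 1 / 2" using K1 by (simp add: field_simps)
  finally have sK1: "s * K1 \<le> 1 / 2" .
  define KT where "KT = KA * KL ^ r * (1 + real r / s) ^ r"
  have KT: "0 \<le> KT" unfolding KT_def using KA_nonneg KL_ge_1 s by simp
  \<comment> \<open>The 2 results from moving half of the norm at \<gamma> to the left-hand
    side.\<close>
  define K2 where "K2 = 2 * C * m * q * KT"
  have K2: "0 \<le> K2" unfolding K2_def using C q KT by simp
  define N where "N = (\<lambda>\<gamma> D. \<Sum>j\<in>UNIV. nagumo (k + l) s (r * multi_deg n \<gamma>) D (\<Phi> \<gamma> j))"
  have N: "0 \<le> N \<gamma> D" for \<gamma> D unfolding N_def using s by (intro sum_nonneg nagumo_nonneg) simp
  have rec: "N \<gamma> D \<le> K2 * (\<Sum>\<mu>\<in>{\<mu>. \<mu> \<le> \<gamma>} - {\<gamma>}. (2 / R) ^ multi_deg n (\<lambda>i. \<gamma> i - \<mu> i) * N \<mu> (D + r))"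
    if \<gamma>: "\<gamma> \<in> multi_indices n - S" for \<gamma> D
  proof -
    let ?\<Sigma> = "\<Sum>\<mu>\<in>{\<mu>. \<mu> \<le> \<gamma>} - {\<gamma>}. (2 / R) ^ multi_deg n (\<lambda>i. \<gamma> i - \<mu> i) * N \<mu> (D + r)"
    define \<kappa> where "\<kappa> = (1 + real (multi_deg n \<gamma>)) ^ r"
    define p where "p = r * multi_deg n \<gamma>"
    have \<kappa>: "0 < \<kappa>" by (simp add: \<kappa>_def)
    have \<gamma>n: "\<gamma> \<in> multi_indices n" using \<gamma> by simp
    define w where "w = (\<lambda>i b. (symb \<gamma> *v (\<chi> j. \<Phi> \<gamma> j b)) $ i)"
    have "\<kappa> * (\<Sum>j\<in>UNIV. nagumo (k + l) s p D (\<Phi> \<gamma> j)) \<le> C * (\<Sum>i\<in>UNIV. nagumo (k + l) s p D (w i))"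
    proof (rule nagumo_system)
      fix b show "\<kappa> * (\<Sum>j\<in>UNIV. norm (\<Phi> \<gamma> j b)) \<le> C * (\<Sum>i\<in>UNIV. norm (w i b))"
        using elliptic[OF \<gamma>, of "\<chi> j. \<Phi> \<gamma> j b"] by (simp add: w_def \<kappa>_def)
    qed (use s in simp)
    also have "\<dots> \<le> C * (\<Sum>i\<in>(UNIV :: 'm set). q * (s * (4 * KA * KL ^ r / R)) * \<kappa> * N \<gamma> D + q * KT * \<kappa> * ?\<Sigma>)"
    proof (intro mult_left_mono sum_mono)
      fix i
      have "nagumo (k + l) s p D (w i) = nagumo (k + l) s p D (\<lambda>b. - (diag_rest \<Phi> \<gamma> i b + off_diag \<Phi> \<gamma> i b))"
      proof (rule nagumo_cong)
        fix b assume b: "b \<in> multi_indices (k + l)"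
        have "w i b + (diag_rest \<Phi> \<gamma> i b + off_diag \<Phi> \<gamma> i b) = 0"
          using formal_arr_split[OF \<gamma>n b, of \<Phi> i] eq[OF \<gamma> b, of i] by (simp add: w_def add.assoc)
        then show "w i b = - (diag_rest \<Phi> \<gamma> i b + off_diag \<Phi> \<gamma> i b)" by (simp only: eq_neg_iff_add_eq_0)
      qed
      also have "\<dots> \<le> nagumo (k + l) s p D (diag_rest \<Phi> \<gamma> i) + nagumo (k + l) s p D (off_diag \<Phi> \<gamma> i)"
        unfolding nagumo_uminus using s by (intro nagumo_add) simp
      also have "nagumo (k + l) s p D (diag_rest \<Phi> \<gamma> i) \<le> q * (s * (4 * KA * KL ^ r / R)) * \<kappa> * N \<gamma> D"
        unfolding q_def \<kappa>_def N_def p_def by (rule diag_rest_nagumo[OF \<gamma>n s(1,2)])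
      also have "nagumo (k + l) s p D (off_diag \<Phi> \<gamma> i) \<le> q * KT * \<kappa> * ?\<Sigma>"
        unfolding q_def \<kappa>_def N_def p_def KT_def by (rule off_diag_nagumo[OF \<gamma>n s(1,2)])
      finally show "nagumo (k + l) s p D (w i) \<le> q * (s * (4 * KA * KL ^ r / R)) * \<kappa> * N \<gamma> D + q * KT * \<kappa> * ?\<Sigma>" by simp
    qed (use C in simp)
    also have "\<dots> = \<kappa> * (s * K1 * N \<gamma> D + C * m * q * KT * ?\<Sigma>)"
      by (simp add: m_def K1_def field_simps)
    finally have "\<kappa> * N \<gamma> D \<le> \<kappa> * (s * K1 * N \<gamma> D + C * m * q * KT * ?\<Sigma>)" by (simp add: N_def p_def)
    then have "N \<gamma> D \<le> s * K1 * N \<gamma> D + C * m * q * KT * ?\<Sigma>" using \<kappa> by simp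
    also have "s * K1 * N \<gamma> D \<le> 1 / 2 * N \<gamma> D" using sK1 N by (rule mult_right_mono)
    finally show ?thesis by (simp add: K2_def)
  qed
  define K where "K = (\<Sum>\<gamma>\<in>?S. \<Sum>j\<in>UNIV. ps_norm (k + l) s (\<Phi> \<gamma> j))"
  have psn: "0 \<le> ps_norm (k + l) s (\<Phi> \<gamma> j)" for \<gamma> j using s by (intro ps_norm_nonneg) simp
  have K: "0 \<le> K" unfolding K_def by (intro sum_nonneg psn)
  \<comment> \<open>The level 0 norms of the starting slices are finite at s, which is less than
    their radii; a higher level only lowers them, so K serves all levels and truncations.\<close>
  have base: "N \<gamma> D \<le> K" if \<gamma>: "\<gamma> \<in> ?S" for \<gamma> D
  proof -
    have "nagumo (k + l) s (r * multi_deg n \<gamma>) D (\<Phi> \<gamma> j) \<le> ps_norm (k + l) s (\<Phi> \<gamma> j)" for j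
    proof -
      have "s < \<rho> (\<gamma>, j)" using s1(2)[of "(\<gamma>, j)"] \<gamma> s(3) by auto
      then have "ps_summable (k + l) s (\<Phi> \<gamma> j)" using bspec[OF \<rho>, of "(\<gamma>, j)"] \<gamma> s(1) by (auto simp: ps_conv_def)
      then have "nagumo (k + l) s 0 D (\<Phi> \<gamma> j) \<le> ps_norm (k + l) s (\<Phi> \<gamma> j)"
        unfolding ps_norm_def using s(1) by (intro nagumo_le_infsum) auto
      then show ?thesis using nagumo_mono_p[of s 0 "r * multi_deg n \<gamma>" "k + l" D "\<Phi> \<gamma> j"] s(1) by simp
    qed
    then have "N \<gamma> D \<le> (\<Sum>j\<in>UNIV. ps_norm (k + l) s (\<Phi> \<gamma> j))" unfolding N_def by (rule sum_mono)
    also have "\<dots> \<le> K" unfolding K_def using \<gamma> finS by (intro member_le_sum sum_nonneg psn) auto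
    finally show ?thesis .
  qed
  \<comment> \<open>The growth rate. B \<ge> 4 / R gives q' = (2 / R) / B \<le> 1/2, and B \<ge> (4
    / R) K2 2^n makes K2 times the sum of the powers of q' over nonzero \<delta> at most 1.\<close>
  define B where "B = 1 + 4 / R + 4 / R * K2 * 2 ^ n"
  have B1: "1 \<le> B" "4 / R \<le> B" "4 / R * K2 * 2 ^ n \<le> B" unfolding B_def using R K2 by auto
  define q' where "q' = 2 / R / B"
  have q': "0 \<le> q'" "q' \<le> 1/2" "K2 * (2 * q' * 2 ^ n) \<le> 1" unfolding q'_def using B1 R by (auto simp: field_simps)
  \<comment> \<open>The truncation stays arbitrary in the induction: the bound at \<gamma> with
    \<open>D\<close> calls for the bounds at \<mu> with \<open>D + r\<close>.\<close>
  have growth: "N \<gamma> D \<le> K * B ^ multi_deg n \<gamma>" if "\<gamma> \<in> multi_indices n" for \<gamma> D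
    using that
  proof (induction "multi_deg n \<gamma>" arbitrary: \<gamma> D rule: less_induct)
    case less
    show ?case
    proof (cases "\<gamma> \<in> S")
      case True
      then have "N \<gamma> D \<le> K" using base less.prems by blast
      also have "\<dots> \<le> K * B ^ multi_deg n \<gamma>" using K B1(1) by (simp add: mult_le_cancel_left1)
      finally show ?thesis .
    next
      case False
      then have \<gamma>: "\<gamma> \<in> multi_indices n - S" using less.prems by simp
      have "N \<gamma> D \<le> K2 * (\<Sum>\<mu>\<in>{\<mu>. \<mu> \<le> \<gamma>} - {\<gamma>}. (2 / R) ^ multi_deg n (\<lambda>i. \<gamma> i - \<mu> i) * N \<mu> (D + r))"
        by (rule rec[OF \<gamma>])
      also have "\<dots> \<le> K2 * (\<Sum>\<mu>\<in>{\<mu>. \<mu> \<le> \<gamma>} - {\<gamma>}. K * B ^ multi_deg n \<gamma> * q' ^ multi_deg n (\<lambda>i. \<gamma> i - \<mu> i))"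
      proof (intro mult_left_mono sum_mono)
        fix \<mu> assume \<mu>: "\<mu> \<in> {\<mu>. \<mu> \<le> \<gamma>} - {\<gamma>}"
        then have \<mu>': "\<mu> \<le> \<gamma>" "\<mu> \<noteq> \<gamma>" by auto
        define d where "d = multi_deg n (\<lambda>i. \<gamma> i - \<mu> i)"
        have "multi_deg n \<gamma> = d + multi_deg n \<mu>"
          unfolding d_def using multi_deg_diff[OF \<mu>'(1), of n] multi_deg_mono[OF \<mu>'(1), of n] by simp
        then have Bd: "B ^ multi_deg n \<gamma> = B ^ d * B ^ multi_deg n \<mu>" by (simp add: power_add)
        have "N \<mu> (D + r) \<le> K * B ^ multi_deg n \<mu>"
          by (rule less.hyps) (use multi_deg_less[OF less.prems \<mu>'] multi_indices_le[OF less.prems \<mu>'(1)] in auto)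
        then have "(2 / R) ^ d * N \<mu> (D + r) \<le> (2 / R) ^ d * (K * B ^ multi_deg n \<mu>)" using R by (intro mult_left_mono) auto
        also have "\<dots> = K * B ^ multi_deg n \<gamma> * q' ^ d"
          unfolding Bd q'_def using B1(1) by (simp add: power_divide power_mult_distrib)
        finally show "(2 / R) ^ multi_deg n (\<lambda>i. \<gamma> i - \<mu> i) * N \<mu> (D + r) \<le> K * B ^ multi_deg n \<gamma> * q' ^ multi_deg n (\<lambda>i. \<gamma> i - \<mu> i)"
          by (simp add: d_def)
      qed (rule K2)
      also have "\<dots> = K * B ^ multi_deg n \<gamma> * (K2 * (\<Sum>\<mu>\<in>{\<mu>. \<mu> \<le> \<gamma>} - {\<gamma>}. q' ^ multi_deg n (\<lambda>i. \<gamma> i - \<mu> i)))"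
        unfolding sum_distrib_left[symmetric] by (simp only: mult_ac)
      \<comment> \<open>Substitution \<delta> = \<gamma> - \<mu>; the excluded index \<mu> =
        \<gamma> becomes \<delta> = 0.\<close>
      also have "(\<Sum>\<mu>\<in>{\<mu>. \<mu> \<le> \<gamma>} - {\<gamma>}. q' ^ multi_deg n (\<lambda>i. \<gamma> i - \<mu> i)) = (\<Sum>\<delta>\<in>{\<delta>. \<delta> \<le> \<gamma>} - {\<lambda>_. 0}. q' ^ multi_deg n \<delta>)"
      proof (rule sum.reindex_bij_witness[of _ "\<lambda>\<delta> i. \<gamma> i - \<delta> i" "\<lambda>\<delta> i. \<gamma> i - \<delta> i"])
        have inv: "(\<lambda>i. \<gamma> i - (\<gamma> i - \<mu> i)) = \<mu>" if "\<mu> \<le> \<gamma>" for \<mu>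
          using that by (auto simp: le_fun_def)
        show "(\<lambda>i. \<gamma> i - (\<gamma> i - \<mu> i)) = \<mu>" if "\<mu> \<in> {\<mu>. \<mu> \<le> \<gamma>} - {\<gamma>}" for \<mu>
          using inv that by blast
        show "(\<lambda>i. \<gamma> i - (\<gamma> i - \<mu> i)) = \<mu>" if "\<mu> \<in> {\<mu>. \<mu> \<le> \<gamma>} - {\<lambda>_. 0}" for \<mu>
          using inv that by blast
        show "(\<lambda>i. \<gamma> i - \<mu> i) \<in> {\<mu>. \<mu> \<le> \<gamma>} - {\<lambda>_. 0}" if \<mu>: "\<mu> \<in> {\<mu>. \<mu> \<le> \<gamma>} - {\<gamma>}" for \<mu>
        proof -
          have "(\<lambda>i. \<gamma> i - \<mu> i) \<noteq> (\<lambda>_. 0)"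
          proof
            assume eq: "(\<lambda>i. \<gamma> i - \<mu> i) = (\<lambda>_. 0)"
            have "(\<lambda>i. \<gamma> i - (\<gamma> i - \<mu> i)) = \<gamma>" using fun_cong[OF eq] by simp
            then show False using inv[of \<mu>] \<mu> by simp
          qed
          then show ?thesis by (auto simp: le_fun_def)
        qed
        show "(\<lambda>i. \<gamma> i - \<mu> i) \<in> {\<mu>. \<mu> \<le> \<gamma>} - {\<gamma>}" if \<mu>: "\<mu> \<in> {\<mu>. \<mu> \<le> \<gamma>} - {\<lambda>_. 0}" for \<mu>
        proof -
          have "(\<lambda>i. \<gamma> i - \<mu> i) \<noteq> \<gamma>"
          proof
            assume eq: "(\<lambda>i. \<gamma> i - \<mu> i) = \<gamma>"
            have "(\<lambda>i. \<gamma> i - (\<gamma> i - \<mu> i)) = (\<lambda>_. 0)" using fun_cong[OF eq] by simp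
            then show False using inv[of \<mu>] \<mu> by simp
          qed
          then show ?thesis by (auto simp: le_fun_def)
        qed
      qed simp
      also have "K * B ^ multi_deg n \<gamma> * (K2 * (\<Sum>\<delta>\<in>{\<delta>. \<delta> \<le> \<gamma>} - {\<lambda>_. 0}. q' ^ multi_deg n \<delta>)) \<le> K * B ^ multi_deg n \<gamma> * 1"
      proof (rule mult_left_mono)
        have "K2 * (\<Sum>\<delta>\<in>{\<delta>. \<delta> \<le> \<gamma>} - {\<lambda>_. 0}. q' ^ multi_deg n \<delta>) \<le> K2 * (2 * q' * 2 ^ n)"
          by (intro mult_left_mono sum_power_multi_deg_nonzero_le q' less.prems K2)
        then show "K2 * (\<Sum>\<delta>\<in>{\<delta>. \<delta> \<le> \<gamma>} - {\<lambda>_. 0}. q' ^ multi_deg n \<delta>) \<le> 1" using q'(3) by linarith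
      qed (use K B1 in simp)
      finally show ?thesis by simp
    qed
  qed
  show ?thesis
  proof (rule ps_conv_of_slices[of "s / 2" "2 ^ r * B" K n "k + l" "\<lambda>\<gamma>. \<Phi> \<gamma> j"])
    fix \<gamma> D assume \<gamma>: "\<gamma> \<in> multi_indices n"
    \<comment> \<open>Return to level 0 at half the radius; the loss 2^(r |\<gamma>|) joins the rate
      B as the factor 2^r.\<close>
    have "nagumo (k + l) (s / 2) 0 D (\<Phi> \<gamma> j) \<le> 2 ^ (r * multi_deg n \<gamma>) * nagumo (k + l) s (r * multi_deg n \<gamma>) D (\<Phi> \<gamma> j)"
      using s by (intro nagumo_half_le) simp
    also have "nagumo (k + l) s (r * multi_deg n \<gamma>) D (\<Phi> \<gamma> j) \<le> N \<gamma> D"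
      unfolding N_def using s by (intro member_le_sum nagumo_nonneg) auto
    also have "N \<gamma> D \<le> K * B ^ multi_deg n \<gamma>" by (rule growth[OF \<gamma>])
    finally show "nagumo (k + l) (s / 2) 0 D (\<Phi> \<gamma> j) \<le> K * (2 ^ r * B) ^ multi_deg n \<gamma>"
      by (simp add: power_mult_distrib power_mult mult_ac)
  qed (use s B1 K in auto)
qed

end

text \<open>The mechanism of \<open>nagumo_no_const\<close>, now for values on the polydisc: every
  term of positive degree carries a factor s / s0.\<close>

lemma norm_ps_eval_diff_const:
  assumes c: "ps_summable d s0 c" and s: "0 < s" "s \<le> s0" and y: "\<And>i. i < d \<Longrightarrow> norm (y i) \<le> s"
  shows "norm (ps_eval d c y - c (\<lambda>_. 0)) \<le> s / s0 * ps_norm d s0 c"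
proof -
  let ?f = "\<lambda>\<alpha>. c \<alpha> * multi_pow d y \<alpha>" and ?Z = "multi_indices d - {\<lambda>_. 0}"
  have sm: "(\<lambda>\<alpha>. norm (?f \<alpha>)) summable_on multi_indices d"
    by (rule ps_terms_summable[OF ps_summable_mono[OF c, of s]]) (use s y in auto)
  have fs: "?f summable_on multi_indices d" by (rule abs_summable_imp_summable[OF sm])
  have "ps_eval d c y = infsum ?f (insert (\<lambda>_. 0) ?Z)"
    unfolding ps_eval_def by (simp add: insert_absorb)
  also have "\<dots> = ?f (\<lambda>_. 0) + infsum ?f ?Z"
    by (rule infsum_insert) (use summable_on_subset_banach[OF fs] in auto)
  finally have "ps_eval d c y - c (\<lambda>_. 0) = infsum ?f ?Z" by simp
  also have "norm \<dots> \<le> (\<Sum>\<^sub>\<infinity>\<alpha>\<in>?Z. norm (?f \<alpha>))"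
    by (rule norm_infsum_bound) (rule summable_on_subset_banach[OF sm], simp)
  also have "\<dots> \<le> (\<Sum>\<^sub>\<infinity>\<alpha>\<in>multi_indices d. s / s0 * (norm (c \<alpha>) * s0 ^ multi_deg d \<alpha>))"
  proof (rule infsum_mono_neutral)
    show "(\<lambda>\<alpha>. norm (?f \<alpha>)) summable_on ?Z" by (rule summable_on_subset_banach[OF sm]) simp
    show "(\<lambda>\<alpha>. s / s0 * (norm (c \<alpha>) * s0 ^ multi_deg d \<alpha>)) summable_on multi_indices d"
      using c unfolding ps_summable_def by (rule summable_on_cmult_right)
    fix \<alpha> assume "\<alpha> \<in> ?Z \<inter> multi_indices d"
    then obtain b where b: "multi_deg d \<alpha> = Suc b"
      using multi_deg_eq_0_iff[of \<alpha> d] not0_implies_Suc by auto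
    have "norm (?f \<alpha>) \<le> norm (c \<alpha>) * s ^ Suc b"
      unfolding norm_mult b[symmetric] by (intro mult_left_mono norm_multi_pow_le y) auto
    also have "\<dots> \<le> norm (c \<alpha>) * (s / s0 * s0 ^ Suc b)"
      using s by (intro mult_left_mono) (auto simp: power_mono)
    finally show "norm (?f \<alpha>) \<le> s / s0 * (norm (c \<alpha>) * s0 ^ multi_deg d \<alpha>)"
      unfolding b by (simp only: mult_ac)
  qed (use s in auto)
  also have "\<dots> = s / s0 * ps_norm d s0 c" unfolding ps_norm_def by (rule infsum_cmult_right')
  finally show ?thesis .
qed

lemma det_nonzeroI:
  fixes M :: "complex ^ 'm::finite ^ 'm"
  assumes "\<And>v. M *v v = 0 \<Longrightarrow> v = 0"
  shows "det M \<noteq> 0"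
  using assms matrix_left_invertible_ker[of M] invertible_left_inverse[of M] invertible_det_nz[of M] by blast

context regular_expansion_at
begin

lemma uniformly_invertible:
  "\<exists>s>0. s \<le> R \<and> (\<forall>\<gamma>\<in>multi_indices n - S. \<forall>x z. in_box 0 k l x0 z0 s (\<lambda>_. 0) x z \<longrightarrow>
     det (sigma_star n P x z (\<lambda>i. lam i z + of_nat (\<gamma> i))) \<noteq> 0)"
proof -
  define q where "q = real (card (op_supp P))"
  define m where "m = real (CARD('m))"
  define K1 where "K1 = C * m * q * (2 / R * (KA * KL ^ r))"
  have q: "0 \<le> q" "0 \<le> m" by (auto simp: q_def m_def)
  have KK: "0 \<le> KA * KL ^ r" using KA_nonneg KL_ge_1 by simp
  have K1: "0 \<le> K1" unfolding K1_def using C q KA_nonneg KL_ge_1 R by simp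
  \<comment> \<open>Makes \<open>s * K1\<close> less than 1: a kernel vector v will satisfy |v|
    \<le> s K1 |v| in the l1 norm and must vanish.\<close>
  define s where "s = min (R / 2) (1 / (2 * (K1 + 1)))"
  have s: "0 < s" "s \<le> R / 2" using R K1 by (auto simp: s_def)
  have "s \<le> 1 / (2 * (K1 + 1))" by (simp add: s_def)
  then have "s * K1 \<le> 1 / (2 * (K1 + 1)) * K1" using K1 by (rule mult_right_mono)
  also have "\<dots> < 1" using K1 by (simp add: field_simps)
  finally have sK1: "s * K1 < 1" .
  have "det (sigma_star n P x z (\<lambda>i. lam i z + of_nat (\<gamma> i))) \<noteq> 0"
    if \<gamma>: "\<gamma> \<in> multi_indices n - S" and box: "in_box 0 k l x0 z0 s (\<lambda>_. 0) x z" for \<gamma> x z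
  proof (rule det_nonzeroI)
    fix v assume v0: "sigma_star n P x z (\<lambda>i. lam i z + of_nat (\<gamma> i)) *v v = 0"
    define \<kappa> where "\<kappa> = (1 + real (multi_deg n \<gamma>)) ^ r"
    let ?\<sigma> = "sigma_star n P x z (\<lambda>i. lam i z + of_nat (\<gamma> i))"
    have boxR: "in_box n k l x0 z0 R (\<lambda>_. 0) x z" "in_box 0 k l x0 z0 R (\<lambda>_. 0) x z"
      using in_box_mono[OF box, of R] s R by (auto simp: in_box_def Euclidean_space_topspace)
    let ?y = "pt 0 k x0 z0 (\<lambda>_. 0) x z"
    have y: "norm (?y i) \<le> s" if "i < k + l" for i using pt_norm_less[OF box, of i] that by simp
    have entry: "norm (?\<sigma> $ i $ j - symb \<gamma> $ i $ j) \<le> q * (s * (2 / R * (KA * KL ^ r))) * \<kappa>" for i j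
    proof -
      have summand: "norm (P \<alpha> (\<lambda>_. 0) (\<lambda>_. 0) x z $ i $ j * multi_pow n (\<lambda>i. lam i z + of_nat (\<gamma> i)) \<alpha> -
          A \<alpha> (\<lambda>_. 0) (i, j) (\<lambda>_. 0) * multi_pow n (\<lambda>i. L i (\<lambda>_. 0) + of_nat (\<gamma> i)) \<alpha>) \<le> s * (2 / R * (KA * KL ^ r)) * \<kappa>"
        if \<alpha>: "\<alpha> \<in> supp0" for \<alpha>
      proof -
        let ?a = "\<lambda>b. A \<alpha> (\<lambda>_. 0) (i, j) (jn n (\<lambda>_. 0) b)" and ?l = "ps_lam_pow L n \<alpha> \<gamma>"
        have \<alpha>': "(\<alpha>, \<lambda>_. 0) \<in> op_supp P" using \<alpha> by simp
        have R2: "0 < R / 2" using R by simp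
        have Pe: "P \<alpha> (\<lambda>_. 0) (\<lambda>_. 0) x z $ i $ j = ps_eval (k + l) ?a ?y"
          using expandsD[OF A_expands[OF \<alpha>', of i j] boxR(1)] by (simp add: pt_def ps_eval_jn_zero)
        have le: "expands 0 k l (\<lambda>_ _ z. multi_pow n (\<lambda>i. lam i z + of_nat (\<gamma> i)) \<alpha>) x0 z0 R ?l"
          by (rule expands_lam_pow[OF L R])
        have Le: "multi_pow n (\<lambda>i. lam i z + of_nat (\<gamma> i)) \<alpha> = ps_eval (k + l) ?l ?y"
          using expandsD[OF le boxR(2)] by simp
        have aconv: "ps_conv (k + l) R ?a"
          using A_expands[OF \<alpha>', of i j] ps_conv_slice[OF _ multi_indices_zero] by (auto simp: expands_def)
        have lconv: "ps_conv (k + l) R ?l" using le by (simp add: expands_def)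
        have ev: "ps_eval (k + l) (ps_mult ?a ?l) ?y = ps_eval (k + l) ?a ?y * ps_eval (k + l) ?l ?y"
          by (rule ps_eval_mult[OF aconv lconv R]) (use pt_norm_less[OF boxR(2)] in simp)
        have l0: "?l (\<lambda>_. 0) = multi_pow n (\<lambda>i. L i (\<lambda>_. 0) + of_nat (\<gamma> i)) \<alpha>"
          using expands_center[OF le x0 z0] expands_center[OF L x0 z0] by (simp add: multi_pow_def)
        have c0: "ps_mult ?a ?l (\<lambda>_. 0) = A \<alpha> (\<lambda>_. 0) (i, j) (\<lambda>_. 0) * multi_pow n (\<lambda>i. L i (\<lambda>_. 0) + of_nat (\<gamma> i)) \<alpha>"
          by (simp add: ps_mult_at_0 l0)
        show ?thesis
        proof (cases "multi_deg n \<alpha> \<le> r")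
          case True
          have asum: "ps_summable (k + l) (R / 2) ?a" by (rule ps_summable_slice(1)[OF A_summable[OF \<alpha>'] multi_indices_zero R2])
          have anorm: "ps_norm (k + l) (R / 2) ?a \<le> KA"
            using ps_summable_slice(2)[OF A_summable[OF \<alpha>'] multi_indices_zero R2, of i j] A_norm[OF \<alpha>', of i j] by (simp add: ps_norm_def)
          have "norm (ps_eval (k + l) (ps_mult ?a ?l) ?y - ps_mult ?a ?l (\<lambda>_. 0)) \<le> s / (R / 2) * ps_norm (k + l) (R / 2) (ps_mult ?a ?l)"
            by (rule norm_ps_eval_diff_const[OF ps_summable_mult(1)[OF asum lam_pow_norm(1)[OF True]] s(1,2) y]) (use R in auto)
          also have "\<dots> \<le> s / (R / 2) * (KA * (KL ^ r * \<kappa>))"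
          proof (intro mult_left_mono)
            have "ps_norm (k + l) (R / 2) ?l \<le> KL ^ r * (1 + real (multi_deg n \<gamma>)) ^ multi_deg n \<alpha>"
              by (rule lam_pow_norm(2)[OF True])
            also have "\<dots> \<le> KL ^ r * \<kappa>" unfolding \<kappa>_def using True KL_ge_1 by (intro mult_left_mono power_increasing) auto
            finally have ln: "ps_norm (k + l) (R / 2) ?l \<le> KL ^ r * \<kappa>" .
            have "ps_norm (k + l) (R / 2) (ps_mult ?a ?l) \<le> ps_norm (k + l) (R / 2) ?a * ps_norm (k + l) (R / 2) ?l"
              by (rule ps_norm_mult[OF asum lam_pow_norm(1)[OF True]]) (use R in simp)
            also have "\<dots> \<le> KA * (KL ^ r * \<kappa>)"
              using anorm ln KA_nonneg R by (intro mult_mono ps_norm_nonneg) auto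
            finally show "ps_norm (k + l) (R / 2) (ps_mult ?a ?l) \<le> KA * (KL ^ r * \<kappa>)" .
          qed (use s R in simp)
          finally show ?thesis unfolding ev Pe[symmetric] Le[symmetric] c0 by (simp add: mult_ac)
        next
          case False
          have a0: "?a b = 0" if "b \<in> multi_indices (k + l)" for b
            using order[OF \<alpha>'] False jn_mem[OF multi_indices_zero that] by simp
          have "ps_eval (k + l) ?a ?y = ps_eval (k + l) (\<lambda>_. 0) ?y" by (rule ps_eval_cong) (use a0 in auto)
          then show ?thesis using a0[of "\<lambda>_. 0"] s R KK by (simp add: Pe \<kappa>_def)
        qed
      qed
      have "norm (?\<sigma> $ i $ j - symb \<gamma> $ i $ j) \<le> (\<Sum>\<alpha>\<in>supp0. s * (2 / R * (KA * KL ^ r)) * \<kappa>)"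
        unfolding sigma_star_def symb_def vec_lambda_beta sum_subtractf[symmetric]
        by (rule order_trans[OF norm_sum sum_mono[OF summand]])
      also have "\<dots> = real (card supp0) * (s * (2 / R * (KA * KL ^ r)) * \<kappa>)" by simp
      also have "\<dots> \<le> q * (s * (2 / R * (KA * KL ^ r)) * \<kappa>)"
        using card_supp0 s R KK by (intro mult_right_mono) (auto simp: q_def \<kappa>_def)
      finally show ?thesis by (simp add: mult_ac)
    qed
    have "\<kappa> * l1norm v \<le> C * l1norm (symb \<gamma> *v v)" unfolding \<kappa>_def by (rule elliptic[OF \<gamma>])
    also have "\<dots> \<le> C * (\<Sum>i\<in>(UNIV :: 'm set). q * (s * (2 / R * (KA * KL ^ r))) * \<kappa> * l1norm v)"
    proof (intro mult_left_mono sum_mono)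
      fix i
      have "(\<Sum>j\<in>UNIV. ?\<sigma> $ i $ j * v $ j) = 0"
        using arg_cong[OF v0, of "\<lambda>w. w $ i"] by (simp add: matrix_vector_mult_def)
      then have "(symb \<gamma> *v v) $ i = - (\<Sum>j\<in>UNIV. (?\<sigma> $ i $ j - symb \<gamma> $ i $ j) * v $ j)"
        by (simp add: matrix_vector_mult_def left_diff_distrib sum_subtractf)
      then have "norm ((symb \<gamma> *v v) $ i) \<le> (\<Sum>j\<in>UNIV. norm ((?\<sigma> $ i $ j - symb \<gamma> $ i $ j) * v $ j))"
        by (simp add: norm_sum)
      also have "\<dots> \<le> (\<Sum>j\<in>UNIV. q * (s * (2 / R * (KA * KL ^ r))) * \<kappa> * norm (v $ j))"
        unfolding norm_mult by (intro sum_mono mult_right_mono entry) auto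
      finally show "norm ((symb \<gamma> *v v) $ i) \<le> q * (s * (2 / R * (KA * KL ^ r))) * \<kappa> * l1norm v"
        by (simp add: sum_distrib_left)
    qed (use C in simp)
    also have "\<dots> = \<kappa> * ((s * K1) * l1norm v)" by (simp add: K1_def m_def mult_ac)
    finally have "l1norm v \<le> (s * K1) * l1norm v" by (simp add: \<kappa>_def)
    moreover have "0 \<le> l1norm v" by (intro sum_nonneg) auto
    ultimately have "l1norm v = 0"
      using sK1 by (smt (verit) mult_le_cancel_right1)
    then show "v = 0" by (simp add: sum_nonneg_eq_0_iff vec_eq_iff)
  qed
  then show ?thesis using s R by (intro exI[of _ s]) auto
qed

end

section \<open>Germs and formal series\<close>

lemma multi_deriv_zero_index [simp]: "multi_deriv d (\<lambda>_. 0) f = f"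
proof -
  have "fold (\<lambda>i. partial_deriv i ^^ 0) xs f = f" for xs :: "nat list" by (induction xs) auto
  then show ?thesis by (simp add: multi_deriv_def)
qed

lemma multi_deriv_const_zero: "multi_deriv d \<alpha> (\<lambda>_. 0 :: 'b::real_normed_vector) = (\<lambda>_. 0)"
proof -
  have pd: "partial_deriv i (\<lambda>_. 0 :: 'b) = (\<lambda>_. 0)" for i
    by (auto simp: partial_deriv_def)
  have pw: "(partial_deriv i ^^ m) (\<lambda>_. 0 :: 'b) = (\<lambda>_. 0)" for i m by (induction m) (auto simp: pd)
  have "fold (\<lambda>i. partial_deriv i ^^ \<alpha> i) xs (\<lambda>_. 0 :: 'b) = (\<lambda>_. 0)" for xs by (induction xs) (auto simp: pw)
  then show ?thesis by (simp add: multi_deriv_def)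
qed

lemma taylor_coeff_zero_index: "taylor_coeff n f (\<lambda>_. 0) x z = f (\<lambda>_. 0) x z"
  by (simp add: taylor_coeff_def)

lemma A_M_vec_iff:
  "f \<in> A_M_vec n k l N U \<longleftrightarrow> (\<forall>x\<in>N. \<forall>z\<in>U. \<exists>R C. vexpands vec_prj n k l f x z R C)"
proof
  assume f: "f \<in> A_M_vec n k l N U"
  show "\<forall>x\<in>N. \<forall>z\<in>U. \<exists>R C. vexpands vec_prj n k l f x z R C"
  proof (intro ballI)
    fix x z assume xz: "x \<in> N" "z \<in> U"
    have "\<exists>R c. expands n k l (\<lambda>t x z. f t x z $ j) x z R c" for j
      using f xz unfolding A_M_vec_def A_M_def by (simp add: jointly_analytic_at_iff)
    then show "\<exists>R C. vexpands vec_prj n k l f x z R C"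
      using vexpandsI[of n k l vec_prj f x z] by metis
  qed
next
  assume *: "\<forall>x\<in>N. \<forall>z\<in>U. \<exists>R C. vexpands vec_prj n k l f x z R C"
  show "f \<in> A_M_vec n k l N U"
    unfolding A_M_vec_def A_M_def
  proof clarsimp
    fix j x z assume xz: "x \<in> N" "z \<in> U"
    then obtain R C where "vexpands vec_prj n k l f x z R C" using * by blast
    then show "jointly_analytic_at n k l (\<lambda>t x z. f t x z $ j) (\<lambda>_. 0) x z"
      unfolding jointly_analytic_at_iff vexpands_def by blast
  qed
qed

lemma A_N_iff:
  "u \<in> A_N k l N U \<longleftrightarrow> (\<forall>x\<in>N. \<forall>z\<in>U. \<exists>R C. vexpands vec_prj 0 k l (\<lambda>_. u) x z R C) \<and>
     (\<forall>x z. x \<notin> N \<or> z \<notin> U \<longrightarrow> u x z = 0)"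
proof -
  have "(\<forall>x\<in>N. \<forall>z\<in>U. \<forall>j. jointly_analytic_at 0 k l (\<lambda>t x z. u x z $ j) (\<lambda>_. 0) x z) \<longleftrightarrow> (\<lambda>_. u) \<in> A_M_vec 0 k l N U"
    unfolding A_M_vec_def A_M_def by auto
  then show ?thesis unfolding A_N_def by (simp add: A_M_vec_iff)
qed

text \<open>Pointwise summation in t. Where the family is not summable \<open>infsum\<close> returns
  0, which is harmless: only values near the zero section matter.\<close>

definition series :: "nat \<Rightarrow> ((nat \<Rightarrow> nat) \<Rightarrow> (nat \<Rightarrow> real) \<Rightarrow> (nat \<Rightarrow> complex) \<Rightarrow> complex ^ 'm::finite)
     \<Rightarrow> (nat \<Rightarrow> real) \<Rightarrow> (nat \<Rightarrow> real) \<Rightarrow> (nat \<Rightarrow> complex) \<Rightarrow> complex ^ 'm" where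
  "series n \<phi> t x z = (\<chi> j. \<Sum>\<^sub>\<infinity>\<gamma>\<in>multi_indices n. \<phi> \<gamma> x z $ j * of_real (multi_pow n t \<gamma>))"

lemma vexpands_series:
  assumes conv: "\<And>j. ps_conv (n + (k + l)) R (C j)" and R: "0 < R"
    and \<phi>: "\<And>\<gamma>. \<gamma> \<in> multi_indices n \<Longrightarrow> vexpands vec_prj 0 k l (\<lambda>_. \<phi> \<gamma>) x0 z0 R (\<lambda>j b. C j (jn n \<gamma> b))"
  shows "vexpands vec_prj n k l (series n \<phi>) x0 z0 R C"
  unfolding vexpands_def expands_def
proof safe
  fix j t x z assume box: "in_box n k l x0 z0 R t x z"
  then have box0: "in_box 0 k l x0 z0 R (\<lambda>_. 0) x z" by (simp add: in_box_def Euclidean_space_topspace)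
  let ?w = "jn k (\<lambda>i. of_real (x i - x0 i)) (\<lambda>i. z i - z0 i)"
  have 1: "((\<lambda>\<gamma>. ps_eval (k + l) (\<lambda>b. C j (jn n \<gamma> b)) ?w * multi_pow n (\<lambda>i. of_real (t i)) \<gamma>) has_sum
      ps_eval (n + (k + l)) (C j) (jn n (\<lambda>i. of_real (t i)) ?w)) (multi_indices n)"
  proof (rule ps_eval_jn_has_sum[OF conv R])
    show "norm (of_real (t i) :: complex) < R" if "i < n" for i using box that by (simp add: in_box_def)
    show "norm (?w i) < R" if "i < k + l" for i using pt_norm_less[OF box0, of i] that by (simp add: pt_def)
  qed
  have 2: "ps_eval (k + l) (\<lambda>b. C j (jn n \<gamma> b)) ?w = \<phi> \<gamma> x z $ j" if "\<gamma> \<in> multi_indices n" for \<gamma>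
    using expandsD[OF \<phi>[OF that, unfolded vexpands_def, rule_format, of j] box0] by (simp add: pt_def)
  have "((\<lambda>\<gamma>. \<phi> \<gamma> x z $ j * of_real (multi_pow n t \<gamma>)) has_sum ps_eval (n + (k + l)) (C j) (pt n k x0 z0 t x z)) (multi_indices n)"
    unfolding pt_def by (rule has_sum_cong[THEN iffD1, OF _ 1]) (simp only: 2 multi_pow_of_real)
  then show "series n \<phi> t x z $ j = ps_eval (n + (k + l)) (C j) (pt n k x0 z0 t x z)"
    by (simp add: series_def infsumI)
qed (use R conv in auto)

locale open_pair =
  fixes k l :: nat and N :: "(nat \<Rightarrow> real) set" and U :: "(nat \<Rightarrow> complex) set"
  assumes N: "openin (Euclidean_space k) N" and U: "openin (Complex_space l) U"
begin

lemma N_top: "x \<in> N \<Longrightarrow> x \<in> topspace (Euclidean_space k)" and U_top: "z \<in> U \<Longrightarrow> z \<in> topspace (Complex_space l)"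
  using N U openin_subset by blast+

lemma box_subset:
  assumes "x0 \<in> N" "z0 \<in> U"
  shows "\<exists>R>0. \<forall>n t x z. in_box n k l x0 z0 R t x z \<longrightarrow> x \<in> N \<and> z \<in> U"
proof -
  obtain R where R: "0 < R" "\<And>t x z. in_box 0 k l x0 z0 R t x z \<Longrightarrow> x \<in> N \<and> z \<in> U"
    using box_in_Times[OF N U assms, of 0] by metis
  have "x \<in> N \<and> z \<in> U" if "in_box n k l x0 z0 R t x z" for n t x z
    using R(2)[of "\<lambda>_. 0" x z] that by (simp add: in_box_def Euclidean_space_topspace)
  then show ?thesis using R(1) by blast
qed

text \<open>For a germ one radius serves all Taylor coefficients. It is reduced so that the box
  stays over \<open>N\<close> and \<open>U\<close>, because \<open>taylor\<close> is set to 0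
  elsewhere.\<close>

lemma taylor_vexpands:
  assumes f: "vexpands vec_prj n k l f x0 z0 R C" and p: "x0 \<in> N" "z0 \<in> U"
  shows "\<exists>s>0. s \<le> R \<and> (\<forall>\<gamma>\<in>multi_indices n. vexpands vec_prj 0 k l (\<lambda>_. taylor n N U f \<gamma>) x0 z0 s (\<lambda>j b. C j (jn n \<gamma> b)))"
proof -
  obtain R' where R': "0 < R'" "\<forall>n t x z. in_box n k l x0 z0 R' t x z \<longrightarrow> x \<in> N \<and> z \<in> U" using box_subset[OF p] by blast
  have R: "0 < R" "ps_conv (n + (k + l)) R (C j)" for j using f by (auto simp: vexpands_def expands_def)
  define s where "s = min R R'"
  have s: "0 < s" "s \<le> R" "s \<le> R'" using R R' by (auto simp: s_def)
  have "vexpands vec_prj 0 k l (\<lambda>_. taylor n N U f \<gamma>) x0 z0 s (\<lambda>j b. C j (jn n \<gamma> b))" if \<gamma>: "\<gamma> \<in> multi_indices n" for \<gamma>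
    unfolding vexpands_def expands_def
  proof safe
    fix j
    show "ps_conv (0 + (k + l)) s (\<lambda>b. C j (jn n \<gamma> b))" using ps_conv_mono[OF ps_conv_slice[OF R(2) \<gamma>] s(2)] by simp
    fix t x z assume box: "in_box 0 k l x0 z0 s t x z"
    have "x \<in> N" "z \<in> U" using R'(2) in_box_mono[OF box s(3)] by blast+
    moreover have "in_box n k l x0 z0 R (\<lambda>_. 0) x z"
      using in_box_mono[OF box s(2)] R(1) by (simp add: in_box_def Euclidean_space_topspace)
    ultimately show "taylor n N U f \<gamma> x z $ j = ps_eval (0 + (k + l)) (\<lambda>b. C j (jn n \<gamma> b)) (pt 0 k x0 z0 t x z)"
      using taylor_coeff_expands[OF components_vec f \<gamma>, of x z j] \<gamma> by (simp add: taylor_def pt_def)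
  qed (rule s)
  then show ?thesis using s by blast
qed

lemma taylor_coeff_center:
  assumes "vexpands vec_prj n k l f x0 z0 R C" "x0 \<in> N" "z0 \<in> U" "\<gamma> \<in> multi_indices n"
  shows "taylor_coeff n f \<gamma> x0 z0 $ j = C j (jn n \<gamma> (\<lambda>_. 0))"
proof -
  have "0 < R" using assms(1) by (simp add: vexpands_def expands_def)
  then have "in_box n k l x0 z0 R (\<lambda>_. 0) x0 z0" using N_top U_top assms by (intro in_box_center) auto
  from taylor_coeff_expands[OF components_vec assms(1,4) this] show ?thesis by (simp add: pt_center ps_eval_at_0)
qed

lemma taylor_in_A_hat:
  assumes f: "f \<in> A_M_vec n k l N U" shows "taylor n N U f \<in> A_hat n k l N U"
proof -
  have "taylor n N U f \<gamma> \<in> A_N k l N U" if \<gamma>: "\<gamma> \<in> multi_indices n" for \<gamma>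
    unfolding A_N_iff
  proof (intro conjI ballI allI impI)
    fix x z assume p: "x \<in> N" "z \<in> U"
    obtain R C where RC: "vexpands vec_prj n k l f x z R C" using f p unfolding A_M_vec_iff by blast
    show "\<exists>R C. vexpands vec_prj 0 k l (\<lambda>_. taylor n N U f \<gamma>) x z R C"
      using taylor_vexpands[OF RC p] \<gamma> by blast
  next
    fix x z assume "x \<notin> N \<or> z \<notin> U"
    then show "taylor n N U f \<gamma> x z = 0" by (auto simp: taylor_def)
  qed
  then show ?thesis by (auto simp: A_hat_def taylor_def fun_eq_iff)
qed

text \<open>The way to show that a formal series comes from a germ. The required arrays are produced
  later by the convergence estimate, by masking an array, or by lifting one.\<close>

lemma taylor_series:
  assumes \<phi>: "\<phi> \<in> A_hat n k l N U"
    and loc: "\<And>x z. x \<in> N \<Longrightarrow> z \<in> U \<Longrightarrow> \<exists>R>0. \<exists>C. (\<forall>j. ps_conv (n + (k + l)) R (C j)) \<and>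
       (\<forall>\<gamma>\<in>multi_indices n. vexpands vec_prj 0 k l (\<lambda>_. \<phi> \<gamma>) x z R (\<lambda>j b. C j (jn n \<gamma> b)))"
  shows "series n \<phi> \<in> A_M_vec n k l N U" "taylor n N U (series n \<phi>) = \<phi>"
proof -
  have ex: "\<exists>R C. vexpands vec_prj n k l (series n \<phi>) x z R C \<and>
       (\<forall>\<gamma>\<in>multi_indices n. vexpands vec_prj 0 k l (\<lambda>_. \<phi> \<gamma>) x z R (\<lambda>j b. C j (jn n \<gamma> b)))" if "x \<in> N" "z \<in> U" for x z
    using loc[OF that] vexpands_series by metis
  then show "series n \<phi> \<in> A_M_vec n k l N U" unfolding A_M_vec_iff by blast
  show "taylor n N U (series n \<phi>) = \<phi>"
  proof (intro ext)
    fix \<gamma> x z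
    show "taylor n N U (series n \<phi>) \<gamma> x z = \<phi> \<gamma> x z"
    proof (cases "\<gamma> \<in> multi_indices n \<and> x \<in> N \<and> z \<in> U")
      case True
      then obtain R C where RC: "vexpands vec_prj n k l (series n \<phi>) x z R C"
        "vexpands vec_prj 0 k l (\<lambda>_. \<phi> \<gamma>) x z R (\<lambda>j b. C j (jn n \<gamma> b))" using ex by blast
      have "taylor_coeff n (series n \<phi>) \<gamma> x z $ j = \<phi> \<gamma> x z $ j" for j
        using taylor_coeff_center[OF RC(1)] True expands_center[OF RC(2)[unfolded vexpands_def, rule_format, of j]] N_top U_top by simp
      then show ?thesis using True by (simp add: taylor_def vec_eq_iff)
    next
      case False
      have "\<phi> \<gamma> x z = 0"
      proof (cases "\<gamma> \<in> multi_indices n")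
        case True
        then have "\<phi> \<gamma> \<in> A_N k l N U" using \<phi> by (simp add: A_hat_def)
        then show ?thesis using False True unfolding A_N_def by blast
      qed (use \<phi> in \<open>simp add: A_hat_def\<close>)
      then show ?thesis using False unfolding taylor_def by presburger
    qed
  qed
qed

lemma expands_zero_array:
  assumes "expands n k l f x0 z0 R c" "x0 \<in> N" "z0 \<in> U" "0 < s" "\<And>t x z. in_box n k l x0 z0 s t x z \<Longrightarrow> f t x z = 0"
    "\<alpha> \<in> multi_indices (n + (k + l))"
  shows "c \<alpha> = 0"
proof -
  have "expands n k l f x0 z0 s (\<lambda>_. 0)" using assms(4,5) by (simp add: expands_def)
  from expands_unique[OF assms(1) this assms(6)] N_top U_top assms(2,3) show ?thesis by simp
qed

text \<open>If all Taylor coefficients vanish on \<open>N \<times> U\<close>, every slice of a local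
  array expands the zero function and is zero by uniqueness; then the array is zero, and so is the
  function on its box.\<close>

lemma near_zero_iff:
  assumes h: "h \<in> A_M_vec n k l N U"
  shows "near_N n k l N U (\<lambda>t x z. h t x z = 0) \<longleftrightarrow> (\<forall>\<gamma>\<in>multi_indices n. \<forall>x\<in>N. \<forall>z\<in>U. taylor_coeff n h \<gamma> x z = 0)"
proof -
  have NU: "N \<subseteq> topspace (Euclidean_space k)" "U \<subseteq> topspace (Complex_space l)" using N_top U_top by blast+
  show ?thesis unfolding near_N_boxes[OF NU]
  proof (intro iffI ballI)
    fix \<gamma> x z assume *: "\<forall>x0\<in>N. \<forall>z0\<in>U. \<exists>R>0. \<forall>t x z. in_box n k l x0 z0 R t x z \<longrightarrow> h t x z = 0"
      and \<gamma>: "\<gamma> \<in> multi_indices n" and xz: "x \<in> N" "z \<in> U"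
    then obtain s where s: "0 < s" "\<forall>t x' z'. in_box n k l x z s t x' z' \<longrightarrow> h t x' z' = 0" by blast
    obtain R C where RC: "vexpands vec_prj n k l h x z R C" using h xz unfolding A_M_vec_iff by blast
    have "C j (jn n \<gamma> (\<lambda>_. 0)) = 0" for j
      by (rule expands_zero_array[OF RC[unfolded vexpands_def, rule_format, of j] xz s(1)])
         (use s(2) jn_mem[OF \<gamma> multi_indices_zero] in auto)
    then show "taylor_coeff n h \<gamma> x z = 0" using taylor_coeff_center[OF RC xz \<gamma>] by (simp add: vec_eq_iff)
  next
    fix x0 z0 assume *: "\<forall>\<gamma>\<in>multi_indices n. \<forall>x\<in>N. \<forall>z\<in>U. taylor_coeff n h \<gamma> x z = 0" and p: "x0 \<in> N" "z0 \<in> U"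
    obtain R C where RC: "vexpands vec_prj n k l h x0 z0 R C" using h p unfolding A_M_vec_iff by blast
    obtain s where s: "0 < s" "s \<le> R" "\<forall>\<gamma>\<in>multi_indices n. vexpands vec_prj 0 k l (\<lambda>_. taylor n N U h \<gamma>) x0 z0 s (\<lambda>j b. C j (jn n \<gamma> b))"
      using taylor_vexpands[OF RC p] by blast
    have t0: "taylor n N U h \<gamma> = (\<lambda>_ _. 0)" for \<gamma> using * by (auto simp: taylor_def fun_eq_iff)
    have C0: "C j \<delta> = 0" if \<delta>: "\<delta> \<in> multi_indices (n + (k + l))" for j \<delta>
    proof -
      obtain \<gamma> b where d: "\<gamma> \<in> multi_indices n" "b \<in> multi_indices (k + l)" "\<delta> = jn n \<gamma> b" using jn_cases[OF \<delta>] by blast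
      have "expands 0 k l (\<lambda>_ _ _. 0) x0 z0 s (\<lambda>b. C j (jn n \<gamma> b))"
        using s(3) d(1) unfolding vexpands_def t0 by simp
      from expands_zero_array[OF this p s(1)] d show ?thesis by simp
    qed
    have "h t x z = 0" if "in_box n k l x0 z0 R t x z" for t x z
    proof -
      have "h t x z $ j = 0" for j
      proof -
        have "h t x z $ j = ps_eval (n + (k + l)) (C j) (pt n k x0 z0 t x z)"
          by (rule expandsD[OF RC[unfolded vexpands_def, rule_format, of j] that])
        also have "\<dots> = ps_eval (n + (k + l)) (\<lambda>_. 0) (pt n k x0 z0 t x z)"
          by (rule ps_eval_cong) (use C0 in auto)
        finally show ?thesis by simp
      qed
      then show ?thesis by (simp add: vec_eq_iff)
    qed
    moreover have "0 < R" using RC by (simp add: vexpands_def expands_def)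
    ultimately show "\<exists>R>0. \<forall>t x z. in_box n k l x0 z0 R t x z \<longrightarrow> h t x z = 0" by blast
  qed
qed

end

locale operator_setting = open_pair k l N U
  for n k l :: nat and N U and P :: "'m::finite op_matrix" and lam :: "nat \<Rightarrow> (nat \<Rightarrow> complex) \<Rightarrow> complex" +
  assumes P: "P \<in> D_star n k l N U" and lam: "\<And>i. i < n \<Longrightarrow> lam i \<in> O_space l U"
begin

text \<open>A common radius exists because \<open>op_supp\<close> and the set of components of
  \<lambda> are finite; the expansions of \<lambda> in z are lifted to (x, z).\<close>

lemma expansion_at_exists:
  assumes p: "x0 \<in> N" "z0 \<in> U"
  shows "\<exists>R A L. expansion_at n k l P lam x0 z0 R A L"
proof -
  have fin: "finite (op_supp P)" "op_supp P \<subseteq> multi_indices n \<times> multi_indices k" using P by (auto simp: D_star_def)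
  have "\<exists>R>0. \<exists>A. vexpands mat_prj n k l (P (fst p) (snd p)) x0 z0 R A" for p
  proof -
    have "\<exists>R c. expands n k l (\<lambda>t x z. mat_prj ij (P (fst p) (snd p) t x z)) x0 z0 R c" for ij
      using P assms unfolding D_star_def A_M_def by (cases ij) (auto simp: jointly_analytic_at_iff)
    then obtain R A where "0 < R" "vexpands mat_prj n k l (P (fst p) (snd p)) x0 z0 R A"
      using vexpandsI[of n k l mat_prj "P (fst p) (snd p)" x0 z0] by metis
    then show ?thesis by blast
  qed
  then have "\<forall>p. \<exists>RA. 0 < fst RA \<and> vexpands mat_prj n k l (P (fst p) (snd p)) x0 z0 (fst RA) (snd RA)" by simp
  from choice[OF this] obtain RA where RA: "\<forall>p. 0 < fst (RA p) \<and> vexpands mat_prj n k l (P (fst p) (snd p)) x0 z0 (fst (RA p)) (snd (RA p))" ..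
  have "\<forall>i\<in>{..<n}. \<exists>RL. 0 < fst RL \<and> expands 0 k l (\<lambda>_ _. lam i) x0 z0 (fst RL) (snd RL)"
  proof
    fix i assume "i \<in> {..<n}"
    then have "jointly_analytic_at 0 0 l (\<lambda>t x. lam i) (\<lambda>_. 0) (\<lambda>_. 0) z0"
      using lam[of i] p by (simp add: O_space_def)
    then obtain R c where "expands 0 0 l (\<lambda>_ _. lam i) (\<lambda>_. 0) z0 R c" unfolding jointly_analytic_at_iff by blast
    from expands_lift_x[OF this] have e: "expands 0 k l (\<lambda>_ _. lam i) x0 z0 R (ps_lift k c)" .
    then have "0 < R" by (simp add: expands_def)
    with e show "\<exists>RL. 0 < fst RL \<and> expands 0 k l (\<lambda>_ _. lam i) x0 z0 (fst RL) (snd RL)" by (intro exI[of _ "(R, ps_lift k c)"]) simp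
  qed
  from bchoice[OF this] obtain RL where RL: "\<forall>i\<in>{..<n}. 0 < fst (RL i) \<and> expands 0 k l (\<lambda>_ _. lam i) x0 z0 (fst (RL i)) (snd (RL i))" ..
  obtain s1 where s1: "0 < s1" "\<And>p. p \<in> op_supp P \<Longrightarrow> s1 \<le> fst (RA p)"
    using finite_common_radius[OF fin(1), of "\<lambda>p. fst (RA p)"] RA by metis
  obtain s2 where s2: "0 < s2" "\<And>i. i \<in> {..<n} \<Longrightarrow> s2 \<le> fst (RL i)"
    using finite_common_radius[of "{..<n}" "\<lambda>i. fst (RL i)"] RL by blast
  define s where "s = min s1 s2"
  have s: "0 < s" "s \<le> s1" "s \<le> s2" using s1 s2 by (auto simp: s_def)
  have "expansion_at n k l P lam x0 z0 s (\<lambda>\<alpha> \<beta>. snd (RA (\<alpha>, \<beta>))) (\<lambda>i. snd (RL i))"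
  proof
    show "0 < s" "x0 \<in> topspace (Euclidean_space k)" "z0 \<in> topspace (Complex_space l)" using s p N_top U_top by auto
    show "finite (op_supp P)" "op_supp P \<subseteq> multi_indices n \<times> multi_indices k" by (rule fin)+
    show "vexpands mat_prj n k l (P \<alpha> \<beta>) x0 z0 s (snd (RA (\<alpha>, \<beta>)))" if "(\<alpha>, \<beta>) \<in> op_supp P" for \<alpha> \<beta>
      using RA[rule_format, of "(\<alpha>, \<beta>)"] s s1(2)[OF that] vexpands_mono[OF _ s(1), of mat_prj n k l "P \<alpha> \<beta>" x0 z0 "fst (RA (\<alpha>, \<beta>))"] by simp
    show "expands 0 k l (\<lambda>_ _. lam i) x0 z0 s (snd (RL i))" if "i < n" for i
      using RL s s2(2)[of i] that expands_mono[OF _ s(1), of 0 k l "\<lambda>_ _. lam i" x0 z0 "fst (RL i)"] by simp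
  qed
  then show ?thesis by blast
qed

lemma conj_apply_in_A_M_vec:
  assumes f: "f \<in> A_M_vec n k l N U"
  shows "conj_apply n k P lam f \<in> A_M_vec n k l N U"
  unfolding A_M_vec_iff
proof (intro ballI)
  fix x z assume p: "x \<in> N" "z \<in> U"
  obtain R A L where "expansion_at n k l P lam x z R A L" using expansion_at_exists[OF p] by blast
  then interpret expansion_at n k l P lam x z R A L .
  obtain R' C where f': "vexpands vec_prj n k l f x z R' C" using f p unfolding A_M_vec_iff by blast
  have "0 < R'" using f' by (simp add: vexpands_def expands_def)
  then have "vexpands vec_prj n k l (conj_apply n k P lam f) x z (min R R') (conj_arr C)"
    using R by (intro vexpands_conj_apply vexpands_mono[OF f']) auto
  then show "\<exists>R C. vexpands vec_prj n k l (conj_apply n k P lam f) x z R C" by blast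
qed

text \<open>The given point is itself taken as the centre of all expansions, so the equality of
  constant terms in \<open>conj_arr_center\<close> is already the equality of values.\<close>

lemma taylor_conj_apply:
  assumes f: "f \<in> A_M_vec n k l N U" and \<gamma>: "\<gamma> \<in> multi_indices n" and p: "x \<in> N" "z \<in> U"
  shows "taylor_coeff n (conj_apply n k P lam f) \<gamma> x z = formal_apply n k P lam (taylor n N U f) \<gamma> x z"
proof -
  obtain R A L where "expansion_at n k l P lam x z R A L" using expansion_at_exists[OF p] by blast
  then interpret expansion_at n k l P lam x z R A L .
  obtain R' C where f': "vexpands vec_prj n k l f x z R' C" using f p unfolding A_M_vec_iff by blast
  have R': "0 < R'" using f' by (simp add: vexpands_def expands_def)
  have c: "vexpands vec_prj n k l (conj_apply n k P lam f) x z (min R R') (conj_arr C)"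
    using R R' by (intro vexpands_conj_apply vexpands_mono[OF f']) auto
  obtain s where s: "0 < s" "s \<le> R'" "\<forall>\<gamma>\<in>multi_indices n. vexpands vec_prj 0 k l (\<lambda>_. taylor n N U f \<gamma>) x z s (\<lambda>j b. C j (jn n \<gamma> b))"
    using taylor_vexpands[OF f' p] by blast
  have fa: "vexpands vec_prj 0 k l (\<lambda>_. formal_apply n k P lam (taylor n N U f) \<gamma>) x z (min R s) (formal_arr (\<lambda>\<mu> j b. C j (jn n \<mu> b)) \<gamma>)"
  proof (rule vexpands_formal_apply[OF \<gamma>])
    fix \<mu> assume "\<mu> \<le> \<gamma>"
    then have "vexpands vec_prj 0 k l (\<lambda>_. taylor n N U f \<mu>) x z s (\<lambda>j b. C j (jn n \<mu> b))" using s(3) multi_indices_le[OF \<gamma>] by blast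
    then show "vexpands vec_prj 0 k l (\<lambda>_. taylor n N U f \<mu>) x z (min R s) (\<lambda>j b. C j (jn n \<mu> b))"
      by (rule vexpands_mono) (use s R in auto)
  qed (use s R in auto)
  have "taylor_coeff n (conj_apply n k P lam f) \<gamma> x z $ i = formal_apply n k P lam (taylor n N U f) \<gamma> x z $ i" for i
    using taylor_coeff_center[OF c p \<gamma>, of i] expands_center[OF fa[unfolded vexpands_def, rule_format, of i] x0 z0] conj_arr_center[OF \<gamma>, of C i] by simp
  then show ?thesis by (simp add: vec_eq_iff)
qed

lemma Sol_iff:
  "\<phi> \<in> Sol n k l N U P lam \<longleftrightarrow> \<phi> \<in> taylor n N U ` A_M_vec n k l N U \<and>
     (\<forall>\<gamma>\<in>multi_indices n. \<forall>x\<in>N. \<forall>z\<in>U. formal_apply n k P lam \<phi> \<gamma> x z = 0)"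
proof -
  have "near_N n k l N U (\<lambda>t x z. conj_apply n k P lam f t x z = 0) \<longleftrightarrow>
      (\<forall>\<gamma>\<in>multi_indices n. \<forall>x\<in>N. \<forall>z\<in>U. formal_apply n k P lam (taylor n N U f) \<gamma> x z = 0)"
    if f: "f \<in> A_M_vec n k l N U" for f
    unfolding near_zero_iff[OF conj_apply_in_A_M_vec[OF f]] using taylor_conj_apply[OF f] by simp
  then show ?thesis unfolding Sol_def by auto
qed

lemma P_zero: "\<beta> \<noteq> (\<lambda>_. 0) \<Longrightarrow> x \<in> N \<Longrightarrow> z \<in> U \<Longrightarrow> P \<alpha> \<beta> (\<lambda>_. 0) x z = 0"
  using P by (simp add: D_star_def)

text \<open>Only \<mu> = \<gamma> meets the coefficients at t = 0, where those with \<beta> \<noteq>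
  0 vanish. The remainder is again a \<open>formal_apply\<close>, of the series with its \<gamma>-th
  term erased; its analyticity and its dependence on lower indices alone then follow from the
  general lemmas.\<close>

lemma formal_apply_split:
  assumes \<gamma>: "\<gamma> \<in> multi_indices n" and p: "x \<in> N" "z \<in> U"
  shows "formal_apply n k P lam \<phi> \<gamma> x z = sigma_star n P x z (\<lambda>i. lam i z + of_nat (\<gamma> i)) *v \<phi> \<gamma> x z +
     formal_apply n k P lam (\<lambda>\<mu>. if \<mu> = \<gamma> then (\<lambda>_ _. 0) else \<phi> \<mu>) \<gamma> x z"
proof -
  let ?T = "\<lambda>\<phi> p \<mu>. taylor_coeff n (P (fst p) (snd p)) (\<lambda>i. \<gamma> i - \<mu> i) x z *v
          (multi_pow n (\<lambda>i. lam i z + of_nat (\<mu> i)) (fst p) *s multi_deriv k (snd p) (\<lambda>x. \<phi> \<mu> x z) x)"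
  let ?\<phi>' = "\<lambda>\<mu>. if \<mu> = \<gamma> then (\<lambda>_ _. 0) else \<phi> \<mu>"
  have fin: "finite {\<mu>. \<mu> \<le> \<gamma>}" by (rule finite_le_multi_index[OF \<gamma>])
  have finP: "finite (op_supp P)" using P by (simp add: D_star_def)
  have fa: "formal_apply n k P lam \<psi> \<gamma> x z = (\<Sum>p\<in>op_supp P. ?T \<psi> p \<gamma>) + (\<Sum>p\<in>op_supp P. \<Sum>\<mu>\<in>{\<mu>. \<mu> \<le> \<gamma>} - {\<gamma>}. ?T \<psi> p \<mu>)" for \<psi>
  proof -
    have "formal_apply n k P lam \<psi> \<gamma> x z = (\<Sum>p\<in>op_supp P. ?T \<psi> p \<gamma> + (\<Sum>\<mu>\<in>{\<mu>. \<mu> \<le> \<gamma>} - {\<gamma>}. ?T \<psi> p \<mu>))"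
      unfolding formal_apply_def case_prod_beta' by (rule sum.cong[OF refl], rule sum.remove[OF fin]) simp
    then show ?thesis by (simp only: sum.distrib)
  qed
  have mv0: "A *v (c *s (0 :: complex ^ 'm)) = 0" for A :: "complex ^ 'm ^ 'm" and c by (simp add: vec_eq_iff matrix_vector_mult_def)
  have off: "(\<Sum>p\<in>op_supp P. \<Sum>\<mu>\<in>{\<mu>. \<mu> \<le> \<gamma>} - {\<gamma>}. ?T ?\<phi>' p \<mu>) = (\<Sum>p\<in>op_supp P. \<Sum>\<mu>\<in>{\<mu>. \<mu> \<le> \<gamma>} - {\<gamma>}. ?T \<phi> p \<mu>)"
    by (intro sum.cong refl) auto
  have diag0: "(\<Sum>p\<in>op_supp P. ?T ?\<phi>' p \<gamma>) = 0"
    by (rule sum.neutral) (simp add: multi_deriv_const_zero mv0)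
  have "(\<Sum>p\<in>op_supp P. ?T \<phi> p \<gamma>) = (\<Sum>p\<in>(\<lambda>\<alpha>. (\<alpha>, \<lambda>_. 0)) ` {\<alpha>. (\<alpha>, \<lambda>_. 0) \<in> op_supp P}. ?T \<phi> p \<gamma>)"
  proof (rule sum.mono_neutral_right[OF finP])
    show "\<forall>q\<in>op_supp P - (\<lambda>\<alpha>. (\<alpha>, \<lambda>_. 0)) ` {\<alpha>. (\<alpha>, \<lambda>_. 0) \<in> op_supp P}. ?T \<phi> q \<gamma> = 0"
    proof
      fix q assume q: "q \<in> op_supp P - (\<lambda>\<alpha>. (\<alpha>, \<lambda>_. 0)) ` {\<alpha>. (\<alpha>, \<lambda>_. 0) \<in> op_supp P}"
      obtain \<alpha> \<beta> where ab: "q = (\<alpha>, \<beta>)" by (cases q)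
      have "\<beta> \<noteq> (\<lambda>_. 0)" using q ab by auto
      then show "?T \<phi> q \<gamma> = 0" using P_zero[OF _ p] by (simp add: ab taylor_coeff_zero_index matrix_vector_mult_def vec_eq_iff)
    qed
  qed auto
  also have "\<dots> = (\<Sum>\<alpha> | (\<alpha>, \<lambda>_. 0) \<in> op_supp P. P \<alpha> (\<lambda>_. 0) (\<lambda>_. 0) x z *v (multi_pow n (\<lambda>i. lam i z + of_nat (\<gamma> i)) \<alpha> *s \<phi> \<gamma> x z))"
    by (subst sum.reindex) (auto simp: inj_on_def taylor_coeff_zero_index)
  also have "\<dots> = sigma_star n P x z (\<lambda>i. lam i z + of_nat (\<gamma> i)) *v \<phi> \<gamma> x z"
  proof -
    have "(\<Sum>\<alpha>\<in>I. \<Sum>j\<in>UNIV. a \<alpha> j * (c \<alpha> * v j)) = (\<Sum>j\<in>UNIV. (\<Sum>\<alpha>\<in>I. a \<alpha> j * c \<alpha>) * v j)"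
      for I and a :: "(nat \<Rightarrow> nat) \<Rightarrow> 'm \<Rightarrow> complex" and c v
      unfolding sum_distrib_right by (subst sum.swap) (simp add: mult.assoc)
    then show ?thesis by (simp add: vec_eq_iff sigma_star_def matrix_vector_mult_def)
  qed
  finally show ?thesis unfolding fa[of \<phi>] fa[of ?\<phi>'] off diag0 by simp
qed

lemma formal_apply_cong:
  assumes "\<And>\<mu>. \<mu> \<le> \<gamma> \<Longrightarrow> \<phi> \<mu> = \<phi>' \<mu>"
  shows "formal_apply n k P lam \<phi> \<gamma> x z = formal_apply n k P lam \<phi>' \<gamma> x z"
  unfolding formal_apply_def using assms by (intro sum.cong refl) auto

lemma formal_apply_zero: "formal_apply n k P lam (\<lambda>_ _ _. 0) \<gamma> x z = 0"
proof -
  have mv0: "A *v (c *s (0 :: complex ^ 'm)) = 0" for A :: "complex ^ 'm ^ 'm" and c by (simp add: vec_eq_iff matrix_vector_mult_def)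
  show ?thesis unfolding formal_apply_def by (intro sum.neutral ballI) (auto simp: multi_deriv_const_zero mv0)
qed

end

section \<open>Solutions modulo the boundary\<close>

lemma Sigma_bar_subset: "Sigma_bar n S \<subseteq> multi_indices n"
  by (auto simp: Sigma_bar_def)

lemma Sigma_bar_le:
  assumes "\<alpha> \<in> Sigma_bar n S" "\<beta> \<le> \<alpha>" shows "\<beta> \<in> Sigma_bar n S"
proof -
  obtain \<gamma> where \<gamma>: "\<alpha> \<in> multi_indices n" "\<gamma> \<in> multi_indices n" "(\<lambda>i. \<alpha> i + \<gamma> i) \<in> S" using assms(1) by (auto simp: Sigma_bar_def)
  have "(\<lambda>i. \<beta> i + ((\<alpha> i - \<beta> i) + \<gamma> i)) = (\<lambda>i. \<alpha> i + \<gamma> i)"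
    using assms(2) by (simp add: fun_eq_iff le_fun_def trans_le_add1)
  then have "(\<lambda>i. \<beta> i + ((\<alpha> i - \<beta> i) + \<gamma> i)) \<in> S" using \<gamma>(3) by simp
  then show ?thesis
    unfolding Sigma_bar_def using multi_indices_add[OF multi_indices_diff[OF \<gamma>(1), of \<beta>] \<gamma>(2)] multi_indices_le[OF \<gamma>(1) assms(2)]
    by (intro CollectI conjI bexI[of _ "\<lambda>i. (\<alpha> i - \<beta> i) + \<gamma> i"])
qed

lemma subset_Sigma_bar: "S \<subseteq> multi_indices n \<Longrightarrow> S \<subseteq> Sigma_bar n S"
  by (auto simp: Sigma_bar_def intro!: bexI[of _ "\<lambda>_. 0"])

lemma finite_Sigma_bar:
  assumes "finite S" "S \<subseteq> multi_indices n" shows "finite (Sigma_bar n S)"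
proof (rule finite_subset)
  show "Sigma_bar n S \<subseteq> (\<Union>\<gamma>\<in>S. {\<beta>. \<beta> \<le> \<gamma>})"
  proof
    fix \<beta> assume "\<beta> \<in> Sigma_bar n S"
    then obtain \<gamma> where "(\<lambda>i. \<beta> i + \<gamma> i) \<in> S" by (auto simp: Sigma_bar_def)
    then show "\<beta> \<in> (\<Union>\<gamma>\<in>S. {\<beta>. \<beta> \<le> \<gamma>})" by (rule UN_I) (simp add: le_fun_def)
  qed
  show "finite (\<Union>\<gamma>\<in>S. {\<beta>. \<beta> \<le> \<gamma>})" using assms finite_le_multi_index by blast
qed

lemma finite_Sigma_bd:
  assumes "finite S" "S \<subseteq> multi_indices n" shows "finite (Sigma_bd n S)"
proof (rule finite_subset)
  \<comment> \<open>An index at distance 1 from \<gamma> is at most \<gamma> + (1, ..., 1).\<close>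
  let ?up = "\<lambda>\<gamma> i. if i < n then \<gamma> i + 1 else 0 :: nat"
  have "?up \<gamma> \<in> multi_indices n" for \<gamma> by (simp add: multi_indices_def)
  then show "finite (\<Union>\<gamma>\<in>Sigma_bar n S. {\<beta>. \<beta> \<le> ?up \<gamma>})"
    using finite_Sigma_bar[OF assms] finite_le_multi_index by blast
  show "Sigma_bd n S \<subseteq> (\<Union>\<gamma>\<in>Sigma_bar n S. {\<beta>. \<beta> \<le> ?up \<gamma>})"
  proof
    fix \<alpha> assume "\<alpha> \<in> Sigma_bd n S"
    then obtain \<gamma> where \<alpha>: "\<alpha> \<in> multi_indices n" and \<gamma>: "\<gamma> \<in> Sigma_bar n S" "(\<Sum>i<n. \<bar>int (\<alpha> i) - int (\<gamma> i)\<bar>) = 1"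
      by (auto simp: Sigma_bd_def)
    have "\<bar>int (\<alpha> i) - int (\<gamma> i)\<bar> \<le> 1" if "i < n" for i
      using member_le_sum[of i "{..<n}" "\<lambda>i. \<bar>int (\<alpha> i) - int (\<gamma> i)\<bar>"] that \<gamma>(2) by simp
    then have "\<alpha> i \<le> ?up \<gamma> i" for i using \<alpha> by (cases "i < n") (fastforce simp: multi_indices_def)+
    then show "\<alpha> \<in> (\<Union>\<gamma>\<in>Sigma_bar n S. {\<beta>. \<beta> \<le> ?up \<gamma>})" using \<gamma>(1) by (intro UN_I[of \<gamma>] CollectI le_funI)
  qed
qed

text \<open>Descending from \<gamma> by unit steps must lead into \<open>Sigma_bar\<close>, which
  contains 0; the last index before entering is a boundary index. Hence the monomials with index
  outside \<open>Sigma_bar\<close> are multiples of boundary monomials.\<close>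

lemma Sigma_bd_le:
  assumes \<gamma>: "\<gamma> \<in> multi_indices n - Sigma_bar n S" and ne: "Sigma_bar n S \<noteq> {}"
  shows "\<exists>\<beta>\<in>Sigma_bd n S. \<beta> \<le> \<gamma>"
  using \<gamma>
proof (induction "multi_deg n \<gamma>" arbitrary: \<gamma>)
  case (0 \<gamma>)
  then have "\<gamma> = (\<lambda>_. 0)" using multi_deg_eq_0_iff[of \<gamma> n] by auto
  moreover obtain \<alpha> where "\<alpha> \<in> Sigma_bar n S" using ne by blast
  ultimately have "\<gamma> \<in> Sigma_bar n S" using Sigma_bar_le[of \<alpha> n S \<gamma>] by (simp add: le_fun_def)
  then show ?case using 0 by blast
next
  case (Suc D \<gamma>)
  then have "\<gamma> \<noteq> (\<lambda>_. 0)" using multi_deg_eq_0_iff[of \<gamma> n] by auto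
  then obtain i where i: "\<gamma> i \<noteq> 0" by auto
  have "i < n"
  proof (rule ccontr)
    assume "\<not> i < n"
    then show False using i Suc.prems by (simp add: multi_indices_def)
  qed
  define \<gamma>' where "\<gamma>' = \<gamma>(i := \<gamma> i - 1)"
  have le: "\<gamma>' \<le> \<gamma>" by (simp add: \<gamma>'_def le_fun_def)
  have MI: "\<gamma>' \<in> multi_indices n" using Suc.prems multi_indices_le[OF _ le] by blast
  show ?case
  proof (cases "\<gamma>' \<in> Sigma_bar n S")
    case True
    have "(\<Sum>j<n. \<bar>int (\<gamma> j) - int (\<gamma>' j)\<bar>) = (\<Sum>j<n. if j = i then 1 else 0)"
      using i by (intro sum.cong) (auto simp: \<gamma>'_def)
    then have "(\<Sum>j<n. \<bar>int (\<gamma> j) - int (\<gamma>' j)\<bar>) = 1" using \<open>i < n\<close> by simp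
    then have "\<gamma> \<in> Sigma_bd n S" unfolding Sigma_bd_def using Suc.prems True by blast
    then show ?thesis by blast
  next
    case False
    have "\<gamma> = (\<lambda>j. \<gamma>' j + (if j = i then 1 else 0))" using i by (auto simp: \<gamma>'_def)
    then have "multi_deg n \<gamma> = multi_deg n \<gamma>' + multi_deg n (\<lambda>j. if j = i then 1 else 0)" using multi_deg_add by metis
    moreover have "multi_deg n (\<lambda>j. if j = i then 1 else 0) = 1" using \<open>i < n\<close> by (simp add: multi_deg_def)
    ultimately have "D = multi_deg n \<gamma>'" using Suc.hyps(2) by simp
    from Suc.hyps(1)[OF this] MI False obtain \<beta> where "\<beta> \<in> Sigma_bd n S" "\<beta> \<le> \<gamma>'" by blast
    then show ?thesis using le order_trans by blast
  qed
qed

section \<open>Ideals generated by monomials in t\<close>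

definition ps_monom :: "nat \<Rightarrow> (nat \<Rightarrow> nat) \<Rightarrow> (nat \<Rightarrow> nat) \<Rightarrow> complex" where
  "ps_monom n \<beta> = (\<lambda>\<delta>. if \<delta> = jn n \<beta> (\<lambda>_. 0) then 1 else 0)"

lemma expands_monom:
  assumes "0 < R" "\<beta> \<in> multi_indices n"
  shows "expands n k l (\<lambda>t x z. of_real (multi_pow n t \<beta>)) x0 z0 R (ps_monom n \<beta>)"
proof -
  have "multi_pow (n + (k + l)) (pt n k x0 z0 t x z) (jn n \<beta> (\<lambda>_. 0)) = of_real (multi_pow n t \<beta>)" for t x z
    by (simp add: pt_def multi_pow_jn multi_pow_of_real)
  then show ?thesis
    using assms jn_mem[OF assms(2) multi_indices_zero[of "k + l"]] by (simp add: expands_def ps_monom_def ps_eval_single)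
qed

lemma ps_mult_monom:
  assumes \<gamma>: "\<gamma> \<in> multi_indices n" and b: "b \<in> multi_indices e"
    and \<beta>: "\<beta> \<in> multi_indices n"
  shows "ps_mult (ps_monom n \<beta>) G (jn n \<gamma> b) = (if \<beta> \<le> \<gamma> then G (jn n (\<lambda>i. \<gamma> i - \<beta> i) b) else 0)"
proof -
  have fin: "finite {\<delta>. \<delta> \<le> jn n \<gamma> b}" using finite_le_multi_index[OF jn_mem[OF \<gamma> b]] .
  have "jn n \<beta> (\<lambda>_. 0) \<le> jn n \<gamma> b \<longleftrightarrow> (\<forall>i<n. \<beta> i \<le> \<gamma> i)"
    by (auto simp: le_fun_def jn_def split: if_splits)
  also have "\<dots> \<longleftrightarrow> \<beta> \<le> \<gamma>" using \<beta> by (auto simp: le_fun_def multi_indices_def) (metis le0 not_le)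
  finally have le: "jn n \<beta> (\<lambda>_. 0) \<le> jn n \<gamma> b \<longleftrightarrow> \<beta> \<le> \<gamma>" .
  have d: "(\<lambda>i. jn n \<gamma> b i - jn n \<beta> (\<lambda>_. 0) i) = jn n (\<lambda>i. \<gamma> i - \<beta> i) b" by (auto simp: jn_def)
  have "ps_mult (ps_monom n \<beta>) G (jn n \<gamma> b) =
      (\<Sum>\<delta> | \<delta> \<le> jn n \<gamma> b. if \<delta> = jn n \<beta> (\<lambda>_. 0) then G (\<lambda>i. jn n \<gamma> b i - jn n \<beta> (\<lambda>_. 0) i) else 0)"
    unfolding ps_mult_def ps_monom_def by (intro sum.cong) auto
  then show ?thesis using fin by (simp add: le d)
qed

text \<open>Division by a monomial on the level of coefficients: the weights change by the fixed
  factor s^|\<beta>|, so the radius is kept.\<close>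

lemma ps_conv_shift:
  assumes c: "ps_conv (n + e) R c" and \<beta>: "\<beta> \<in> multi_indices (n + e)"
  shows "ps_conv (n + e) R (\<lambda>\<delta>. c (\<lambda>i. \<delta> i + \<beta> i))"
  unfolding ps_conv_def ps_summable_def
proof (intro allI impI)
  let ?d = "n + e"
  fix s :: real assume s: "0 < s \<and> s < R"
  have "(\<lambda>\<alpha>. norm (c \<alpha>) * s ^ multi_deg ?d \<alpha>) summable_on multi_indices ?d" using c s by (simp add: ps_conv_def ps_summable_def)
  then have "(\<lambda>\<alpha>. norm (c \<alpha>) * s ^ multi_deg ?d \<alpha>) summable_on (\<lambda>\<delta> i. \<delta> i + \<beta> i) ` multi_indices ?d"
    by (rule summable_on_subset_banach) (use multi_indices_add[OF _ \<beta>] in blast)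
  moreover have "inj_on (\<lambda>\<delta> i. \<delta> i + \<beta> i) (multi_indices ?d)" by (auto simp: inj_on_def fun_eq_iff)
  ultimately have "((\<lambda>\<alpha>. norm (c \<alpha>) * s ^ multi_deg ?d \<alpha>) \<circ> (\<lambda>\<delta> i. \<delta> i + \<beta> i)) summable_on multi_indices ?d"
    by (simp add: summable_on_reindex)
  then have "(\<lambda>\<delta>. inverse (s ^ multi_deg ?d \<beta>) * (norm (c (\<lambda>i. \<delta> i + \<beta> i)) * s ^ multi_deg ?d (\<lambda>i. \<delta> i + \<beta> i))) summable_on multi_indices ?d"
    unfolding comp_def by (rule summable_on_cmult_right)
  moreover have "inverse (s ^ multi_deg ?d \<beta>) * (norm (c (\<lambda>i. \<delta> i + \<beta> i)) * s ^ multi_deg ?d (\<lambda>i. \<delta> i + \<beta> i)) = norm (c (\<lambda>i. \<delta> i + \<beta> i)) * s ^ multi_deg ?d \<delta>" for \<delta>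
    using s by (simp add: multi_deg_add power_add)
  ultimately show "(\<lambda>\<delta>. norm (c (\<lambda>i. \<delta> i + \<beta> i)) * s ^ multi_deg ?d \<delta>) summable_on multi_indices ?d" by simp
qed

lemma ps_conv_mask: "ps_conv d R c \<Longrightarrow> ps_conv d R (\<lambda>\<delta>. if Q \<delta> then c \<delta> else 0)"
  unfolding ps_conv_def ps_summable_def
proof (intro allI impI)
  fix s :: real assume "\<forall>s. 0 < s \<and> s < R \<longrightarrow> (\<lambda>\<alpha>. norm (c \<alpha>) * s ^ multi_deg d \<alpha>) summable_on multi_indices d" and s: "0 < s \<and> s < R"
  then have "(\<lambda>\<alpha>. norm (c \<alpha>) * s ^ multi_deg d \<alpha>) summable_on multi_indices d" by blast
  then show "(\<lambda>\<alpha>. norm (if Q \<alpha> then c \<alpha> else 0) * s ^ multi_deg d \<alpha>) summable_on multi_indices d"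
    by (rule summable_on_comparison_test) (use s in auto)
qed

context open_pair
begin

lemma A_M_vecI_series:
  assumes "\<And>x z. x \<in> N \<Longrightarrow> z \<in> U \<Longrightarrow> \<exists>R>0. \<exists>C. (\<forall>j. ps_conv (n + (k + l)) R (C j)) \<and>
       (\<forall>\<gamma>\<in>multi_indices n. vexpands vec_prj 0 k l (\<lambda>_. \<phi> \<gamma>) x z R (\<lambda>j b. C j (jn n \<gamma> b)))"
  shows "series n \<phi> \<in> A_M_vec n k l N U"
  unfolding A_M_vec_iff using assms vexpands_series by metis

text \<open>Membership in the sum of the ideals generated by the monomials \<open>t\<^sup>\<beta>\<close>: the terms of the Taylor
  series outside the given downward closed set are distributed to the generators by \<open>B\<close>.\<close>
lemma near_N_monomial_ideal:
  fixes h :: "(nat \<Rightarrow> real) \<Rightarrow> (nat \<Rightarrow> real) \<Rightarrow> (nat \<Rightarrow> complex) \<Rightarrow> complex ^ 'm::finite"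
  assumes h: "h \<in> A_M_vec n k l N U" and E: "finite E" "E \<subseteq> multi_indices n"
    and D: "\<And>\<gamma>. \<gamma> \<in> multi_indices n \<Longrightarrow> \<gamma> \<in> D \<longleftrightarrow> \<not> (\<exists>\<beta>\<in>E. \<beta> \<le> \<gamma>)"
  shows "(\<exists>g. (\<forall>\<beta>\<in>E. g \<beta> \<in> A_M_vec n k l N U) \<and>
      near_N n k l N U (\<lambda>t x z. h t x z = (\<Sum>\<beta>\<in>E. multi_pow n t \<beta> *\<^sub>R g \<beta> t x z))) \<longleftrightarrow>
    (\<forall>\<gamma>\<in>multi_indices n \<inter> D. \<forall>x\<in>N. \<forall>z\<in>U. taylor_coeff n h \<gamma> x z = 0)" (is "?L \<longleftrightarrow> ?R")
proof -
  have NU: "N \<subseteq> topspace (Euclidean_space k)" "U \<subseteq> topspace (Complex_space l)" using N_top U_top by blast+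
  have sum_exp: "expands n k l (\<lambda>t x z. (\<Sum>\<beta>\<in>E. multi_pow n t \<beta> *\<^sub>R g \<beta> t x z) $ j) x0 z0 s (\<lambda>\<delta>. \<Sum>\<beta>\<in>E. ps_mult (ps_monom n \<beta>) (G \<beta> j) \<delta>)"
    if "0 < s" "\<And>\<beta>. \<beta> \<in> E \<Longrightarrow> vexpands vec_prj n k l (g \<beta>) x0 z0 s (G \<beta>)" for g :: "_ \<Rightarrow> _ \<Rightarrow> _ \<Rightarrow> _ \<Rightarrow> complex ^ 'm" and j x0 z0 s G
  proof -
    have "expands n k l (\<lambda>t x z. \<Sum>\<beta>\<in>E. of_real (multi_pow n t \<beta>) * g \<beta> t x z $ j) x0 z0 s (\<lambda>\<delta>. \<Sum>\<beta>\<in>E. ps_mult (ps_monom n \<beta>) (G \<beta> j) \<delta>)"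
    proof (rule expands_sum[OF _ that(1)], rule expands_mult)
      fix \<beta> assume \<beta>: "\<beta> \<in> E"
      show "expands n k l (\<lambda>t x z. of_real (multi_pow n t \<beta>)) x0 z0 s (ps_monom n \<beta>)" using expands_monom[OF that(1)] \<beta> E(2) by blast
      show "expands n k l (\<lambda>t x z. g \<beta> t x z $ j) x0 z0 s (G \<beta> j)" using that(2)[OF \<beta>] by (simp add: vexpands_def)
    qed
    then show ?thesis by (simp add: scaleR_conv_of_real[where ?'a = complex])
  qed
  show ?thesis
  proof
    assume ?L
    then obtain g where g: "\<And>\<beta>. \<beta> \<in> E \<Longrightarrow> g \<beta> \<in> A_M_vec n k l N U"
      and eq: "\<forall>x0\<in>N. \<forall>z0\<in>U. \<exists>R>0. \<forall>t x z. in_box n k l x0 z0 R t x z \<longrightarrow> h t x z = (\<Sum>\<beta>\<in>E. multi_pow n t \<beta> *\<^sub>R g \<beta> t x z)"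
      unfolding near_N_boxes[OF NU] by blast
    show ?R
    proof (intro ballI)
      fix \<gamma> x z assume \<gamma>: "\<gamma> \<in> multi_indices n \<inter> D" and p: "x \<in> N" "z \<in> U"
      obtain R C where RC: "vexpands vec_prj n k l h x z R C" using h p unfolding A_M_vec_iff by blast
      have "\<forall>\<beta>\<in>E. \<exists>RG. vexpands vec_prj n k l (g \<beta>) x z (fst RG) (snd RG)"
        using g p unfolding A_M_vec_iff by fastforce
      from bchoice[OF this] obtain RG where RG: "\<forall>\<beta>\<in>E. vexpands vec_prj n k l (g \<beta>) x z (fst (RG \<beta>)) (snd (RG \<beta>))" ..
      then have "\<And>\<beta>. \<beta> \<in> E \<Longrightarrow> 0 < fst (RG \<beta>)" by (simp add: vexpands_def expands_def)
      then obtain s1 where s1: "0 < s1" "\<And>\<beta>. \<beta> \<in> E \<Longrightarrow> s1 \<le> fst (RG \<beta>)" using finite_common_radius[OF E(1), of "\<lambda>\<beta>. fst (RG \<beta>)"] by blast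
      obtain s2 where s2: "0 < s2" "\<forall>t x' z'. in_box n k l x z s2 t x' z' \<longrightarrow> h t x' z' = (\<Sum>\<beta>\<in>E. multi_pow n t \<beta> *\<^sub>R g \<beta> t x' z')" using eq p by blast
      define s where "s = min s1 s2"
      have s: "0 < s" "s \<le> s1" "s \<le> s2" using s1 s2 by (auto simp: s_def)
      have gs: "vexpands vec_prj n k l (g \<beta>) x z s (snd (RG \<beta>))" if "\<beta> \<in> E" for \<beta>
        by (rule vexpands_mono[OF RG[rule_format, OF that] s(1) order_trans[OF s(2) s1(2)[OF that]]])
      have "taylor_coeff n h \<gamma> x z $ j = 0" for j
      proof -
        have "expands n k l (\<lambda>t x z. h t x z $ j) x z s (\<lambda>\<delta>. \<Sum>\<beta>\<in>E. ps_mult (ps_monom n \<beta>) (snd (RG \<beta>) j) \<delta>)"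
        proof (rule iffD2[OF expands_cong sum_exp[where j = j]])
          fix t x' z' assume "in_box n k l x z s t x' z'"
          then show "h t x' z' $ j = (\<Sum>\<beta>\<in>E. multi_pow n t \<beta> *\<^sub>R g \<beta> t x' z') $ j" using s2(2) in_box_mono[OF _ s(3)] by simp
        qed (rule s(1) gs; assumption?)+
        note e = this
        have "C j (jn n \<gamma> (\<lambda>_. 0)) = (\<Sum>\<beta>\<in>E. ps_mult (ps_monom n \<beta>) (snd (RG \<beta>) j) (jn n \<gamma> (\<lambda>_. 0)))"
          by (rule expands_unique[OF RC[unfolded vexpands_def, rule_format, of j] e])
            (use \<gamma> N_top U_top p jn_mem[of \<gamma> n "\<lambda>_. 0" "k + l"] in auto)
        \<comment> \<open>For \<gamma> in \<open>D\<close> no generator divides t^\<gamma>, so no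
          term reaches this coefficient.\<close>
        also have "\<dots> = 0"
        proof (intro sum.neutral ballI)
          fix \<beta> assume "\<beta> \<in> E"
          then show "ps_mult (ps_monom n \<beta>) (snd (RG \<beta>) j) (jn n \<gamma> (\<lambda>_. 0)) = 0"
            using D[of \<gamma>] \<gamma> E(2) ps_mult_monom[of \<gamma> n "\<lambda>_. 0" "k + l" \<beta>] by auto
        qed
        finally show ?thesis using taylor_coeff_center[OF RC p] \<gamma> by simp
      qed
      then show "taylor_coeff n h \<gamma> x z = 0" by (simp add: vec_eq_iff)
    qed
  next
    assume ?R
    have "\<forall>\<gamma>\<in>multi_indices n - D. \<exists>\<beta>. \<beta> \<in> E \<and> \<beta> \<le> \<gamma>" using D by blast
    from bchoice[OF this] obtain B where B: "\<forall>\<gamma>\<in>multi_indices n - D. B \<gamma> \<in> E \<and> B \<gamma> \<le> \<gamma>" ..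
    \<comment> \<open>\<open>\<psi> \<beta> \<delta>\<close> is the coefficient of t^\<delta> in the
      cofactor of t^\<beta>: the Taylor coefficient at \<delta> + \<beta> if \<open>B\<close>
      assigns this index to \<beta>, and 0 otherwise.\<close>
    define \<psi> where "\<psi> = (\<lambda>\<beta> \<delta>. if (\<lambda>i. \<delta> i + \<beta> i) \<notin> D \<and> B (\<lambda>i. \<delta> i + \<beta> i) = \<beta> then taylor n N U h (\<lambda>i. \<delta> i + \<beta> i) else (\<lambda>_ _. 0))"
    \<comment> \<open>The arrays of these cofactors, obtained from the array \<open>C\<close> of
      \<open>h\<close> by a shift and a mask, both of which preserve the radius.\<close>
    define H where "H = (\<lambda>C \<beta> (j::'m) \<delta>'. if (\<lambda>i. if i < n then \<delta>' i + \<beta> i else 0) \<notin> D \<and> B (\<lambda>i. if i < n then \<delta>' i + \<beta> i else 0) = \<beta> then C j (\<lambda>i. \<delta>' i + jn n \<beta> (\<lambda>_. 0) i) else 0 :: complex)"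
    have H_jn: "H C \<beta> j (jn n \<delta> b) = (if (\<lambda>i. \<delta> i + \<beta> i) \<notin> D \<and> B (\<lambda>i. \<delta> i + \<beta> i) = \<beta> then C j (jn n (\<lambda>i. \<delta> i + \<beta> i) b) else 0)"
      if "\<delta> \<in> multi_indices n" "\<beta> \<in> multi_indices n" for C \<beta> j \<delta> b
    proof -
      have "(\<lambda>i. if i < n then jn n \<delta> b i + \<beta> i else 0) = (\<lambda>i. \<delta> i + \<beta> i)" using that by (auto simp: jn_def multi_indices_def)
      moreover have "(\<lambda>i. jn n \<delta> b i + jn n \<beta> (\<lambda>_. 0) i) = jn n (\<lambda>i. \<delta> i + \<beta> i) b" by (auto simp: jn_def)
      ultimately show ?thesis unfolding H_def by presburger
    qed
    have H_conv: "ps_conv (n + (k + l)) s (H C \<beta> j)" if "ps_conv (n + (k + l)) s (C j)" "\<beta> \<in> E" for s C \<beta> j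
      unfolding H_def by (intro ps_conv_mask ps_conv_shift that(1) jn_mem) (use that E in auto)
    have ex: "\<exists>s>0. \<exists>C. vexpands vec_prj n k l h x z s C \<and> (\<forall>\<gamma>\<in>multi_indices n \<inter> D. \<forall>j b. b \<in> multi_indices (k + l) \<longrightarrow> C j (jn n \<gamma> b) = 0) \<and>
        (\<forall>\<beta>\<in>E. \<forall>\<delta>\<in>multi_indices n. vexpands vec_prj 0 k l (\<lambda>_. \<psi> \<beta> \<delta>) x z s (\<lambda>j b. H C \<beta> j (jn n \<delta> b)))" if p: "x \<in> N" "z \<in> U" for x z
    proof -
      obtain R C where RC: "vexpands vec_prj n k l h x z R C" using h p unfolding A_M_vec_iff by blast
      obtain s where s: "0 < s" "s \<le> R" "\<forall>\<gamma>\<in>multi_indices n. vexpands vec_prj 0 k l (\<lambda>_. taylor n N U h \<gamma>) x z s (\<lambda>j b. C j (jn n \<gamma> b))"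
        using taylor_vexpands[OF RC p] by blast
      have C0: "C j (jn n \<gamma> b) = 0" if \<gamma>: "\<gamma> \<in> multi_indices n \<inter> D" and b: "b \<in> multi_indices (k + l)" for \<gamma> j b
      proof -
        have t0: "taylor n N U h \<gamma> = (\<lambda>_ _. 0)" using \<open>?R\<close> \<gamma> by (auto simp: taylor_def fun_eq_iff)
        have "vexpands vec_prj 0 k l (\<lambda>_. taylor n N U h \<gamma>) x z s (\<lambda>j b. C j (jn n \<gamma> b))" using s(3) \<gamma> by blast
        then have "expands 0 k l (\<lambda>_ _ _. 0) x z s (\<lambda>b. C j (jn n \<gamma> b))" unfolding vexpands_def t0 by simp
        from expands_zero_array[OF this p s(1)] b show ?thesis by simp
      qed
      have "vexpands vec_prj 0 k l (\<lambda>_. \<psi> \<beta> \<delta>) x z s (\<lambda>j b. H C \<beta> j (jn n \<delta> b))" if "\<beta> \<in> E" "\<delta> \<in> multi_indices n" for \<beta> \<delta>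
      proof (cases "(\<lambda>i. \<delta> i + \<beta> i) \<notin> D \<and> B (\<lambda>i. \<delta> i + \<beta> i) = \<beta>")
        case True
        have MI: "\<beta> \<in> multi_indices n" using that E by blast
        from True have "(\<lambda>j b. H C \<beta> j (jn n \<delta> b)) = (\<lambda>j b. C j (jn n (\<lambda>i. \<delta> i + \<beta> i) b))" using H_jn[OF that(2) MI] by simp
        moreover have "\<psi> \<beta> \<delta> = taylor n N U h (\<lambda>i. \<delta> i + \<beta> i)" using True by (simp add: \<psi>_def)
        ultimately show ?thesis using s(3) multi_indices_add[OF that(2) MI] by simp
      next
        case False
        have MI: "\<beta> \<in> multi_indices n" using that E by blast
        from False have "(\<lambda>j b. H C \<beta> j (jn n \<delta> b)) = (\<lambda>j b. 0)" using H_jn[OF that(2) MI] by auto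
        moreover have "\<psi> \<beta> \<delta> = (\<lambda>_ _. 0)" using False by (auto simp: \<psi>_def)
        ultimately show ?thesis using s(1) by (simp add: vexpands_def expands_zero)
      qed
      then show ?thesis using s(1) C0 vexpands_mono[OF RC s(1,2)] by blast
    qed
    have conv: "ps_conv (n + (k + l)) s (C j)" if "vexpands vec_prj n k l h x z s C" for s C j x z
      using that by (simp add: vexpands_def expands_def)
    show ?L
    proof (intro exI[of _ "\<lambda>\<beta>. series n (\<psi> \<beta>)"] conjI ballI)
      fix \<beta> assume \<beta>: "\<beta> \<in> E"
      show "series n (\<psi> \<beta>) \<in> A_M_vec n k l N U"
      proof (rule A_M_vecI_series)
        fix x z assume p: "x \<in> N" "z \<in> U"
        obtain s C where s: "0 < s" and C: "vexpands vec_prj n k l h x z s C"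
          and \<psi>: "\<forall>\<delta>\<in>multi_indices n. vexpands vec_prj 0 k l (\<lambda>_. \<psi> \<beta> \<delta>) x z s (\<lambda>j b. H C \<beta> j (jn n \<delta> b))" using ex[OF p] \<beta> by blast
        have "ps_conv (n + (k + l)) s (H C \<beta> j)" for j by (rule H_conv[OF conv[OF C] \<beta>])
        then show "\<exists>R>0. \<exists>C. (\<forall>j. ps_conv (n + (k + l)) R (C j)) \<and> (\<forall>\<gamma>\<in>multi_indices n. vexpands vec_prj 0 k l (\<lambda>_. \<psi> \<beta> \<gamma>) x z R (\<lambda>j b. C j (jn n \<gamma> b)))"
          using s \<psi> by (intro exI[of _ s] conjI exI[of _ "H C \<beta>"] allI)
      qed
    next
      show "near_N n k l N U (\<lambda>t x z. h t x z = (\<Sum>\<beta>\<in>E. multi_pow n t \<beta> *\<^sub>R series n (\<psi> \<beta>) t x z))"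
        unfolding near_N_boxes[OF NU]
      proof (intro ballI)
        fix x0 z0 assume p: "x0 \<in> N" "z0 \<in> U"
        obtain s C where s: "0 < s" and C: "vexpands vec_prj n k l h x0 z0 s C" "\<forall>\<gamma>\<in>multi_indices n \<inter> D. \<forall>j b. b \<in> multi_indices (k + l) \<longrightarrow> C j (jn n \<gamma> b) = 0"
          and \<psi>: "\<forall>\<beta>\<in>E. \<forall>\<delta>\<in>multi_indices n. vexpands vec_prj 0 k l (\<lambda>_. \<psi> \<beta> \<delta>) x0 z0 s (\<lambda>j b. H C \<beta> j (jn n \<delta> b))" using ex[OF p] by blast
        have ser: "vexpands vec_prj n k l (series n (\<psi> \<beta>)) x0 z0 s (H C \<beta>)" if "\<beta> \<in> E" for \<beta>
        proof (rule vexpands_series[OF _ s])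
          show "ps_conv (n + (k + l)) s (H C \<beta> j)" for j by (rule H_conv[OF conv[OF C(1)] that])
        qed (use \<psi> that in blast)
        have "h t x z $ j = (\<Sum>\<beta>\<in>E. multi_pow n t \<beta> *\<^sub>R series n (\<psi> \<beta>) t x z) $ j" if box: "in_box n k l x0 z0 s t x z" for t x z j
        proof -
          have "h t x z $ j = ps_eval (n + (k + l)) (C j) (pt n k x0 z0 t x z)"
            by (rule expandsD[OF C(1)[unfolded vexpands_def, rule_format, of j] box])
          also have "\<dots> = ps_eval (n + (k + l)) (\<lambda>\<delta>. \<Sum>\<beta>\<in>E. ps_mult (ps_monom n \<beta>) (H C \<beta> j) \<delta>) (pt n k x0 z0 t x z)"
          proof (rule ps_eval_cong[OF _ refl])
            fix \<delta>' assume "\<delta>' \<in> multi_indices (n + (k + l))"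
            then obtain \<gamma> b where d: "\<gamma> \<in> multi_indices n" "b \<in> multi_indices (k + l)" "\<delta>' = jn n \<gamma> b" using jn_cases by blast
            \<comment> \<open>An index \<gamma> outside \<open>D\<close> is produced by the
              generator \<open>B \<gamma>\<close> alone, so the sum over \<open>E\<close> has a
              single nonzero term at most.\<close>
            have "ps_mult (ps_monom n \<beta>) (H C \<beta> j) (jn n \<gamma> b) = (if \<beta> = B \<gamma> \<and> \<gamma> \<notin> D then C j (jn n \<gamma> b) else 0)" if "\<beta> \<in> E" for \<beta>
            proof -
              have MI: "\<beta> \<in> multi_indices n" using that E by blast
              have "(\<lambda>i. \<gamma> i - \<beta> i + \<beta> i) = \<gamma>" if "\<beta> \<le> \<gamma>" using that by (auto simp: le_fun_def)
              moreover have "\<beta> \<le> \<gamma>" if "\<beta> = B \<gamma>" "\<gamma> \<notin> D" using that B d(1) by blast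
              ultimately show ?thesis unfolding ps_mult_monom[OF d(1,2) MI] H_jn[OF multi_indices_diff[OF d(1)] MI] by auto
            qed
            then have "(\<Sum>\<beta>\<in>E. ps_mult (ps_monom n \<beta>) (H C \<beta> j) (jn n \<gamma> b)) = (\<Sum>\<beta>\<in>E. if \<beta> = B \<gamma> \<and> \<gamma> \<notin> D then C j (jn n \<gamma> b) else 0)" by simp
            also have "\<dots> = C j (jn n \<gamma> b)"
            proof (cases "\<gamma> \<in> D")
              case True
              then show ?thesis using C(2) d by simp
            next
              case False
              then have "B \<gamma> \<in> E" using B d(1) by blast
              then show ?thesis using False E(1) by simp
            qed
            finally show "C j \<delta>' = (\<Sum>\<beta>\<in>E. ps_mult (ps_monom n \<beta>) (H C \<beta> j) \<delta>')" using d(3) by simp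
          qed
          also have "\<dots> = (\<Sum>\<beta>\<in>E. multi_pow n t \<beta> *\<^sub>R series n (\<psi> \<beta>) t x z) $ j"
            by (rule expandsD[OF _ box, symmetric], rule sum_exp[where j = j]) (rule s ser; assumption?)+
          finally show ?thesis .
        qed
        then show "\<exists>R>0. \<forall>t x z. in_box n k l x0 z0 R t x z \<longrightarrow> h t x z = (\<Sum>\<beta>\<in>E. multi_pow n t \<beta> *\<^sub>R series n (\<psi> \<beta>) t x z)"
          using s by (intro exI[of _ s] conjI) (auto simp: vec_eq_iff)
      qed
    qed
  qed
qed

end

context operator_setting
begin

text \<open>The complement of \<open>Sigma_bar\<close> consists of the multiples of the boundary
  indices, so membership in the ideal of the boundary monomials means vanishing of the Taylor
  coefficients on \<open>Sigma_bar\<close>.\<close>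

lemma Sol_Sigma_iff:
  assumes S: "finite S" "S \<subseteq> multi_indices n"
  shows "\<phi> \<in> Sol_Sigma n k l N U P lam S \<longleftrightarrow> \<phi> \<in> taylor n N U ` A_M_vec n k l N U \<and>
     (\<forall>\<alpha>. \<alpha> \<notin> Sigma_bar n S \<longrightarrow> \<phi> \<alpha> = (\<lambda>_ _. 0)) \<and>
     (\<forall>\<gamma>\<in>Sigma_bar n S. \<forall>x\<in>N. \<forall>z\<in>U. formal_apply n k P lam \<phi> \<gamma> x z = 0)"
proof -
  define Q where "Q f \<longleftrightarrow> (\<exists>g. (\<forall>\<beta>\<in>Sigma_bd n S. g \<beta> \<in> A_M_vec n k l N U) \<and>
        near_N n k l N U (\<lambda>t x z. conj_apply n k P lam f t x z = (\<Sum>\<beta>\<in>Sigma_bd n S. multi_pow n t \<beta> *\<^sub>R g \<beta> t x z)))" for f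
  have *: "Q f \<longleftrightarrow>
      (\<forall>\<gamma>\<in>Sigma_bar n S. \<forall>x\<in>N. \<forall>z\<in>U. formal_apply n k P lam (taylor n N U f) \<gamma> x z = 0)"
    if f: "f \<in> A_M_vec n k l N U" and f0: "\<forall>\<alpha>. \<alpha> \<notin> Sigma_bar n S \<longrightarrow> taylor n N U f \<alpha> = (\<lambda>_ _. 0)" for f
  \<comment> \<open>If \<open>Sigma_bar\<close> is empty there is no boundary index, although every
    index lies in the complement; but then all Taylor coefficients of f are zero and both sides
    hold.\<close>
  proof (cases "Sigma_bar n S = {}")
    case True
    then have "taylor n N U f = (\<lambda>_ _ _. 0)" using f0 by auto
    then have "near_N n k l N U (\<lambda>t x z. conj_apply n k P lam f t x z = 0)"
      unfolding near_zero_iff[OF conj_apply_in_A_M_vec[OF f]] using taylor_conj_apply[OF f] formal_apply_zero by simp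
    moreover have "Sigma_bd n S = {}" using True by (auto simp: Sigma_bd_def)
    ultimately show ?thesis using True by (simp add: Q_def)
  next
    case False
    have "Sigma_bd n S \<subseteq> multi_indices n" by (auto simp: Sigma_bd_def)
    moreover have "\<gamma> \<in> Sigma_bar n S \<longleftrightarrow> \<not> (\<exists>\<beta>\<in>Sigma_bd n S. \<beta> \<le> \<gamma>)" if "\<gamma> \<in> multi_indices n" for \<gamma>
    proof
      assume "\<gamma> \<in> Sigma_bar n S"
      then show "\<not> (\<exists>\<beta>\<in>Sigma_bd n S. \<beta> \<le> \<gamma>)" using Sigma_bar_le[of \<gamma> n S] by (auto simp: Sigma_bd_def)
    next
      assume "\<not> (\<exists>\<beta>\<in>Sigma_bd n S. \<beta> \<le> \<gamma>)"
      then show "\<gamma> \<in> Sigma_bar n S" using Sigma_bd_le[of \<gamma> n S] that False by blast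
    qed
    ultimately have "Q f \<longleftrightarrow>
      (\<forall>\<gamma>\<in>multi_indices n \<inter> Sigma_bar n S. \<forall>x\<in>N. \<forall>z\<in>U. taylor_coeff n (conj_apply n k P lam f) \<gamma> x z = 0)"
      unfolding Q_def by (rule near_N_monomial_ideal[OF conj_apply_in_A_M_vec[OF f] finite_Sigma_bd[OF S]])
    also have "\<dots> \<longleftrightarrow> (\<forall>\<gamma>\<in>Sigma_bar n S. \<forall>x\<in>N. \<forall>z\<in>U. formal_apply n k P lam (taylor n N U f) \<gamma> x z = 0)"
      using taylor_conj_apply[OF f] Sigma_bar_subset[of n S] by auto
    finally show ?thesis .
  qed
  have "\<phi> \<in> Sol_Sigma n k l N U P lam S \<longleftrightarrow> (\<exists>f. \<phi> = taylor n N U f \<and> f \<in> A_M_vec n k l N U \<and>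
      (\<forall>\<alpha>. \<alpha> \<notin> Sigma_bar n S \<longrightarrow> taylor n N U f \<alpha> = (\<lambda>_ _. 0)) \<and> Q f)"
    unfolding Sol_Sigma_def Q_def by simp
  also have "\<dots> \<longleftrightarrow> (\<exists>f. \<phi> = taylor n N U f \<and> f \<in> A_M_vec n k l N U \<and>
      (\<forall>\<alpha>. \<alpha> \<notin> Sigma_bar n S \<longrightarrow> taylor n N U f \<alpha> = (\<lambda>_ _. 0)) \<and> (\<forall>\<gamma>\<in>Sigma_bar n S. \<forall>x\<in>N. \<forall>z\<in>U. formal_apply n k P lam (taylor n N U f) \<gamma> x z = 0))"
    using * by (intro ex_cong1 conj_cong refl)
  finally show ?thesis by auto
qed

end

section \<open>Solving the recursion for the coefficients\<close>

lemma expands_prod: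
  assumes "finite I" "0 < R" "\<And>i. i \<in> I \<Longrightarrow> \<exists>c. expands n k l (f i) x0 z0 R c"
  shows "\<exists>c. expands n k l (\<lambda>t x z. \<Prod>i\<in>I. f i t x z) x0 z0 R c"
  using assms(1,3)
proof (induction I rule: finite_induct)
  case empty
  show ?case using expands_const[OF assms(2), of n k l 1 x0 z0] by auto
next
  case (insert i I)
  obtain c where c: "expands n k l (f i) x0 z0 R c" using insert.prems by blast
  obtain e where e: "expands n k l (\<lambda>t x z. \<Prod>i\<in>I. f i t x z) x0 z0 R e" using insert by blast
  show ?case using expands_mult[OF c e] insert.hyps by auto
qed

lemma expands_det:
  fixes M :: "(nat \<Rightarrow> real) \<Rightarrow> (nat \<Rightarrow> real) \<Rightarrow> (nat \<Rightarrow> complex) \<Rightarrow> complex ^ 'm::finite ^ 'm"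
  assumes R: "0 < R" and M: "\<And>i j. \<exists>c. expands n k l (\<lambda>t x z. M t x z $ i $ j) x0 z0 R c"
  shows "\<exists>c. expands n k l (\<lambda>t x z. det (M t x z)) x0 z0 R c"
proof -
  have "\<exists>c. expands n k l (\<lambda>t x z. of_int (sign p) * (\<Prod>i\<in>UNIV. M t x z $ i $ p i)) x0 z0 R c" for p :: "'m \<Rightarrow> 'm"
  proof -
    obtain c where "expands n k l (\<lambda>t x z. \<Prod>i\<in>UNIV. M t x z $ i $ p i) x0 z0 R c"
      using expands_prod[of UNIV R n k l "\<lambda>i t x z. M t x z $ i $ p i" x0 z0] R M by auto
    from expands_mult[OF expands_const[OF R] this] show ?thesis by blast
  qed
  then have "\<forall>p. \<exists>c. expands n k l (\<lambda>t x z. of_int (sign p) * (\<Prod>i\<in>UNIV. M t x z $ i $ p i)) x0 z0 R c" by blast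
  from choice[OF this] obtain c where "\<forall>p. expands n k l (\<lambda>t x z. of_int (sign p) * (\<Prod>i\<in>UNIV. M t x z $ i $ p i)) x0 z0 R (c p)" ..
  then have "expands n k l (\<lambda>t x z. \<Sum>p | p permutes UNIV. of_int (sign p) * (\<Prod>i\<in>UNIV. M t x z $ i $ p i)) x0 z0 R (\<lambda>\<alpha>. \<Sum>p | p permutes UNIV. c p \<alpha>)"
    by (intro expands_sum R) blast
  then show ?thesis unfolding det_def by blast
qed

lemma expands_inverse_ex:
  assumes "expands n k l f x0 z0 R c" "c (\<lambda>_. 0) \<noteq> 0"
  shows "\<exists>e S. expands n k l (\<lambda>t x z. inverse (f t x z)) x0 z0 S e \<and> (\<forall>t x z. in_box n k l x0 z0 S t x z \<longrightarrow> f t x z \<noteq> 0)"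
proof (rule expands_inverse[OF assms])
  fix e S assume "expands n k l (\<lambda>t x z. inverse (f t x z)) x0 z0 S e" and *: "\<And>t x z. in_box n k l x0 z0 S t x z \<Longrightarrow> f t x z \<noteq> 0"
  then show ?thesis by (intro exI[of _ e] exI[of _ S] conjI allI impI) (assumption, rule *)
qed

text \<open>Cramer's rule: near the point the solution is a quotient of determinants with analytic
  entries, whose denominator does not vanish.\<close>

lemma vexpands_solution:
  fixes M :: "(nat \<Rightarrow> real) \<Rightarrow> (nat \<Rightarrow> complex) \<Rightarrow> complex ^ 'm::finite ^ 'm"
  assumes R: "0 < R" and M: "\<And>i j. \<exists>c. expands 0 k l (\<lambda>_ x z. M x z $ i $ j) x0 z0 R c"
    and w: "\<And>i. \<exists>c. expands 0 k l (\<lambda>_ x z. w x z $ i) x0 z0 R c"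
    and inv: "det (M x0 z0) \<noteq> 0" and p: "x0 \<in> topspace (Euclidean_space k)" "z0 \<in> topspace (Complex_space l)"
    and s: "0 < s" and u: "\<And>t x z. in_box 0 k l x0 z0 s t x z \<Longrightarrow> M x z *v u x z = w x z"
  shows "\<exists>R C. vexpands vec_prj 0 k l (\<lambda>_. u) x0 z0 R C"
proof -
  obtain d where d: "expands 0 k l (\<lambda>_ x z. det (M x z)) x0 z0 R d"
    using expands_det[OF R, of 0 k l "\<lambda>_. M"] M by blast
  have "d (\<lambda>_. 0) \<noteq> 0" using expands_center[OF d p] inv by simp
  from expands_inverse_ex[OF d this] obtain e S where
    e: "expands 0 k l (\<lambda>_ x z. inverse (det (M x z))) x0 z0 S e" and nz: "\<forall>t x z. in_box 0 k l x0 z0 S t x z \<longrightarrow> det (M x z) \<noteq> 0"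
    by (elim exE conjE)
  have S: "0 < S" using e by (simp add: expands_def)
  define T where "T = min s (min R S)"
  have T: "0 < T" "T \<le> s" "T \<le> R" "T \<le> S" using s R S by (auto simp: T_def)
  have "\<exists>R c. expands 0 k l (\<lambda>_ x z. u x z $ a) x0 z0 R c" for a
  proof -
    have "\<exists>c. expands 0 k l (\<lambda>_ x z. (\<chi> i j. if j = a then w x z $ i else M x z $ i $ j) $ i $ j) x0 z0 R c" for i j
      using M[of i j] w[of i] by (cases "j = a") auto
    then obtain c where c: "expands 0 k l (\<lambda>_ x z. det (\<chi> i j. if j = a then w x z $ i else M x z $ i $ j)) x0 z0 R c"
      using expands_det[OF R, of 0 k l "\<lambda>_ x z. \<chi> i j. if j = a then w x z $ i else M x z $ i $ j" x0 z0] by blast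
    have "expands 0 k l (\<lambda>_ x z. det (\<chi> i j. if j = a then w x z $ i else M x z $ i $ j) * inverse (det (M x z))) x0 z0 T (ps_mult c e)"
      by (rule expands_mult[OF expands_mono[OF c T(1,3)] expands_mono[OF e T(1,4)]])
    moreover have "det (\<chi> i j. if j = a then w x z $ i else M x z $ i $ j) * inverse (det (M x z)) = u x z $ a"
      if box: "in_box 0 k l x0 z0 T t x z" for t x z
    proof -
      have "u x z = (\<chi> a. det (\<chi> i j. if j = a then w x z $ i else M x z $ i $ j) / det (M x z))"
        using cramer[OF nz[rule_format, OF in_box_mono[OF box T(4)]], of "u x z" "w x z"] u[OF in_box_mono[OF box T(2)]] by blast
      then show ?thesis by (simp add: divide_inverse)
    qed
    ultimately have "expands 0 k l (\<lambda>_ x z. u x z $ a) x0 z0 T (ps_mult c e)"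
      by (subst (asm) expands_cong) auto
    then show ?thesis by blast
  qed
  then obtain R C where "vexpands vec_prj 0 k l (\<lambda>_. u) x0 z0 R C"
    using vexpandsI[of 0 k l vec_prj "\<lambda>_. u" x0 z0] by blast
  then show ?thesis by blast
qed

lemma (in expansion_at) sigma_expands:
  "\<exists>c. expands 0 k l (\<lambda>_ x z. sigma_star n P x z (\<lambda>i. lam i z + of_nat (\<gamma> i)) $ i $ j) x0 z0 R c"
proof -
  have "expands 0 k l (\<lambda>_ x z. \<Sum>\<alpha>\<in>supp0. taylor_coeff n (P \<alpha> (\<lambda>_. 0)) (\<lambda>_. 0) x z $ i $ j * multi_pow n (\<lambda>i. lam i z + of_nat (\<gamma> i)) \<alpha>) x0 z0 R
     (\<lambda>b. \<Sum>\<alpha>\<in>supp0. ps_mult (\<lambda>b. A \<alpha> (\<lambda>_. 0) (i, j) (jn n (\<lambda>_. 0) b)) (ps_lam_pow L n \<alpha> \<gamma>) b)"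
    by (intro expands_sum expands_mult expands_taylor_coeff expands_lam_pow) (use R L in auto)
  then show ?thesis by (auto simp: sigma_star_def taylor_coeff_zero_index)
qed

text \<open>The hypothesis at a single point with an explicit order. In this form \<open>r\<close>
  can remain the order on the original \<open>N\<close> and \<open>U\<close> when these are shrunk,
  and the condition passes to subsets.\<close>

definition elliptic_at :: "nat \<Rightarrow> nat \<Rightarrow> nat \<Rightarrow> 'm::finite op_matrix \<Rightarrow> nat \<Rightarrow> (nat \<Rightarrow> real) \<Rightarrow> (nat \<Rightarrow> complex) \<Rightarrow> bool" where
  "elliptic_at n k l P r x0 z0 \<longleftrightarrow>
     (\<forall>(\<alpha>, \<beta>)\<in>op_supp P. r < multi_deg n \<alpha> + multi_deg k \<beta> \<longrightarrow> (\<exists>s>0. \<forall>t x z. in_box n k l x0 z0 s t x z \<longrightarrow> P \<alpha> \<beta> t x z = 0)) \<and>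
     (\<forall>\<xi>. (\<forall>i\<ge>n. \<xi> i = 0) \<longrightarrow> (\<forall>i<n. 0 \<le> \<xi> i) \<longrightarrow> \<xi> \<noteq> (\<lambda>_. 0) \<longrightarrow>
        det (\<chi> i j. \<Sum>\<alpha> | \<alpha> \<in> {\<alpha>. (\<alpha>, \<lambda>_. 0) \<in> op_supp P} \<and> multi_deg n \<alpha> = r. P \<alpha> (\<lambda>_. 0) (\<lambda>_. 0) x0 z0 $ i $ j * multi_pow n (\<lambda>i. of_real (\<xi> i :: real)) \<alpha>) \<noteq> 0)"

lemma elliptic_atD:
  "elliptic_at n k l P r x0 z0 \<Longrightarrow> (\<alpha>, \<beta>) \<in> op_supp P \<Longrightarrow> r < multi_deg n \<alpha> + multi_deg k \<beta> \<Longrightarrow>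
     \<exists>s>0. \<forall>t x z. in_box n k l x0 z0 s t x z \<longrightarrow> P \<alpha> \<beta> t x z = 0"
  unfolding elliptic_at_def by blast

context operator_setting
begin

text \<open>Finitely many pairs have a nonzero germ, so \<open>Max\<close> bounds their orders; a
  pair beyond it has a coefficient vanishing around the whole zero section, in particular near the
  given point.\<close>

lemma elliptic_at_op_ord:
  assumes p: "x0 \<in> N" "z0 \<in> U"
    and bar: "\<And>\<xi>. \<xi> \<in> topspace (Euclidean_space n) \<Longrightarrow> (\<forall>i<n. 0 \<le> \<xi> i) \<Longrightarrow> \<xi> \<noteq> (\<lambda>_. 0) \<Longrightarrow> det (sigma_bar n k l N U P x0 z0 (\<lambda>i. of_real (\<xi> i))) \<noteq> 0"
  shows "elliptic_at n k l P (op_ord n k l N U P) x0 z0"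
proof -
  let ?D = "{multi_deg n \<alpha> + multi_deg k \<beta> | \<alpha> \<beta>. \<not> near_N n k l N U (\<lambda>t x z. P \<alpha> \<beta> t x z = 0)}"
  have NU: "N \<subseteq> topspace (Euclidean_space k)" "U \<subseteq> topspace (Complex_space l)" using N_top U_top by blast+
  have fin: "finite (op_supp P)" using P by (simp add: D_star_def)
  have "?D \<subseteq> (\<lambda>(\<alpha>, \<beta>). multi_deg n \<alpha> + multi_deg k \<beta>) ` op_supp P"
  proof
    fix d assume "d \<in> ?D"
    then obtain \<alpha> \<beta> where d: "d = multi_deg n \<alpha> + multi_deg k \<beta>" "\<not> near_N n k l N U (\<lambda>t x z. P \<alpha> \<beta> t x z = 0)" by blast
    have "(\<alpha>, \<beta>) \<in> op_supp P"
    proof (rule ccontr)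
      assume "(\<alpha>, \<beta>) \<notin> op_supp P"
      then have "P \<alpha> \<beta> = (\<lambda>_ _ _. 0)" by (simp add: op_supp_def)
      then show False using d(2) unfolding near_N_boxes[OF NU] by (auto intro: zero_less_one)
    qed
    then show "d \<in> (\<lambda>(\<alpha>, \<beta>). multi_deg n \<alpha> + multi_deg k \<beta>) ` op_supp P" using d(1) by force
  qed
  then have finD: "finite ?D" using fin finite_surj by blast
  have "\<exists>s>0. \<forall>t x z. in_box n k l x0 z0 s t x z \<longrightarrow> P \<alpha> \<beta> t x z = 0" if r: "op_ord n k l N U P < multi_deg n \<alpha> + multi_deg k \<beta>" for \<alpha> \<beta>
  proof -
    have "near_N n k l N U (\<lambda>t x z. P \<alpha> \<beta> t x z = 0)"
    proof (rule ccontr)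
      assume "\<not> near_N n k l N U (\<lambda>t x z. P \<alpha> \<beta> t x z = 0)"
      then have "multi_deg n \<alpha> + multi_deg k \<beta> \<le> op_ord n k l N U P" unfolding op_ord_def by (intro Max_ge finD) blast
      then show False using r by simp
    qed
    then show ?thesis unfolding near_N_boxes[OF NU] using p by blast
  qed
  then show ?thesis
    unfolding elliptic_at_def using bar by (auto simp: sigma_bar_def Euclidean_space_topspace)
qed

text \<open>Uniqueness of expansions carries the vanishing of germs, and the vanishing at t = 0,
  over to the arrays; the constant comes from \<open>elliptic_bound_off_finite\<close>, as
  \<open>symb\<close> is the symbol at the point.\<close>

lemma regular_expansion_exists:
  assumes p: "x0 \<in> N" "z0 \<in> U" and ell: "elliptic_at n k l P r x0 z0"
    and S: "\<And>\<gamma>. \<gamma> \<in> multi_indices n - S \<Longrightarrow> det (sigma_star n P x0 z0 (\<lambda>i. lam i z0 + of_nat (\<gamma> i))) \<noteq> 0"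
  shows "\<exists>R A L C. regular_expansion_at n k l P lam x0 z0 R A L r S C"
proof -
  obtain R A L where "expansion_at n k l P lam x0 z0 R A L" using expansion_at_exists[OF p] by blast
  then interpret expansion_at n k l P lam x0 z0 R A L .
  have order: "A \<alpha> \<beta> (i, j) \<delta> = 0" if ab: "(\<alpha>, \<beta>) \<in> op_supp P" "r < multi_deg n \<alpha> + multi_deg k \<beta>" and \<delta>: "\<delta> \<in> multi_indices (n + (k + l))" for \<alpha> \<beta> i j \<delta>
  proof -
    obtain s where "0 < s" "\<forall>t x z. in_box n k l x0 z0 s t x z \<longrightarrow> P \<alpha> \<beta> t x z = 0" using elliptic_atD[OF ell ab] by blast
    then show ?thesis using expands_zero_array[OF A_expands[OF ab(1)] p _ _ \<delta>, of s i j] by simp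
  qed
  obtain \<rho> where \<rho>: "0 < \<rho>" "\<forall>n t x z. in_box n k l x0 z0 \<rho> t x z \<longrightarrow> x \<in> N \<and> z \<in> U" using box_subset[OF p] by blast
  have t0: "A \<alpha> \<beta> (i, j) (jn n (\<lambda>_. 0) b) = 0" if "(\<alpha>, \<beta>) \<in> op_supp P" "\<beta> \<noteq> (\<lambda>_. 0)" "b \<in> multi_indices (k + l)" for \<alpha> \<beta> i j b
  proof -
    have e: "expands 0 k l (\<lambda>_ x z. taylor_coeff n (P \<alpha> \<beta>) (\<lambda>_. 0) x z $ i $ j) x0 z0 R (\<lambda>b. A \<alpha> \<beta> (i, j) (jn n (\<lambda>_. 0) b))"
      by (rule expands_taylor_coeff[OF that(1) multi_indices_zero R order_refl])
    show ?thesis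
    proof (rule expands_zero_array[OF e p \<rho>(1)])
      fix t x z assume "in_box 0 k l x0 z0 \<rho> t x z"
      then have "x \<in> N" "z \<in> U" using \<rho>(2) by blast+
      then show "taylor_coeff n (P \<alpha> \<beta>) (\<lambda>_. 0) x z $ i $ j = 0" using P_zero[OF that(2)] by (simp add: taylor_coeff_zero_index)
    qed (use that in simp)
  qed
  let ?I = "{\<alpha>. (\<alpha>, \<lambda>_. 0) \<in> op_supp P}" and ?M = "\<lambda>\<alpha>. P \<alpha> (\<lambda>_. 0) (\<lambda>_. 0) x0 z0"
  have A0: "A \<alpha> (\<lambda>_. 0) (i, j) (\<lambda>_. 0) = ?M \<alpha> $ i $ j" if "\<alpha> \<in> ?I" for \<alpha> i j
    using expands_center[OF A_expands x0 z0, of \<alpha> "\<lambda>_. 0" i j] that by simp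
  have L0: "L i (\<lambda>_. 0) = lam i z0" if "i < n" for i using expands_center[OF L[OF that] x0 z0] by simp
  have symb_eq: "symb \<gamma> = (\<chi> i j. \<Sum>\<alpha>\<in>?I. ?M \<alpha> $ i $ j * multi_pow n (\<lambda>i. lam i z0 + of_nat (\<gamma> i)) \<alpha>)" for \<gamma>
    unfolding symb_def vec_eq_iff using A0 L0 by (auto simp: multi_pow_def intro!: sum.cong)
  have sigma_eq: "sigma_star n P x0 z0 (\<lambda>i. lam i z0 + of_nat (\<gamma> i)) = symb \<gamma>" for \<gamma>
    unfolding symb_eq sigma_star_def ..
  have "\<exists>C>0. \<forall>\<gamma>\<in>multi_indices n - S. \<forall>v. (1 + real (multi_deg n \<gamma>)) ^ r * l1norm v \<le> C * l1norm (symb \<gamma> *v v)"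
    unfolding symb_eq
  proof (rule elliptic_bound_off_finite)
    show "finite ?I" by (rule finite_supp0)
    show "?M \<alpha> = 0" if "\<alpha> \<in> ?I" "multi_deg n \<alpha> > r" for \<alpha>
    proof -
      have "?M \<alpha> $ i $ j = 0" for i j using A0[OF that(1), of i j] order[of \<alpha> "\<lambda>_. 0" "\<lambda>_. 0" i j] that by simp
      then show ?thesis by (simp add: vec_eq_iff)
    qed
    show "det (\<chi> i j. \<Sum>\<alpha>\<in>?I. ?M \<alpha> $ i $ j * multi_pow n (\<lambda>i. lam i z0 + of_nat (\<gamma> i)) \<alpha>) \<noteq> 0" if "\<gamma> \<in> multi_indices n - S" for \<gamma>
      using S[OF that] unfolding sigma_star_def .
  qed (use ell in \<open>unfold elliptic_at_def, blast\<close>)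
  then obtain C where "0 < C" "\<forall>\<gamma>\<in>multi_indices n - S. \<forall>v. (1 + real (multi_deg n \<gamma>)) ^ r * l1norm v \<le> C * l1norm (symb \<gamma> *v v)" by blast
  then have "regular_expansion_at n k l P lam x0 z0 R A L r S C"
    by unfold_locales (use order t0 in auto)
  then show ?thesis by blast
qed

text \<open>Makes \<open>convergence\<close> applicable at a point: beyond some degree the elliptic
  estimate excludes kernel vectors. The set found is auxiliary and has no relation to the \<Sigma>
  of the solution spaces.\<close>

lemma invertible_off_finite:
  assumes p: "x0 \<in> N" "z0 \<in> U" and ell: "elliptic_at n k l P r x0 z0"
  shows "\<exists>S. finite S \<and> (\<forall>\<gamma>\<in>multi_indices n - S. det (sigma_star n P x0 z0 (\<lambda>i. lam i z0 + of_nat (\<gamma> i))) \<noteq> 0)"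
proof -
  let ?I = "{\<alpha>. (\<alpha>, \<lambda>_. 0) \<in> op_supp P}" and ?M = "\<lambda>\<alpha>. P \<alpha> (\<lambda>_. 0) (\<lambda>_. 0) x0 z0"
  have "\<exists>C>0. \<exists>g0. \<forall>\<gamma>\<in>multi_indices n. \<forall>v. g0 \<le> multi_deg n \<gamma> \<longrightarrow>
      (1 + real (multi_deg n \<gamma>)) ^ r * l1norm v \<le> C * l1norm ((\<chi> i j. \<Sum>\<alpha>\<in>?I. ?M \<alpha> $ i $ j * multi_pow n (\<lambda>i. lam i z0 + of_nat (\<gamma> i)) \<alpha>) *v v)"
  proof (rule elliptic_bound)
    have "?I \<subseteq> fst ` op_supp P" by force
    then show "finite ?I" using P finite_surj by (auto simp: D_star_def)
    show "?M \<alpha> = 0" if \<alpha>: "\<alpha> \<in> ?I" "multi_deg n \<alpha> > r" for \<alpha>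
    proof -
      obtain s where s: "0 < s" "\<forall>t x z. in_box n k l x0 z0 s t x z \<longrightarrow> P \<alpha> (\<lambda>_. 0) t x z = 0"
        using elliptic_atD[OF ell, of \<alpha> "\<lambda>_. 0"] \<alpha> by auto
      then show ?thesis using in_box_center[OF s(1)] N_top U_top p by blast
    qed
  qed (use ell in \<open>unfold elliptic_at_def, blast\<close>)
  then obtain C g0 where C: "\<forall>\<gamma>\<in>multi_indices n. \<forall>v. g0 \<le> multi_deg n \<gamma> \<longrightarrow>
      (1 + real (multi_deg n \<gamma>)) ^ r * l1norm v \<le> C * l1norm (sigma_star n P x0 z0 (\<lambda>i. lam i z0 + of_nat (\<gamma> i)) *v v)"
    unfolding sigma_star_def by blast
  have "det (sigma_star n P x0 z0 (\<lambda>i. lam i z0 + of_nat (\<gamma> i))) \<noteq> 0" if \<gamma>: "\<gamma> \<in> multi_indices n" "g0 \<le> multi_deg n \<gamma>" for \<gamma>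
  proof (rule det_nonzeroI)
    fix v :: "complex ^ 'm" assume v: "sigma_star n P x0 z0 (\<lambda>i. lam i z0 + of_nat (\<gamma> i)) *v v = 0"
    have "(1 + real (multi_deg n \<gamma>)) ^ r * l1norm v \<le> 0" using C[rule_format, OF \<gamma>, of v] by (simp add: v)
    moreover have "0 < (1 + real (multi_deg n \<gamma>)) ^ r" by simp
    ultimately have l0: "l1norm v \<le> 0" using mult_le_0_iff[of "(1 + real (multi_deg n \<gamma>)) ^ r" "l1norm v"] by linarith
    have "norm (v $ j) \<le> 0" for j by (rule order_trans[OF _ l0], rule member_le_sum) auto
    then show "v = 0" by (simp add: vec_eq_iff)
  qed
  note inv = this
  show ?thesis
  proof (intro exI[of _ "{\<gamma> \<in> multi_indices n. multi_deg n \<gamma> \<le> g0}"] conjI ballI finite_multi_deg_le)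
    fix \<gamma> assume "\<gamma> \<in> multi_indices n - {\<gamma> \<in> multi_indices n. multi_deg n \<gamma> \<le> g0}"
    then have "\<gamma> \<in> multi_indices n" "g0 \<le> multi_deg n \<gamma>" by auto
    then show "det (sigma_star n P x0 z0 (\<lambda>i. lam i z0 + of_nat (\<gamma> i))) \<noteq> 0" by (rule inv)
  qed
qed

text \<open>Convergence is local, so the finite exceptional set may be chosen anew at each point. On
  it the slices converge because \<phi> lies in \<open>A_hat\<close>; \<open>convergence\<close>
  takes care of the others and yields a radius common to all.\<close>

lemma formal_solution_converges:
  assumes \<phi>: "\<phi> \<in> A_hat n k l N U"
    and eq: "\<And>\<gamma> x z. \<gamma> \<in> multi_indices n \<Longrightarrow> x \<in> N \<Longrightarrow> z \<in> U \<Longrightarrow> formal_apply n k P lam \<phi> \<gamma> x z = 0"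
    and ell: "\<And>x z. x \<in> N \<Longrightarrow> z \<in> U \<Longrightarrow> elliptic_at n k l P r x z"
  shows "\<phi> \<in> taylor n N U ` A_M_vec n k l N U"
proof -
  have an: "\<exists>R C. vexpands vec_prj 0 k l (\<lambda>_. \<phi> \<gamma>) x z R C" if "\<gamma> \<in> multi_indices n" "x \<in> N" "z \<in> U" for \<gamma> x z
    using \<phi> that unfolding A_hat_def A_N_iff by blast
  have "\<exists>R>0. \<exists>C. (\<forall>j. ps_conv (n + (k + l)) R (C j)) \<and>
       (\<forall>\<gamma>\<in>multi_indices n. vexpands vec_prj 0 k l (\<lambda>_. \<phi> \<gamma>) x0 z0 R (\<lambda>j b. C j (jn n \<gamma> b)))" if p: "x0 \<in> N" "z0 \<in> U" for x0 z0
  proof -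
    obtain S where S: "finite S" "\<forall>\<gamma>\<in>multi_indices n - S. det (sigma_star n P x0 z0 (\<lambda>i. lam i z0 + of_nat (\<gamma> i))) \<noteq> 0"
      using invertible_off_finite[OF p ell[OF p]] by blast
    obtain R A L C where "regular_expansion_at n k l P lam x0 z0 R A L r S C"
      using regular_expansion_exists[OF p ell[OF p], of S] S(2) by blast
    then interpret regular_expansion_at n k l P lam x0 z0 R A L r S C .
    obtain \<rho> where \<rho>: "0 < \<rho>" "\<forall>n t x z. in_box n k l x0 z0 \<rho> t x z \<longrightarrow> x \<in> N \<and> z \<in> U" using box_subset[OF p] by blast
    have "\<forall>\<gamma>\<in>multi_indices n. \<exists>RC. vexpands vec_prj 0 k l (\<lambda>_. \<phi> \<gamma>) x0 z0 (fst RC) (snd RC)" using an[OF _ p] by fastforce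
    from bchoice[OF this] obtain RC where RC: "\<forall>\<gamma>\<in>multi_indices n. vexpands vec_prj 0 k l (\<lambda>_. \<phi> \<gamma>) x0 z0 (fst (RC \<gamma>)) (snd (RC \<gamma>))" ..
    \<comment> \<open>The arrays of all coefficients at the centre, each still with its own radius
      \<open>fst (RC \<gamma>)\<close>.\<close>
    define \<Phi> where "\<Phi> = (\<lambda>\<gamma>. snd (RC \<gamma>))"
    have rad: "0 < fst (RC \<gamma>)" if "\<gamma> \<in> multi_indices n" for \<gamma> using RC that by (simp add: vexpands_def expands_def)
    have formal0: "formal_arr \<Phi> \<gamma> i b = 0" if \<gamma>: "\<gamma> \<in> multi_indices n" and b: "b \<in> multi_indices (k + l)" for \<gamma> i b
    proof -
      \<comment> \<open>For a fixed \<gamma> only finitely many \<mu> \<le> \<gamma> occur, so a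
        positive common radius is available; it may depend on \<gamma>, as only coefficients are
        compared.\<close>
      obtain s where s: "0 < s" "\<And>\<mu>. \<mu> \<in> {\<mu>. \<mu> \<le> \<gamma>} \<Longrightarrow> s \<le> fst (RC \<mu>)"
        using finite_common_radius[OF finite_le_multi_index[OF \<gamma>], of "\<lambda>\<mu>. fst (RC \<mu>)"] rad multi_indices_le[OF \<gamma>] by blast
      have "vexpands vec_prj 0 k l (\<lambda>_. formal_apply n k P lam \<phi> \<gamma>) x0 z0 (min s R) (formal_arr \<Phi> \<gamma>)"
      proof (rule vexpands_formal_apply[OF \<gamma>])
        fix \<mu> assume \<mu>: "\<mu> \<le> \<gamma>"
        show "vexpands vec_prj 0 k l (\<lambda>_. \<phi> \<mu>) x0 z0 (min s R) (\<Phi> \<mu>)"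
          unfolding \<Phi>_def by (rule vexpands_mono[OF RC[rule_format, OF multi_indices_le[OF \<gamma> \<mu>]]]) (use s(1) s(2)[of \<mu>] \<mu> R in auto)
      qed (use s(1) R in auto)
      then have "expands 0 k l (\<lambda>_ x z. formal_apply n k P lam \<phi> \<gamma> x z $ i) x0 z0 (min s R) (formal_arr \<Phi> \<gamma> i)" by (simp add: vexpands_def)
      from expands_zero_array[OF this p \<rho>(1)] show ?thesis using eq[OF \<gamma>] \<rho>(2) b by simp
    qed
    have "\<exists>T>0. ps_conv (n + (k + l)) T (\<lambda>\<delta>. \<Phi> (\<lambda>i. if i < n then \<delta> i else 0) j (\<lambda>i. \<delta> (i + n)))" for j
    proof (rule convergence[where \<Phi> = \<Phi> and j = j, OF S(1)])
      fix \<mu> j assume "\<mu> \<in> multi_indices n \<inter> S"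
      then have "0 < fst (RC \<mu>) \<and> ps_conv (k + l) (fst (RC \<mu>)) (\<Phi> \<mu> j)" using RC by (auto simp: vexpands_def expands_def \<Phi>_def)
      then show "\<exists>\<rho>>0. ps_conv (k + l) \<rho> (\<Phi> \<mu> j)" by blast
    qed (use formal0 in blast)
    then have "\<forall>j. \<exists>T. 0 < T \<and> ps_conv (n + (k + l)) T (\<lambda>\<delta>. \<Phi> (\<lambda>i. if i < n then \<delta> i else 0) j (\<lambda>i. \<delta> (i + n)))" by blast
    from choice[OF this] obtain T where T: "\<forall>j. 0 < T j \<and> ps_conv (n + (k + l)) (T j) (\<lambda>\<delta>. \<Phi> (\<lambda>i. if i < n then \<delta> i else 0) j (\<lambda>i. \<delta> (i + n)))" ..
    obtain T0 where T0: "0 < T0" "\<And>j. j \<in> UNIV \<Longrightarrow> T0 \<le> T j" using finite_common_radius[of UNIV T] T by auto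
    define s where "s = min T0 \<rho>"
    have s: "0 < s" "s \<le> T0" "s \<le> \<rho>" using T0(1) \<rho>(1) by (auto simp: s_def)
    define D where "D = (\<lambda>j \<delta>. \<Phi> (\<lambda>i. if i < n then \<delta> i else 0) j (\<lambda>i. \<delta> (i + n)))"
    have D_conv: "ps_conv (n + (k + l)) s (D j)" for j
      unfolding D_def using T ps_conv_mono[of "n + (k + l)" "T j" _ s] T0(2)[of j] s(2) by auto
    have D_jn: "D j (jn n \<gamma> b) = \<Phi> \<gamma> j b" if "\<gamma> \<in> multi_indices n" for j \<gamma> b
    proof -
      have "(\<lambda>i. if i < n then jn n \<gamma> b i else 0) = \<gamma>" using that by (auto simp: jn_def multi_indices_def)
      moreover have "(\<lambda>i. jn n \<gamma> b (i + n)) = b" by (auto simp: jn_def)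
      ultimately show ?thesis by (simp add: D_def)
    qed
    have "vexpands vec_prj 0 k l (\<lambda>_. \<phi> \<gamma>) x0 z0 s (\<lambda>j b. D j (jn n \<gamma> b))" if \<gamma>: "\<gamma> \<in> multi_indices n" for \<gamma>
      unfolding vexpands_def
    proof
      fix j
      show "expands 0 k l (\<lambda>_ x z. \<phi> \<gamma> x z $ j) x0 z0 s (\<lambda>b. D j (jn n \<gamma> b))"
      \<comment> \<open>Up to here \<open>\<phi> \<gamma>\<close> equals the sum of its array only
        within its own radius; continuation extends the equality to the common radius
        \<open>s\<close>.\<close>
      proof (rule expands_on_box[OF _ _ s(1)])
        fix t x z assume "in_box 0 k l x0 z0 s t x z"
        then have "x \<in> N" "z \<in> U" using \<rho>(2) in_box_mono[OF _ s(3)] by blast+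
        then show "\<exists>S e. expands 0 k l (\<lambda>_ x z. \<phi> \<gamma> x z $ j) x z S e" using an[OF \<gamma>] unfolding vexpands_def by blast
      next
        show "expands 0 k l (\<lambda>_ x z. \<phi> \<gamma> x z $ j) x0 z0 (fst (RC \<gamma>)) (\<lambda>b. D j (jn n \<gamma> b))"
          using RC \<gamma> unfolding D_jn[OF \<gamma>] \<Phi>_def vexpands_def by blast
      qed (use ps_conv_slice[OF D_conv \<gamma>] N_top U_top p in auto)
    qed
    then show ?thesis using s(1) D_conv by blast
  qed
  note conv = this
  have "series n \<phi> \<in> A_M_vec n k l N U" "taylor n N U (series n \<phi>) = \<phi>"
    by (rule taylor_series[OF \<phi>], rule conv; assumption)+
  then show ?thesis by (metis image_eqI)
qed

text \<open>Comparing two series covers uniqueness in (i), with zero as the second series, and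
  injectivity in (iii). The point at which the symbol is invertible may vary with \<gamma>.\<close>

lemma formal_solution_unique:
  assumes conn: "connectedin (Euclidean_space k) N" "connectedin (Complex_space l) U"
    and \<phi>: "\<phi> \<in> A_hat n k l N U" and \<psi>: "\<psi> \<in> A_hat n k l N U"
    and eq: "\<And>\<gamma> x z. \<gamma> \<in> multi_indices n - S \<Longrightarrow> x \<in> N \<Longrightarrow> z \<in> U \<Longrightarrow> formal_apply n k P lam \<phi> \<gamma> x z = formal_apply n k P lam \<psi> \<gamma> x z"
    and S: "\<And>\<gamma>. \<gamma> \<in> S \<Longrightarrow> \<phi> \<gamma> = \<psi> \<gamma>"
    and inv: "\<And>\<gamma>. \<gamma> \<in> multi_indices n - S \<Longrightarrow> \<exists>x\<in>N. \<exists>z\<in>U. det (sigma_star n P x z (\<lambda>i. lam i z + of_nat (\<gamma> i))) \<noteq> 0"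
  shows "\<phi> = \<psi>"
proof -
  have "\<phi> \<gamma> = \<psi> \<gamma>" if "\<gamma> \<in> multi_indices n" for \<gamma>
    using that
  proof (induction "multi_deg n \<gamma>" arbitrary: \<gamma> rule: less_induct)
    case (less \<gamma>)
    show ?case
    proof (cases "\<gamma> \<in> S")
      case False
      then have \<gamma>: "\<gamma> \<in> multi_indices n - S" using less.prems by blast
      have A_N: "\<phi> \<gamma> \<in> A_N k l N U" "\<psi> \<gamma> \<in> A_N k l N U" using \<phi> \<psi> less.prems by (auto simp: A_hat_def)
      obtain x1 z1 where q: "x1 \<in> N" "z1 \<in> U" and det1: "det (sigma_star n P x1 z1 (\<lambda>i. lam i z1 + of_nat (\<gamma> i))) \<noteq> 0" using inv[OF \<gamma>] by blast
      obtain R A L where "expansion_at n k l P lam x1 z1 R A L" using expansion_at_exists[OF q] by blast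
      then interpret expansion_at n k l P lam x1 z1 R A L .
      obtain d where d: "expands 0 k l (\<lambda>_ x z. det (sigma_star n P x z (\<lambda>i. lam i z + of_nat (\<gamma> i)))) x1 z1 R d"
        using expands_det[OF R, of 0 k l "\<lambda>_ x z. sigma_star n P x z (\<lambda>i. lam i z + of_nat (\<gamma> i))" x1 z1] sigma_expands by blast
      have "d (\<lambda>_. 0) \<noteq> 0" using expands_center[OF d x0 z0] det1 by simp
      from expands_inverse_ex[OF d this] obtain e T where e: "expands 0 k l (\<lambda>_ x z. inverse (det (sigma_star n P x z (\<lambda>i. lam i z + of_nat (\<gamma> i))))) x1 z1 T e"
        and nz: "\<forall>t x z. in_box 0 k l x1 z1 T t x z \<longrightarrow> det (sigma_star n P x z (\<lambda>i. lam i z + of_nat (\<gamma> i))) \<noteq> 0" by (elim exE conjE)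
      obtain \<rho> where \<rho>: "0 < \<rho>" "\<forall>n t x z. in_box n k l x1 z1 \<rho> t x z \<longrightarrow> x \<in> N \<and> z \<in> U" using box_subset[OF q] by blast
      define s where "s = min T \<rho>"
      have s: "0 < s" "s \<le> T" "s \<le> \<rho>" using \<rho>(1) e by (auto simp: s_def expands_def)
      \<comment> \<open>With the \<gamma>-th term erased only lower indices occur, where the series
        agree by induction.\<close>
      have rest: "formal_apply n k P lam (\<lambda>\<mu>. if \<mu> = \<gamma> then (\<lambda>_ _. 0) else \<phi> \<mu>) \<gamma> x z = formal_apply n k P lam (\<lambda>\<mu>. if \<mu> = \<gamma> then (\<lambda>_ _. 0) else \<psi> \<mu>) \<gamma> x z" for x z
      proof (rule formal_apply_cong)
        fix \<mu> assume "\<mu> \<le> \<gamma>"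
        then show "(if \<mu> = \<gamma> then (\<lambda>_ _. 0) else \<phi> \<mu>) = (if \<mu> = \<gamma> then (\<lambda>_ _. 0) else \<psi> \<mu>)"
          using less.hyps[of \<mu>] multi_deg_less[of \<gamma> n \<mu>] multi_indices_le[of \<gamma> n \<mu>] less.prems by auto
      qed
      have eq_box: "\<phi> \<gamma> x z = \<psi> \<gamma> x z" if box: "in_box 0 k l x1 z1 s t x z" for t x z
      proof -
        have xz: "x \<in> N" "z \<in> U" using \<rho>(2) in_box_mono[OF box s(3)] by blast+
        let ?M = "sigma_star n P x z (\<lambda>i. lam i z + of_nat (\<gamma> i))"
        have "?M *v \<phi> \<gamma> x z = ?M *v \<psi> \<gamma> x z"
          using eq[OF \<gamma> xz] formal_apply_split[OF less.prems xz, of \<phi>] formal_apply_split[OF less.prems xz, of \<psi>] rest by simp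
        moreover have dM: "det ?M \<noteq> 0" by (rule nz[rule_format, OF in_box_mono[OF box s(2)]])
        ultimately show ?thesis
          using cramer[OF dM, of "\<phi> \<gamma> x z" "?M *v \<psi> \<gamma> x z"] cramer[OF dM, of "\<psi> \<gamma> x z" "?M *v \<psi> \<gamma> x z"] by simp
      qed
      have loc: "\<exists>S e. expands 0 k l (\<lambda>_ x z. \<phi> \<gamma> x z $ j - \<psi> \<gamma> x z $ j) x z S e" if xz: "x \<in> N" "z \<in> U" for x z j
      proof -
        obtain R1 C1 R2 C2 where 1: "expands 0 k l (\<lambda>_ x z. \<phi> \<gamma> x z $ j) x z R1 C1" and 2: "expands 0 k l (\<lambda>_ x z. \<psi> \<gamma> x z $ j) x z R2 C2"
          using A_N xz unfolding A_N_iff vexpands_def by blast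
        have R12: "0 < min R1 R2" "min R1 R2 \<le> R1" "min R1 R2 \<le> R2" using 1 2 by (auto simp: expands_def)
        show ?thesis using expands_add[OF expands_mono[OF 1 R12(1,2)] expands_uminus[OF expands_mono[OF 2 R12(1,3)]]] by auto
      qed
      have "\<phi> \<gamma> x z $ j = \<psi> \<gamma> x z $ j" if xz: "x \<in> N" "z \<in> U" for x z j
      proof -
        have "expands 0 k l (\<lambda>_ x z. \<phi> \<gamma> x z $ j - \<psi> \<gamma> x z $ j) x1 z1 s (\<lambda>_. 0)" using s(1) eq_box by (simp add: expands_def)
        from expands_identity_theorem[OF N conn(1) U conn(2) loc q this xz] show ?thesis by simp
      qed
      moreover have "\<phi> \<gamma> x z = \<psi> \<gamma> x z" if "\<not> (x \<in> N \<and> z \<in> U)" for x z using A_N that unfolding A_N_def by auto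
      ultimately show ?thesis by (intro ext) (metis vec_eq_iff)
    qed (use S in blast)
  qed
  moreover have "\<phi> \<gamma> = \<psi> \<gamma>" if "\<gamma> \<notin> multi_indices n" for \<gamma> using \<phi> \<psi> that by (simp add: A_hat_def)
  ultimately show ?thesis by blast
qed

end

section \<open>The restriction map\<close>

lemma restrict_to_Sigma_bar_eqI:
  "(\<And>\<gamma>. \<gamma> \<in> Sigma_bar n S \<Longrightarrow> \<phi> \<gamma> = \<psi> \<gamma>) \<Longrightarrow> (\<And>\<gamma>. \<gamma> \<notin> Sigma_bar n S \<Longrightarrow> \<psi> \<gamma> = (\<lambda>_ _. 0)) \<Longrightarrow> restrict_to_Sigma_bar n S \<phi> = \<psi>"
  by (rule ext) (simp add: restrict_to_Sigma_bar_def)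

context open_pair
begin

lemma A_N_zero: "(\<lambda>_ _. 0 :: complex ^ 'm::finite) \<in> A_N k l N U"
proof -
  have "vexpands vec_prj 0 k l (\<lambda>_ _ _. 0 :: complex ^ 'm) x z 1 (\<lambda>_ _. 0)" for x z by (simp add: vexpands_def expands_zero)
  then show ?thesis unfolding A_N_iff by blast
qed

text \<open>Truncating the series amounts to masking the joint array, which converges at the same
  radius.\<close>

lemma restrict_in_taylor:
  assumes "\<phi> \<in> taylor n N U ` A_M_vec n k l N U"
  shows "restrict_to_Sigma_bar n S \<phi> \<in> taylor n N U ` A_M_vec n k l N U"
proof -
  let ?\<phi> = "restrict_to_Sigma_bar n S \<phi>"
  obtain f where f: "f \<in> A_M_vec n k l N U" "\<phi> = taylor n N U f" using assms by blast
  have "\<phi> \<in> A_hat n k l N U" unfolding f(2) by (rule taylor_in_A_hat[OF f(1)])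
  then have hat: "?\<phi> \<in> A_hat n k l N U" by (auto simp: A_hat_def restrict_to_Sigma_bar_def A_N_zero)
  have loc: "\<exists>R>0. \<exists>C. (\<forall>j. ps_conv (n + (k + l)) R (C j)) \<and> (\<forall>\<gamma>\<in>multi_indices n. vexpands vec_prj 0 k l (\<lambda>_. ?\<phi> \<gamma>) x z R (\<lambda>j b. C j (jn n \<gamma> b)))"
    if p: "x \<in> N" "z \<in> U" for x z
  proof -
    obtain R C where RC: "vexpands vec_prj n k l f x z R C" using f(1) p unfolding A_M_vec_iff by blast
    obtain s where s: "0 < s" "s \<le> R" "\<forall>\<gamma>\<in>multi_indices n. vexpands vec_prj 0 k l (\<lambda>_. \<phi> \<gamma>) x z s (\<lambda>j b. C j (jn n \<gamma> b))"
      using taylor_vexpands[OF RC p] unfolding f(2) by blast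
    define D where "D = (\<lambda>j \<delta>. if (\<lambda>i. if i < n then \<delta> i else 0) \<in> Sigma_bar n S then C j \<delta> else 0)"
    have "ps_conv (n + (k + l)) s (C j)" for j using RC ps_conv_mono[OF _ s(2)] by (simp add: vexpands_def expands_def)
    then have D: "ps_conv (n + (k + l)) s (D j)" for j unfolding D_def by (rule ps_conv_mask)
    have "vexpands vec_prj 0 k l (\<lambda>_. ?\<phi> \<gamma>) x z s (\<lambda>j b. D j (jn n \<gamma> b))" if \<gamma>: "\<gamma> \<in> multi_indices n" for \<gamma>
    proof -
      have "(\<lambda>i. if i < n then jn n \<gamma> b i else 0) = \<gamma>" for b using \<gamma> by (auto simp: jn_def multi_indices_def)
      then have D_jn: "D j (jn n \<gamma> b) = (if \<gamma> \<in> Sigma_bar n S then C j (jn n \<gamma> b) else 0)" for j b by (simp add: D_def)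
      show ?thesis
      proof (cases "\<gamma> \<in> Sigma_bar n S")
        case True
        then show ?thesis unfolding D_jn using s(3) \<gamma> by (simp add: restrict_to_Sigma_bar_def)
      next
        case False
        then show ?thesis unfolding D_jn using s(1) by (simp add: restrict_to_Sigma_bar_def vexpands_def expands_zero)
      qed
    qed
    then show ?thesis using s(1) D by (intro exI[of _ s] conjI exI[of _ D]) auto
  qed
  have "series n ?\<phi> \<in> A_M_vec n k l N U" "taylor n N U (series n ?\<phi>) = ?\<phi>"
    by (rule taylor_series[OF hat], rule loc; assumption)+
  then show ?thesis by (metis image_eqI)
qed

lemma const_series_in_taylor:
  assumes u: "u \<in> A_N k l N U" shows "const_series u \<in> taylor n N U ` A_M_vec n k l N U"
proof -
  have hat: "const_series u \<in> A_hat n k l N U" using u by (auto simp: A_hat_def const_series_def A_N_zero)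
  have loc: "\<exists>R>0. \<exists>C. (\<forall>j. ps_conv (n + (k + l)) R (C j)) \<and> (\<forall>\<gamma>\<in>multi_indices n. vexpands vec_prj 0 k l (\<lambda>_. const_series u \<gamma>) x z R (\<lambda>j b. C j (jn n \<gamma> b)))"
    if p: "x \<in> N" "z \<in> U" for x z
  proof -
    obtain R c where Rc: "vexpands vec_prj 0 k l (\<lambda>_. u) x z R c" using u p unfolding A_N_iff by blast
    then have R: "0 < R" "\<And>j. ps_conv (k + l) R (c j)" by (auto simp: vexpands_def expands_def)
    have "vexpands vec_prj 0 k l (\<lambda>_. const_series u \<gamma>) x z R (\<lambda>j b. ps_lift n (c j) (jn n \<gamma> b))" if "\<gamma> \<in> multi_indices n" for \<gamma>
      unfolding ps_lift_jn[OF that] using Rc R(1) by (cases "\<gamma> = (\<lambda>_. 0)") (auto simp: const_series_def vexpands_def expands_zero)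
    then show ?thesis using R ps_conv_lift by (intro exI[of _ R] conjI exI[of _ "\<lambda>j. ps_lift n (c j)"]) auto
  qed
  have "series n (const_series u) \<in> A_M_vec n k l N U" "taylor n N U (series n (const_series u)) = const_series u"
    by (rule taylor_series[OF hat], rule loc; assumption)+
  then show ?thesis by (metis image_eqI)
qed

end

context operator_setting
begin

text \<open>Here \<open>Sigma_bar\<close> is {0}: one coefficient and one equation are left, and
  that equation has no lower-order terms.\<close>

lemma Sol_Sigma_zero:
  "Sol_Sigma n k l N U P lam {\<lambda>_. 0} =
     const_series ` {u \<in> A_N k l N U. \<forall>x\<in>N. \<forall>z\<in>U. sigma_star n P x z (\<lambda>i. lam i z) *v u x z = 0}"
proof -
  have bar: "Sigma_bar n {\<lambda>_. 0} = {\<lambda>_. 0}" by (auto simp: Sigma_bar_def fun_eq_iff)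
  have split: "formal_apply n k P lam \<phi> (\<lambda>_. 0) x z = sigma_star n P x z (\<lambda>i. lam i z) *v \<phi> (\<lambda>_. 0) x z"
    if p: "x \<in> N" "z \<in> U" and \<phi>: "\<forall>\<alpha>. \<alpha> \<noteq> (\<lambda>_. 0) \<longrightarrow> \<phi> \<alpha> = (\<lambda>_ _. 0)" for \<phi> x z
  proof -
    have "(\<lambda>\<mu>. if \<mu> = (\<lambda>_. 0) then (\<lambda>_ _. 0) else \<phi> \<mu>) = (\<lambda>_ _ _. 0)" using \<phi> by auto
    then show ?thesis using formal_apply_split[OF multi_indices_zero p, of \<phi>] formal_apply_zero by simp
  qed
  have iff: "\<phi> \<in> Sol_Sigma n k l N U P lam {\<lambda>_. 0} \<longleftrightarrow> \<phi> \<in> taylor n N U ` A_M_vec n k l N U \<and>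
      (\<forall>\<alpha>. \<alpha> \<noteq> (\<lambda>_. 0) \<longrightarrow> \<phi> \<alpha> = (\<lambda>_ _. 0)) \<and> (\<forall>x\<in>N. \<forall>z\<in>U. sigma_star n P x z (\<lambda>i. lam i z) *v \<phi> (\<lambda>_. 0) x z = 0)" for \<phi>
    using split[of _ _ \<phi>] by (subst Sol_Sigma_iff) (auto simp: bar)
  show ?thesis
  proof (intro set_eqI iffI)
    fix \<phi> assume "\<phi> \<in> Sol_Sigma n k l N U P lam {\<lambda>_. 0}"
    then have \<phi>: "\<phi> \<in> taylor n N U ` A_M_vec n k l N U" "\<forall>\<alpha>. \<alpha> \<noteq> (\<lambda>_. 0) \<longrightarrow> \<phi> \<alpha> = (\<lambda>_ _. 0)"
      "\<forall>x\<in>N. \<forall>z\<in>U. sigma_star n P x z (\<lambda>i. lam i z) *v \<phi> (\<lambda>_. 0) x z = 0" unfolding iff by blast+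
    have "\<phi> \<in> A_hat n k l N U" using \<phi>(1) taylor_in_A_hat by blast
    then have "\<phi> (\<lambda>_. 0) \<in> A_N k l N U" by (simp add: A_hat_def)
    moreover have "\<phi> = const_series (\<phi> (\<lambda>_. 0))"
    proof (rule ext)
      show "\<phi> \<alpha> = const_series (\<phi> (\<lambda>_. 0)) \<alpha>" for \<alpha>
        using \<phi>(2) by (cases "\<alpha> = (\<lambda>_. 0)") (simp_all only: const_series_def if_True if_False simp_thms)
    qed
    ultimately show "\<phi> \<in> const_series ` {u \<in> A_N k l N U. \<forall>x\<in>N. \<forall>z\<in>U. sigma_star n P x z (\<lambda>i. lam i z) *v u x z = 0}"
      using \<phi>(3) by (intro image_eqI[of _ _ "\<phi> (\<lambda>_. 0)"]) auto
  next
    fix \<phi> assume "\<phi> \<in> const_series ` {u \<in> A_N k l N U. \<forall>x\<in>N. \<forall>z\<in>U. sigma_star n P x z (\<lambda>i. lam i z) *v u x z = 0}"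
    then obtain u where u: "u \<in> A_N k l N U" "\<forall>x\<in>N. \<forall>z\<in>U. sigma_star n P x z (\<lambda>i. lam i z) *v u x z = 0" "\<phi> = const_series u" by blast
    show "\<phi> \<in> Sol_Sigma n k l N U P lam {\<lambda>_. 0}"
      unfolding iff u(3) using const_series_in_taylor[OF u(1)] u(2) by (auto simp: const_series_def)
  qed
qed

text \<open>Invertibility at every point of \<open>N \<times> U\<close> lets the coefficients
  outside \<open>D\<close> be solved for pointwise; their analyticity follows by induction on the
  degree from \<open>vexpands_solution\<close>.\<close>

lemma formal_solution_exists:
  assumes \<psi>: "\<psi> \<in> A_hat n k l N U"
    and inv: "\<And>\<gamma> x z. \<gamma> \<in> multi_indices n - D \<Longrightarrow> x \<in> N \<Longrightarrow> z \<in> U \<Longrightarrow> det (sigma_star n P x z (\<lambda>i. lam i z + of_nat (\<gamma> i))) \<noteq> 0"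
  shows "\<exists>\<phi>. \<phi> \<in> A_hat n k l N U \<and> (\<forall>\<gamma>\<in>multi_indices n \<inter> D. \<phi> \<gamma> = \<psi> \<gamma>) \<and>
     (\<forall>\<gamma>\<in>multi_indices n - D. \<forall>x\<in>N. \<forall>z\<in>U. formal_apply n k P lam \<phi> \<gamma> x z = 0)"
proof -
  let ?M = "\<lambda>\<gamma> x z. sigma_star n P x z (\<lambda>i. lam i z + of_nat (\<gamma> i))"
  let ?mask = "\<lambda>\<gamma> (e :: (nat \<Rightarrow> nat) \<Rightarrow> (nat \<Rightarrow> real) \<Rightarrow> (nat \<Rightarrow> complex) \<Rightarrow> complex ^ 'm) \<mu>. if \<mu> = \<gamma> then (\<lambda>_ _. 0) else e \<mu>"
  let ?F = "\<lambda>e \<gamma> x z. formal_apply n k P lam (?mask \<gamma> e) \<gamma> x z"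
  \<comment> \<open>\<open>SOME\<close> selects a solution of the linear system, which exists where
    the symbol is invertible; the value 0 outside \<open>N\<close> and \<open>U\<close> is imposed
    by \<open>A_N\<close>.\<close>
  define H where "H = (\<lambda>e \<gamma>. if \<gamma> \<in> D then \<psi> \<gamma> else (\<lambda>x z. if x \<in> N \<and> z \<in> U then SOME v. ?M \<gamma> x z *v v = - ?F e \<gamma> x z else 0))"
  have H_cong: "H e \<gamma> = H e' \<gamma>" if \<gamma>: "\<gamma> \<in> multi_indices n" and ee: "\<And>\<beta>. \<beta> \<in> multi_indices n \<Longrightarrow> multi_deg n \<beta> < multi_deg n \<gamma> \<Longrightarrow> e \<beta> = e' \<beta>" for e e' \<gamma>
  proof -
    have "?F e \<gamma> x z = ?F e' \<gamma> x z" for x z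
    proof (rule formal_apply_cong)
      fix \<mu> assume "\<mu> \<le> \<gamma>"
      then show "?mask \<gamma> e \<mu> = ?mask \<gamma> e' \<mu>" using ee[of \<mu>] multi_deg_less[OF \<gamma>, of \<mu>] multi_indices_le[OF \<gamma>, of \<mu>] by auto
    qed
    then show ?thesis by (simp only: H_def)
  qed
  have "\<exists>e. \<forall>\<gamma>\<in>multi_indices n. e \<gamma> = H e \<gamma>"
  proof (rule multi_index_recursion[of n H])
    fix e assume "\<And>\<gamma>. \<gamma> \<in> multi_indices n \<Longrightarrow> e \<gamma> = H e \<gamma>"
    then show ?thesis by (intro exI[of _ e] ballI)
  qed (rule H_cong; assumption?)
  then obtain e where e: "\<forall>\<gamma>\<in>multi_indices n. e \<gamma> = H e \<gamma>" ..
  \<comment> \<open>\<open>A_hat\<close> prescribes 0 outside the multi-indices; \<open>H\<close> at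
    a multi-index does not see the change.\<close>
  define \<phi> where "\<phi> = (\<lambda>\<gamma>. if \<gamma> \<in> multi_indices n then e \<gamma> else (\<lambda>_ _. 0))"
  have \<phi>: "\<phi> \<gamma> = H \<phi> \<gamma>" if \<gamma>: "\<gamma> \<in> multi_indices n" for \<gamma>
  proof -
    have "H e \<gamma> = H \<phi> \<gamma>" by (rule H_cong[OF \<gamma>]) (simp add: \<phi>_def)
    then show ?thesis using e \<gamma> by (simp add: \<phi>_def)
  qed
  have sol: "?M \<gamma> x z *v \<phi> \<gamma> x z = - ?F \<phi> \<gamma> x z" if \<gamma>: "\<gamma> \<in> multi_indices n - D" and p: "x \<in> N" "z \<in> U" for \<gamma> x z
  proof -
    have "\<exists>v. ?M \<gamma> x z *v v = - ?F \<phi> \<gamma> x z" using cramer[OF inv[OF \<gamma> p], of _ "- ?F \<phi> \<gamma> x z"] by blast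
    from someI_ex[OF this] show ?thesis using \<phi>[of \<gamma>] \<gamma> p by (simp add: H_def)
  qed
  have A_N: "\<phi> \<gamma> \<in> A_N k l N U" if "\<gamma> \<in> multi_indices n" for \<gamma>
    using that
  proof (induction "multi_deg n \<gamma>" arbitrary: \<gamma> rule: less_induct)
    case (less \<gamma>)
    show ?case
    proof (cases "\<gamma> \<in> D")
      case True
      then show ?thesis using \<phi>[OF less.prems] \<psi> less.prems by (simp add: H_def A_hat_def)
    next
      case False
      then have \<gamma>: "\<gamma> \<in> multi_indices n - D" using less.prems by blast
      have "\<exists>R C. vexpands vec_prj 0 k l (\<lambda>_. \<phi> \<gamma>) x0 z0 R C" if p: "x0 \<in> N" "z0 \<in> U" for x0 z0
      proof -
        obtain R A L where "expansion_at n k l P lam x0 z0 R A L" using expansion_at_exists[OF p] by blast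
        then interpret expansion_at n k l P lam x0 z0 R A L .
        obtain \<rho> where \<rho>: "0 < \<rho>" "\<forall>n t x z. in_box n k l x0 z0 \<rho> t x z \<longrightarrow> x \<in> N \<and> z \<in> U" using box_subset[OF p] by blast
        have "?mask \<gamma> \<phi> \<mu> \<in> A_N k l N U" if \<mu>: "\<mu> \<le> \<gamma>" for \<mu>
          using less.hyps[of \<mu>] multi_deg_less[OF less.prems \<mu>] multi_indices_le[OF less.prems \<mu>] A_N_zero by auto
        then have "\<forall>\<mu>\<in>{\<mu>. \<mu> \<le> \<gamma>}. \<exists>RC. vexpands vec_prj 0 k l (\<lambda>_. ?mask \<gamma> \<phi> \<mu>) x0 z0 (fst RC) (snd RC)"
          using p unfolding A_N_iff by fastforce
        from bchoice[OF this] obtain RC where RC: "\<forall>\<mu>\<in>{\<mu>. \<mu> \<le> \<gamma>}. vexpands vec_prj 0 k l (\<lambda>_. ?mask \<gamma> \<phi> \<mu>) x0 z0 (fst (RC \<mu>)) (snd (RC \<mu>))" ..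
        have rad: "0 < fst (RC \<mu>)" if "\<mu> \<in> {\<mu>. \<mu> \<le> \<gamma>}" for \<mu> using RC[rule_format, OF that] by (simp add: vexpands_def expands_def)
        obtain s where s: "0 < s" "\<And>\<mu>. \<mu> \<in> {\<mu>. \<mu> \<le> \<gamma>} \<Longrightarrow> s \<le> fst (RC \<mu>)"
          using finite_common_radius[OF finite_le_multi_index[OF less.prems], of "\<lambda>\<mu>. fst (RC \<mu>)"] rad by blast
        define T where "T = min s R"
        have T: "0 < T" "T \<le> s" "T \<le> R" using s(1) R by (auto simp: T_def)
        have F: "vexpands vec_prj 0 k l (\<lambda>_. ?F \<phi> \<gamma>) x0 z0 T (formal_arr (\<lambda>\<mu>. snd (RC \<mu>)) \<gamma>)"
        proof (rule vexpands_formal_apply[OF less.prems T(1,3)])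
          fix \<mu> assume "\<mu> \<le> \<gamma>"
          then have \<mu>: "\<mu> \<in> {\<mu>. \<mu> \<le> \<gamma>}" by simp
          show "vexpands vec_prj 0 k l (\<lambda>_. ?mask \<gamma> \<phi> \<mu>) x0 z0 T (snd (RC \<mu>))"
            by (rule vexpands_mono[OF RC[rule_format, OF \<mu>] T(1) order_trans[OF T(2) s(2)[OF \<mu>]]])
        qed
        show ?thesis
        proof (rule vexpands_solution[OF T(1), of k l "?M \<gamma>" x0 z0 "\<lambda>x z. - ?F \<phi> \<gamma> x z"])
          show "\<exists>c. expands 0 k l (\<lambda>_ x z. ?M \<gamma> x z $ i $ j) x0 z0 T c" for i j
            using sigma_expands[of \<gamma> i j] expands_mono[OF _ T(1,3)] by blast
          show "\<exists>c. expands 0 k l (\<lambda>_ x z. (- ?F \<phi> \<gamma> x z) $ i) x0 z0 T c" for i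
            using expands_uminus[OF F[unfolded vexpands_def, rule_format, of i]] by auto
          show "?M \<gamma> x z *v \<phi> \<gamma> x z = - ?F \<phi> \<gamma> x z" if "in_box 0 k l x0 z0 \<rho> t x z" for t x z
            using sol[OF \<gamma>] \<rho>(2) that by blast
        qed (use inv[OF \<gamma> p] x0 z0 \<rho>(1) in auto)
      qed
      moreover have "\<phi> \<gamma> x z = 0" if "x \<notin> N \<or> z \<notin> U" for x z using \<phi>[OF less.prems] False that by (auto simp: H_def)
      ultimately show ?thesis unfolding A_N_iff by blast
    qed
  qed
  have "\<phi> \<in> A_hat n k l N U" using A_N by (simp add: A_hat_def \<phi>_def)
  moreover have "\<phi> \<gamma> = \<psi> \<gamma>" if "\<gamma> \<in> multi_indices n \<inter> D" for \<gamma> using \<phi>[of \<gamma>] that by (simp add: H_def)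
  moreover have "formal_apply n k P lam \<phi> \<gamma> x z = 0" if \<gamma>: "\<gamma> \<in> multi_indices n - D" and p: "x \<in> N" "z \<in> U" for \<gamma> x z
    using formal_apply_split[OF _ p, of \<gamma> \<phi>] sol[OF \<gamma> p] \<gamma> by simp
  ultimately show ?thesis by blast
qed

lemma bij_betw_restrict_to_Sigma_bar:
  assumes conn: "connectedin (Euclidean_space k) N" "connectedin (Complex_space l) U"
    and ne: "x1 \<in> N" "z1 \<in> U" and S: "finite S" "S \<subseteq> multi_indices n"
    and ell: "\<And>x z. x \<in> N \<Longrightarrow> z \<in> U \<Longrightarrow> elliptic_at n k l P r x z"
    and inv: "\<And>\<gamma> x z. \<gamma> \<in> multi_indices n - S \<Longrightarrow> x \<in> N \<Longrightarrow> z \<in> U \<Longrightarrow> det (sigma_star n P x z (\<lambda>i. lam i z + of_nat (\<gamma> i))) \<noteq> 0"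
  shows "bij_betw (restrict_to_Sigma_bar n S) (Sol n k l N U P lam) (Sol_Sigma n k l N U P lam S)"
proof (rule bij_betw_imageI)
  let ?D = "Sigma_bar n S"
  have inv': "det (sigma_star n P x z (\<lambda>i. lam i z + of_nat (\<gamma> i))) \<noteq> 0" if "\<gamma> \<in> multi_indices n - ?D" "x \<in> N" "z \<in> U" for \<gamma> x z
    using inv[of \<gamma> x z] that subset_Sigma_bar[OF S(2)] by blast
  \<comment> \<open>The equation at \<gamma> involves only \<mu> \<le> \<gamma>, which remain in the
    downward closed \<open>?D\<close>; truncating or extending a series therefore leaves the
    equations in \<open>?D\<close> unchanged.\<close>
  have cong: "formal_apply n k P lam \<phi> \<gamma> x z = formal_apply n k P lam \<psi> \<gamma> x z" if \<gamma>: "\<gamma> \<in> ?D" and eq: "\<And>\<mu>. \<mu> \<in> ?D \<Longrightarrow> \<phi> \<mu> = \<psi> \<mu>" for \<phi> \<psi> \<gamma> x z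
    by (rule formal_apply_cong) (rule eq, rule Sigma_bar_le[OF \<gamma>])
  show "inj_on (restrict_to_Sigma_bar n S) (Sol n k l N U P lam)"
  proof (rule inj_onI)
    fix \<phi> \<psi> assume \<phi>: "\<phi> \<in> Sol n k l N U P lam" and \<psi>: "\<psi> \<in> Sol n k l N U P lam"
      and eq: "restrict_to_Sigma_bar n S \<phi> = restrict_to_Sigma_bar n S \<psi>"
    show "\<phi> = \<psi>"
    proof (rule formal_solution_unique[OF conn, where S = ?D])
      show "\<phi> \<in> A_hat n k l N U" "\<psi> \<in> A_hat n k l N U" using \<phi> \<psi> taylor_in_A_hat unfolding Sol_iff by blast+
      show "\<phi> \<gamma> = \<psi> \<gamma>" if "\<gamma> \<in> ?D" for \<gamma> using fun_cong[OF eq, of \<gamma>] that by (simp add: restrict_to_Sigma_bar_def)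
      show "formal_apply n k P lam \<phi> \<gamma> x z = formal_apply n k P lam \<psi> \<gamma> x z" if "\<gamma> \<in> multi_indices n - ?D" "x \<in> N" "z \<in> U" for \<gamma> x z
        using \<phi> \<psi> that unfolding Sol_iff by simp
      show "\<exists>x\<in>N. \<exists>z\<in>U. det (sigma_star n P x z (\<lambda>i. lam i z + of_nat (\<gamma> i))) \<noteq> 0" if "\<gamma> \<in> multi_indices n - ?D" for \<gamma>
        using inv'[OF that ne] ne by blast
    qed
  qed
  show "restrict_to_Sigma_bar n S ` Sol n k l N U P lam = Sol_Sigma n k l N U P lam S"
  proof (intro subset_antisym subsetI)
    fix \<psi> assume "\<psi> \<in> restrict_to_Sigma_bar n S ` Sol n k l N U P lam"
    then obtain \<phi> where \<phi>: "\<phi> \<in> Sol n k l N U P lam" "\<psi> = restrict_to_Sigma_bar n S \<phi>" by blast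
    have "formal_apply n k P lam \<psi> \<gamma> x z = 0" if "\<gamma> \<in> ?D" "x \<in> N" "z \<in> U" for \<gamma> x z
    proof -
      have "formal_apply n k P lam \<psi> \<gamma> x z = formal_apply n k P lam \<phi> \<gamma> x z"
        by (rule cong[OF that(1)]) (simp add: \<phi>(2) restrict_to_Sigma_bar_def)
      then show ?thesis using \<phi>(1) that Sigma_bar_subset[of n S] unfolding Sol_iff by auto
    qed
    moreover have "\<psi> \<in> taylor n N U ` A_M_vec n k l N U" using restrict_in_taylor \<phi> unfolding Sol_iff by blast
    moreover have "\<psi> \<alpha> = (\<lambda>_ _. 0)" if "\<alpha> \<notin> ?D" for \<alpha> using that by (simp add: \<phi>(2) restrict_to_Sigma_bar_def)
    ultimately show "\<psi> \<in> Sol_Sigma n k l N U P lam S" unfolding Sol_Sigma_iff[OF S] by blast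
  next
    fix \<psi> assume "\<psi> \<in> Sol_Sigma n k l N U P lam S"
    then have \<psi>: "\<psi> \<in> taylor n N U ` A_M_vec n k l N U" "\<forall>\<alpha>. \<alpha> \<notin> ?D \<longrightarrow> \<psi> \<alpha> = (\<lambda>_ _. 0)"
      "\<forall>\<gamma>\<in>?D. \<forall>x\<in>N. \<forall>z\<in>U. formal_apply n k P lam \<psi> \<gamma> x z = 0" unfolding Sol_Sigma_iff[OF S] by blast+
    have "\<psi> \<in> A_hat n k l N U" using \<psi>(1) taylor_in_A_hat by blast
    then obtain \<phi> where \<phi>: "\<phi> \<in> A_hat n k l N U" "\<forall>\<gamma>\<in>multi_indices n \<inter> ?D. \<phi> \<gamma> = \<psi> \<gamma>"
      "\<forall>\<gamma>\<in>multi_indices n - ?D. \<forall>x\<in>N. \<forall>z\<in>U. formal_apply n k P lam \<phi> \<gamma> x z = 0"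
      using formal_solution_exists[of \<psi> ?D] inv' by blast
    have eq: "\<phi> \<gamma> = \<psi> \<gamma>" if "\<gamma> \<in> ?D" for \<gamma> using \<phi>(2) that Sigma_bar_subset[of n S] by blast
    have formal: "formal_apply n k P lam \<phi> \<gamma> x z = 0" if "\<gamma> \<in> multi_indices n" "x \<in> N" "z \<in> U" for \<gamma> x z
    proof (cases "\<gamma> \<in> ?D")
      case True
      then show ?thesis using cong[OF True, of \<phi> \<psi> x z] eq \<psi>(3) that by simp
    next
      case False
      then show ?thesis using \<phi>(3) that by blast
    qed
    have "\<phi> \<in> taylor n N U ` A_M_vec n k l N U" by (rule formal_solution_converges[OF \<phi>(1)]) (rule formal ell; assumption)+
    then have "\<phi> \<in> Sol n k l N U P lam" unfolding Sol_iff using formal by blast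
    moreover have "restrict_to_Sigma_bar n S \<phi> = \<psi>" by (rule restrict_to_Sigma_bar_eqI) (use eq \<psi>(2) in auto)
    ultimately show "\<psi> \<in> restrict_to_Sigma_bar n S ` Sol n k l N U P lam" by blast
  qed
qed

end

section \<open>Coordinate domains\<close>

lemma openin_N_of:
  assumes "openin (prod_topology (Euclidean_space n) (Euclidean_space k)) M"
  shows "openin (Euclidean_space k) (N_of M)"
proof (subst openin_subopen, intro ballI)
  fix x assume "x \<in> N_of M"
  then have "(\<lambda>_. 0, x) \<in> M" by (simp add: N_of_def)
  from openin_prod_topology_alt[THEN iffD1, rule_format, OF assms this]
  obtain T V where "openin (Euclidean_space k) V" "(\<lambda>_. 0) \<in> T" "x \<in> V" "T \<times> V \<subseteq> M" by (elim exE conjE)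
  then show "\<exists>V. openin (Euclidean_space k) V \<and> x \<in> V \<and> V \<subseteq> N_of M" by (intro exI[of _ V]) (auto simp: N_of_def)
qed

text \<open>Boxes keep everything connected: \<open>M'\<close> is a product of two of them, and its
  x-factor is exactly \<open>N_of M'\<close> because 0 lies in the t-factor.\<close>

lemma small_coordinate_domain:
  assumes M: "coordinate_domain n k M" and U: "parameter_domain l zo U" and xo: "xo \<in> N_of M" and s: "0 < s"
  shows "\<exists>M' U'. M' \<subseteq> M \<and> coordinate_domain n k M' \<and> xo \<in> N_of M' \<and> U' \<subseteq> U \<and> parameter_domain l zo U' \<and>
     (\<forall>x\<in>N_of M'. \<forall>z\<in>U'. in_box 0 k l xo zo s (\<lambda>_. 0) x z)"
proof -
  define BT where "BT = (\<lambda>R. {t :: nat \<Rightarrow> real. (\<forall>i\<ge>n. t i = 0) \<and> (\<forall>i<n. norm (t i - 0) < R)})"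
  define BX where "BX = (\<lambda>R. {x. (\<forall>i\<ge>k. x i = 0) \<and> (\<forall>i<k. norm (x i - xo i) < R)})"
  define BZ where "BZ = (\<lambda>R. {z. (\<forall>i\<ge>l. z i = 0) \<and> (\<forall>i<l. norm (z i - zo i) < R)})"
  have BT: "openin (Euclidean_space n) (BT R)" "connectedin (Euclidean_space n) (BT R)" for R
    unfolding BT_def Euclidean_space_eq by (rule openin_coordinate_ball connectedin_coordinate_ball)+
  have BX: "openin (Euclidean_space k) (BX R)" "connectedin (Euclidean_space k) (BX R)" for R
    unfolding BX_def Euclidean_space_eq by (rule openin_coordinate_ball connectedin_coordinate_ball)+
  have BZ: "openin (Complex_space l) (BZ R)" "connectedin (Complex_space l) (BZ R)" for R
    unfolding BZ_def Complex_space_def by (rule openin_coordinate_ball connectedin_coordinate_ball)+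
  have oM: "openin (prod_topology (Euclidean_space n) (Euclidean_space k)) M" using M by (simp add: coordinate_domain_def)
  have "(\<lambda>_. 0, xo) \<in> M" using xo by (simp add: N_of_def)
  from openin_prod_topology_alt[THEN iffD1, rule_format, OF oM this]
  obtain T V where TV: "openin (Euclidean_space n) T" "openin (Euclidean_space k) V" "(\<lambda>_. 0) \<in> T" "xo \<in> V" "T \<times> V \<subseteq> M" by (elim exE conjE)
  obtain R1 where R1: "0 < R1" "BT R1 \<subseteq> T"
    using coordinate_ball_subset[of n T "\<lambda>_. 0"] TV(1,3) unfolding BT_def Euclidean_space_eq by auto
  obtain R2 where R2: "0 < R2" "BX R2 \<subseteq> V"
    using coordinate_ball_subset[of k V xo] TV(2,4) unfolding BX_def Euclidean_space_eq by auto
  obtain R3 where R3: "0 < R3" "BZ R3 \<subseteq> U"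
    using coordinate_ball_subset[of l U zo] U unfolding BZ_def Complex_space_def parameter_domain_def by auto
  define r where "r = min s (min R1 (min R2 R3))"
  have r: "0 < r" "r \<le> s" "r \<le> R1" "r \<le> R2" "r \<le> R3" using s R1 R2 R3 by (auto simp: r_def)
  have mono: "BT r \<subseteq> BT R1" "BX r \<subseteq> BX R2" "BX r \<subseteq> BX s" "BZ r \<subseteq> BZ R3" "BZ r \<subseteq> BZ s"
    using r unfolding BT_def BX_def BZ_def by force+
  have top: "xo \<in> topspace (Euclidean_space k)" "zo \<in> topspace (Complex_space l)"
    using TV(2,4) U openin_subset unfolding parameter_domain_def by blast+
  have in_T: "(\<lambda>_. 0) \<in> BT r" and in_X: "xo \<in> BX r" and in_Z: "zo \<in> BZ r"
    using r(1) top by (auto simp: BT_def BX_def BZ_def Euclidean_space_topspace Complex_space_topspace)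
  have N': "N_of (BT r \<times> BX r) = BX r" using in_T by (auto simp: N_of_def)
  have "in_box 0 k l xo zo s (\<lambda>_. 0) x z" if "x \<in> BX r" "z \<in> BZ r" for x z
  proof -
    have "x \<in> BX s" "z \<in> BZ s" using that mono by blast+
    then show ?thesis by (simp add: in_box_def BX_def BZ_def Euclidean_space_topspace Complex_space_topspace)
  qed
  moreover have "BT r \<times> BX r \<subseteq> M" using mono(1,2) R1(2) R2(2) TV(5) by blast
  moreover have "coordinate_domain n k (BT r \<times> BX r)"
    unfolding coordinate_domain_def N' openin_prod_Times_iff connectedin_Times using BT BX by blast
  moreover have "BZ r \<subseteq> U" using mono(4) R3(2) by blast
  moreover have "parameter_domain l zo (BZ r)" unfolding parameter_domain_def using BZ in_Z by blast
  ultimately show ?thesis using in_X N' by (intro exI[of _ "BT r \<times> BX r"] exI[of _ "BZ r"]) simp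
qed

lemma operator_setting_subset:
  assumes "operator_setting n k l N U P lam" "N' \<subseteq> N" "U' \<subseteq> U" "openin (Euclidean_space k) N'" "openin (Complex_space l) U'"
  shows "operator_setting n k l N' U' P lam"
proof -
  interpret operator_setting n k l N U P lam by fact
  show ?thesis
  proof
    show "P \<in> D_star n k l N' U'" using P assms(2,3) unfolding D_star_def A_M_def by blast
    show "lam i \<in> O_space l U'" if "i < n" for i using lam[OF that] assms(3) unfolding O_space_def by blast
  qed (use assms in auto)
qed

theorem theorem3p2:
  fixes n k l :: nat
    and M :: "((nat \<Rightarrow> real) \<times> (nat \<Rightarrow> real)) set"
    and N :: "(nat \<Rightarrow> real) set"
    and U :: "(nat \<Rightarrow> complex) set"
    and zo :: "nat \<Rightarrow> complex"
    and P :: "'m::finite op_matrix"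
    and lam :: "nat \<Rightarrow> (nat \<Rightarrow> complex) \<Rightarrow> complex"
  assumes "coordinate_domain n k M"
    and "N = N_of M"
    and "parameter_domain l zo U"
    and "P \<in> D_star n k l N U"
    and "\<forall>i<n. lam i \<in> O_space l U"
  shows
    "(\<forall>S \<subseteq> multi_indices n.
        (\<forall>\<gamma> \<in> multi_indices n - S. \<exists>x\<in>N. \<exists>z\<in>U.
           det (sigma_star n P x z (\<lambda>i. lam i z + of_nat (\<gamma> i))) \<noteq> 0) \<longrightarrow>
        (\<forall>\<phi> \<in> A_hat n k l N U.
           (\<forall>\<gamma> \<in> multi_indices n. \<forall>x\<in>N. \<forall>z\<in>U. formal_apply n k P lam \<phi> \<gamma> x z = 0) \<longrightarrow>
           (\<forall>\<alpha>\<in>S. \<phi> \<alpha> = (\<lambda>_ _. 0)) \<longrightarrow>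
           \<phi> = (\<lambda>_ _ _. 0)))
     \<and>
     ((\<forall>x\<in>N. \<forall>z\<in>U. \<forall>\<xi> \<in> topspace (Euclidean_space n).
         (\<forall>i<n. 0 \<le> \<xi> i) \<and> \<xi> \<noteq> (\<lambda>_. 0) \<longrightarrow>
         det (sigma_bar n k l N U P x z (\<lambda>i. of_real (\<xi> i))) \<noteq> 0) \<longrightarrow>
      (\<forall>\<phi> \<in> A_hat n k l N U.
         (\<forall>\<gamma> \<in> multi_indices n. \<forall>x\<in>N. \<forall>z\<in>U. formal_apply n k P lam \<phi> \<gamma> x z = 0) \<longrightarrow>
         \<phi> \<in> taylor n N U ` A_M_vec n k l N U)
      \<and>
      (\<forall>xo\<in>N. \<forall>S \<subseteq> multi_indices n.
         finite S \<longrightarrow>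
         (\<forall>\<gamma> \<in> multi_indices n - S.
            det (sigma_star n P xo zo (\<lambda>i. lam i zo + of_nat (\<gamma> i))) \<noteq> 0) \<longrightarrow>
         (\<exists>M' N' U'. M' \<subseteq> M \<and> coordinate_domain n k M' \<and> N' = N_of M' \<and> xo \<in> N' \<and>
            U' \<subseteq> U \<and> parameter_domain l zo U' \<and>
            bij_betw (restrict_to_Sigma_bar n S)
              (Sol n k l N' U' P lam) (Sol_Sigma n k l N' U' P lam S)))
      \<and>
      Sol_Sigma n k l N U P lam {\<lambda>_. 0} =
        const_series ` {u \<in> A_N k l N U.
          \<forall>x\<in>N. \<forall>z\<in>U. sigma_star n P x z (\<lambda>i. lam i z) *v u x z = 0})"
proof -
  have NN: "openin (Euclidean_space k) N" "connectedin (Euclidean_space k) N"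
    using assms(1,2) openin_N_of by (auto simp: coordinate_domain_def)
  have UU: "openin (Complex_space l) U" "connectedin (Complex_space l) U" "zo \<in> U" using assms(3) by (auto simp: parameter_domain_def)
  interpret operator_setting n k l N U P lam by unfold_locales (use NN UU assms(4,5) in auto)
  have zero_hat: "(\<lambda>_ _ _. 0) \<in> A_hat n k l N U" by (simp add: A_hat_def A_N_zero)
  \<comment> \<open>Comparison with the zero series, whose formal image is zero.\<close>
  have i: "\<phi> = (\<lambda>_ _ _. 0)"
    if "\<forall>\<gamma> \<in> multi_indices n - S. \<exists>x\<in>N. \<exists>z\<in>U. det (sigma_star n P x z (\<lambda>i. lam i z + of_nat (\<gamma> i))) \<noteq> 0"
      "\<phi> \<in> A_hat n k l N U" "\<forall>\<gamma> \<in> multi_indices n. \<forall>x\<in>N. \<forall>z\<in>U. formal_apply n k P lam \<phi> \<gamma> x z = 0" "\<forall>\<alpha>\<in>S. \<phi> \<alpha> = (\<lambda>_ _. 0)" for S \<phi>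
    by (rule formal_solution_unique[OF NN(2) UU(2) that(2) zero_hat, of S]) (use that formal_apply_zero in auto)
  have ell: "elliptic_at n k l P (op_ord n k l N U P) x z"
    if bar: "\<forall>x\<in>N. \<forall>z\<in>U. \<forall>\<xi> \<in> topspace (Euclidean_space n). (\<forall>i<n. 0 \<le> \<xi> i) \<and> \<xi> \<noteq> (\<lambda>_. 0) \<longrightarrow>
         det (sigma_bar n k l N U P x z (\<lambda>i. of_real (\<xi> i))) \<noteq> 0" and p: "x \<in> N" "z \<in> U" for x z
    by (rule elliptic_at_op_ord[OF p]) (use bar p in blast)
  have iii: "\<exists>M' N' U'. M' \<subseteq> M \<and> coordinate_domain n k M' \<and> N' = N_of M' \<and> xo \<in> N' \<and> U' \<subseteq> U \<and> parameter_domain l zo U' \<and>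
      bij_betw (restrict_to_Sigma_bar n S) (Sol n k l N' U' P lam) (Sol_Sigma n k l N' U' P lam S)"
    if ell: "\<And>x z. x \<in> N \<Longrightarrow> z \<in> U \<Longrightarrow> elliptic_at n k l P (op_ord n k l N U P) x z"
      and xo: "xo \<in> N" and S: "S \<subseteq> multi_indices n" "finite S"
      and inv: "\<forall>\<gamma> \<in> multi_indices n - S. det (sigma_star n P xo zo (\<lambda>i. lam i zo + of_nat (\<gamma> i))) \<noteq> 0" for xo S
  proof -
    \<comment> \<open>The box on which all symbols outside \<open>S\<close> are invertible is found
      on the original domain and with its order; invertibility and \<open>elliptic_at\<close> then
      hold on every smaller domain inside that box.\<close>
    obtain R A L C where "regular_expansion_at n k l P lam xo zo R A L (op_ord n k l N U P) S C"
      using regular_expansion_exists[OF xo UU(3) ell[OF xo UU(3)], of S] inv by blast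
    from regular_expansion_at.uniformly_invertible[OF this] obtain s where s: "0 < s"
      and inv_box: "\<forall>\<gamma>\<in>multi_indices n - S. \<forall>x z. in_box 0 k l xo zo s (\<lambda>_. 0) x z \<longrightarrow> det (sigma_star n P x z (\<lambda>i. lam i z + of_nat (\<gamma> i))) \<noteq> 0"
      by (elim exE conjE)
    obtain M' U' where M': "M' \<subseteq> M" "coordinate_domain n k M'" "xo \<in> N_of M'" and U': "U' \<subseteq> U" "parameter_domain l zo U'"
      and box: "\<forall>x\<in>N_of M'. \<forall>z\<in>U'. in_box 0 k l xo zo s (\<lambda>_. 0) x z"
      using small_coordinate_domain[OF assms(1,3) _ s, of xo] xo assms(2) by blast
    have N': "N_of M' \<subseteq> N" using M'(1) assms(2) by (auto simp: N_of_def)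
    have NU': "openin (Euclidean_space k) (N_of M')" "connectedin (Euclidean_space k) (N_of M')" "openin (Complex_space l) U'" "connectedin (Complex_space l) U'" "zo \<in> U'"
      using M'(2) U'(2) openin_N_of by (auto simp: coordinate_domain_def parameter_domain_def)
    interpret small: operator_setting n k l "N_of M'" U' P lam
      by (rule operator_setting_subset[OF operator_setting_axioms N' U'(1) NU'(1,3)])
    have "bij_betw (restrict_to_Sigma_bar n S) (Sol n k l (N_of M') U' P lam) (Sol_Sigma n k l (N_of M') U' P lam S)"
    proof (rule small.bij_betw_restrict_to_Sigma_bar[OF NU'(2,4) M'(3) NU'(5) S(2,1)])
      show "elliptic_at n k l P (op_ord n k l N U P) x z" if "x \<in> N_of M'" "z \<in> U'" for x z
        using ell N' U'(1) that by blast
      show "det (sigma_star n P x z (\<lambda>i. lam i z + of_nat (\<gamma> i))) \<noteq> 0" if "\<gamma> \<in> multi_indices n - S" "x \<in> N_of M'" "z \<in> U'" for \<gamma> x z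
        using inv_box box that by blast
    qed
    then show ?thesis using M' U' by (intro exI[of _ M'] exI[of _ "N_of M'"] exI[of _ U'] conjI refl)
  qed
  show ?thesis
  proof (intro conjI allI impI ballI)
    fix S \<phi> assume "\<forall>\<gamma> \<in> multi_indices n - S. \<exists>x\<in>N. \<exists>z\<in>U. det (sigma_star n P x z (\<lambda>i. lam i z + of_nat (\<gamma> i))) \<noteq> 0"
      "\<phi> \<in> A_hat n k l N U" "\<forall>\<gamma> \<in> multi_indices n. \<forall>x\<in>N. \<forall>z\<in>U. formal_apply n k P lam \<phi> \<gamma> x z = 0" "\<forall>\<alpha>\<in>S. \<phi> \<alpha> = (\<lambda>_ _. 0)"
    then show "\<phi> = (\<lambda>_ _ _. 0)" by (rule i)
  next
    assume bar: "\<forall>x\<in>N. \<forall>z\<in>U. \<forall>\<xi> \<in> topspace (Euclidean_space n). (\<forall>i<n. 0 \<le> \<xi> i) \<and> \<xi> \<noteq> (\<lambda>_. 0) \<longrightarrow>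
         det (sigma_bar n k l N U P x z (\<lambda>i. of_real (\<xi> i))) \<noteq> 0"
    {
      fix \<phi> assume \<phi>: "\<phi> \<in> A_hat n k l N U" "\<forall>\<gamma> \<in> multi_indices n. \<forall>x\<in>N. \<forall>z\<in>U. formal_apply n k P lam \<phi> \<gamma> x z = 0"
      show "\<phi> \<in> taylor n N U ` A_M_vec n k l N U"
        by (rule formal_solution_converges[OF \<phi>(1)], rule \<phi>(2)[rule_format], assumption+, rule ell[OF bar])
    next
      fix xo S assume "xo \<in> N" "S \<subseteq> multi_indices n" "finite S"
        "\<forall>\<gamma> \<in> multi_indices n - S. det (sigma_star n P xo zo (\<lambda>i. lam i zo + of_nat (\<gamma> i))) \<noteq> 0"
      then show "\<exists>M' N' U'. M' \<subseteq> M \<and> coordinate_domain n k M' \<and> N' = N_of M' \<and> xo \<in> N' \<and> U' \<subseteq> U \<and> parameter_domain l zo U' \<and>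
          bij_betw (restrict_to_Sigma_bar n S) (Sol n k l N' U' P lam) (Sol_Sigma n k l N' U' P lam S)"
        by (intro iii ell[OF bar])
    next
      show "Sol_Sigma n k l N U P lam {\<lambda>_. 0} = const_series ` {u \<in> A_N k l N U. \<forall>x\<in>N. \<forall>z\<in>U. sigma_star n P x z (\<lambda>i. lam i z) *v u x z = 0}"
        by (rule Sol_Sigma_zero)
    }
  qed
qed


end
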